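(* Let $A$ be a basic connected Artin algebra such that $\mathrm{add}(\mathcal{L}_A)$ is an abelian exact subcategory of $\mathrm{mod}_A$. Then: (1) The left support $A_\lambda$ of $A$ is hereditary. (2) The algebra $A$ is left supported. (3) If, furthermore, the valued quiver of $A$ has no oriented cycles, then $A=A_\lambda$. In particular, $A$ itself is hereditary.
   Context: Connected means indecomposable as a ring. $\mathrm{mod}_A$ is the category of finitely generated right $A$-modules, and $\mathrm{ind}_A$ is a full subcategory of $\mathrm{mod}_A$ consisting of a complete set of representatives of the isomorphism classes of indecomposable $A$-modules; all subcategories are closed under isomorphic images. For a full subcategory $\mathcal{C}$ of $\mathrm{mod}_A$, $\mathrm{add}(\mathcal{C})$ is the full subcategory of $\mathrm{mod}_A$ whose objects are the direct summands of finite direct sums of modules in $\mathcal{C}$. For $X,Y\in\mathrm{ind}_A$, $X$ is a predecessor of $Y$ if there is a sequence $X=X_0\to X_1\to\cdots\to X_t=Y$ of non-zero morphisms between indecomposable $A$-modules. The left part $\mathcal{L}_A$ is the full subcategory of $\mathrm{ind}_A$ consisting of those $X\in\mathrm{ind}_A$ such that every predecessor of $X$ has projective dimension at most one. The supporting projective module of $\mathcal{L}_A$ is the direct sum of all indecomposable projective modules in $\mathcal{L}_A$ (one for each isomorphism class), and the left support $A_\lambda$ of $A$ is its endomorphism algebra; $A=A_\lambda$ means that all indecomposable projective $A$-modules lie in $\mathcal{L}_A$. A full subcategory $\mathcal{A}$ of $\mathrm{mod}_A$ is an abelian exact subcategory if it is abelian as a category and the inclusion functor $\mathcal{A}\hookrightarrow\mathrm{mod}_A$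 is exact; equivalently, it is closed under kernels and cokernels. An additive full subcategory $\mathcal{D}$ of $\mathrm{mod}_A$ is contravariantly finite if for every $X\in\mathrm{mod}_A$ there is a morphism $f:D_X\to X$ with $D_X\in\mathcal{D}$ such that every morphism $g:D\to X$ with $D\in\mathcal{D}$ factors as $g=f\circ h$ for some $h:D\to D_X$. $A$ is left supported if $\mathrm{add}(\mathcal{L}_A)$ is contravariantly finite in $\mathrm{mod}_A$. The valued quiver $Q_A$ of $A$ has as points the elements of a complete set of primitive orthogonal idempotents $e_x$ of $A$, with an arrow $y\to x$ whenever $e_yJ(A)e_x/e_yJ(A)^2e_x\neq 0$, where $J(A)$ is the Jacobson radical (the valuation plays no role here). *)

theory Defs
  imports "HOL-Algebra.Module" "HOL-Algebra.Chinese_Remainder" "HOL-Library.Extended_Nat"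
begin

section \<open>Right modules\<close>

text \<open>
  The record of modules and the locale \<^locale>\<open>submodule\<close> are reused from the library. All modules
  here are right modules over a possibly noncommutative ring: the term \<open>a \<odot>\<^bsub>M\<^esub> x\<close> stands for the
  right action \<open>x \<cdot> a\<close>, which is visible in the associativity law. The fields \<open>mult\<close> and \<open>one\<close>
  that the record inherits from rings carry no meaning for a module.
\<close>

locale right_module = A?: ring A + M?: abelian_group M
  for A :: "('a, 'b) ring_scheme" (structure) and M :: "('a, 'm) module" (structure) +
  assumes smult_closed [simp, intro]:
      "\<lbrakk>a \<in> carrier A; x \<in> carrier M\<rbrakk> \<Longrightarrow> a \<odot>\<^bsub>M\<^esub> x \<in> carrier M"
    and smult_l_distr:
      "\<lbrakk>a \<in> carrier A; b \<in> carrier A; x \<in> carrier M\<rbrakk> \<Longrightarrow>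
        (a \<oplus>\<^bsub>A\<^esub> b) \<odot>\<^bsub>M\<^esub> x = a \<odot>\<^bsub>M\<^esub> x \<oplus>\<^bsub>M\<^esub> b \<odot>\<^bsub>M\<^esub> x"
    and smult_r_distr:
      "\<lbrakk>a \<in> carrier A; x \<in> carrier M; y \<in> carrier M\<rbrakk> \<Longrightarrow>
        a \<odot>\<^bsub>M\<^esub> (x \<oplus>\<^bsub>M\<^esub> y) = a \<odot>\<^bsub>M\<^esub> x \<oplus>\<^bsub>M\<^esub> a \<odot>\<^bsub>M\<^esub> y"
    and smult_assoc:
      "\<lbrakk>a \<in> carrier A; b \<in> carrier A; x \<in> carrier M\<rbrakk> \<Longrightarrow>
        (a \<otimes>\<^bsub>A\<^esub> b) \<odot>\<^bsub>M\<^esub> x = b \<odot>\<^bsub>M\<^esub> (a \<odot>\<^bsub>M\<^esub> x)"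
    and smult_one [simp]:
      "x \<in> carrier M \<Longrightarrow> \<one>\<^bsub>A\<^esub> \<odot>\<^bsub>M\<^esub> x = x"

definition regular_module :: "('a, 'b) ring_scheme \<Rightarrow> ('a, 'a) module" where
  "regular_module A = \<lparr>carrier = carrier A, mult = mult A, one = \<one>\<^bsub>A\<^esub>, zero = \<zero>\<^bsub>A\<^esub>,
     add = add A, smult = (\<lambda>a x. x \<otimes>\<^bsub>A\<^esub> a)\<rparr>"

definition fin_gen :: "('a, 'b) ring_scheme \<Rightarrow> ('a, 'm) module \<Rightarrow> bool" where
  "fin_gen A M \<longleftrightarrow> (\<exists>S \<subseteq> carrier M. finite S \<and>
     (\<forall>H. submodule H A M \<and> S \<subseteq> H \<longrightarrow> H = carrier M))"

text \<open>
  Homomorphisms are extensional functions, so that equality of homomorphisms is equality on the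
  carrier of the source.
\<close>

definition rmod_hom ::
    "('a, 'b) ring_scheme \<Rightarrow> ('a, 'm) module \<Rightarrow> ('a, 'n) module \<Rightarrow> ('m \<Rightarrow> 'n) set" where
  "rmod_hom A M N = {f \<in> carrier M \<rightarrow>\<^sub>E carrier N.
     (\<forall>x \<in> carrier M. \<forall>y \<in> carrier M. f (x \<oplus>\<^bsub>M\<^esub> y) = f x \<oplus>\<^bsub>N\<^esub> f y) \<and>
     (\<forall>a \<in> carrier A. \<forall>x \<in> carrier M. f (a \<odot>\<^bsub>M\<^esub> x) = a \<odot>\<^bsub>N\<^esub> f x)}"

definition zero_hom :: "('a, 'm) module \<Rightarrow> ('a, 'n) module \<Rightarrow> 'm \<Rightarrow> 'n" where
  "zero_hom M N = (\<lambda>x \<in> carrier M. \<zero>\<^bsub>N\<^esub>)"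

definition rmod_iso :: "('a, 'b) ring_scheme \<Rightarrow> ('a, 'm) module \<Rightarrow> ('a, 'n) module \<Rightarrow> bool" where
  "rmod_iso A M N \<longleftrightarrow> (\<exists>f \<in> rmod_hom A M N. bij_betw f (carrier M) (carrier N))"

definition internal_sum ::
    "('a, 'b) ring_scheme \<Rightarrow> ('a, 'm) module \<Rightarrow> 'm set \<Rightarrow> 'm set \<Rightarrow> bool" where
  "internal_sum A M U V \<longleftrightarrow> submodule U A M \<and> submodule V A M \<and>
     U \<inter> V = {\<zero>\<^bsub>M\<^esub>} \<and> U <+>\<^bsub>M\<^esub> V = carrier M"

definition direct_summand ::
    "('a, 'b) ring_scheme \<Rightarrow> ('a, 'm) module \<Rightarrow> ('a, 'n) module \<Rightarrow> bool" where
  "direct_summand A M S \<longleftrightarrow> (\<exists>U V. internal_sum A S U V \<and> rmod_iso A M (S\<lparr>carrier := U\<rparr>))"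

definition indecomposable :: "('a, 'b) ring_scheme \<Rightarrow> ('a, 'm) module \<Rightarrow> bool" where
  "indecomposable A M \<longleftrightarrow> carrier M \<noteq> {\<zero>\<^bsub>M\<^esub>} \<and>
     (\<forall>U V. internal_sum A M U V \<longrightarrow> U = {\<zero>\<^bsub>M\<^esub>} \<or> V = {\<zero>\<^bsub>M\<^esub>})"

definition direct_sum :: "'i set \<Rightarrow> ('i \<Rightarrow> ('a, 'm) module) \<Rightarrow> ('a, 'i \<Rightarrow> 'm) module" where
  "direct_sum I X = \<lparr>
     carrier = {f \<in> \<Pi>\<^sub>E i \<in> I. carrier (X i). finite {i \<in> I. f i \<noteq> \<zero>\<^bsub>X i\<^esub>}},
     mult = undefined, one = undefined,
     zero = (\<lambda>i \<in> I. \<zero>\<^bsub>X i\<^esub>),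
     add = (\<lambda>f g. \<lambda>i \<in> I. f i \<oplus>\<^bsub>X i\<^esub> g i),
     smult = (\<lambda>a f. \<lambda>i \<in> I. a \<odot>\<^bsub>X i\<^esub> f i)\<rparr>"

definition rmod_End :: "('a, 'b) ring_scheme \<Rightarrow> ('a, 'm) module \<Rightarrow> ('m \<Rightarrow> 'm) ring" where
  "rmod_End A M = \<lparr>
     carrier = rmod_hom A M M,
     mult = (\<lambda>g f. compose (carrier M) g f),
     one = (\<lambda>x \<in> carrier M. x),
     zero = zero_hom M M,
     add = (\<lambda>f g. \<lambda>x \<in> carrier M. f x \<oplus>\<^bsub>M\<^esub> g x)\<rparr>"


section \<open>The category of finitely generated modules\<close>

text \<open>
  The objects of \<open>mod\<^sub>A\<close> have to live in one type. Every finitely generated module is isomorphic to a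
  quotient of some \<open>A\<^sup>n\<close>, whose elements are cosets of tuples, so the carrier type
  \<^typ>\<open>(nat \<Rightarrow> 'a) set\<close> contains a copy of every finitely generated module of any type. This is
  the lemma \<open>mod_cat_complete\<close> below. Full subcategories are sets of objects.
\<close>

type_synonym 'a fg_module = "('a, (nat \<Rightarrow> 'a) set) module"
type_synonym 'a fg_map = "(nat \<Rightarrow> 'a) set \<Rightarrow> (nat \<Rightarrow> 'a) set"

definition mod_cat :: "('a, 'b) ring_scheme \<Rightarrow> 'a fg_module set" where
  "mod_cat A = {M. right_module A M \<and> fin_gen A M}"

context right_module
begin

lemma smult_zero_left: "x \<in> carrier M \<Longrightarrow> \<zero>\<^bsub>A\<^esub> \<odot>\<^bsub>M\<^esub> x = \<zero>\<^bsub>M\<^esub>"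
  by (metis A.l_zero A.zero_closed M.add.r_cancel_one' smult_closed smult_l_distr)

lemma smult_zero_right: "a \<in> carrier A \<Longrightarrow> a \<odot>\<^bsub>M\<^esub> \<zero>\<^bsub>M\<^esub> = \<zero>\<^bsub>M\<^esub>"
  by (metis M.l_zero M.zero_closed M.add.r_cancel_one' smult_closed smult_r_distr)

lemma smult_minus_one: "x \<in> carrier M \<Longrightarrow> (\<ominus>\<^bsub>A\<^esub> \<one>\<^bsub>A\<^esub>) \<odot>\<^bsub>M\<^esub> x = \<ominus>\<^bsub>M\<^esub> x"
  by (metis A.add.inv_closed A.l_neg A.one_closed M.minus_equality smult_closed
      smult_l_distr smult_one smult_zero_left)

lemma finsum_smult:
  "finite S \<Longrightarrow> a \<in> carrier A \<Longrightarrow> f \<in> S \<rightarrow> carrier M \<Longrightarrow>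
    a \<odot>\<^bsub>M\<^esub> (\<Oplus>\<^bsub>M\<^esub>s\<in>S. f s) = (\<Oplus>\<^bsub>M\<^esub>s\<in>S. a \<odot>\<^bsub>M\<^esub> f s)"
  by (induction S rule: finite_induct) (auto simp: smult_zero_right smult_r_distr Pi_def)

lemma fin_gen_coordinates:
  assumes "fin_gen A M"
  obtains n :: nat and s where "s \<in> {..<n} \<rightarrow> carrier M"
    "\<And>x. x \<in> carrier M \<Longrightarrow> \<exists>c \<in> {..<n} \<rightarrow> carrier A. (\<Oplus>\<^bsub>M\<^esub>i\<in>{..<n}. c i \<odot>\<^bsub>M\<^esub> s i) = x"
proof -
  obtain S where S: "S \<subseteq> carrier M" "finite S"
    and gen: "\<And>H. submodule H A M \<Longrightarrow> S \<subseteq> H \<Longrightarrow> H = carrier M"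
    using assms by (auto simp: fin_gen_def)
  obtain s where s: "bij_betw s {..<card S} S"
    using ex_bij_betw_nat_finite[OF S(2)] by (auto simp: atLeast0LessThan)
  let ?n = "card S"
  let ?v = "\<lambda>c. \<Oplus>\<^bsub>M\<^esub>i\<in>{..<?n}. c i \<odot>\<^bsub>M\<^esub> s i"
  have sM: "s \<in> {..<?n} \<rightarrow> carrier M"
    using s S(1) by (auto simp: bij_betw_def)
  define H where "H = ?v ` ({..<?n} \<rightarrow> carrier A)"
  have fin: "(\<lambda>i. c i \<odot>\<^bsub>M\<^esub> s i) \<in> {..<?n} \<rightarrow> carrier M" if "c \<in> {..<?n} \<rightarrow> carrier A" for c
    using that sM by (auto simp: Pi_def)
  have sm: "a \<odot>\<^bsub>M\<^esub> x \<in> H" if a: "a \<in> carrier A" and x: "x \<in> H" for a x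
  proof -
    obtain c where c: "c \<in> {..<?n} \<rightarrow> carrier A" "x = ?v c" using x H_def by auto
    have "a \<odot>\<^bsub>M\<^esub> x = (\<Oplus>\<^bsub>M\<^esub>i\<in>{..<?n}. a \<odot>\<^bsub>M\<^esub> (c i \<odot>\<^bsub>M\<^esub> s i))"
      unfolding c(2) by (rule finsum_smult) (use fin[OF c(1)] a in auto)
    also have "\<dots> = ?v (\<lambda>i. c i \<otimes>\<^bsub>A\<^esub> a)"
      by (rule M.finsum_cong') (use c(1) sM a in \<open>auto simp: smult_assoc Pi_def\<close>)
    finally show ?thesis using c(1) a unfolding H_def by (auto simp: Pi_def)
  qed
  have "submodule H A M"
  proof (unfold_locales)
    show HM: "H \<subseteq> carrier (add_monoid M)"
      using fin by (auto simp: H_def)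
    show "\<one>\<^bsub>add_monoid M\<^esub> \<in> H"
    proof -
      have "?v (\<lambda>_. \<zero>\<^bsub>A\<^esub>) = \<zero>\<^bsub>M\<^esub>"
        by (rule M.add.finprod_one_eqI) (use sM in \<open>auto simp: smult_zero_left Pi_def\<close>)
      moreover have "?v (\<lambda>_. \<zero>\<^bsub>A\<^esub>) \<in> H" unfolding H_def by (rule imageI) auto
      ultimately show ?thesis by simp
    qed
    show "x \<otimes>\<^bsub>add_monoid M\<^esub> y \<in> H" if xy: "x \<in> H" "y \<in> H" for x y
    proof -
      obtain c d where c: "c \<in> {..<?n} \<rightarrow> carrier A" "x = ?v c"
        and d: "d \<in> {..<?n} \<rightarrow> carrier A" "y = ?v d" using xy H_def by auto
      have "?v (\<lambda>i. c i \<oplus>\<^bsub>A\<^esub> d i) = (\<Oplus>\<^bsub>M\<^esub>i\<in>{..<?n}. c i \<odot>\<^bsub>M\<^esub> s i \<oplus>\<^bsub>M\<^esub> d i \<odot>\<^bsub>M\<^esub> s i)"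
        by (rule M.finsum_cong') (use c d sM in \<open>auto simp: smult_l_distr Pi_def\<close>)
      also have "\<dots> = x \<oplus>\<^bsub>M\<^esub> y"
        unfolding c(2) d(2) by (rule M.finsum_addf) (use fin c d in auto)
      finally have "x \<oplus>\<^bsub>M\<^esub> y = ?v (\<lambda>i. c i \<oplus>\<^bsub>A\<^esub> d i)" ..
      then show ?thesis using c d unfolding H_def by (auto simp: Pi_def)
    qed
    show "inv\<^bsub>add_monoid M\<^esub> x \<in> H" if "x \<in> H" for x
    proof -
      have "\<ominus>\<^bsub>M\<^esub> x \<in> H"
        using sm[OF _ that, of "\<ominus>\<^bsub>A\<^esub> \<one>\<^bsub>A\<^esub>"] that HM by (auto simp: smult_minus_one)
      then show ?thesis by (simp add: a_inv_def)
    qed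
  qed (rule sm)
  moreover have "S \<subseteq> H"
  proof
    fix x assume "x \<in> S"
    then obtain j where j: "j < ?n" "s j = x" using bij_betw_imp_surj_on[OF s] by (metis imageE lessThan_iff)
    have "?v (\<lambda>i. if j = i then \<one>\<^bsub>A\<^esub> else \<zero>\<^bsub>A\<^esub>) = (\<Oplus>\<^bsub>M\<^esub>i\<in>{..<?n}. if j = i then s i else \<zero>\<^bsub>M\<^esub>)"
      by (rule M.finsum_cong') (use sM in \<open>auto simp: smult_zero_left Pi_def\<close>)
    also have "\<dots> = x"
      using M.add.finprod_singleton[of j "{..<?n}" s] j sM by auto
    finally have "x = ?v (\<lambda>i. if j = i then \<one>\<^bsub>A\<^esub> else \<zero>\<^bsub>A\<^esub>)" ..
    moreover have "(\<lambda>i. if j = i then \<one>\<^bsub>A\<^esub> else \<zero>\<^bsub>A\<^esub>) \<in> {..<?n} \<rightarrow> carrier A" by simp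
    ultimately show "x \<in> H" unfolding H_def by (rule image_eqI)
  qed
  ultimately have "H = carrier M" by (rule gen)
  have "\<exists>c \<in> {..<?n} \<rightarrow> carrier A. ?v c = x" if "x \<in> carrier M" for x
  proof -
    have "x \<in> H" using that \<open>H = carrier M\<close> by simp
    then show ?thesis unfolding H_def by (elim imageE) (rule bexI, simp_all)
  qed
  then show thesis by (rule that[OF sM])
qed

lemma transport:
  fixes h :: "'m \<Rightarrow> 'd"
  assumes inj: "inj_on h (carrier M)"
  defines "g \<equiv> inv_into (carrier M) h"
  defines "N \<equiv> \<lparr>carrier = h ` carrier M, mult = undefined, one = undefined, zero = h \<zero>\<^bsub>M\<^esub>,
     add = (\<lambda>u v. h (g u \<oplus>\<^bsub>M\<^esub> g v)), smult = (\<lambda>a u. h (a \<odot>\<^bsub>M\<^esub> g u))\<rparr>"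
  shows "right_module A N" and "restrict h (carrier M) \<in> rmod_hom A M N"
    and "bij_betw (restrict h (carrier M)) (carrier M) (carrier N)"
proof -
  have gh [simp]: "g (h x) = x" if "x \<in> carrier M" for x
    using that inj by (simp add: g_def)
  have [simp]: "carrier N = h ` carrier M" "\<zero>\<^bsub>N\<^esub> = h \<zero>\<^bsub>M\<^esub>"
    by (simp_all add: N_def)
  have [simp]: "h x \<oplus>\<^bsub>N\<^esub> h y = h (x \<oplus>\<^bsub>M\<^esub> y)" if "x \<in> carrier M" "y \<in> carrier M" for x y
    using that by (simp add: N_def)
  have [simp]: "a \<odot>\<^bsub>N\<^esub> h x = h (a \<odot>\<^bsub>M\<^esub> x)" if "x \<in> carrier M" for a x
    using that by (simp add: N_def)
  have "abelian_group N"
  proof (rule abelian_groupI)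
    fix x assume "x \<in> carrier N"
    then obtain y where "y \<in> carrier M" "x = h y" by auto
    then show "\<exists>z \<in> carrier N. z \<oplus>\<^bsub>N\<^esub> x = \<zero>\<^bsub>N\<^esub>"
      by (intro bexI[of _ "h (\<ominus>\<^bsub>M\<^esub> y)"]) (simp_all add: M.l_neg)
  next
    fix x y assume "x \<in> carrier N" "y \<in> carrier N"
    then show "x \<oplus>\<^bsub>N\<^esub> y = y \<oplus>\<^bsub>N\<^esub> x" by (clarsimp simp: M.a_comm)
  next
    fix x y z assume "x \<in> carrier N" "y \<in> carrier N" "z \<in> carrier N"
    then show "x \<oplus>\<^bsub>N\<^esub> y \<oplus>\<^bsub>N\<^esub> z = x \<oplus>\<^bsub>N\<^esub> (y \<oplus>\<^bsub>N\<^esub> z)" by (clarsimp simp: M.a_assoc)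
  qed auto
  then show "right_module A N"
    by (intro right_module.intro right_module_axioms.intro A.ring_axioms)
       (auto simp: smult_l_distr smult_r_distr smult_assoc)
  show "restrict h (carrier M) \<in> rmod_hom A M N"
    by (simp add: rmod_hom_def)
  show "bij_betw (restrict h (carrier M)) (carrier M) (carrier N)"
    using inj by (simp add: bij_betw_def)
qed

end

lemma fin_gen_iso:
  assumes M: "right_module A M" and N: "right_module A N"
    and f: "f \<in> rmod_hom A M N" "bij_betw f (carrier M) (carrier N)" and fg: "fin_gen A M"
  shows "fin_gen A N"
proof -
  interpret M: right_module A M by (rule M)
  interpret N: right_module A N by (rule N)
  obtain S where S: "S \<subseteq> carrier M" "finite S"
    and gen: "\<And>H. submodule H A M \<Longrightarrow> S \<subseteq> H \<Longrightarrow> H = carrier M"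
    using fg by (auto simp: fin_gen_def)
  have fc: "f x \<in> carrier N" if "x \<in> carrier M" for x using f(1) that by (auto simp: rmod_hom_def)
  have add: "f (x \<oplus>\<^bsub>M\<^esub> y) = f x \<oplus>\<^bsub>N\<^esub> f y" if "x \<in> carrier M" "y \<in> carrier M" for x y
    using f(1) that by (auto simp: rmod_hom_def)
  have sm: "f (a \<odot>\<^bsub>M\<^esub> x) = a \<odot>\<^bsub>N\<^esub> f x" if "a \<in> carrier A" "x \<in> carrier M" for a x
    using f(1) that by (auto simp: rmod_hom_def)
  have zero: "f \<zero>\<^bsub>M\<^esub> = \<zero>\<^bsub>N\<^esub>"
    using sm[OF M.A.zero_closed M.M.zero_closed] fc[OF M.M.zero_closed]
    by (simp add: M.smult_zero_left N.smult_zero_left)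
  have neg: "f (\<ominus>\<^bsub>M\<^esub> x) = \<ominus>\<^bsub>N\<^esub> f x" if "x \<in> carrier M" for x
    using sm[OF M.A.a_inv_closed[OF M.A.one_closed] that] fc[OF that] that
    by (simp add: M.smult_minus_one N.smult_minus_one)
  have "H = carrier N" if H: "submodule H A N" and SH: "f ` S \<subseteq> H" for H
  proof -
    interpret H: submodule H A N by (rule H)
    let ?K = "{x \<in> carrier M. f x \<in> H}"
    have "submodule ?K A M"
    proof (unfold_locales)
      show "inv\<^bsub>add_monoid M\<^esub> x \<in> ?K" if "x \<in> ?K" for x
        using that neg[of x] H.m_inv_closed[of "f x"] M.M.a_inv_closed[of x]
        by (simp add: a_inv_def)
    qed (use H.m_closed H.one_closed H.smult_closed in \<open>auto simp: add sm zero\<close>)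
    then have K: "?K = carrier M" using S SH by (intro gen) auto
    have "carrier N \<subseteq> H"
    proof
      fix y assume "y \<in> carrier N"
      then obtain x where "x \<in> carrier M" "y = f x" using f(2) by (auto simp: bij_betw_def)
      then show "y \<in> H" using K by blast
    qed
    then show ?thesis using H.subset by auto
  qed
  moreover have "f ` S \<subseteq> carrier N" "finite (f ` S)" using S fc by auto
  ultimately show ?thesis unfolding fin_gen_def by blast
qed

lemma mod_cat_complete:
  assumes "right_module A M" and "fin_gen A M"
  shows "\<exists>N \<in> mod_cat A. rmod_iso A M N"
proof -
  interpret right_module A M by fact
  obtain n :: nat and s where s: "s \<in> {..<n} \<rightarrow> carrier M"
    and gen: "\<And>x. x \<in> carrier M \<Longrightarrow>
      \<exists>c \<in> {..<n} \<rightarrow> carrier A. (\<Oplus>\<^bsub>M\<^esub>i\<in>{..<n}. c i \<odot>\<^bsub>M\<^esub> s i) = x"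
    by (rule fin_gen_coordinates[OF assms(2)]) (rule that)
  define h where
    "h x = {c \<in> {..<n} \<rightarrow> carrier A. (\<Oplus>\<^bsub>M\<^esub>i\<in>{..<n}. c i \<odot>\<^bsub>M\<^esub> s i) = x}" for x
  have inj: "inj_on h (carrier M)"
  proof (rule inj_onI)
    fix x y assume x: "x \<in> carrier M" and eq: "h x = h y"
    obtain c where "c \<in> h x" using gen[OF x] by (auto simp: h_def)
    then have "c \<in> h x" "c \<in> h y" using eq by auto
    then show "x = y" by (simp add: h_def)
  qed
  obtain N :: "'a fg_module" and f where N: "right_module A N" "f \<in> rmod_hom A M N"
      "bij_betw f (carrier M) (carrier N)"
    by (rule that[OF transport[OF inj]])
  have "N \<in> mod_cat A"
    using N(1) fin_gen_iso[OF assms(1) N assms(2)] by (simp add: mod_cat_def)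
  moreover have "rmod_iso A M N"
    unfolding rmod_iso_def by (rule bexI[of _ f]) (rule N)+
  ultimately show ?thesis by (intro bexI[of _ N])
qed

definition projective :: "('a, 'b) ring_scheme \<Rightarrow> ('a, 'm) module \<Rightarrow> bool" where
  "projective A P \<longleftrightarrow> right_module A P \<and>
     (\<forall>M \<in> mod_cat A. \<forall>N \<in> mod_cat A. \<forall>g \<in> rmod_hom A M N. \<forall>f \<in> rmod_hom A P N.
        g ` carrier M = carrier N \<longrightarrow>
        (\<exists>h \<in> rmod_hom A P M. compose (carrier P) g h = f))"

text \<open>
  A resolution \<open>0 \<rightarrow> C (n + 1) \<rightarrow> \<dots> \<rightarrow> C 1 \<rightarrow> C 0 = M \<rightarrow> 0\<close> of length \<open>n\<close>, with the module in position 0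
  and differentials \<open>d i : C (i + 1) \<rightarrow> C i\<close>.
\<close>

definition projective_resolution ::
    "('a, 'b) ring_scheme \<Rightarrow> 'a fg_module \<Rightarrow> nat \<Rightarrow> (nat \<Rightarrow> 'a fg_module) \<Rightarrow>
      (nat \<Rightarrow> 'a fg_map) \<Rightarrow> bool" where
  "projective_resolution A M n C d \<longleftrightarrow>
     C 0 = M \<and>
     (\<forall>i \<in> {1..Suc n}. C i \<in> mod_cat A \<and> projective A (C i)) \<and>
     (\<forall>i \<le> n. d i \<in> rmod_hom A (C (Suc i)) (C i)) \<and>
     d 0 ` carrier (C 1) = carrier M \<and>
     (\<forall>i < n. d (Suc i) ` carrier (C (Suc (Suc i))) =
        {x \<in> carrier (C (Suc i)). d i x = \<zero>\<^bsub>C i\<^esub>}) \<and>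
     inj_on (d n) (carrier (C (Suc n)))"

definition proj_dim :: "('a, 'b) ring_scheme \<Rightarrow> 'a fg_module \<Rightarrow> enat" where
  "proj_dim A M = Inf {enat n | n. \<exists>C d. projective_resolution A M n C d}"

text \<open>Full subcategories are closed under isomorphic images, so no representatives are chosen.\<close>

definition ind_cat :: "('a, 'b) ring_scheme \<Rightarrow> 'a fg_module set" where
  "ind_cat A = {M \<in> mod_cat A. indecomposable A M}"

definition add_closure :: "('a, 'b) ring_scheme \<Rightarrow> 'a fg_module set \<Rightarrow> 'a fg_module set" where
  "add_closure A \<C> = {M \<in> mod_cat A. \<exists>(n::nat) F. (\<forall>i < n. F i \<in> \<C>) \<and>
     direct_summand A M (direct_sum {..<n} F)}"


section \<open>Abelian exact and contravariantly finite subcategories\<close>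

text \<open>
  In this section, \<open>\<C>\<close> is a set of objects of \<open>mod\<^sub>A\<close>, regarded as a full subcategory. All notions up
  to \<open>abelian_category\<close> are internal to \<open>\<C>\<close>: universal properties are tested on objects of \<open>\<C>\<close> only.
\<close>

definition zero_object :: "('a, 'b) ring_scheme \<Rightarrow> 'a fg_module set \<Rightarrow> 'a fg_module \<Rightarrow> bool" where
  "zero_object A \<C> Z \<longleftrightarrow> Z \<in> \<C> \<and>
     (\<forall>T \<in> \<C>. (\<exists>!f. f \<in> rmod_hom A T Z) \<and> (\<exists>!f. f \<in> rmod_hom A Z T))"

definition is_product ::
    "('a, 'b) ring_scheme \<Rightarrow> 'a fg_module set \<Rightarrow> 'a fg_module \<Rightarrow> 'a fg_module \<Rightarrow> 'a fg_module \<Rightarrow>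
      'a fg_map \<Rightarrow> 'a fg_map \<Rightarrow> bool" where
  "is_product A \<C> M N P p q \<longleftrightarrow> P \<in> \<C> \<and> p \<in> rmod_hom A P M \<and> q \<in> rmod_hom A P N \<and>
     (\<forall>T \<in> \<C>. \<forall>f \<in> rmod_hom A T M. \<forall>g \<in> rmod_hom A T N.
        \<exists>!h. h \<in> rmod_hom A T P \<and> compose (carrier T) p h = f \<and> compose (carrier T) q h = g)"

definition is_kernel ::
    "('a, 'b) ring_scheme \<Rightarrow> 'a fg_module set \<Rightarrow> 'a fg_module \<Rightarrow> 'a fg_module \<Rightarrow> 'a fg_map \<Rightarrow>
      'a fg_module \<Rightarrow> 'a fg_map \<Rightarrow> bool" where
  "is_kernel A \<C> M N f K k \<longleftrightarrow> K \<in> \<C> \<and> k \<in> rmod_hom A K M \<and>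
     compose (carrier K) f k = zero_hom K N \<and>
     (\<forall>T \<in> \<C>. \<forall>t \<in> rmod_hom A T M. compose (carrier T) f t = zero_hom T N \<longrightarrow>
        (\<exists>!u. u \<in> rmod_hom A T K \<and> compose (carrier T) k u = t))"

definition is_cokernel ::
    "('a, 'b) ring_scheme \<Rightarrow> 'a fg_module set \<Rightarrow> 'a fg_module \<Rightarrow> 'a fg_module \<Rightarrow> 'a fg_map \<Rightarrow>
      'a fg_module \<Rightarrow> 'a fg_map \<Rightarrow> bool" where
  "is_cokernel A \<C> M N f C c \<longleftrightarrow> C \<in> \<C> \<and> c \<in> rmod_hom A N C \<and>
     compose (carrier M) c f = zero_hom M C \<and>
     (\<forall>T \<in> \<C>. \<forall>t \<in> rmod_hom A N T. compose (carrier M) t f = zero_hom M T \<longrightarrow>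
        (\<exists>!u. u \<in> rmod_hom A C T \<and> compose (carrier N) u c = t))"

definition is_mono ::
    "('a, 'b) ring_scheme \<Rightarrow> 'a fg_module set \<Rightarrow> 'a fg_module \<Rightarrow> 'a fg_module \<Rightarrow> 'a fg_map \<Rightarrow> bool" where
  "is_mono A \<C> M N f \<longleftrightarrow> (\<forall>T \<in> \<C>. \<forall>s \<in> rmod_hom A T M. \<forall>t \<in> rmod_hom A T M.
     compose (carrier T) f s = compose (carrier T) f t \<longrightarrow> s = t)"

definition is_epi ::
    "('a, 'b) ring_scheme \<Rightarrow> 'a fg_module set \<Rightarrow> 'a fg_module \<Rightarrow> 'a fg_module \<Rightarrow> 'a fg_map \<Rightarrow> bool" where
  "is_epi A \<C> M N f \<longleftrightarrow> (\<forall>T \<in> \<C>. \<forall>s \<in> rmod_hom A N T. \<forall>t \<in> rmod_hom A N T.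
     compose (carrier M) s f = compose (carrier M) t f \<longrightarrow> s = t)"

text \<open>Preadditivity is automatic for a full subcategory of \<open>mod\<^sub>A\<close>.\<close>

definition abelian_category :: "('a, 'b) ring_scheme \<Rightarrow> 'a fg_module set \<Rightarrow> bool" where
  "abelian_category A \<C> \<longleftrightarrow>
     (\<exists>Z. zero_object A \<C> Z) \<and>
     (\<forall>M \<in> \<C>. \<forall>N \<in> \<C>. \<exists>P p q. is_product A \<C> M N P p q) \<and>
     (\<forall>M \<in> \<C>. \<forall>N \<in> \<C>. \<forall>f \<in> rmod_hom A M N.
        (\<exists>K k. is_kernel A \<C> M N f K k) \<and>
        (\<exists>C c. is_cokernel A \<C> M N f C c) \<and>
        (is_mono A \<C> M N f \<longrightarrow>
           (\<exists>L \<in> \<C>. \<exists>g \<in> rmod_hom A N L. is_kernel A \<C> N L g M f)) \<and>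
        (is_epi A \<C> M N f \<longrightarrow>
           (\<exists>L \<in> \<C>. \<exists>g \<in> rmod_hom A L M. is_cokernel A \<C> L M g N f)))"

text \<open>
  The inclusion functor is exact: every sequence \<open>0 \<rightarrow> L \<rightarrow> M \<rightarrow> N \<rightarrow> 0\<close> that is short exact in the
  abelian category \<open>\<C>\<close> is short exact as a sequence of modules.
\<close>

definition exact_inclusion :: "('a, 'b) ring_scheme \<Rightarrow> 'a fg_module set \<Rightarrow> bool" where
  "exact_inclusion A \<C> \<longleftrightarrow>
     (\<forall>L \<in> \<C>. \<forall>M \<in> \<C>. \<forall>N \<in> \<C>. \<forall>f \<in> rmod_hom A L M. \<forall>g \<in> rmod_hom A M N.
        is_kernel A \<C> M N g L f \<and> is_cokernel A \<C> L M f N g \<longrightarrow>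
        inj_on f (carrier L) \<and>
        f ` carrier L = {x \<in> carrier M. g x = \<zero>\<^bsub>N\<^esub>} \<and>
        g ` carrier M = carrier N)"

definition abelian_exact_subcategory :: "('a, 'b) ring_scheme \<Rightarrow> 'a fg_module set \<Rightarrow> bool" where
  "abelian_exact_subcategory A \<C> \<longleftrightarrow>
     \<C> \<subseteq> mod_cat A \<and> abelian_category A \<C> \<and> exact_inclusion A \<C>"

definition contravariantly_finite :: "('a, 'b) ring_scheme \<Rightarrow> 'a fg_module set \<Rightarrow> bool" where
  "contravariantly_finite A \<D> \<longleftrightarrow> (\<forall>M \<in> mod_cat A. \<exists>D \<in> \<D>. \<exists>f \<in> rmod_hom A D M.
     \<forall>D' \<in> \<D>. \<forall>g \<in> rmod_hom A D' M. \<exists>h \<in> rmod_hom A D' D. g = compose (carrier D') f h)"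


section \<open>The left part and the left support\<close>

definition predecessor :: "('a, 'b) ring_scheme \<Rightarrow> 'a fg_module \<Rightarrow> 'a fg_module \<Rightarrow> bool" where
  "predecessor A M N \<longleftrightarrow> M \<in> ind_cat A \<and> N \<in> ind_cat A \<and>
     (M, N) \<in> {(U, V). U \<in> ind_cat A \<and> V \<in> ind_cat A \<and>
       (\<exists>f \<in> rmod_hom A U V. f \<noteq> zero_hom U V)}\<^sup>*"

definition left_part :: "('a, 'b) ring_scheme \<Rightarrow> 'a fg_module set" where
  "left_part A = {M \<in> ind_cat A. \<forall>L. predecessor A L M \<longrightarrow> proj_dim A L \<le> 1}"

definition left_part_projectives :: "('a, 'b) ring_scheme \<Rightarrow> 'a fg_module set" where
  "left_part_projectives A = {P \<in> left_part A. projective A P}"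

text \<open>
  The direct sum is indexed by the set of isomorphism classes, with one representative chosen in
  each class.
\<close>

definition supporting_projective ::
    "('a, 'b) ring_scheme \<Rightarrow> ('a, 'a fg_module set \<Rightarrow> (nat \<Rightarrow> 'a) set) module" where
  "supporting_projective A =
     direct_sum
       (left_part_projectives A //
         {(P, Q). P \<in> left_part_projectives A \<and> Q \<in> left_part_projectives A \<and> rmod_iso A P Q})
       (\<lambda>c. SOME P. P \<in> c)"

definition left_support ::
    "('a, 'b) ring_scheme \<Rightarrow>
      (('a fg_module set \<Rightarrow> (nat \<Rightarrow> 'a) set) \<Rightarrow> ('a fg_module set \<Rightarrow> (nat \<Rightarrow> 'a) set)) ring" where
  "left_support A = rmod_End A (supporting_projective A)"

text \<open>The meaning of \<open>A = A\<^sub>\<lambda>\<close>: every indecomposable projective module lies in the left part.\<close>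

definition equals_left_support :: "('a, 'b) ring_scheme \<Rightarrow> bool" where
  "equals_left_support A \<longleftrightarrow> (\<forall>P \<in> ind_cat A. projective A P \<longrightarrow> P \<in> left_part A)"

definition left_supported :: "('a, 'b) ring_scheme \<Rightarrow> bool" where
  "left_supported A \<longleftrightarrow> contravariantly_finite A (add_closure A (left_part A))"


section \<open>Artin algebras\<close>

text \<open>
  The base ring \<open>K\<close> acts through a ring homomorphism \<open>\<phi>\<close> into the centre of \<open>A\<close>. Since \<open>K\<close> is
  commutative, right and left \<open>K\<close>-modules agree.
\<close>

definition artinian :: "('k, 'c) ring_scheme \<Rightarrow> bool" where
  "artinian K \<longleftrightarrow> (\<forall>I :: nat \<Rightarrow> 'k set. (\<forall>n. ideal (I n) K \<and> I (Suc n) \<subseteq> I n) \<longrightarrow>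
     (\<exists>m. \<forall>n \<ge> m. I n = I m))"

definition artin_algebra ::
    "('k, 'c) ring_scheme \<Rightarrow> ('k \<Rightarrow> 'a) \<Rightarrow> ('a, 'b) ring_scheme \<Rightarrow> bool" where
  "artin_algebra K \<phi> A \<longleftrightarrow> cring K \<and> artinian K \<and> ring A \<and> \<phi> \<in> ring_hom K A \<and>
     (\<forall>r \<in> carrier K. \<forall>a \<in> carrier A. \<phi> r \<otimes>\<^bsub>A\<^esub> a = a \<otimes>\<^bsub>A\<^esub> \<phi> r) \<and>
     fin_gen K \<lparr>carrier = carrier A, mult = mult A, one = \<one>\<^bsub>A\<^esub>, zero = \<zero>\<^bsub>A\<^esub>, add = add A,
       smult = (\<lambda>r a. \<phi> r \<otimes>\<^bsub>A\<^esub> a)\<rparr>"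

text \<open>
  A factor of \<open>A\<close> in a decomposition as a product is isomorphic to an ideal of \<open>A\<close> (with its own unit),
  so factors over the same carrier type suffice.
\<close>

definition connected_ring :: "('a, 'b) ring_scheme \<Rightarrow> bool" where
  "connected_ring A \<longleftrightarrow> carrier A \<noteq> {\<zero>\<^bsub>A\<^esub>} \<and>
     \<not> (\<exists>(B :: 'a ring) (C :: 'a ring). ring B \<and> ring C \<and>
          carrier B \<noteq> {\<zero>\<^bsub>B\<^esub>} \<and> carrier C \<noteq> {\<zero>\<^bsub>C\<^esub>} \<and> A \<simeq> RDirProd B C)"

definition orthogonal_idempotents :: "('a, 'b) ring_scheme \<Rightarrow> 'a set \<Rightarrow> bool" where
  "orthogonal_idempotents A E \<longleftrightarrow> E \<subseteq> carrier A \<and>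
     (\<forall>e \<in> E. \<forall>f \<in> E. e \<otimes>\<^bsub>A\<^esub> f = (if e = f then e else \<zero>\<^bsub>A\<^esub>))"

definition primitive_idempotent :: "('a, 'b) ring_scheme \<Rightarrow> 'a \<Rightarrow> bool" where
  "primitive_idempotent A e \<longleftrightarrow> e \<in> carrier A \<and> e \<otimes>\<^bsub>A\<^esub> e = e \<and> e \<noteq> \<zero>\<^bsub>A\<^esub> \<and>
     (\<forall>f \<in> carrier A. \<forall>g \<in> carrier A.
        f \<otimes>\<^bsub>A\<^esub> f = f \<and> g \<otimes>\<^bsub>A\<^esub> g = g \<and> f \<otimes>\<^bsub>A\<^esub> g = \<zero>\<^bsub>A\<^esub> \<and> g \<otimes>\<^bsub>A\<^esub> f = \<zero>\<^bsub>A\<^esub> \<and> e = f \<oplus>\<^bsub>A\<^esub> g \<longrightarrow>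
        f = \<zero>\<^bsub>A\<^esub> \<or> g = \<zero>\<^bsub>A\<^esub>)"

definition complete_primitive_idempotents :: "('a, 'b) ring_scheme \<Rightarrow> 'a set \<Rightarrow> bool" where
  "complete_primitive_idempotents A E \<longleftrightarrow> finite E \<and> orthogonal_idempotents A E \<and>
     (\<forall>e \<in> E. primitive_idempotent A e) \<and> (\<Oplus>\<^bsub>A\<^esub>e\<in>E. e) = \<one>\<^bsub>A\<^esub>"

definition basic :: "('a, 'b) ring_scheme \<Rightarrow> bool" where
  "basic A \<longleftrightarrow> (\<exists>E. complete_primitive_idempotents A E \<and>
     (\<forall>e \<in> E. \<forall>f \<in> E. e \<noteq> f \<longrightarrow>
        \<not> rmod_iso A ((regular_module A)\<lparr>carrier := e <#\<^bsub>A\<^esub> carrier A\<rparr>)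
                     ((regular_module A)\<lparr>carrier := f <#\<^bsub>A\<^esub> carrier A\<rparr>)))"

text \<open>
  Submodules of the regular module are the right ideals. Over an Artin algebra they are finitely
  generated, and the right-hand notion agrees with the left-hand one.
\<close>

definition hereditary :: "('a, 'b) ring_scheme \<Rightarrow> bool" where
  "hereditary A \<longleftrightarrow> (\<forall>I. submodule I A (regular_module A) \<longrightarrow>
     projective A ((regular_module A)\<lparr>carrier := I\<rparr>))"

definition jacobson_radical :: "('a, 'b) ring_scheme \<Rightarrow> 'a set" where
  "jacobson_radical A = carrier A \<inter> \<Inter> {I. submodule I A (regular_module A) \<and> I \<noteq> carrier A \<and>
     (\<forall>H. submodule H A (regular_module A) \<and> I \<subseteq> H \<longrightarrow> H = I \<or> H = carrier A)}"

text \<open>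
  A pair \<open>(y, x)\<close> stands for an arrow \<open>y \<rightarrow> x\<close>. As \<open>e\<^sub>y J\<^sup>2 e\<^sub>x \<subseteq> e\<^sub>y J e\<^sub>x\<close>, the quotient is non-zero if and
  only if the two sets differ. Loops are arrows \<open>(x, x)\<close>, hence oriented cycles.
\<close>

definition valued_quiver :: "('a, 'b) ring_scheme \<Rightarrow> 'a set \<Rightarrow> ('a \<times> 'a) set" where
  "valued_quiver A E = (let J = jacobson_radical A in
     {(y, x). y \<in> E \<and> x \<in> E \<and>
       (\<lambda>j. y \<otimes>\<^bsub>A\<^esub> j \<otimes>\<^bsub>A\<^esub> x) ` J \<noteq> (\<lambda>j. y \<otimes>\<^bsub>A\<^esub> j \<otimes>\<^bsub>A\<^esub> x) ` (J \<cdot>\<^bsub>A\<^esub> J)})"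

end

theory Submission
  imports Defs
begin

text \<open>
  Let \<open>\<C> = add \<L>\<close>. Since \<open>\<L>\<close> is closed under predecessors, \<open>\<C>\<close> is closed under submodules, and
  because it is abelian exact it is also closed under quotients. Hence every module has a largest
  submodule in \<open>\<C>\<close>, whose inclusion is a right \<open>\<C>\<close>-approximation. If \<open>P \<in> \<C>\<close> is projective and
  \<open>U \<subseteq> P\<close>, then \<open>P/U \<in> \<C>\<close> has projective dimension at most one, so \<open>U\<close> is projective. Applied to
  the supporting projective module this makes its endomorphism ring hereditary. If the quiver has no
  oriented cycles and some \<open>yA\<close> is not in \<open>\<L>\<close>, choose \<open>y\<close> as far down the quiver as possible: then
  \<open>yJ\<close> is a quotient of a module in \<open>\<C>\<close>, so all proper predecessors of \<open>yA\<close> lie in \<open>\<L>\<close>, a contradiction.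
\<close>

section \<open>Submodules and homomorphisms\<close>

text \<open>Closure of \<open>\<C>\<close> under submodules rests on the definition of
  \<open>\<L>\<close>: an indecomposable piece of a submodule of \<open>M \<in> \<C>\<close> has a
  non-zero map to some summand from \<open>\<L>\<close>, so it is a predecessor and lies in
  \<open>\<L>\<close>. The bound on projective dimension holds by definition on \<open>\<L>\<close>;
  Schanuel's argument turns it into a statement about kernels of arbitrary epimorphisms from
  projective modules, which extends to all of \<open>\<C>\<close>. The obstacle is the carrier type.
  \<open>mod_cat\<close> fixes one type, whereas \<open>eA\<close>, the regular module and the
  supporting projective module live in others. Such a module is replaced by an isomorphic copy in
  \<open>mod_cat\<close>, and the copy is recognised as a member of \<open>\<C>\<close> because its
  largest submodule in \<open>\<C>\<close> contains the image of every map from \<open>\<C>\<close>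
  and turns out to be everything. The final contradiction comes from the form of the definition of
  \<open>\<L>\<close>, which speaks of predecessors only: those of \<open>yA\<close> outside
  \<open>\<L>\<close> are isomorphic to \<open>yA\<close>, hence projective, so \<open>yA\<close>
  satisfies the condition and belongs to \<open>\<L>\<close> after all.\<close>

context right_module
begin

text \<open>Negatives come from acting with -1, so the subgroup part of the locale comes down to
  zero and sums. Most submodules below are checked and used through this criterion.\<close>

lemma submodule_iff:
  "submodule U A M \<longleftrightarrow> U \<subseteq> carrier M \<and> \<zero>\<^bsub>M\<^esub> \<in> U \<and> (\<forall>x\<in>U. \<forall>y\<in>U. x \<oplus>\<^bsub>M\<^esub> y \<in> U) \<and>
     (\<forall>a\<in>carrier A. \<forall>x\<in>U. a \<odot>\<^bsub>M\<^esub> x \<in> U)" (is "?l \<longleftrightarrow> ?r")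
proof
  assume ?l
  then interpret U: submodule U A M .
  show ?r using U.subset U.one_closed U.m_closed U.smult_closed by auto
next
  assume r: ?r
  show ?l
  proof (unfold_locales)
    show "inv\<^bsub>add_monoid M\<^esub> x \<in> U" if "x \<in> U" for x
    proof -
      have "(\<ominus>\<^bsub>A\<^esub> \<one>\<^bsub>A\<^esub>) \<odot>\<^bsub>M\<^esub> x \<in> U" using r that by simp
      moreover have "x \<in> carrier M" using r that by auto
      ultimately show ?thesis using smult_minus_one[of x] by (simp add: a_inv_def)
    qed
  qed (use r in auto)
qed

lemma submodule_carrier: "submodule (carrier M) A M"
  by (auto simp: submodule_iff)

lemma submodule_zero: "submodule {\<zero>\<^bsub>M\<^esub>} A M"
  by (auto simp: submodule_iff smult_zero_right)

lemma submodule_Int: "submodule U A M \<Longrightarrow> submodule V A M \<Longrightarrow> submodule (U \<inter> V) A M"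
  by (auto simp: submodule_iff)

lemma submodule_minus: "submodule U A M \<Longrightarrow> x \<in> U \<Longrightarrow> \<ominus>\<^bsub>M\<^esub> x \<in> U"
  using smult_minus_one[of x] by (metis A.add.inv_closed A.one_closed submodule_iff subset_iff)

lemma submodule_sum:
  assumes "submodule U A M" "submodule V A M"
  shows "submodule (U <+>\<^bsub>M\<^esub> V) A M"
proof -
  have U: "U \<subseteq> carrier M" "\<zero>\<^bsub>M\<^esub> \<in> U" "\<And>x y. x\<in>U \<Longrightarrow> y\<in>U \<Longrightarrow> x \<oplus>\<^bsub>M\<^esub> y \<in> U"
     "\<And>x a. a\<in>carrier A \<Longrightarrow> x\<in>U \<Longrightarrow> a \<odot>\<^bsub>M\<^esub> x \<in> U" using assms(1) by (auto simp: submodule_iff)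
  have V: "V \<subseteq> carrier M" "\<zero>\<^bsub>M\<^esub> \<in> V" "\<And>x y. x\<in>V \<Longrightarrow> y\<in>V \<Longrightarrow> x \<oplus>\<^bsub>M\<^esub> y \<in> V"
     "\<And>x a. a\<in>carrier A \<Longrightarrow> x\<in>V \<Longrightarrow> a \<odot>\<^bsub>M\<^esub> x \<in> V" using assms(2) by (auto simp: submodule_iff)
  show ?thesis unfolding submodule_iff set_add_def'
  proof (intro conjI ballI)
    show "(\<Union>h\<in>U. \<Union>k\<in>V. {h \<oplus>\<^bsub>M\<^esub> k}) \<subseteq> carrier M" using U V by blast
    show "\<zero>\<^bsub>M\<^esub> \<in> (\<Union>h\<in>U. \<Union>k\<in>V. {h \<oplus>\<^bsub>M\<^esub> k})" using U V by force
    fix x assume "x \<in> (\<Union>h\<in>U. \<Union>k\<in>V. {h \<oplus>\<^bsub>M\<^esub> k})"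
    then obtain h k where x: "h \<in> U" "k \<in> V" "x = h \<oplus>\<^bsub>M\<^esub> k" by blast
    have c: "h \<in> carrier M" "k \<in> carrier M" using x U V by auto
    show "a \<odot>\<^bsub>M\<^esub> x \<in> (\<Union>h\<in>U. \<Union>k\<in>V. {h \<oplus>\<^bsub>M\<^esub> k})" if "a \<in> carrier A" for a
      using that x c U(4)[of a h] V(4)[of a k] by (auto simp: smult_r_distr)
    fix y assume "y \<in> (\<Union>h\<in>U. \<Union>k\<in>V. {h \<oplus>\<^bsub>M\<^esub> k})"
    then obtain h' k' where y: "h' \<in> U" "k' \<in> V" "y = h' \<oplus>\<^bsub>M\<^esub> k'" by blast
    have c': "h' \<in> carrier M" "k' \<in> carrier M" using y U V by auto
    have "x \<oplus>\<^bsub>M\<^esub> y = (h \<oplus>\<^bsub>M\<^esub> h') \<oplus>\<^bsub>M\<^esub> (k \<oplus>\<^bsub>M\<^esub> k')" using x y c c' by (simp add: M.a_ac)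
    then show "x \<oplus>\<^bsub>M\<^esub> y \<in> (\<Union>h\<in>U. \<Union>k\<in>V. {h \<oplus>\<^bsub>M\<^esub> k})" using x y U(3)[of h h'] V(3)[of k k'] by blast
  qed
qed

lemma right_module_submodule:
  assumes "submodule U A M"
  shows "right_module A (M\<lparr>carrier := U\<rparr>)"
proof -
  have U: "U \<subseteq> carrier M" "\<zero>\<^bsub>M\<^esub> \<in> U" "\<And>x y. x\<in>U \<Longrightarrow> y\<in>U \<Longrightarrow> x \<oplus>\<^bsub>M\<^esub> y \<in> U"
     "\<And>x a. a\<in>carrier A \<Longrightarrow> x\<in>U \<Longrightarrow> a \<odot>\<^bsub>M\<^esub> x \<in> U" using assms by (auto simp: submodule_iff)
  have c: "x \<in> U \<Longrightarrow> x \<in> carrier M" for x using U by auto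
  have "abelian_group (M\<lparr>carrier := U\<rparr>)"
  proof (rule abelian_groupI)
    fix x assume "x \<in> carrier (M\<lparr>carrier := U\<rparr>)"
    then show "\<exists>y\<in>carrier (M\<lparr>carrier := U\<rparr>). y \<oplus>\<^bsub>M\<lparr>carrier := U\<rparr>\<^esub> x = \<zero>\<^bsub>M\<lparr>carrier := U\<rparr>\<^esub>"
      using submodule_minus[OF assms, of x] c by (intro bexI[of _ "\<ominus>\<^bsub>M\<^esub> x"]) (auto simp: M.l_neg)
  qed (use U c in \<open>auto simp: M.a_ac\<close>)
  then show ?thesis
    by (intro right_module.intro right_module_axioms.intro A.ring_axioms)
       (use U c in \<open>auto simp: smult_l_distr smult_r_distr smult_assoc\<close>)
qed

lemma submodule_submodule_iff:
  assumes "submodule U A M"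
  shows "submodule V A (M\<lparr>carrier := U\<rparr>) \<longleftrightarrow> submodule V A M \<and> V \<subseteq> U"
proof -
  interpret U: right_module A "M\<lparr>carrier := U\<rparr>" by (rule right_module_submodule) fact
  show ?thesis using assms unfolding U.submodule_iff submodule_iff by auto
qed

end

lemma rmod_hom_closed: "f \<in> rmod_hom A M N \<Longrightarrow> x \<in> carrier M \<Longrightarrow> f x \<in> carrier N"
  by (auto simp: rmod_hom_def)

lemma rmod_hom_add: "f \<in> rmod_hom A M N \<Longrightarrow> x \<in> carrier M \<Longrightarrow> y \<in> carrier M \<Longrightarrow>
    f (x \<oplus>\<^bsub>M\<^esub> y) = f x \<oplus>\<^bsub>N\<^esub> f y"
  by (auto simp: rmod_hom_def)

lemma rmod_hom_smult: "f \<in> rmod_hom A M N \<Longrightarrow> a \<in> carrier A \<Longrightarrow> x \<in> carrier M \<Longrightarrow>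
    f (a \<odot>\<^bsub>M\<^esub> x) = a \<odot>\<^bsub>N\<^esub> f x"
  by (auto simp: rmod_hom_def)

lemma rmod_hom_ext: "f \<in> rmod_hom A M N \<Longrightarrow> g \<in> rmod_hom A M N' \<Longrightarrow> (\<And>x. x \<in> carrier M \<Longrightarrow> f x = g x) \<Longrightarrow> f = g"
  unfolding rmod_hom_def by (auto intro!: extensionalityI[of f "carrier M" g] simp: PiE_def)

lemma rmod_hom_restrictI:
  assumes "\<And>x. x \<in> carrier M \<Longrightarrow> f x \<in> carrier N"
    "\<And>x y. x \<in> carrier M \<Longrightarrow> y \<in> carrier M \<Longrightarrow> f (x \<oplus>\<^bsub>M\<^esub> y) = f x \<oplus>\<^bsub>N\<^esub> f y"
    "\<And>a x. a \<in> carrier A \<Longrightarrow> x \<in> carrier M \<Longrightarrow> f (a \<odot>\<^bsub>M\<^esub> x) = a \<odot>\<^bsub>N\<^esub> f x"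
    and M: "right_module A M"
  shows "restrict f (carrier M) \<in> rmod_hom A M N"
proof -
  interpret right_module A M by fact
  show ?thesis using assms(1-3) by (simp add: rmod_hom_def)
qed

lemma rmod_hom_zero:
  assumes "right_module A M" "right_module A N" "f \<in> rmod_hom A M N"
  shows "f \<zero>\<^bsub>M\<^esub> = \<zero>\<^bsub>N\<^esub>"
proof -
  interpret M: right_module A M by fact
  interpret N: right_module A N by fact
  show ?thesis using rmod_hom_smult[OF assms(3) M.A.zero_closed M.M.zero_closed] rmod_hom_closed[OF assms(3)]
    by (simp add: M.smult_zero_left N.smult_zero_left)
qed

lemma rmod_hom_minus:
  assumes "right_module A M" "right_module A N" "f \<in> rmod_hom A M N" "x \<in> carrier M"
  shows "f (\<ominus>\<^bsub>M\<^esub> x) = \<ominus>\<^bsub>N\<^esub> f x"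
proof -
  interpret M: right_module A M by fact
  interpret N: right_module A N by fact
  show ?thesis using rmod_hom_smult[OF assms(3), of "\<ominus>\<^bsub>A\<^esub> \<one>\<^bsub>A\<^esub>" x] assms(4) rmod_hom_closed[OF assms(3)]
    by (simp add: M.smult_minus_one N.smult_minus_one)
qed

lemma rmod_hom_diff:
  assumes "right_module A M" "right_module A N" "f \<in> rmod_hom A M N" "x \<in> carrier M" "y \<in> carrier M"
  shows "f (x \<ominus>\<^bsub>M\<^esub> y) = f x \<ominus>\<^bsub>N\<^esub> f y"
proof -
  interpret M: right_module A M by fact
  show ?thesis using assms rmod_hom_add[OF assms(3), of x "\<ominus>\<^bsub>M\<^esub> y"] rmod_hom_minus[OF assms(1-3), of y]
    by (simp add: a_minus_def)
qed

lemma rmod_hom_compose: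
  assumes "right_module A M" "f \<in> rmod_hom A M N" "g \<in> rmod_hom A N Q"
  shows "compose (carrier M) g f \<in> rmod_hom A M Q"
  unfolding compose_def
  by (rule rmod_hom_restrictI) (use assms(1) rmod_hom_closed[OF assms(2)] rmod_hom_closed[OF assms(3)] in
        \<open>auto simp: rmod_hom_add[OF assms(2)] rmod_hom_add[OF assms(3)]
          rmod_hom_smult[OF assms(2)] rmod_hom_smult[OF assms(3)]\<close>)

lemma rmod_hom_restrict_dom:
  assumes "right_module A M" "f \<in> rmod_hom A M N" "submodule U A M"
  shows "restrict f U \<in> rmod_hom A (M\<lparr>carrier := U\<rparr>) N"
proof -
  interpret right_module A M by fact
  have "U \<subseteq> carrier M" using assms(3) by (simp add: submodule_iff)
  then show ?thesis
    using rmod_hom_restrictI[OF _ _ _ right_module_submodule[OF assms(3)], of f N] rmod_hom_closed[OF assms(2)]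
    by (auto simp: rmod_hom_add[OF assms(2)] rmod_hom_smult[OF assms(2)] subset_iff)
qed

lemma rmod_hom_inclusion:
  assumes "right_module A M" "submodule U A M"
  shows "(\<lambda>x\<in>U. x) \<in> rmod_hom A (M\<lparr>carrier := U\<rparr>) M"
proof -
  interpret right_module A M by fact
  show ?thesis
    using rmod_hom_restrictI[OF _ _ _ right_module_submodule[OF assms(2)], of "\<lambda>x. x" M] assms(2)
    by (auto simp: submodule_iff)
qed

lemma rmod_hom_id: "right_module A M \<Longrightarrow> (\<lambda>x\<in>carrier M. x) \<in> rmod_hom A M M"
  by (rule rmod_hom_restrictI) auto

text \<open>A submodule is the same record with a smaller carrier, so the operations agree and the
  very same function serves as a map into it.\<close>

lemma rmod_hom_codom_restrict:
  assumes "f \<in> rmod_hom A M N" "\<And>x. x \<in> carrier M \<Longrightarrow> f x \<in> U"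
  shows "f \<in> rmod_hom A M (N\<lparr>carrier := U\<rparr>)"
  using assms by (simp add: rmod_hom_def PiE_iff)

lemma rmod_hom_codom_extend:
  assumes "f \<in> rmod_hom A M (N\<lparr>carrier := U\<rparr>)" "U \<subseteq> carrier N"
  shows "f \<in> rmod_hom A M N"
  using assms by (simp add: rmod_hom_def PiE_iff subset_iff)

lemma submodule_image:
  assumes "right_module A M" "right_module A N" "f \<in> rmod_hom A M N" "submodule U A M"
  shows "submodule (f ` U) A N"
proof -
  interpret M: right_module A M by fact
  interpret N: right_module A N by fact
  have U: "U \<subseteq> carrier M" "\<zero>\<^bsub>M\<^esub> \<in> U" "\<And>x y. x\<in>U \<Longrightarrow> y\<in>U \<Longrightarrow> x \<oplus>\<^bsub>M\<^esub> y \<in> U"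
     "\<And>x a. a\<in>carrier A \<Longrightarrow> x\<in>U \<Longrightarrow> a \<odot>\<^bsub>M\<^esub> x \<in> U" using assms(4) by (auto simp: M.submodule_iff)
  have c: "x \<in> U \<Longrightarrow> x \<in> carrier M" for x using U by auto
  have f: "x \<in> U \<Longrightarrow> y \<in> U \<Longrightarrow> f x \<oplus>\<^bsub>N\<^esub> f y = f (x \<oplus>\<^bsub>M\<^esub> y)"
      "a \<in> carrier A \<Longrightarrow> x \<in> U \<Longrightarrow> a \<odot>\<^bsub>N\<^esub> f x = f (a \<odot>\<^bsub>M\<^esub> x)" for x y a
    using c by (auto simp: rmod_hom_add[OF assms(3)] rmod_hom_smult[OF assms(3)])
  have z: "\<zero>\<^bsub>N\<^esub> = f \<zero>\<^bsub>M\<^esub>" using rmod_hom_zero[OF assms(1-3)] by simp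
  show ?thesis unfolding N.submodule_iff
    using U c rmod_hom_closed[OF assms(3)] by (auto simp: f z)
qed

lemma submodule_preimage:
  assumes "right_module A M" "right_module A N" "f \<in> rmod_hom A M N" "submodule V A N"
  shows "submodule {x \<in> carrier M. f x \<in> V} A M"
proof -
  interpret M: right_module A M by fact
  interpret N: right_module A N by fact
  show ?thesis
    unfolding M.submodule_iff using assms(4) rmod_hom_zero[OF assms(1-3)]
    by (auto simp: rmod_hom_add[OF assms(3)] rmod_hom_smult[OF assms(3)] N.submodule_iff)
qed

lemma submodule_kernel:
  assumes "right_module A M" "right_module A N" "f \<in> rmod_hom A M N"
  shows "submodule {x \<in> carrier M. f x = \<zero>\<^bsub>N\<^esub>} A M"
proof -
  interpret N: right_module A N by fact
  show ?thesis using submodule_preimage[OF assms N.submodule_zero] by simp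
qed

lemma zero_hom_mem: "right_module A M \<Longrightarrow> right_module A N \<Longrightarrow> zero_hom M N \<in> rmod_hom A M N"
  unfolding zero_hom_def
  by (rule rmod_hom_restrictI)
     (simp_all add: right_module.smult_zero_right right_module.axioms(2) abelian_group.axioms(1)
       abelian_monoid.zero_closed abelian_monoid.l_zero)

lemma rmod_hom_finsum:
  assumes M: "right_module A M" and N: "right_module A N" and f: "f \<in> rmod_hom A M N"
    and S: "finite S" "\<And>i. i \<in> S \<Longrightarrow> \<phi> i \<in> carrier M"
  shows "f (\<Oplus>\<^bsub>M\<^esub>i\<in>S. \<phi> i) = (\<Oplus>\<^bsub>N\<^esub>i\<in>S. f (\<phi> i))"
  using S
proof induction
  case empty
  show ?case using rmod_hom_zero[OF M N f] right_module.axioms(2)[OF M] right_module.axioms(2)[OF N]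
    by (simp add: abelian_group_def abelian_monoid.finsum_empty)
next
  interpret M: right_module A M by fact
  interpret N: right_module A N by fact
  case (insert i S)
  have 1: "(\<Oplus>\<^bsub>M\<^esub>i\<in>insert i S. \<phi> i) = \<phi> i \<oplus>\<^bsub>M\<^esub> (\<Oplus>\<^bsub>M\<^esub>i\<in>S. \<phi> i)"
    using insert by (intro M.M.finsum_insert) auto
  have 2: "(\<Oplus>\<^bsub>N\<^esub>i\<in>insert i S. f (\<phi> i)) = f (\<phi> i) \<oplus>\<^bsub>N\<^esub> (\<Oplus>\<^bsub>N\<^esub>i\<in>S. f (\<phi> i))"
    using insert rmod_hom_closed[OF f] by (intro N.M.finsum_insert) auto
  have 3: "(\<Oplus>\<^bsub>M\<^esub>i\<in>S. \<phi> i) \<in> carrier M" using insert by (intro M.M.finsum_closed) auto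
  show ?case unfolding 1 2 using rmod_hom_add[OF f _ 3, of "\<phi> i"] insert by simp
qed

lemma rmod_hom_inj_iff:
  assumes "right_module A M" "right_module A N" "f \<in> rmod_hom A M N"
  shows "inj_on f (carrier M) \<longleftrightarrow> (\<forall>x\<in>carrier M. f x = \<zero>\<^bsub>N\<^esub> \<longrightarrow> x = \<zero>\<^bsub>M\<^esub>)"
proof -
  interpret M: right_module A M by fact
  interpret N: right_module A N by fact
  show ?thesis
  proof
    assume "inj_on f (carrier M)"
    then show "\<forall>x\<in>carrier M. f x = \<zero>\<^bsub>N\<^esub> \<longrightarrow> x = \<zero>\<^bsub>M\<^esub>"
      using rmod_hom_zero[OF assms] by (metis M.M.zero_closed inj_onD)
  next
    assume r: "\<forall>x\<in>carrier M. f x = \<zero>\<^bsub>N\<^esub> \<longrightarrow> x = \<zero>\<^bsub>M\<^esub>"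
    show "inj_on f (carrier M)"
    proof (rule inj_onI)
      fix x y assume xy: "x \<in> carrier M" "y \<in> carrier M" "f x = f y"
      have "f (x \<ominus>\<^bsub>M\<^esub> y) = \<zero>\<^bsub>N\<^esub>" using xy rmod_hom_closed[OF assms(3)]
        by (simp only: rmod_hom_diff[OF assms]) (simp add: N.M.r_neg a_minus_def)
      then have "x \<ominus>\<^bsub>M\<^esub> y = \<zero>\<^bsub>M\<^esub>" using r xy(1,2) M.M.minus_closed by blast
      moreover have "x = (x \<ominus>\<^bsub>M\<^esub> y) \<oplus>\<^bsub>M\<^esub> y" using xy(1,2) by (simp add: a_minus_def M.M.a_assoc M.M.l_neg)
      ultimately show "x = y" using xy(1,2) by simp
    qed
  qed
qed

section \<open>Isomorphisms and finitely generated images\<close>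

lemma rmod_hom_inv:
  assumes M: "right_module A M" and f: "f \<in> rmod_hom A M N" "bij_betw f (carrier M) (carrier N)"
    and N: "right_module A N"
  shows "restrict (inv_into (carrier M) f) (carrier N) \<in> rmod_hom A N M"
proof (rule rmod_hom_restrictI[OF _ _ _ N])
  interpret M: right_module A M by fact
  interpret N: right_module A N by fact
  let ?g = "inv_into (carrier M) f"
  have g: "?g y \<in> carrier M" "f (?g y) = y" if "y \<in> carrier N" for y
    using f(2) that by (auto simp: bij_betw_def f_inv_into_f inv_into_into)
  have gf: "?g (f x) = x" if "x \<in> carrier M" for x
    using f(2) that by (simp add: bij_betw_def)
  show "?g x \<in> carrier M" if "x \<in> carrier N" for x using g that by simp
  show "?g (x \<oplus>\<^bsub>N\<^esub> y) = ?g x \<oplus>\<^bsub>M\<^esub> ?g y" if "x \<in> carrier N" "y \<in> carrier N" for x y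
    using gf[of "?g x \<oplus>\<^bsub>M\<^esub> ?g y"] g that by (simp add: rmod_hom_add[OF f(1)])
  show "?g (a \<odot>\<^bsub>N\<^esub> x) = a \<odot>\<^bsub>M\<^esub> ?g x" if "a \<in> carrier A" "x \<in> carrier N" for a x
    using gf[of "a \<odot>\<^bsub>M\<^esub> ?g x"] g that by (simp add: rmod_hom_smult[OF f(1)])
qed

lemma rmod_isoE:
  assumes "rmod_iso A M N" "right_module A M" "right_module A N"
  obtains f g where "f \<in> rmod_hom A M N" "g \<in> rmod_hom A N M"
    "\<And>x. x \<in> carrier M \<Longrightarrow> g (f x) = x" "\<And>y. y \<in> carrier N \<Longrightarrow> f (g y) = y"
proof -
  obtain f where f: "f \<in> rmod_hom A M N" "bij_betw f (carrier M) (carrier N)"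
    using assms(1) by (auto simp: rmod_iso_def)
  show thesis
    by (rule that[OF f(1) rmod_hom_inv[OF assms(2) f assms(3)]])
       (use f in \<open>auto simp: bij_betw_def f_inv_into_f\<close>)
qed

lemma rmod_isoI:
  assumes "f \<in> rmod_hom A M N" "g \<in> rmod_hom A N M"
    "\<And>x. x \<in> carrier M \<Longrightarrow> g (f x) = x" "\<And>y. y \<in> carrier N \<Longrightarrow> f (g y) = y"
  shows "rmod_iso A M N"
  unfolding rmod_iso_def using assms
  by (intro bexI[OF _ assms(1)] bij_betw_byWitness[where f' = g]) (auto simp: rmod_hom_closed)

lemma rmod_iso_sym: "rmod_iso A M N \<Longrightarrow> right_module A M \<Longrightarrow> right_module A N \<Longrightarrow> rmod_iso A N M"
  by (erule rmod_isoE) (auto intro: rmod_isoI)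

lemma rmod_iso_trans: "rmod_iso A M N \<Longrightarrow> rmod_iso A N Q \<Longrightarrow> right_module A M \<Longrightarrow> rmod_iso A M Q"
  unfolding rmod_iso_def using rmod_hom_compose bij_betw_comp_iff
  apply (clarsimp)
  subgoal for f g
    by (rule bexI[of _ "compose (carrier M) g f"]) (auto simp: bij_betw_compose intro: rmod_hom_compose)
  done

lemma fin_gen_hom_image:
  assumes M: "right_module A M" and N: "right_module A N" and f: "f \<in> rmod_hom A M N"
    "f ` carrier M = carrier N" and fg: "fin_gen A M"
  shows "fin_gen A N"
proof -
  interpret M: right_module A M by fact
  interpret N: right_module A N by fact
  obtain S where S: "S \<subseteq> carrier M" "finite S"
    and gen: "\<And>H. submodule H A M \<Longrightarrow> S \<subseteq> H \<Longrightarrow> H = carrier M"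
    using fg by (auto simp: fin_gen_def)
  have "H = carrier N" if H: "submodule H A N" and SH: "f ` S \<subseteq> H" for H
  proof -
    have "{x \<in> carrier M. f x \<in> H} = carrier M"
      by (rule gen[OF submodule_preimage[OF M N f(1) H]]) (use S SH in auto)
    then have "f ` carrier M \<subseteq> H" by blast
    then show ?thesis using f(2) H by (simp add: N.submodule_iff subset_antisym)
  qed
  then show ?thesis unfolding fin_gen_def using S rmod_hom_closed[OF f(1)]
    by (intro exI[of _ "f ` S"]) auto
qed

lemma regular_module_simps [simp]:
  "carrier (regular_module A) = carrier A" "\<zero>\<^bsub>regular_module A\<^esub> = \<zero>\<^bsub>A\<^esub>"
  "x \<oplus>\<^bsub>regular_module A\<^esub> y = x \<oplus>\<^bsub>A\<^esub> y" "a \<odot>\<^bsub>regular_module A\<^esub> x = x \<otimes>\<^bsub>A\<^esub> a"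
  by (simp_all add: regular_module_def)

lemma (in ring) right_module_regular: "right_module R (regular_module R)"
proof -
  have "abelian_group (regular_module R)"
    by (rule abelian_groupI) (auto simp: a_ac intro: l_neg bexI[of _ "\<ominus> _"])
  then show ?thesis
    by (intro right_module.intro right_module_axioms.intro ring_axioms) (auto simp: l_distr r_distr m_assoc)
qed

section \<open>Chain conditions\<close>

text \<open>Strict inclusion is kept as a relation so that both chain conditions become
  well-foundedness. They can then be moved along inverse images and lexicographic products, and
  minimal or maximal submodules exist at once.\<close>

definition submodule_rel :: "('a, 'b) ring_scheme \<Rightarrow> ('a, 'm) module \<Rightarrow> ('m set \<times> 'm set) set" where
  "submodule_rel A M = {(U, V). submodule U A M \<and> submodule V A M \<and> U \<subset> V}"

definition artinian_module :: "('a, 'b) ring_scheme \<Rightarrow> ('a, 'm) module \<Rightarrow> bool" where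
  "artinian_module A M \<longleftrightarrow> wf (submodule_rel A M)"

definition noetherian_module :: "('a, 'b) ring_scheme \<Rightarrow> ('a, 'm) module \<Rightarrow> bool" where
  "noetherian_module A M \<longleftrightarrow> wf ((submodule_rel A M)\<inverse>)"

lemma artinian_minimal:
  assumes "artinian_module A M" "submodule U A M" "P U"
  shows "\<exists>V. submodule V A M \<and> P V \<and> (\<forall>W. submodule W A M \<longrightarrow> W \<subset> V \<longrightarrow> \<not> P W)"
proof -
  obtain V where V: "V \<in> {V. submodule V A M \<and> P V}"
      "\<And>W. (W, V) \<in> submodule_rel A M \<Longrightarrow> W \<notin> {V. submodule V A M \<and> P V}"
    using assms wfE_min[of "submodule_rel A M" U "{V. submodule V A M \<and> P V}"]
    by (auto simp: artinian_module_def)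
  show ?thesis by (rule exI[of _ V]) (use V in \<open>auto simp: submodule_rel_def\<close>)
qed

lemma noetherian_maximal:
  assumes "noetherian_module A M" "submodule U A M" "P U"
  shows "\<exists>V. submodule V A M \<and> P V \<and> (\<forall>W. submodule W A M \<longrightarrow> V \<subset> W \<longrightarrow> \<not> P W)"
proof -
  obtain V where V: "V \<in> {V. submodule V A M \<and> P V}"
      "\<And>W. (W, V) \<in> (submodule_rel A M)\<inverse> \<Longrightarrow> W \<notin> {V. submodule V A M \<and> P V}"
    using assms wfE_min[of "(submodule_rel A M)\<inverse>" U "{V. submodule V A M \<and> P V}"]
    by (auto simp: noetherian_module_def)
  show ?thesis by (rule exI[of _ V]) (use V in \<open>auto simp: submodule_rel_def\<close>)
qed

lemma artinian_chain_stable: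
  assumes "artinian_module A M" "\<And>n. submodule (U n) A M" "\<And>n. U (Suc n) \<subseteq> U n"
  shows "\<exists>m. \<forall>n\<ge>m. U n = U m"
proof -
  obtain V where V: "V \<in> range U" "\<And>W. (W, V) \<in> submodule_rel A M \<Longrightarrow> W \<notin> range U"
    using assms(1) wfE_min[of "submodule_rel A M" "U 0" "range U"] by (auto simp: artinian_module_def)
  then obtain m where m: "V = U m" by auto
  have "U n = U m" if "n \<ge> m" for n
  proof -
    have "U n \<subseteq> U m" using that assms(3) by (rule lift_Suc_antimono_le[rotated])
    then show ?thesis using V(2)[of "U n"] assms(2) m by (auto simp: submodule_rel_def)
  qed
  then show ?thesis by blast
qed

lemma noetherian_chain_stable:
  assumes "noetherian_module A M" "\<And>n. submodule (U n) A M" "\<And>n. U n \<subseteq> U (Suc n)"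
  shows "\<exists>m. \<forall>n\<ge>m. U n = U m"
proof -
  obtain V where V: "V \<in> range U" "\<And>W. (W, V) \<in> (submodule_rel A M)\<inverse> \<Longrightarrow> W \<notin> range U"
    using assms(1) wfE_min[of "(submodule_rel A M)\<inverse>" "U 0" "range U"] by (auto simp: noetherian_module_def)
  then obtain m where m: "V = U m" by auto
  have "U n = U m" if "n \<ge> m" for n
  proof -
    have "U m \<subseteq> U n" using that assms(3) by (rule lift_Suc_mono_le[rotated])
    then show ?thesis using V(2)[of "U n"] assms(2) m by (auto simp: submodule_rel_def)
  qed
  then show ?thesis by blast
qed

lemma (in right_module) submodule_rel_submodule:
  "submodule U A M \<Longrightarrow> submodule_rel A (M\<lparr>carrier := U\<rparr>) \<subseteq> submodule_rel A M"
  by (auto simp: submodule_rel_def submodule_submodule_iff)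

lemma (in right_module) artinian_submodule:
  "submodule U A M \<Longrightarrow> artinian_module A M \<Longrightarrow> artinian_module A (M\<lparr>carrier := U\<rparr>)"
  unfolding artinian_module_def by (rule wf_subset[OF _ submodule_rel_submodule])

lemma (in right_module) noetherian_submodule:
  "submodule U A M \<Longrightarrow> noetherian_module A M \<Longrightarrow> noetherian_module A (M\<lparr>carrier := U\<rparr>)"
  unfolding noetherian_module_def
  by (rule wf_subset[of "(submodule_rel A M)\<inverse>"]) (use submodule_rel_submodule in blast)+

text \<open>
  For submodules \<open>N \<subseteq> W + sA\<close>, the pair formed by \<open>N \<inter> W\<close> and the right ideal
  \<open>{a. sa \<in> N + W}\<close> grows strictly with \<open>N\<close>, so both chain conditions pass from \<open>W\<close> to \<open>W + sA\<close>.
\<close>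

lemma (in right_module) adjoin_element:
  assumes W: "submodule W A M" and s: "s \<in> carrier M"
  defines "W' \<equiv> {w \<oplus>\<^bsub>M\<^esub> a \<odot>\<^bsub>M\<^esub> s | w a. w \<in> W \<and> a \<in> carrier A}"
  shows "submodule W' A M" "W \<subseteq> W'" "s \<in> W'"
    "artinian_module A (regular_module A) \<Longrightarrow> artinian_module A (M\<lparr>carrier := W\<rparr>) \<Longrightarrow>
       artinian_module A (M\<lparr>carrier := W'\<rparr>)"
    "noetherian_module A (regular_module A) \<Longrightarrow> noetherian_module A (M\<lparr>carrier := W\<rparr>) \<Longrightarrow>
       noetherian_module A (M\<lparr>carrier := W'\<rparr>)"
proof -
  interpret R: right_module A "regular_module A" by (rule A.right_module_regular)
  have Wp: "W \<subseteq> carrier M" "\<zero>\<^bsub>M\<^esub> \<in> W" "\<And>x y. x\<in>W \<Longrightarrow> y\<in>W \<Longrightarrow> x \<oplus>\<^bsub>M\<^esub> y \<in> W"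
     "\<And>x a. a\<in>carrier A \<Longrightarrow> x\<in>W \<Longrightarrow> a \<odot>\<^bsub>M\<^esub> x \<in> W" using W by (auto simp: submodule_iff)
  have Wc: "x \<in> W \<Longrightarrow> x \<in> carrier M" for x using Wp by auto
  have 1: "(w \<oplus>\<^bsub>M\<^esub> a \<odot>\<^bsub>M\<^esub> s) \<oplus>\<^bsub>M\<^esub> (w' \<oplus>\<^bsub>M\<^esub> a' \<odot>\<^bsub>M\<^esub> s) = (w \<oplus>\<^bsub>M\<^esub> w') \<oplus>\<^bsub>M\<^esub> (a \<oplus>\<^bsub>A\<^esub> a') \<odot>\<^bsub>M\<^esub> s"
    if "w \<in> carrier M" "w' \<in> carrier M" "a \<in> carrier A" "a' \<in> carrier A" for w w' a a'
    using that s by (simp add: smult_l_distr M.a_ac)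
  have 2: "b \<odot>\<^bsub>M\<^esub> (w \<oplus>\<^bsub>M\<^esub> a \<odot>\<^bsub>M\<^esub> s) = b \<odot>\<^bsub>M\<^esub> w \<oplus>\<^bsub>M\<^esub> (a \<otimes>\<^bsub>A\<^esub> b) \<odot>\<^bsub>M\<^esub> s"
    if "w \<in> carrier M" "b \<in> carrier A" "a \<in> carrier A" for w a b
    using that s by (simp add: smult_r_distr smult_assoc)
  have W'I: "w \<in> W \<Longrightarrow> a \<in> carrier A \<Longrightarrow> w \<oplus>\<^bsub>M\<^esub> a \<odot>\<^bsub>M\<^esub> s \<in> W'" for w a
    unfolding W'_def by blast
  show "W \<subseteq> W'"
  proof
    fix w assume "w \<in> W"
    then show "w \<in> W'" using W'I[of w "\<zero>\<^bsub>A\<^esub>"] s Wc by (simp add: smult_zero_left)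
  qed
  show "s \<in> W'" using W'I[of "\<zero>\<^bsub>M\<^esub>" "\<one>\<^bsub>A\<^esub>"] s Wp by simp
  show W': "submodule W' A M"
    unfolding submodule_iff
  proof (intro conjI ballI)
    show "W' \<subseteq> carrier M" using Wc s by (auto simp: W'_def)
    show "\<zero>\<^bsub>M\<^esub> \<in> W'" using \<open>W \<subseteq> W'\<close> Wp by auto
    fix x assume "x \<in> W'"
    then obtain w a where x: "w \<in> W" "a \<in> carrier A" "x = w \<oplus>\<^bsub>M\<^esub> a \<odot>\<^bsub>M\<^esub> s" by (auto simp: W'_def)
    show "b \<odot>\<^bsub>M\<^esub> x \<in> W'" if "b \<in> carrier A" for b
      using x that Wc W'I[of "b \<odot>\<^bsub>M\<^esub> w" "a \<otimes>\<^bsub>A\<^esub> b"] Wp(4) by (simp add: 2)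
    fix y assume "y \<in> W'"
    then obtain w' a' where y: "w' \<in> W" "a' \<in> carrier A" "y = w' \<oplus>\<^bsub>M\<^esub> a' \<odot>\<^bsub>M\<^esub> s" by (auto simp: W'_def)
    show "x \<oplus>\<^bsub>M\<^esub> y \<in> W'" using x y Wc W'I[of "w \<oplus>\<^bsub>M\<^esub> w'" "a \<oplus>\<^bsub>A\<^esub> a'"] Wp(3) by (simp add: 1)
  qed
  \<comment> \<open>This is the right ideal attached to \<open>N\<close>: since \<open>W\<close> is
    closed under negatives, \<open>sa \<in> N + W\<close> can be tested by
    \<open>w + sa \<in> N\<close> with \<open>w\<close> in \<open>W\<close>.\<close>
  define g where "g N = {a \<in> carrier A. \<exists>w\<in>W. w \<oplus>\<^bsub>M\<^esub> a \<odot>\<^bsub>M\<^esub> s \<in> N}" for N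
  have g: "submodule (g N) A (regular_module A)" if N: "submodule N A M" for N
  proof -
    have Np: "\<zero>\<^bsub>M\<^esub> \<in> N" "\<And>x y. x\<in>N \<Longrightarrow> y\<in>N \<Longrightarrow> x \<oplus>\<^bsub>M\<^esub> y \<in> N"
     "\<And>x a. a\<in>carrier A \<Longrightarrow> x\<in>N \<Longrightarrow> a \<odot>\<^bsub>M\<^esub> x \<in> N" using N by (auto simp: submodule_iff)
    show ?thesis unfolding R.submodule_iff
    proof (intro conjI ballI)
      show "g N \<subseteq> carrier (regular_module A)" by (auto simp: g_def)
      show "\<zero>\<^bsub>regular_module A\<^esub> \<in> g N" using Np Wp s by (auto simp: g_def smult_zero_left)
      fix a assume "a \<in> g N"
      then obtain w where a: "a \<in> carrier A" "w \<in> W" "w \<oplus>\<^bsub>M\<^esub> a \<odot>\<^bsub>M\<^esub> s \<in> N" by (auto simp: g_def)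
      show "b \<odot>\<^bsub>regular_module A\<^esub> a \<in> g N" if b: "b \<in> carrier A" for b
        using Np(3)[OF b a(3)] a b Wp(4)[OF b a(2)] Wc by (auto simp: g_def 2)
      fix b assume "b \<in> g N"
      then obtain v where b: "b \<in> carrier A" "v \<in> W" "v \<oplus>\<^bsub>M\<^esub> b \<odot>\<^bsub>M\<^esub> s \<in> N" by (auto simp: g_def)
      show "a \<oplus>\<^bsub>regular_module A\<^esub> b \<in> g N"
        using Np(2)[OF a(3) b(3)] a b Wc Wp(3) by (auto simp: g_def 1)
    qed
  qed
  \<comment> \<open>This makes the pair faithful: \<open>x = w + sa\<close> in \<open>N'\<close> has
    a companion \<open>v + sa\<close> in \<open>N\<close>, and their difference \<open>w - v\<close>
    lies in \<open>N' \<inter> W = N \<inter> W\<close>.\<close>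
  have key: "N' \<subseteq> N" if N: "submodule N A M" "submodule N' A M" "N \<subseteq> N'" "N' \<subseteq> W'"
    "N' \<inter> W = N \<inter> W" "g N' = g N" for N N'
  proof
    fix x assume x: "x \<in> N'"
    then obtain w a where wa: "w \<in> W" "a \<in> carrier A" "x = w \<oplus>\<^bsub>M\<^esub> a \<odot>\<^bsub>M\<^esub> s" using N by (auto simp: W'_def)
    then have "a \<in> g N" using x N by (auto simp: g_def)
    then obtain v where v: "v \<in> W" "v \<oplus>\<^bsub>M\<^esub> a \<odot>\<^bsub>M\<^esub> s \<in> N" (is "?y \<in> N") by (auto simp: g_def)
    have c: "w \<in> carrier M" "v \<in> carrier M" "a \<odot>\<^bsub>M\<^esub> s \<in> carrier M" using wa v Wc s by auto
    have eq: "x \<ominus>\<^bsub>M\<^esub> ?y = w \<ominus>\<^bsub>M\<^esub> v"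
      unfolding wa(3) using c by (simp add: a_minus_def M.minus_add M.a_ac M.r_neg1 M.r_neg)
    have "x \<ominus>\<^bsub>M\<^esub> ?y \<in> N'" using submodule_minus[OF N(2), of ?y] x v N by (auto simp: a_minus_def submodule_iff)
    moreover have "w \<ominus>\<^bsub>M\<^esub> v \<in> W" using submodule_minus[OF W v(1)] wa Wp by (simp add: a_minus_def)
    ultimately have "x \<ominus>\<^bsub>M\<^esub> ?y \<in> N" using N(5) eq by auto
    then have "(x \<ominus>\<^bsub>M\<^esub> ?y) \<oplus>\<^bsub>M\<^esub> ?y \<in> N" using v N(1) by (simp add: submodule_iff)
    moreover have "(x \<ominus>\<^bsub>M\<^esub> ?y) \<oplus>\<^bsub>M\<^esub> ?y = x" using wa c by (simp add: a_minus_def M.a_assoc M.l_neg)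
    ultimately show "x \<in> N" by simp
  qed
  let ?h = "\<lambda>N. (N \<inter> W, g N)"
  let ?r = "submodule_rel A (M\<lparr>carrier := W\<rparr>)" and ?r' = "submodule_rel A (regular_module A)"
  have sub: "(N \<inter> W, N' \<inter> W) \<in> ?r \<or> N \<inter> W = N' \<inter> W \<and> (g N, g N') \<in> ?r'"
    if "(N, N') \<in> submodule_rel A (M\<lparr>carrier := W'\<rparr>)" for N N'
  proof -
    have N: "submodule N A M" "submodule N' A M" "N \<subset> N'" "N' \<subseteq> W'"
      using that by (auto simp: submodule_rel_def submodule_submodule_iff[OF W'])
    have gm: "g N \<subseteq> g N'" using N(3) by (auto simp: g_def)
    have i: "submodule (N \<inter> W) A M" "submodule (N' \<inter> W) A M" by (rule submodule_Int[OF _ W]; fact)+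
    show ?thesis
    proof (cases "N \<inter> W = N' \<inter> W")
      case True
      have "g N' \<noteq> g N" using key[OF N(1,2) _ N(4)] N(3) True by blast
      then show ?thesis using True gm g[OF N(1)] g[OF N(2)] by (simp add: submodule_rel_def psubset_eq)
    next
      case False
      have "N \<inter> W \<subset> N' \<inter> W" using False N(3) by blast
      then show ?thesis using i by (simp add: submodule_rel_def submodule_submodule_iff[OF W])
    qed
  qed
  let ?s = "submodule_rel A (M\<lparr>carrier := W'\<rparr>)"
  have incl: "?s \<subseteq> inv_image (?r <*lex*> ?r') ?h"
    by (rule subrelI, drule sub) (simp add: in_inv_image)
  have incl': "?s\<inverse> \<subseteq> inv_image (?r\<inverse> <*lex*> ?r'\<inverse>) ?h"
    by (rule subrelI, simp only: converse_iff, drule sub) (simp add: in_inv_image, metis)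
  show "artinian_module A (M\<lparr>carrier := W'\<rparr>)"
    if "artinian_module A (regular_module A)" "artinian_module A (M\<lparr>carrier := W\<rparr>)"
    using that unfolding artinian_module_def
    by (intro wf_subset[OF _ incl] wf_inv_image wf_lex_prod)
  show "noetherian_module A (M\<lparr>carrier := W'\<rparr>)"
    if "noetherian_module A (regular_module A)" "noetherian_module A (M\<lparr>carrier := W\<rparr>)"
    using that unfolding noetherian_module_def
    by (intro wf_subset[OF _ incl'] wf_inv_image wf_lex_prod)
qed

lemma (in right_module) zero_submodule_chain:
  "artinian_module A (M\<lparr>carrier := {\<zero>\<^bsub>M\<^esub>}\<rparr>)" "noetherian_module A (M\<lparr>carrier := {\<zero>\<^bsub>M\<^esub>}\<rparr>)"
proof -
  have "submodule_rel A (M\<lparr>carrier := {\<zero>\<^bsub>M\<^esub>}\<rparr>) = {}"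
    by (auto simp: submodule_rel_def submodule_submodule_iff[OF submodule_zero] submodule_iff)
  then show "artinian_module A (M\<lparr>carrier := {\<zero>\<^bsub>M\<^esub>}\<rparr>)" "noetherian_module A (M\<lparr>carrier := {\<zero>\<^bsub>M\<^esub>}\<rparr>)"
    by (simp_all add: artinian_module_def noetherian_module_def)
qed

text \<open>Generators are adjoined one at a time to the zero submodule, and each adjunction
  preserves both chain conditions.\<close>

lemma (in right_module) fin_gen_submodule_chain:
  assumes "finite S" "S \<subseteq> carrier M"
    "artinian_module A (regular_module A)" "noetherian_module A (regular_module A)"
  shows "\<exists>W. submodule W A M \<and> S \<subseteq> W \<and>
    artinian_module A (M\<lparr>carrier := W\<rparr>) \<and> noetherian_module A (M\<lparr>carrier := W\<rparr>)"
  using assms(1,2)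
proof induction
  case empty
  show ?case using submodule_zero zero_submodule_chain by auto
next
  case (insert s S)
  then obtain W where W: "submodule W A M" "S \<subseteq> W"
    "artinian_module A (M\<lparr>carrier := W\<rparr>)" "noetherian_module A (M\<lparr>carrier := W\<rparr>)" by auto
  have s: "s \<in> carrier M" using insert.prems by simp
  note a = adjoin_element[OF W(1) s]
  show ?case using a(1) subset_trans[OF W(2) a(2)] a(3) a(4)[OF assms(3) W(3)] a(5)[OF assms(4) W(4)]
    by (intro exI conjI) simp_all
qed

lemma fin_gen_chain:
  assumes "right_module A M" "fin_gen A M"
    "artinian_module A (regular_module A)" "noetherian_module A (regular_module A)"
  shows "artinian_module A M" "noetherian_module A M"
proof -
  interpret right_module A M by fact
  obtain S where S: "S \<subseteq> carrier M" "finite S"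
    and gen: "\<And>H. submodule H A M \<Longrightarrow> S \<subseteq> H \<Longrightarrow> H = carrier M"
    using assms(2) by (auto simp: fin_gen_def)
  obtain W where W: "submodule W A M" "S \<subseteq> W"
    "artinian_module A (M\<lparr>carrier := W\<rparr>)" "noetherian_module A (M\<lparr>carrier := W\<rparr>)"
    using fin_gen_submodule_chain[OF S(2,1) assms(3,4)] by blast
  have "W = carrier M" by (rule gen) fact+
  then show "artinian_module A M" "noetherian_module A M" using W by simp_all
qed

text \<open>A submodule that is maximal among the finitely generated ones contains every element,
  because adjoining an element gives a finitely generated submodule again.\<close>

lemma noetherian_fin_gen:
  assumes "right_module A M" "noetherian_module A M"
  shows "fin_gen A M"
proof -
  interpret right_module A M by fact
  define P where "P U \<longleftrightarrow> (\<exists>S\<subseteq>carrier M. finite S \<and> S \<subseteq> U \<and> (\<forall>H. submodule H A M \<and> S \<subseteq> H \<longrightarrow> U \<subseteq> H))" for U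
  have P0: "P {\<zero>\<^bsub>M\<^esub>}" unfolding P_def by (rule exI[of _ "{}"]) (auto simp: submodule_iff)
  obtain V where V: "submodule V A M" "P V" "\<And>W. submodule W A M \<Longrightarrow> V \<subset> W \<Longrightarrow> \<not> P W"
    using noetherian_maximal[where P = P, OF assms(2) submodule_zero P0] by auto
  obtain S where S: "S\<subseteq>carrier M" "finite S" "S \<subseteq> V" "\<forall>H. submodule H A M \<and> S \<subseteq> H \<longrightarrow> V \<subseteq> H"
    using V(2) unfolding P_def by (elim exE conjE) (rule that)
  have "carrier M \<subseteq> V"
  proof
    fix s assume s: "s \<in> carrier M"
    define W where "W = {w \<oplus>\<^bsub>M\<^esub> a \<odot>\<^bsub>M\<^esub> s | w a. w \<in> V \<and> a \<in> carrier A}"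
    have W: "submodule W A M" "V \<subseteq> W" "s \<in> W"
      unfolding W_def by (rule adjoin_element(1-3)[OF V(1) s])+
    have "P W" unfolding P_def
    proof (intro exI[of _ "insert s S"] conjI allI impI)
      fix H assume H: "submodule H A M \<and> insert s S \<subseteq> H"
      then have "V \<subseteq> H" using S(4) by auto
      then show "W \<subseteq> H" using H unfolding submodule_iff W_def by auto
    qed (use S s W in auto)
    then have "V = W" using V(3)[OF W(1)] W(2) by auto
    then show "s \<in> V" using W by simp
  qed
  moreover have "V \<subseteq> H" "H \<subseteq> carrier M" if "submodule H A M" "S \<subseteq> H" for H
    using S(4) that by (simp_all add: submodule_iff)
  ultimately have "H = carrier M" if "submodule H A M" "S \<subseteq> H" for H
    using that by (meson subset_antisym subset_trans)
  then show ?thesis unfolding fin_gen_def using S(1,2)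
    by (intro exI[of _ S] conjI allI impI) simp_all
qed

section \<open>Artinian commutative rings are noetherian\<close>

text \<open>
  Take an ideal \<open>I\<close> minimal among those above which the ascending chain condition holds, and suppose
  that \<open>I \<noteq> 0\<close>. Let \<open>X\<close> be minimal with \<open>XI \<noteq> 0\<close>; then \<open>X = xK\<close>, and \<open>m = {a. xaI = 0}\<close> is a maximal
  ideal. As \<open>m\<close> annihilates \<open>xI\<close>, there is a submodule \<open>H \<subseteq> I\<close> with \<open>I/H\<close> simple, and the ascending
  chain condition holds above \<open>H\<close> as well.
\<close>

lemma (in cring) artinian_imp_noetherian_regular:
  assumes "artinian_module R (regular_module R)"
  shows "noetherian_module R (regular_module R)"
proof -
  let ?R = "regular_module R"
  interpret R: right_module R ?R by (rule right_module_regular)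
  \<comment> \<open>The pairs put the larger submodule first, so well-foundedness is the ascending
    chain condition for the submodules containing \<open>I\<close>.\<close>
  define acc where "acc I \<longleftrightarrow> wf {(U, V). submodule U R ?R \<and> submodule V R ?R \<and> I \<subseteq> V \<and> V \<subset> U}" for I
  have sub: "U \<subseteq> carrier R" "\<zero> \<in> U" "\<And>x y. x \<in> U \<Longrightarrow> y \<in> U \<Longrightarrow> x \<oplus> y \<in> U"
    "\<And>a x. a \<in> carrier R \<Longrightarrow> x \<in> U \<Longrightarrow> x \<otimes> a \<in> U" "\<And>x. x \<in> U \<Longrightarrow> \<ominus> x \<in> U" if "submodule U R ?R" for U
  proof -
    show *: "U \<subseteq> carrier R" "\<zero> \<in> U" "\<And>x y. x \<in> U \<Longrightarrow> y \<in> U \<Longrightarrow> x \<oplus> y \<in> U"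
      "\<And>a x. a \<in> carrier R \<Longrightarrow> x \<in> U \<Longrightarrow> x \<otimes> a \<in> U"
      using that by (auto simp: R.submodule_iff)
    show "\<ominus> x \<in> U" if "x \<in> U" for x
    proof -
      have "x \<otimes> (\<ominus> \<one>) \<in> U" by (rule *(4)) (use that in auto)
      moreover have "x \<otimes> (\<ominus> \<one>) = \<ominus> x" using that *(1) by (simp add: r_minus subset_iff)
      ultimately show ?thesis by simp
    qed
  qed
  have subI: "submodule U R ?R" if "U \<subseteq> carrier R" "\<zero> \<in> U" "\<And>x y. x \<in> U \<Longrightarrow> y \<in> U \<Longrightarrow> x \<oplus> y \<in> U"
    "\<And>a x. a \<in> carrier R \<Longrightarrow> x \<in> U \<Longrightarrow> x \<otimes> a \<in> U" for U
    using that by (simp add: R.submodule_iff)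
  have "acc (carrier R)"
  proof -
    have e: "{(U, V). submodule U R ?R \<and> submodule V R ?R \<and> carrier R \<subseteq> V \<and> V \<subset> U} = {}"
      using sub(1) by blast
    show ?thesis unfolding acc_def e by simp
  qed
  then obtain I where I: "submodule I R ?R" "acc I" "\<And>J. submodule J R ?R \<Longrightarrow> J \<subset> I \<Longrightarrow> \<not> acc J"
    using artinian_minimal[where P = acc, OF assms R.submodule_carrier] by auto
  note Is = sub[OF I(1)]
  have "I = {\<zero>}"
  proof (rule ccontr)
    assume "I \<noteq> {\<zero>}"
    define P where "P X \<longleftrightarrow> (\<exists>x\<in>X. \<exists>i\<in>I. x \<otimes> i \<noteq> \<zero>)" for X
    have "P (carrier R)"
    proof -
      obtain i where "i \<in> I" "i \<noteq> \<zero>" using \<open>I \<noteq> {\<zero>}\<close> Is(2) by auto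
      then show ?thesis unfolding P_def using Is(1) by (intro bexI[of _ \<one>] bexI[of _ i]) auto
    qed
    then obtain X where X: "submodule X R ?R" "P X" "\<And>Y. submodule Y R ?R \<Longrightarrow> Y \<subset> X \<Longrightarrow> \<not> P Y"
      using artinian_minimal[where P = P, OF assms R.submodule_carrier] by auto
    note Xs = sub[OF X(1)]
    obtain x i0 where x: "x \<in> X" "i0 \<in> I" "x \<otimes> i0 \<noteq> \<zero>" using X(2) by (auto simp: P_def)
    have xc: "x \<in> carrier R" using x Xs(1) by auto
    define m where "m = {a \<in> carrier R. \<forall>i\<in>I. x \<otimes> a \<otimes> i = \<zero>}"
    \<comment> \<open>\<open>m\<close> is maximal in the form that elements outside it are
      invertible modulo it: for such \<open>a\<close> the ideal \<open>xaR\<close> still fails to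
      annihilate \<open>I\<close>, so by minimality it is \<open>X\<close> and contains
      \<open>x = xab\<close>.\<close>
    have inv: "\<exists>b\<in>carrier R. \<one> \<ominus> a \<otimes> b \<in> m" if a: "a \<in> carrier R" "a \<notin> m" for a
    proof -
      let ?Y = "{x \<otimes> a \<otimes> b | b. b \<in> carrier R}"
      have xa: "x \<otimes> a \<in> carrier R" using xc a by simp
      have Y: "submodule ?Y R ?R"
      proof (rule subI)
        show "?Y \<subseteq> carrier R" using xa by auto
        show "\<zero> \<in> ?Y" using xa by (auto intro!: exI[of _ \<zero>])
        show "y \<oplus> z \<in> ?Y" if yz: "y \<in> ?Y" "z \<in> ?Y" for y z
        proof -
          obtain b c where bc: "b \<in> carrier R" "c \<in> carrier R" "y = x \<otimes> a \<otimes> b" "z = x \<otimes> a \<otimes> c" using yz by auto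
          then have "y \<oplus> z = x \<otimes> a \<otimes> (b \<oplus> c)" using xa by (simp add: r_distr)
          then show ?thesis using bc by auto
        qed
        show "y \<otimes> r \<in> ?Y" if r: "r \<in> carrier R" "y \<in> ?Y" for y r
        proof -
          obtain b where bc: "b \<in> carrier R" "y = x \<otimes> a \<otimes> b" using r by auto
          then have "y \<otimes> r = x \<otimes> a \<otimes> (b \<otimes> r)" using xa r by (simp add: m_assoc)
          then show ?thesis using bc r by auto
        qed
      qed
      have "?Y \<subseteq> X" using Xs(4)[OF _ x(1)] a Xs(4) by auto
      moreover have "P ?Y"
      proof -
        obtain i where i: "i \<in> I" "x \<otimes> a \<otimes> i \<noteq> \<zero>" using a by (auto simp: m_def)
        have "x \<otimes> a \<in> ?Y" using xa by (auto intro!: exI[of _ \<one>])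
        then show ?thesis using i unfolding P_def by blast
      qed
      ultimately have "?Y = X" using X(3)[OF Y] by blast
      then obtain b where b: "b \<in> carrier R" "x = x \<otimes> a \<otimes> b" using x(1) by blast
      have "x \<otimes> (\<one> \<ominus> a \<otimes> b) = x \<ominus> x \<otimes> a \<otimes> b"
        using b(1) a xc by (simp add: a_minus_def r_distr r_minus m_assoc)
      also have "\<dots> = \<zero>" using b xc by (simp add: a_minus_def r_neg)
      finally have "x \<otimes> (\<one> \<ominus> a \<otimes> b) = \<zero>" .
      then have "\<one> \<ominus> a \<otimes> b \<in> m" using a b(1) Is(1) by (auto simp: m_def)
      then show ?thesis using b by blast
    qed
    define I' where "I' = {i \<in> I. x \<otimes> i = \<zero>}"
    have I': "submodule I' R ?R"
    proof (rule subI)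
      show "I' \<subseteq> carrier R" using Is(1) by (auto simp: I'_def)
      show "\<zero> \<in> I'" using Is(2) xc by (auto simp: I'_def)
      show "y \<oplus> z \<in> I'" if "y \<in> I'" "z \<in> I'" for y z
      proof -
        have "y \<in> carrier R" "z \<in> carrier R" using that Is(1) by (auto simp: I'_def)
        then show ?thesis using that Is(3) xc by (auto simp: I'_def r_distr)
      qed
      show "y \<otimes> a \<in> I'" if "a \<in> carrier R" "y \<in> I'" for y a
      proof -
        have "y \<in> carrier R" using that Is(1) by (auto simp: I'_def)
        then show ?thesis using that Is(4) xc by (auto simp: I'_def m_assoc[symmetric])
      qed
    qed
    have mI: "i \<otimes> a \<in> I'" if "a \<in> m" "i \<in> I" for a i
    proof -
      have c: "a \<in> carrier R" "i \<in> carrier R" "x \<otimes> a \<otimes> i = \<zero>" using that Is(1) by (auto simp: m_def)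
      have "x \<otimes> (i \<otimes> a) = x \<otimes> a \<otimes> i" using c xc by (simp add: m_ac)
      then show ?thesis using c Is(4)[OF c(1) that(2)] by (simp add: I'_def)
    qed
    define \<H> where "\<H> = {H. submodule H R ?R \<and> I' \<subseteq> H \<and> H \<subseteq> I \<and> i0 \<notin> H}"
    have "I' \<in> \<H>" using I' x by (auto simp: \<H>_def I'_def)
    \<comment> \<open>\<open>I'\<close> is the annihilator of \<open>x\<close> in \<open>I\<close>,
      so \<open>I/I'\<close> is a vector space over \<open>R/m\<close>, and \<open>H\<close> is to
      be a hyperplane of it that avoids \<open>i0\<close>. No ascending chain condition is available
      below \<open>I\<close>, hence Zorn's lemma.\<close>
    have "\<exists>H\<in>\<H>. \<forall>H'\<in>\<H>. H \<subseteq> H' \<longrightarrow> H' = H"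
    proof (rule subset_Zorn_nonempty)
      show "\<H> \<noteq> {}" using \<open>I' \<in> \<H>\<close> by auto
      fix C assume C: "C \<noteq> {}" "subset.chain \<H> C"
      then have CH: "C \<subseteq> \<H>" and lin: "\<And>U V. U \<in> C \<Longrightarrow> V \<in> C \<Longrightarrow> U \<subseteq> V \<or> V \<subseteq> U"
        by (auto simp: subset.chain_def)
      have "submodule (\<Union>C) R ?R"
      proof (rule subI)
        show "\<Union>C \<subseteq> carrier R" using CH sub(1) unfolding \<H>_def by blast
        show "\<zero> \<in> \<Union>C" using C(1) CH sub(2) unfolding \<H>_def by blast
        show "y \<oplus> z \<in> \<Union>C" if yz: "y \<in> \<Union>C" "z \<in> \<Union>C" for y z
        proof -
          obtain U V where UV: "U \<in> C" "V \<in> C" "y \<in> U" "z \<in> V" using yz by blast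
          then obtain W where W: "W \<in> C" "y \<in> W" "z \<in> W" using lin[of U V] by blast
          have "submodule W R ?R" using CH W unfolding \<H>_def by blast
          then show ?thesis using sub(3) W by blast
        qed
        show "y \<otimes> a \<in> \<Union>C" if yz: "a \<in> carrier R" "y \<in> \<Union>C" for y a
        proof -
          obtain U where U: "U \<in> C" "y \<in> U" using yz by blast
          have "submodule U R ?R" using CH U unfolding \<H>_def by blast
          then show ?thesis using sub(4) U yz by blast
        qed
      qed
      moreover have "I' \<subseteq> U" "U \<subseteq> I" "i0 \<notin> U" if "U \<in> C" for U
        using CH that by (auto simp: \<H>_def)
      ultimately show "\<Union>C \<in> \<H>" using C(1) by (simp add: \<H>_def) (meson Sup_least Union_upper all_not_in_conv subset_trans)
    qed
    then obtain H where "H \<in> \<H>" and Hmax: "\<forall>H'\<in>\<H>. H \<subseteq> H' \<longrightarrow> H' = H" by (elim bexE)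
    then have H: "submodule H R ?R" "I' \<subseteq> H" "H \<subseteq> I" "i0 \<notin> H" by (simp_all add: \<H>_def)
    note Hs = sub[OF H(1)]
    have ic: "i0 \<in> carrier R" using x Is(1) by auto
    have top: "N = I" if N: "submodule N R ?R" "H \<subset> N" "N \<subseteq> I" for N
    proof -
      note Ns = sub[OF N(1)]
      have "N \<notin> \<H>" using Hmax N(2) by blast
      then have i0N: "i0 \<in> N" using N H(2) by (auto simp: \<H>_def)
      have "I \<subseteq> N"
      proof
        fix w assume w: "w \<in> I"
        have wc: "w \<in> carrier R" using w Is(1) by auto
        show "w \<in> N"
        proof (cases "w \<in> H")
          case True then show ?thesis using N by auto
        next
          case False
          let ?W = "{h \<oplus> a \<odot>\<^bsub>?R\<^esub> w | h a. h \<in> H \<and> a \<in> carrier R}"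
          have W: "submodule ?W R ?R" "H \<subseteq> ?W" "w \<in> ?W"
            using R.adjoin_element(1-3)[OF H(1), of w] wc by auto
          have "?W \<subseteq> I"
          proof
            fix z assume "z \<in> ?W"
            then obtain h a where "h \<in> H" "a \<in> carrier R" "z = h \<oplus> w \<otimes> a" by auto
            then show "z \<in> I" using Is(3)[of h "w \<otimes> a"] Is(4)[of a w] H(3) w by auto
          qed
          moreover have "?W \<notin> \<H>"
          proof
            assume "?W \<in> \<H>"
            then have "?W = H" by (rule Hmax[THEN bspec, THEN mp, OF _ W(2)])
            then show False using W(3) False by argo
          qed
          moreover have "I' \<subseteq> ?W" using H(2) W(2) by (rule subset_trans)
          ultimately have "i0 \<in> ?W" using W(1) unfolding \<H>_def mem_Collect_eq by argo
          then obtain h c where hc: "h \<in> H" "c \<in> carrier R" "i0 = h \<oplus> w \<otimes> c" by auto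
          have hcar: "h \<in> carrier R" using hc Hs by auto
          have "c \<notin> m"
          proof
            assume "c \<in> m"
            then have "w \<otimes> c \<in> H" using mI[of c w] w H(2) by blast
            then show False using hc Hs(3) H(4) by auto
          qed
          then obtain b where b: "b \<in> carrier R" "\<one> \<ominus> c \<otimes> b \<in> m" using inv hc by blast
          have *: "w \<otimes> (\<one> \<ominus> c \<otimes> b) \<in> N" using mI[OF b(2) w] H(2) N(2) by blast
          have **: "(i0 \<oplus> \<ominus> h) \<otimes> b \<in> N" using Ns(3,4,5) i0N hc(1) b(1) N(2) by blast
          have "i0 \<oplus> \<ominus> h = w \<otimes> c"
            using hc hcar wc by (simp add: a_ac r_neg r_neg1 r_neg2)
          \<comment> \<open>Modulo \<open>m\<close> the factor \<open>c\<close> has the inverse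
            \<open>b\<close>, so \<open>w\<close> is recovered from \<open>wc = i0 - h\<close> up to
            the element \<open>w(1 - cb)\<close>, which lies in \<open>H\<close>.\<close>
          then have "w = w \<otimes> (\<one> \<ominus> c \<otimes> b) \<oplus> (i0 \<oplus> \<ominus> h) \<otimes> b"
            using wc hc(2) b(1) by (simp add: a_minus_def r_distr r_minus m_assoc a_assoc l_neg)
          then show ?thesis using Ns(3)[OF * **] by simp
        qed
      qed
      then show ?thesis using N by auto
    qed
    have "acc H"
    proof -
      let ?r = "{(U, V). submodule U R ?R \<and> submodule V R ?R \<and> I \<subseteq> V \<and> V \<subset> U}"
      let ?s = "{(U, V). submodule U R ?R \<and> submodule V R ?R \<and> H \<subseteq> V \<and> V \<subset> U}"
      \<comment> \<open>From \<open>V\<close> up to \<open>U\<close> either the sum with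
        \<open>I\<close> grows, or simplicity of \<open>I/H\<close> gives
        \<open>I \<subseteq> U\<close> while \<open>I\<close> is not contained in \<open>V\<close>.
        The second component records the latter, which can happen only once along a chain.\<close>
      let ?h = "\<lambda>N. (N <+>\<^bsub>?R\<^esub> I, if I \<subseteq> N then 0 else 1::nat)"
      have "?s \<subseteq> inv_image (?r <*lex*> less_than) ?h"
      proof (rule subrelI)
        fix U V assume "(U, V) \<in> ?s"
        then have UV: "submodule U R ?R" "submodule V R ?R" "H \<subseteq> V" "V \<subset> U" by auto
        have S: "submodule (U <+>\<^bsub>?R\<^esub> I) R ?R" "submodule (V <+>\<^bsub>?R\<^esub> I) R ?R"
          using R.submodule_sum[OF _ I(1)] UV by auto
        have memI: "I \<subseteq> V <+>\<^bsub>?R\<^esub> I"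
        proof
          fix i assume i: "i \<in> I"
          then have "i = \<zero> \<oplus> i" using Is(1) by auto
          then show "i \<in> V <+>\<^bsub>?R\<^esub> I" using i sub(2)[OF UV(2)] by (auto simp: set_add_def')
        qed
        have mono: "V <+>\<^bsub>?R\<^esub> I \<subseteq> U <+>\<^bsub>?R\<^esub> I" using UV(4) by (auto simp: set_add_def')
        show "(U, V) \<in> inv_image (?r <*lex*> less_than) ?h"
        proof (cases "V <+>\<^bsub>?R\<^esub> I = U <+>\<^bsub>?R\<^esub> I")
          case False
          then show ?thesis using S memI mono by auto
        next
          case True
          obtain u where u: "u \<in> U" "u \<notin> V" using UV(4) by blast
          have uc: "u \<in> carrier R" using u sub(1)[OF UV(1)] by auto
          have "u \<oplus> \<zero> \<in> U <+>\<^bsub>?R\<^esub> I" using u Is(2) unfolding set_add_def' by auto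
          then have "u \<in> V <+>\<^bsub>?R\<^esub> I" using True uc by simp
          then obtain v i where vi: "v \<in> V" "i \<in> I" "u = v \<oplus> i" by (auto simp: set_add_def')
          have c: "v \<in> carrier R" "i \<in> carrier R" using vi sub(1)[OF UV(2)] Is(1) by auto
          have "i = u \<oplus> \<ominus> v" unfolding vi(3) using c by (simp add: a_ac r_neg r_neg1 r_neg2)
          then have iU: "i \<in> U" using sub(3,5)[OF UV(1)] u vi(1) UV(4) by blast
          have iV: "i \<notin> V" using u vi sub(3)[OF UV(2)] by blast
          have "H \<subset> U \<inter> I" using H(3) UV(3,4) iU iV vi(2) by blast
          then have "U \<inter> I = I" using top[of "U \<inter> I"] R.submodule_Int[OF UV(1) I(1)] by blast
          moreover have "\<not> I \<subseteq> V" using iV vi by blast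
          ultimately show ?thesis using True by auto
        qed
      qed
      moreover have "wf ?r" using I(2) by (simp add: acc_def)
      ultimately show ?thesis unfolding acc_def
        by (intro wf_subset[of "inv_image (?r <*lex*> less_than) ?h" ?s] wf_inv_image wf_lex_prod) auto
    qed
    then show False using I(3)[OF H(1)] H(3,4) x(2) by blast
  qed
  then have "wf {(U, V). submodule U R ?R \<and> submodule V R ?R \<and> {\<zero>} \<subseteq> V \<and> V \<subset> U}"
    using I(2) by (simp add: acc_def)
  then show ?thesis unfolding noetherian_module_def submodule_rel_def
    by (rule wf_subset) (use sub(2) in auto)
qed

section \<open>From the base ring to the algebra\<close>

lemma (in cring) submodule_regular_iff_ideal: "submodule U R (regular_module R) \<longleftrightarrow> ideal U R"
proof -
  interpret R: right_module R "regular_module R" by (rule right_module_regular)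
  show ?thesis
  proof
    assume U: "submodule U R (regular_module R)"
    show "ideal U R"
    proof (rule idealI[OF ring_axioms])
      show "subgroup U (add_monoid R)"
      proof (rule subgroup.intro)
        show "inv\<^bsub>add_monoid R\<^esub> x \<in> U" if "x \<in> U" for x
        proof -
          have x: "x \<in> carrier R" using U that by (auto simp: R.submodule_iff)
          have "x \<otimes> (\<ominus> \<one>) \<in> U" using U that by (simp add: R.submodule_iff)
          then show ?thesis using x by (simp add: r_minus a_inv_def[symmetric])
        qed
      qed (use U in \<open>auto simp: R.submodule_iff\<close>)
    qed (use U in \<open>auto simp: R.submodule_iff m_comm subset_iff\<close>)
  next
    assume "ideal U R"
    then interpret ideal U R .
    show "submodule U R (regular_module R)"
      by (auto simp: R.submodule_iff I_r_closed a_Hcarr)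
  qed
qed

lemma (in cring) artinian_imp_artinian_regular:
  assumes "artinian R" shows "artinian_module R (regular_module R)"
  unfolding artinian_module_def wf_iff_no_infinite_down_chain
proof
  assume "\<exists>f. \<forall>i. (f (Suc i), f i) \<in> submodule_rel R (regular_module R)"
  then obtain f where "\<forall>i. (f (Suc i), f i) \<in> submodule_rel R (regular_module R)" by blast
  then have f: "\<forall>i. ideal (f i) R \<and> f (Suc i) \<subset> f i"
    by (simp add: submodule_rel_def submodule_regular_iff_ideal)
  then have "\<forall>n. ideal (f n) R \<and> f (Suc n) \<subseteq> f n" by auto
  then obtain m where m: "\<forall>n\<ge>m. f n = f m"
    using assms[unfolded artinian_def, THEN spec, of f] by (elim impE exE)
  have "f (Suc m) = f m" using m[THEN spec, of "Suc m"] by simp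
  then show False using f[THEN spec, of m] by simp
qed

text \<open>Right ideals of \<open>A\<close> are \<open>K\<close>-submodules because
  \<open>K\<close> acts through central elements, and \<open>A\<close> is finitely generated over
  \<open>K\<close>, which is artinian and therefore noetherian.\<close>

lemma artin_algebra_chain:
  assumes "artin_algebra K \<phi> A"
  shows "artinian_module A (regular_module A)" "noetherian_module A (regular_module A)"
proof -
  let ?M = "\<lparr>carrier = carrier A, mult = mult A, one = \<one>\<^bsub>A\<^esub>, zero = \<zero>\<^bsub>A\<^esub>, add = add A,
       smult = (\<lambda>r a. \<phi> r \<otimes>\<^bsub>A\<^esub> a)\<rparr>"
  have a: "cring K" "artinian K" "ring A" "\<phi> \<in> ring_hom K A" "fin_gen K ?M"
    and comm: "\<And>r a. r \<in> carrier K \<Longrightarrow> a \<in> carrier A \<Longrightarrow> \<phi> r \<otimes>\<^bsub>A\<^esub> a = a \<otimes>\<^bsub>A\<^esub> \<phi> r"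
    using assms by (auto simp: artin_algebra_def)
  interpret K: cring K by fact
  interpret A: ring A by fact
  interpret R: right_module A "regular_module A" by (rule A.right_module_regular)
  have \<phi>: "r \<in> carrier K \<Longrightarrow> \<phi> r \<in> carrier A" for r using a(4) by (rule ring_hom_closed)
  have "abelian_group ?M"
    by (rule abelian_groupI) (auto simp: A.a_ac intro: A.l_neg bexI[of _ "\<ominus>\<^bsub>A\<^esub> _"])
  then have M: "right_module K ?M"
  proof (intro right_module.intro right_module_axioms.intro K.ring_axioms)
    fix r s x assume "r \<in> carrier K" "s \<in> carrier K" "x \<in> carrier ?M"
    then show "(r \<otimes>\<^bsub>K\<^esub> s) \<odot>\<^bsub>?M\<^esub> x = s \<odot>\<^bsub>?M\<^esub> (r \<odot>\<^bsub>?M\<^esub> x)"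
      using \<phi> comm[of r "\<phi> s"] ring_hom_mult[OF a(4)] by (simp add: A.m_assoc[symmetric])
  qed (use \<phi> ring_hom_add[OF a(4)] ring_hom_one[OF a(4)] in \<open>auto simp: A.l_distr A.r_distr\<close>)
  interpret M: right_module K ?M by fact
  have "artinian_module K (regular_module K)" by (rule K.artinian_imp_artinian_regular) fact
  note ch = fin_gen_chain[OF M a(5) this K.artinian_imp_noetherian_regular[OF this]]
  have "submodule U K ?M" if "submodule U A (regular_module A)" for U
    using that comm \<phi> unfolding R.submodule_iff M.submodule_iff by (auto simp: subset_iff)
  then have rel: "submodule_rel A (regular_module A) \<subseteq> submodule_rel K ?M"
    by (auto simp: submodule_rel_def)
  show "artinian_module A (regular_module A)"
    using ch(1) rel unfolding artinian_module_def by (rule wf_subset)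
  show "noetherian_module A (regular_module A)"
    using ch(2) unfolding noetherian_module_def by (rule wf_subset) (simp add: rel)
qed

section \<open>Direct decompositions and Fitting's lemma\<close>

lemma (in right_module) internal_sumD:
  assumes "internal_sum A M U V"
  shows "submodule U A M" "submodule V A M" "U \<inter> V = {\<zero>\<^bsub>M\<^esub>}"
    "x \<in> carrier M \<Longrightarrow> \<exists>u\<in>U. \<exists>v\<in>V. x = u \<oplus>\<^bsub>M\<^esub> v"
    "u \<in> U \<Longrightarrow> u \<in> carrier M" "v \<in> V \<Longrightarrow> v \<in> carrier M"
proof -
  show s: "submodule U A M" "submodule V A M" and "U \<inter> V = {\<zero>\<^bsub>M\<^esub>}"
    using assms by (auto simp: internal_sum_def)
  have "x \<in> U <+>\<^bsub>M\<^esub> V" if "x \<in> carrier M" using assms that by (simp add: internal_sum_def)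
  then show "x \<in> carrier M \<Longrightarrow> \<exists>u\<in>U. \<exists>v\<in>V. x = u \<oplus>\<^bsub>M\<^esub> v" by (simp add: set_add_def')
  show "u \<in> U \<Longrightarrow> u \<in> carrier M" "v \<in> V \<Longrightarrow> v \<in> carrier M" using s by (auto simp: submodule_iff)
qed

lemma (in right_module) internal_sumI:
  assumes "submodule U A M" "submodule V A M" "U \<inter> V \<subseteq> {\<zero>\<^bsub>M\<^esub>}"
    "\<And>x. x \<in> carrier M \<Longrightarrow> \<exists>u\<in>U. \<exists>v\<in>V. x = u \<oplus>\<^bsub>M\<^esub> v"
  shows "internal_sum A M U V"
proof -
  have "submodule (U <+>\<^bsub>M\<^esub> V) A M" by (rule submodule_sum) fact+
  then have "U <+>\<^bsub>M\<^esub> V \<subseteq> carrier M" by (simp add: submodule_iff)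
  moreover have "carrier M \<subseteq> U <+>\<^bsub>M\<^esub> V" using assms(4) by (auto simp: set_add_def')
  moreover have "\<zero>\<^bsub>M\<^esub> \<in> U" "\<zero>\<^bsub>M\<^esub> \<in> V" using assms(1,2) by (simp_all add: submodule_iff)
  ultimately show ?thesis using assms(1-3) unfolding internal_sum_def by blast
qed

lemma (in right_module) diff_mem_submodule:
  "submodule U A M \<Longrightarrow> x \<in> U \<Longrightarrow> y \<in> U \<Longrightarrow> x \<ominus>\<^bsub>M\<^esub> y \<in> U"
  using submodule_minus[of U y] by (simp add: a_minus_def submodule_iff)

lemma (in abelian_group) diff_eq_zero: "x \<in> carrier G \<Longrightarrow> y \<in> carrier G \<Longrightarrow> x \<ominus> y = \<zero> \<Longrightarrow> x = y"
  by (metis a_minus_def add.inv_closed l_neg add.inv_equality add.m_comm minus_minus)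

lemma (in abelian_group) diff_add_cancel:
  "x \<in> carrier G \<Longrightarrow> y \<in> carrier G \<Longrightarrow> (x \<ominus> y) \<oplus> y = x"
  by (simp add: a_minus_def a_assoc l_neg)

lemma (in abelian_group) add_diff_cancel:
  "x \<in> carrier G \<Longrightarrow> y \<in> carrier G \<Longrightarrow> (x \<oplus> y) \<ominus> y = x"
  by (simp add: a_minus_def a_assoc r_neg)

lemma (in abelian_group) add_diff_swap:
  "a \<in> carrier G \<Longrightarrow> b \<in> carrier G \<Longrightarrow> c \<in> carrier G \<Longrightarrow> d \<in> carrier G \<Longrightarrow> a \<oplus> b = c \<oplus> d \<Longrightarrow> a \<ominus> c = d \<ominus> b"
proof -
  assume c: "a \<in> carrier G" "b \<in> carrier G" "c \<in> carrier G" "d \<in> carrier G" and e: "a \<oplus> b = c \<oplus> d"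
  have "a \<ominus> c = (a \<oplus> b) \<oplus> (\<ominus> b \<oplus> \<ominus> c)" using c by (simp add: a_minus_def a_ac r_neg r_neg1 r_neg2)
  also have "\<dots> = (d \<oplus> \<ominus> b) \<oplus> (c \<oplus> \<ominus> c)" unfolding e using c by (simp add: a_ac)
  also have "\<dots> = d \<ominus> b" using c by (simp add: a_minus_def r_neg)
  finally show ?thesis .
qed

lemma (in right_module) internal_sum_projections:
  assumes UV: "internal_sum A M U V"
  obtains p q where "p \<in> rmod_hom A M (M\<lparr>carrier := U\<rparr>)" "q \<in> rmod_hom A M (M\<lparr>carrier := V\<rparr>)"
    "\<And>x. x \<in> carrier M \<Longrightarrow> p x \<oplus>\<^bsub>M\<^esub> q x = x"
proof -
  note d = internal_sumD[OF UV]
  have Us: "\<And>x y. x \<in> U \<Longrightarrow> y \<in> U \<Longrightarrow> x \<oplus>\<^bsub>M\<^esub> y \<in> U" "\<And>a x. a \<in> carrier A \<Longrightarrow> x \<in> U \<Longrightarrow> a \<odot>\<^bsub>M\<^esub> x \<in> U"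
    and Vs: "\<And>x y. x \<in> V \<Longrightarrow> y \<in> V \<Longrightarrow> x \<oplus>\<^bsub>M\<^esub> y \<in> V" "\<And>a x. a \<in> carrier A \<Longrightarrow> x \<in> V \<Longrightarrow> a \<odot>\<^bsub>M\<^esub> x \<in> V"
    using d(1,2) by (auto simp: submodule_iff)
  have uniq: "u = u' \<and> v = v'" if "u \<in> U" "u' \<in> U" "v \<in> V" "v' \<in> V" "u \<oplus>\<^bsub>M\<^esub> v = u' \<oplus>\<^bsub>M\<^esub> v'" for u u' v v'
  proof -
    have c: "u \<in> carrier M" "u' \<in> carrier M" "v \<in> carrier M" "v' \<in> carrier M" using that d(5,6) by auto
    have e: "u \<ominus>\<^bsub>M\<^esub> u' = v' \<ominus>\<^bsub>M\<^esub> v" using M.add_diff_swap[OF c(1,3,2,4)] that(5) by simp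
    have "u \<ominus>\<^bsub>M\<^esub> u' \<in> U" using diff_mem_submodule[OF d(1)] that by simp
    moreover have "v' \<ominus>\<^bsub>M\<^esub> v \<in> V" using diff_mem_submodule[OF d(2)] that by simp
    ultimately have "u \<ominus>\<^bsub>M\<^esub> u' = \<zero>\<^bsub>M\<^esub>" "v' \<ominus>\<^bsub>M\<^esub> v = \<zero>\<^bsub>M\<^esub>" using e d(3) by auto
    then show ?thesis using M.diff_eq_zero c by metis
  qed
  have "\<forall>x\<in>carrier M. \<exists>z. fst z \<in> U \<and> snd z \<in> V \<and> x = fst z \<oplus>\<^bsub>M\<^esub> snd z" using d(4) by force
  from bchoice[OF this]
  obtain z where "\<forall>x\<in>carrier M. fst (z x) \<in> U \<and> snd (z x) \<in> V \<and> x = fst (z x) \<oplus>\<^bsub>M\<^esub> snd (z x)"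
    by (elim exE)
  note z = this[THEN bspec]
  let ?p = "\<lambda>x. fst (z x)" and ?q = "\<lambda>x. snd (z x)"
  have zc: "?p x \<in> carrier M" "?q x \<in> carrier M" if "x \<in> carrier M" for x using z[OF that] d(5,6) by auto
  have add: "?p (x \<oplus>\<^bsub>M\<^esub> y) = ?p x \<oplus>\<^bsub>M\<^esub> ?p y \<and> ?q (x \<oplus>\<^bsub>M\<^esub> y) = ?q x \<oplus>\<^bsub>M\<^esub> ?q y"
    if xy: "x \<in> carrier M" "y \<in> carrier M" for x y
  proof (rule uniq)
    have "?p (x \<oplus>\<^bsub>M\<^esub> y) \<oplus>\<^bsub>M\<^esub> ?q (x \<oplus>\<^bsub>M\<^esub> y) = x \<oplus>\<^bsub>M\<^esub> y" using z[of "x \<oplus>\<^bsub>M\<^esub> y"] xy by simp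
    also have "\<dots> = (?p x \<oplus>\<^bsub>M\<^esub> ?q x) \<oplus>\<^bsub>M\<^esub> (?p y \<oplus>\<^bsub>M\<^esub> ?q y)" using z[OF xy(1)] z[OF xy(2)] by simp
    also have "\<dots> = (?p x \<oplus>\<^bsub>M\<^esub> ?p y) \<oplus>\<^bsub>M\<^esub> (?q x \<oplus>\<^bsub>M\<^esub> ?q y)" using zc xy by (simp add: M.a_ac)
    finally show "?p (x \<oplus>\<^bsub>M\<^esub> y) \<oplus>\<^bsub>M\<^esub> ?q (x \<oplus>\<^bsub>M\<^esub> y) = (?p x \<oplus>\<^bsub>M\<^esub> ?p y) \<oplus>\<^bsub>M\<^esub> (?q x \<oplus>\<^bsub>M\<^esub> ?q y)" .
  qed (use z xy Us Vs in auto)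
  have sm: "?p (a \<odot>\<^bsub>M\<^esub> x) = a \<odot>\<^bsub>M\<^esub> ?p x \<and> ?q (a \<odot>\<^bsub>M\<^esub> x) = a \<odot>\<^bsub>M\<^esub> ?q x"
    if xy: "a \<in> carrier A" "x \<in> carrier M" for a x
  proof (rule uniq)
    have "?p (a \<odot>\<^bsub>M\<^esub> x) \<oplus>\<^bsub>M\<^esub> ?q (a \<odot>\<^bsub>M\<^esub> x) = a \<odot>\<^bsub>M\<^esub> x" using z[of "a \<odot>\<^bsub>M\<^esub> x"] xy by simp
    also have "\<dots> = a \<odot>\<^bsub>M\<^esub> (?p x \<oplus>\<^bsub>M\<^esub> ?q x)" using z[OF xy(2)] by simp
    also have "\<dots> = a \<odot>\<^bsub>M\<^esub> ?p x \<oplus>\<^bsub>M\<^esub> a \<odot>\<^bsub>M\<^esub> ?q x" using zc xy by (simp add: smult_r_distr)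
    finally show "?p (a \<odot>\<^bsub>M\<^esub> x) \<oplus>\<^bsub>M\<^esub> ?q (a \<odot>\<^bsub>M\<^esub> x) = a \<odot>\<^bsub>M\<^esub> ?p x \<oplus>\<^bsub>M\<^esub> a \<odot>\<^bsub>M\<^esub> ?q x" .
  qed (use z xy Us Vs in auto)
  have "restrict ?p (carrier M) \<in> rmod_hom A M (M\<lparr>carrier := U\<rparr>)"
    by (rule rmod_hom_restrictI[OF _ _ _ right_module_axioms]) (use z add sm in auto)
  moreover have "restrict ?q (carrier M) \<in> rmod_hom A M (M\<lparr>carrier := V\<rparr>)"
    by (rule rmod_hom_restrictI[OF _ _ _ right_module_axioms]) (use z add sm in auto)
  ultimately show thesis by (rule that) (use z in simp)
qed

lemma retract_internal_sum:
  assumes M: "right_module A M" and S: "right_module A S"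
    and i: "i \<in> rmod_hom A M S" and p: "p \<in> rmod_hom A S M" "\<And>x. x \<in> carrier M \<Longrightarrow> p (i x) = x"
  shows "internal_sum A S (i ` carrier M) {x \<in> carrier S. p x = \<zero>\<^bsub>M\<^esub>}"
proof -
  interpret M: right_module A M by fact
  interpret S: right_module A S by fact
  let ?U = "i ` carrier M" and ?K = "{x \<in> carrier S. p x = \<zero>\<^bsub>M\<^esub>}"
  note ic = rmod_hom_closed[OF i] and pc = rmod_hom_closed[OF p(1)]
  show ?thesis
  proof (rule S.internal_sumI)
    show "submodule ?U A S" by (rule submodule_image[OF M S i M.submodule_carrier])
    show "submodule ?K A S" by (rule submodule_kernel[OF S M p(1)])
    show "?U \<inter> ?K \<subseteq> {\<zero>\<^bsub>S\<^esub>}" using p(2) rmod_hom_zero[OF M S i] by auto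
    fix x assume x: "x \<in> carrier S"
    have ix: "i (p x) \<in> carrier S" using ic pc x by blast
    have "p (x \<ominus>\<^bsub>S\<^esub> i (p x)) = \<zero>\<^bsub>M\<^esub>"
      using rmod_hom_diff[OF S M p(1) x ix] p(2)[OF pc[OF x]] pc[OF x] by (simp add: a_minus_def M.M.r_neg)
    then have "x \<ominus>\<^bsub>S\<^esub> i (p x) \<in> ?K" using x ix by simp
    moreover have "x = i (p x) \<oplus>\<^bsub>S\<^esub> (x \<ominus>\<^bsub>S\<^esub> i (p x))"
      using S.M.diff_add_cancel[OF x ix] x ix by (simp add: S.M.a_comm)
    moreover have "i (p x) \<in> ?U" using pc x by blast
    ultimately show "\<exists>u\<in>?U. \<exists>v\<in>?K. x = u \<oplus>\<^bsub>S\<^esub> v" by blast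
  qed
qed

section \<open>Fitting's lemma and endomorphisms of indecomposable modules\<close>

lemma (in right_module) funpow_hom:
  assumes f: "f \<in> rmod_hom A M M"
  shows "x \<in> carrier M \<Longrightarrow> (f ^^ n) x \<in> carrier M"
    "x \<in> carrier M \<Longrightarrow> y \<in> carrier M \<Longrightarrow> (f ^^ n) (x \<oplus>\<^bsub>M\<^esub> y) = (f ^^ n) x \<oplus>\<^bsub>M\<^esub> (f ^^ n) y"
    "a \<in> carrier A \<Longrightarrow> x \<in> carrier M \<Longrightarrow> (f ^^ n) (a \<odot>\<^bsub>M\<^esub> x) = a \<odot>\<^bsub>M\<^esub> (f ^^ n) x"
proof -
  show c: "x \<in> carrier M \<Longrightarrow> (f ^^ n) x \<in> carrier M" for x n
    by (induction n) (auto intro: rmod_hom_closed[OF f])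
  show "x \<in> carrier M \<Longrightarrow> y \<in> carrier M \<Longrightarrow> (f ^^ n) (x \<oplus>\<^bsub>M\<^esub> y) = (f ^^ n) x \<oplus>\<^bsub>M\<^esub> (f ^^ n) y"
    by (induction n) (auto simp: rmod_hom_add[OF f] c)
  show "a \<in> carrier A \<Longrightarrow> x \<in> carrier M \<Longrightarrow> (f ^^ n) (a \<odot>\<^bsub>M\<^esub> x) = a \<odot>\<^bsub>M\<^esub> (f ^^ n) x"
    by (induction n) (auto simp: rmod_hom_smult[OF f] c)
qed

text \<open>The images of the powers decrease and the kernels increase, so both are constant from
  some exponent on. There \<open>f ^^ n\<close> and \<open>f ^^ (n + n)\<close> share image and
  kernel, which yields the decomposition.\<close>

lemma (in right_module) fitting:
  assumes f: "f \<in> rmod_hom A M M" and art: "artinian_module A M" and noeth: "noetherian_module A M"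
  obtains n where "n > 0" "internal_sum A M ((f ^^ n) ` carrier M) {x \<in> carrier M. (f ^^ n) x = \<zero>\<^bsub>M\<^esub>}"
proof -
  note fp = funpow_hom[OF f]
  let ?g = "\<lambda>n. restrict (f ^^ n) (carrier M)"
  let ?I = "\<lambda>n. (f ^^ n) ` carrier M" and ?K = "\<lambda>n. {x \<in> carrier M. (f ^^ n) x = \<zero>\<^bsub>M\<^esub>}"
  have g: "?g n \<in> rmod_hom A M M" for n
    by (rule rmod_hom_restrictI[OF _ _ _ right_module_axioms]) (use fp in auto)
  have I: "submodule (?I n) A M" for n
    using submodule_image[OF right_module_axioms right_module_axioms g submodule_carrier, of n] by simp
  have K: "submodule (?K n) A M" for n
  proof -
    have "?K n = {x \<in> carrier M. ?g n x = \<zero>\<^bsub>M\<^esub>}" by auto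
    then show ?thesis using submodule_kernel[OF right_module_axioms right_module_axioms g, of n] by simp
  qed
  have "?I (Suc n) \<subseteq> ?I n" for n
    using rmod_hom_closed[OF f] by (auto simp: funpow_Suc_right simp del: funpow.simps)
  then obtain m where m: "\<forall>n\<ge>m. ?I n = ?I m"
    using artinian_chain_stable[where U = ?I, OF art I] by blast
  have "?K n \<subseteq> ?K (Suc n)" for n
    using rmod_hom_zero[OF right_module_axioms right_module_axioms f] by auto
  then obtain k where k: "\<forall>n\<ge>k. ?K n = ?K k"
    using noetherian_chain_stable[where U = ?K, OF noeth K] by blast
  \<comment> \<open>The successor makes \<open>n\<close> positive; with \<open>n = 0\<close> the
    decomposition would say nothing about \<open>f\<close>.\<close>
  define n where "n = Suc (max m k)"
  have I2: "?I (n + n) = ?I n" using m[THEN spec, of "n + n"] m[THEN spec, of n] by (simp add: n_def)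
  have K2: "?K (n + n) = ?K n" using k[THEN spec, of "n + n"] k[THEN spec, of n] by (simp add: n_def)
  have "internal_sum A M (?I n) (?K n)"
  proof (rule internal_sumI[OF I K])
    show "?I n \<inter> ?K n \<subseteq> {\<zero>\<^bsub>M\<^esub>}"
    proof
      fix y assume "y \<in> ?I n \<inter> ?K n"
      then obtain x where x: "x \<in> carrier M" "y = (f ^^ n) x" "(f ^^ n) y = \<zero>\<^bsub>M\<^esub>" by auto
      then have "x \<in> ?K (n + n)" by (simp add: funpow_add)
      then have "x \<in> ?K n" using K2 by blast
      then show "y \<in> {\<zero>\<^bsub>M\<^esub>}" using x by simp
    qed
    fix x assume x: "x \<in> carrier M"
    have "(f ^^ n) x \<in> ?I n" using x by blast
    then have "(f ^^ n) x \<in> ?I (n + n)" using I2 by blast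
    then obtain y where y: "y \<in> carrier M" "(f ^^ n) x = (f ^^ n) ((f ^^ n) y)" by (auto simp: funpow_add)
    let ?u = "(f ^^ n) y"
    have uc: "?u \<in> carrier M" using fp(1) y by blast
    have "(f ^^ n) (x \<ominus>\<^bsub>M\<^esub> ?u) = (f ^^ n) x \<ominus>\<^bsub>M\<^esub> (f ^^ n) ?u"
      using rmod_hom_diff[OF right_module_axioms right_module_axioms g x uc, of n] x uc by simp
    also have "\<dots> = \<zero>\<^bsub>M\<^esub>" using y fp(1)[OF uc] by (simp add: a_minus_def M.r_neg)
    finally have "x \<ominus>\<^bsub>M\<^esub> ?u \<in> ?K n" using x uc by simp
    moreover have "x = ?u \<oplus>\<^bsub>M\<^esub> (x \<ominus>\<^bsub>M\<^esub> ?u)"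
      using M.diff_add_cancel[OF x uc] x uc by (simp add: M.a_comm)
    moreover have "?u \<in> ?I n" using y by blast
    ultimately show "\<exists>u\<in>?I n. \<exists>v\<in>?K n. x = u \<oplus>\<^bsub>M\<^esub> v" by blast
  qed
  then show thesis by (intro that[of n]) (simp_all add: n_def)
qed

text \<open>One of the two Fitting summands vanishes. If it is the image, \<open>f\<close> is
  nilpotent; if it is the kernel, a positive power of \<open>f\<close> is bijective, hence so is
  \<open>f\<close>.\<close>

lemma (in right_module) indecomposable_endomorphism:
  assumes f: "f \<in> rmod_hom A M M" and art: "artinian_module A M" and noeth: "noetherian_module A M"
    and ind: "indecomposable A M"
  obtains "f ` carrier M = carrier M" "inj_on f (carrier M)"
  | n where "\<And>x. x \<in> carrier M \<Longrightarrow> (f ^^ n) x = \<zero>\<^bsub>M\<^esub>"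
proof -
  note fp = funpow_hom[OF f]
  have fc: "x \<in> carrier M \<Longrightarrow> f x \<in> carrier M" for x using f by (rule rmod_hom_closed)
  have fz: "(f ^^ n) \<zero>\<^bsub>M\<^esub> = \<zero>\<^bsub>M\<^esub>" for n
    by (induction n) (auto simp: rmod_hom_zero[OF right_module_axioms right_module_axioms f])
  obtain n where n0: "n > 0" and n: "internal_sum A M ((f ^^ n) ` carrier M) {x \<in> carrier M. (f ^^ n) x = \<zero>\<^bsub>M\<^esub>}"
    by (rule fitting[OF f art noeth])
  then consider "(f ^^ n) ` carrier M = {\<zero>\<^bsub>M\<^esub>}" | "{x \<in> carrier M. (f ^^ n) x = \<zero>\<^bsub>M\<^esub>} = {\<zero>\<^bsub>M\<^esub>}"
    using ind unfolding indecomposable_def by blast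
  then show thesis
  proof cases
    case 1
    then have "(f ^^ n) x = \<zero>\<^bsub>M\<^esub>" if "x \<in> carrier M" for x using that by auto
    then show thesis by (rule that(2))
  next
    case 2
    have img: "carrier M \<subseteq> (f ^^ n) ` carrier M"
    proof
      fix x assume "x \<in> carrier M"
      then obtain u v where uv: "u \<in> (f ^^ n) ` carrier M" "v \<in> {\<zero>\<^bsub>M\<^esub>}" "x = u \<oplus>\<^bsub>M\<^esub> v"
        using internal_sumD(4)[OF n] 2 by metis
      then have "x = u" using fp(1) by auto
      then show "x \<in> (f ^^ n) ` carrier M" using uv by simp
    qed
    show thesis
    proof (cases n)
      case 0
      then show thesis using n0 by simp
    next
      case (Suc k)
      have "carrier M \<subseteq> f ` carrier M"
      proof
        fix y assume "y \<in> carrier M"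
        then obtain x where x: "x \<in> carrier M" "y = (f ^^ Suc k) x" using img Suc by blast
        then have "y = f ((f ^^ k) x)" by simp
        then show "y \<in> f ` carrier M" using fp(1) x by blast
      qed
      then have "f ` carrier M = carrier M" using fc by auto
      moreover have "inj_on f (carrier M)"
        unfolding rmod_hom_inj_iff[OF right_module_axioms right_module_axioms f]
      proof (intro ballI impI)
        fix x assume x: "x \<in> carrier M" "f x = \<zero>\<^bsub>M\<^esub>"
        have "(f ^^ n) x = (f ^^ k) (f x)" by (simp add: Suc funpow_swap1)
        then have "(f ^^ n) x = \<zero>\<^bsub>M\<^esub>" using x fz by simp
        then show "x = \<zero>\<^bsub>M\<^esub>" using 2 x by blast
      qed
      ultimately show thesis by (rule that(1))
    qed
  qed
qed

text \<open>Locality of the endomorphism ring in the shape used later: \<open>t\<close> is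
  nilpotent, and an element killed by \<open>u\<close> is fixed by \<open>t\<close>, hence zero. So
  \<open>u\<close> is injective, cannot be nilpotent on a non-zero module, and is bijective by the
  dichotomy.\<close>

lemma (in right_module) indecomposable_local:
  assumes t: "t \<in> rmod_hom A M M" and u: "u \<in> rmod_hom A M M"
    and tu: "\<And>x. x \<in> carrier M \<Longrightarrow> t x \<oplus>\<^bsub>M\<^esub> u x = x"
    and art: "artinian_module A M" and noeth: "noetherian_module A M" and ind: "indecomposable A M"
    and nt: "t ` carrier M \<noteq> carrier M"
  shows "u ` carrier M = carrier M"
proof -
  obtain n where n: "\<And>x. x \<in> carrier M \<Longrightarrow> (t ^^ n) x = \<zero>\<^bsub>M\<^esub>"
    using indecomposable_endomorphism[OF t art noeth ind] nt by metis
  show ?thesis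
  proof (rule indecomposable_endomorphism[OF u art noeth ind])
    fix m assume m: "\<And>x. x \<in> carrier M \<Longrightarrow> (u ^^ m) x = \<zero>\<^bsub>M\<^esub>"
    have key: "x = \<zero>\<^bsub>M\<^esub>" if x: "x \<in> carrier M" "u x = \<zero>\<^bsub>M\<^esub>" for x
    proof -
      have "t x = x" using tu[OF x(1)] x rmod_hom_closed[OF t x(1)] by simp
      then have "(t ^^ k) x = x" for k by (induction k) auto
      then show ?thesis using n[OF x(1)] by simp
    qed
    have "x = \<zero>\<^bsub>M\<^esub>" if "x \<in> carrier M" "(u ^^ m) x = \<zero>\<^bsub>M\<^esub>" for x m
      using that by (induction m) (auto simp: key funpow_hom[OF u])
    then have "carrier M = {\<zero>\<^bsub>M\<^esub>}" using m by blast
    then show ?thesis using ind by (simp add: indecomposable_def)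
  qed
qed

text \<open>A minimal counterexample is neither zero nor indecomposable, so it splits into two
  smaller submodules. Arguments that decompose a module into indecomposables are run through this
  rule.\<close>

lemma (in right_module) decomposition_induct:
  assumes art: "artinian_module A M" and U: "submodule U A M"
    and zero: "P {\<zero>\<^bsub>M\<^esub>}"
    and ind: "\<And>U. submodule U A M \<Longrightarrow> indecomposable A (M\<lparr>carrier := U\<rparr>) \<Longrightarrow> P U"
    and sum: "\<And>U V W. submodule U A M \<Longrightarrow> internal_sum A (M\<lparr>carrier := U\<rparr>) V W \<Longrightarrow> P V \<Longrightarrow> P W \<Longrightarrow> P U"
  shows "P U"
proof (rule ccontr)
  assume "\<not> P U"
  then obtain V where V: "submodule V A M" "\<not> P V" "\<forall>W. submodule W A M \<longrightarrow> W \<subset> V \<longrightarrow> \<not> \<not> P W"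
    using artinian_minimal[where P = "\<lambda>V. \<not> P V", OF art U] by auto
  have "V \<noteq> {\<zero>\<^bsub>M\<^esub>}" using zero V by blast
  moreover have "\<not> indecomposable A (M\<lparr>carrier := V\<rparr>)" using ind V by blast
  ultimately obtain X Y where XY: "internal_sum A (M\<lparr>carrier := V\<rparr>) X Y" "X \<noteq> {\<zero>\<^bsub>M\<^esub>}" "Y \<noteq> {\<zero>\<^bsub>M\<^esub>}"
    unfolding indecomposable_def by auto
  interpret V: right_module A "M\<lparr>carrier := V\<rparr>" by (rule right_module_submodule) fact
  note d = V.internal_sumD[OF XY(1)]
  have s: "submodule X A M" "X \<subseteq> V" "submodule Y A M" "Y \<subseteq> V"
    using d(1,2) by (simp_all add: submodule_submodule_iff[OF V(1)])
  have XYi: "X \<inter> Y = {\<zero>\<^bsub>M\<^esub>}" using d(3) by simp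
  have "X \<noteq> V" using XYi XY(3) s(4) by blast
  moreover have "Y \<noteq> V" using XYi XY(2) s(2) by blast
  ultimately have "P X" "P Y" using V(3) s by auto
  then show False using sum[OF V(1) XY(1)] V(2) by blast
qed

section \<open>Direct sums\<close>

lemma (in abelian_monoid) finsum_mem:
  assumes "finite F" "\<zero> \<in> R" "\<And>x y. x \<in> R \<Longrightarrow> y \<in> R \<Longrightarrow> x \<oplus> y \<in> R" "R \<subseteq> carrier G" "\<And>i. i \<in> F \<Longrightarrow> f i \<in> R"
  shows "(\<Oplus>i\<in>F. f i) \<in> R"
  using assms(1,5)
proof induction
  case (insert i F)
  have "f \<in> F \<rightarrow> carrier G" "f i \<in> carrier G" using insert assms(4) by auto
  then show ?case using insert assms(3) by simp
qed (simp add: assms(2))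

lemma direct_sum_simps:
  assumes "finite I"
  shows "carrier (direct_sum I X) = (\<Pi>\<^sub>E i\<in>I. carrier (X i))"
    "\<zero>\<^bsub>direct_sum I X\<^esub> = (\<lambda>i\<in>I. \<zero>\<^bsub>X i\<^esub>)"
    "f \<oplus>\<^bsub>direct_sum I X\<^esub> g = (\<lambda>i\<in>I. f i \<oplus>\<^bsub>X i\<^esub> g i)"
    "a \<odot>\<^bsub>direct_sum I X\<^esub> f = (\<lambda>i\<in>I. a \<odot>\<^bsub>X i\<^esub> f i)"
  using assms by (auto simp: direct_sum_def)

locale finite_direct_sum = ring A for A :: "('a, 'b) ring_scheme" (structure) +
  fixes I :: "'i set" and X :: "'i \<Rightarrow> ('a, 'm) module"
  assumes fin: "finite I" and summand: "\<And>i. i \<in> I \<Longrightarrow> right_module A (X i)"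
begin

abbreviation "D \<equiv> direct_sum I X"

lemmas ds = direct_sum_simps[OF fin]

lemma summand_facts:
  assumes "i \<in> I"
  shows "\<zero>\<^bsub>X i\<^esub> \<in> carrier (X i)" "x \<in> carrier (X i) \<Longrightarrow> y \<in> carrier (X i) \<Longrightarrow> x \<oplus>\<^bsub>X i\<^esub> y \<in> carrier (X i)"
    "a \<in> carrier A \<Longrightarrow> x \<in> carrier (X i) \<Longrightarrow> a \<odot>\<^bsub>X i\<^esub> x \<in> carrier (X i)"
    "x \<in> carrier (X i) \<Longrightarrow> \<zero>\<^bsub>X i\<^esub> \<oplus>\<^bsub>X i\<^esub> x = x" "x \<in> carrier (X i) \<Longrightarrow> x \<oplus>\<^bsub>X i\<^esub> \<zero>\<^bsub>X i\<^esub> = x"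
    "a \<in> carrier A \<Longrightarrow> a \<odot>\<^bsub>X i\<^esub> \<zero>\<^bsub>X i\<^esub> = \<zero>\<^bsub>X i\<^esub>"
proof -
  interpret right_module A "X i" by (rule summand) fact
  show "\<zero>\<^bsub>X i\<^esub> \<in> carrier (X i)" "x \<in> carrier (X i) \<Longrightarrow> y \<in> carrier (X i) \<Longrightarrow> x \<oplus>\<^bsub>X i\<^esub> y \<in> carrier (X i)"
    "a \<in> carrier A \<Longrightarrow> x \<in> carrier (X i) \<Longrightarrow> a \<odot>\<^bsub>X i\<^esub> x \<in> carrier (X i)"
    "x \<in> carrier (X i) \<Longrightarrow> \<zero>\<^bsub>X i\<^esub> \<oplus>\<^bsub>X i\<^esub> x = x" "x \<in> carrier (X i) \<Longrightarrow> x \<oplus>\<^bsub>X i\<^esub> \<zero>\<^bsub>X i\<^esub> = x"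
    "a \<in> carrier A \<Longrightarrow> a \<odot>\<^bsub>X i\<^esub> \<zero>\<^bsub>X i\<^esub> = \<zero>\<^bsub>X i\<^esub>"
    by (auto simp: smult_zero_right)
qed

lemma ext: "f \<in> carrier D \<Longrightarrow> g \<in> carrier D \<Longrightarrow> (\<And>i. i \<in> I \<Longrightarrow> f i = g i) \<Longrightarrow> f = g"
  unfolding ds(1) by (rule PiE_ext)

lemma comp: "f \<in> carrier D \<Longrightarrow> i \<in> I \<Longrightarrow> f i \<in> carrier (X i)"
  unfolding ds(1) by (rule PiE_mem)

lemma D_closed:
  "\<zero>\<^bsub>D\<^esub> \<in> carrier D" "f \<in> carrier D \<Longrightarrow> g \<in> carrier D \<Longrightarrow> f \<oplus>\<^bsub>D\<^esub> g \<in> carrier D"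
  "a \<in> carrier A \<Longrightarrow> f \<in> carrier D \<Longrightarrow> a \<odot>\<^bsub>D\<^esub> f \<in> carrier D"
  using summand_facts comp by (auto simp: ds)

lemma D_comp:
  "i \<in> I \<Longrightarrow> \<zero>\<^bsub>D\<^esub> i = \<zero>\<^bsub>X i\<^esub>" "i \<in> I \<Longrightarrow> (f \<oplus>\<^bsub>D\<^esub> g) i = f i \<oplus>\<^bsub>X i\<^esub> g i"
  "i \<in> I \<Longrightarrow> (a \<odot>\<^bsub>D\<^esub> f) i = a \<odot>\<^bsub>X i\<^esub> f i"
  by (auto simp: ds)

lemma right_module_D: "right_module A D"
proof -
  have "abelian_group D"
  proof (rule abelian_groupI)
    fix f g h assume f: "f \<in> carrier D" and g: "g \<in> carrier D" and h: "h \<in> carrier D"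
    show "f \<oplus>\<^bsub>D\<^esub> g \<oplus>\<^bsub>D\<^esub> h = f \<oplus>\<^bsub>D\<^esub> (g \<oplus>\<^bsub>D\<^esub> h)"
    proof (rule ext)
      fix i assume i: "i \<in> I"
      interpret Xi: right_module A "X i" by (rule summand) fact
      show "(f \<oplus>\<^bsub>D\<^esub> g \<oplus>\<^bsub>D\<^esub> h) i = (f \<oplus>\<^bsub>D\<^esub> (g \<oplus>\<^bsub>D\<^esub> h)) i"
        using comp[OF f i] comp[OF g i] comp[OF h i] i by (simp add: D_comp Xi.M.a_assoc)
    qed (simp_all add: f g h D_closed)
    show "f \<oplus>\<^bsub>D\<^esub> g = g \<oplus>\<^bsub>D\<^esub> f"
    proof (rule ext)
      fix i assume i: "i \<in> I"
      interpret Xi: right_module A "X i" by (rule summand) fact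
      show "(f \<oplus>\<^bsub>D\<^esub> g) i = (g \<oplus>\<^bsub>D\<^esub> f) i"
        using comp[OF f i] comp[OF g i] i by (simp add: D_comp Xi.M.a_comm)
    qed (simp_all add: f g D_closed)
  next
    fix f assume f: "f \<in> carrier D"
    show "\<zero>\<^bsub>D\<^esub> \<oplus>\<^bsub>D\<^esub> f = f"
      by (rule ext) (use f comp[OF f] in \<open>simp_all add: D_closed D_comp summand_facts\<close>)
    let ?g = "\<lambda>i\<in>I. \<ominus>\<^bsub>X i\<^esub> f i"
    have n: "\<ominus>\<^bsub>X i\<^esub> f i \<in> carrier (X i)" "\<ominus>\<^bsub>X i\<^esub> f i \<oplus>\<^bsub>X i\<^esub> f i = \<zero>\<^bsub>X i\<^esub>" if i: "i \<in> I" for i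
    proof -
      interpret Xi: right_module A "X i" by (rule summand) fact
      show "\<ominus>\<^bsub>X i\<^esub> f i \<in> carrier (X i)" "\<ominus>\<^bsub>X i\<^esub> f i \<oplus>\<^bsub>X i\<^esub> f i = \<zero>\<^bsub>X i\<^esub>"
        using comp[OF f i] by (simp_all add: Xi.M.l_neg)
    qed
    have g: "?g \<in> carrier D" unfolding ds(1) using n by auto
    have "?g \<oplus>\<^bsub>D\<^esub> f = \<zero>\<^bsub>D\<^esub>"
      by (rule ext) (use f g n in \<open>simp_all add: D_closed D_comp\<close>)
    then show "\<exists>g\<in>carrier D. g \<oplus>\<^bsub>D\<^esub> f = \<zero>\<^bsub>D\<^esub>" using g by blast
  qed (rule D_closed; assumption)+
  then show ?thesis
  proof (intro right_module.intro right_module_axioms.intro ring_axioms)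
    fix a b f assume a: "a \<in> carrier A" and b: "b \<in> carrier A" and f: "f \<in> carrier D"
    show "(a \<oplus>\<^bsub>A\<^esub> b) \<odot>\<^bsub>D\<^esub> f = a \<odot>\<^bsub>D\<^esub> f \<oplus>\<^bsub>D\<^esub> b \<odot>\<^bsub>D\<^esub> f"
    proof (rule ext)
      fix i assume i: "i \<in> I"
      interpret Xi: right_module A "X i" by (rule summand) fact
      show "((a \<oplus>\<^bsub>A\<^esub> b) \<odot>\<^bsub>D\<^esub> f) i = (a \<odot>\<^bsub>D\<^esub> f \<oplus>\<^bsub>D\<^esub> b \<odot>\<^bsub>D\<^esub> f) i"
        using comp[OF f i] a b i by (simp add: D_comp Xi.smult_l_distr)
    qed (simp_all add: a b f D_closed)
    show "(a \<otimes>\<^bsub>A\<^esub> b) \<odot>\<^bsub>D\<^esub> f = b \<odot>\<^bsub>D\<^esub> (a \<odot>\<^bsub>D\<^esub> f)"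
    proof (rule ext)
      fix i assume i: "i \<in> I"
      interpret Xi: right_module A "X i" by (rule summand) fact
      show "((a \<otimes>\<^bsub>A\<^esub> b) \<odot>\<^bsub>D\<^esub> f) i = (b \<odot>\<^bsub>D\<^esub> (a \<odot>\<^bsub>D\<^esub> f)) i"
        using comp[OF f i] a b i by (simp add: D_comp Xi.smult_assoc)
    qed (simp_all add: a b f D_closed)
  next
    fix a f g assume a: "a \<in> carrier A" and f: "f \<in> carrier D" and g: "g \<in> carrier D"
    show "a \<odot>\<^bsub>D\<^esub> (f \<oplus>\<^bsub>D\<^esub> g) = a \<odot>\<^bsub>D\<^esub> f \<oplus>\<^bsub>D\<^esub> a \<odot>\<^bsub>D\<^esub> g"
    proof (rule ext)
      fix i assume i: "i \<in> I"
      interpret Xi: right_module A "X i" by (rule summand) fact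
      show "(a \<odot>\<^bsub>D\<^esub> (f \<oplus>\<^bsub>D\<^esub> g)) i = (a \<odot>\<^bsub>D\<^esub> f \<oplus>\<^bsub>D\<^esub> a \<odot>\<^bsub>D\<^esub> g) i"
        using comp[OF f i] comp[OF g i] a i by (simp add: D_comp Xi.smult_r_distr)
    qed (simp_all add: a g f D_closed)
  next
    fix f assume f: "f \<in> carrier D"
    show "\<one>\<^bsub>A\<^esub> \<odot>\<^bsub>D\<^esub> f = f"
    proof (rule ext)
      fix i assume i: "i \<in> I"
      interpret Xi: right_module A "X i" by (rule summand) fact
      show "(\<one>\<^bsub>A\<^esub> \<odot>\<^bsub>D\<^esub> f) i = f i"
        using comp[OF f i] i by (simp add: D_comp)
    qed (simp_all add: f D_closed)
  qed (assumption | (rule D_closed; assumption))+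
qed

lemma proj_hom: "i \<in> I \<Longrightarrow> (\<lambda>f\<in>carrier D. f i) \<in> rmod_hom A D (X i)"
  by (rule rmod_hom_restrictI[OF _ _ _ right_module_D]) (simp_all add: comp D_comp)

definition emb :: "'i \<Rightarrow> 'm \<Rightarrow> 'i \<Rightarrow> 'm" where
  "emb i = (\<lambda>x\<in>carrier (X i). \<lambda>j\<in>I. if j = i then x else \<zero>\<^bsub>X j\<^esub>)"

lemma emb_hom: assumes i: "i \<in> I" shows "emb i \<in> rmod_hom A (X i) D"
  unfolding emb_def
proof (rule rmod_hom_restrictI[OF _ _ _ summand[OF i]])
  let ?f = "\<lambda>x. \<lambda>j\<in>I. if j = i then x else \<zero>\<^bsub>X j\<^esub>"
  show c: "?f x \<in> carrier D" if "x \<in> carrier (X i)" for x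
    using that summand_facts(1) by (auto simp: ds)
  show "?f (x \<oplus>\<^bsub>X i\<^esub> y) = ?f x \<oplus>\<^bsub>D\<^esub> ?f y" if "x \<in> carrier (X i)" "y \<in> carrier (X i)" for x y
    by (rule ext) (use that c D_closed summand_facts[OF i] summand_facts in \<open>auto simp: D_comp\<close>)
  show "?f (a \<odot>\<^bsub>X i\<^esub> x) = a \<odot>\<^bsub>D\<^esub> ?f x" if "a \<in> carrier A" "x \<in> carrier (X i)" for a x
    by (rule ext) (use that c D_closed summand_facts[OF i] summand_facts in \<open>auto simp: D_comp\<close>)
qed

text \<open>Truncating \<open>z\<close> to \<open>T\<close> keeps all terms in the same direct sum,
  so the expansion into embedded components can be proved by induction on \<open>T\<close>.\<close>

lemma partial_sum:
  assumes N: "right_module A N" and f: "f \<in> rmod_hom A D N" and z: "z \<in> carrier D" and T: "T \<subseteq> I"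
  shows "f (\<lambda>i\<in>I. if i \<in> T then z i else \<zero>\<^bsub>X i\<^esub>) = (\<Oplus>\<^bsub>N\<^esub>i\<in>T. f (emb i (z i)))"
proof -
  interpret N: right_module A N by fact
  have "finite T" using T fin by (rule finite_subset)
  then show ?thesis using T
  proof induction
    case empty
    have "(\<lambda>i\<in>I. if i \<in> {} then z i else \<zero>\<^bsub>X i\<^esub>) = \<zero>\<^bsub>D\<^esub>" by (simp add: ds)
    then show ?case using rmod_hom_zero[OF right_module_D N f] by simp
  next
    case (insert k T)
    let ?z = "\<lambda>T. \<lambda>i\<in>I. if i \<in> T then z i else \<zero>\<^bsub>X i\<^esub>"
    have k: "k \<in> I" using insert by simp
    have zc: "?z T \<in> carrier D" for T using comp[OF z] summand_facts(1) by (auto simp: ds)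
    have ic: "emb i (z i) \<in> carrier D" if "i \<in> I" for i
      using rmod_hom_closed[OF emb_hom comp] that z by blast
    have "?z (insert k T) = emb k (z k) \<oplus>\<^bsub>D\<^esub> ?z T"
      by (rule ext[OF zc D_closed(2)[OF ic[OF k] zc]])
         (use k insert.hyps insert.prems comp[OF z] summand_facts in \<open>auto simp: D_comp emb_def\<close>)
    then have "f (?z (insert k T)) = f (emb k (z k)) \<oplus>\<^bsub>N\<^esub> f (?z T)"
      using rmod_hom_add[OF f ic[OF k] zc[of T]] by simp
    also have "f (?z T) = (\<Oplus>\<^bsub>N\<^esub>i\<in>T. f (emb i (z i)))"
      by (rule insert.IH) (use insert.prems in blast)
    also have "f (emb k (z k)) \<oplus>\<^bsub>N\<^esub> \<dots> = (\<Oplus>\<^bsub>N\<^esub>i\<in>insert k T. f (emb i (z i)))"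
      by (rule N.M.finsum_insert[symmetric])
         (use insert.hyps insert.prems rmod_hom_closed[OF f] ic k in auto)
    finally show ?case .
  qed
qed

lemma hom_eq_finsum:
  assumes N: "right_module A N" and f: "f \<in> rmod_hom A D N" and z: "z \<in> carrier D"
  shows "f z = (\<Oplus>\<^bsub>N\<^esub>i\<in>I. f (emb i (z i)))"
proof -
  have "(\<lambda>i\<in>I. if i \<in> I then z i else \<zero>\<^bsub>X i\<^esub>) = z"
    by (rule ext) (use z comp[OF z] in \<open>auto simp: ds\<close>)
  then show ?thesis using partial_sum[OF N f z, of I] by simp
qed

lemma D_generated:
  assumes H: "submodule H A D" and c: "\<And>i x. i \<in> I \<Longrightarrow> x \<in> carrier (X i) \<Longrightarrow> emb i x \<in> H"
  shows "H = carrier D"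
proof
  interpret D: right_module A D by (rule right_module_D)
  have Hs: "H \<subseteq> carrier D" "\<zero>\<^bsub>D\<^esub> \<in> H" "\<And>x y. x \<in> H \<Longrightarrow> y \<in> H \<Longrightarrow> x \<oplus>\<^bsub>D\<^esub> y \<in> H"
    using H by (simp_all add: D.submodule_iff)
  show "H \<subseteq> carrier D" by fact
  show "carrier D \<subseteq> H"
  proof
    fix z assume z: "z \<in> carrier D"
    have "z = (\<Oplus>\<^bsub>D\<^esub>i\<in>I. emb i (z i))"
    proof -
      have "(\<lambda>x\<in>carrier D. x) z = (\<Oplus>\<^bsub>D\<^esub>i\<in>I. (\<lambda>x\<in>carrier D. x) (emb i (z i)))"
        by (rule hom_eq_finsum[OF right_module_D rmod_hom_id[OF right_module_D] z])
      also have "\<dots> = (\<Oplus>\<^bsub>D\<^esub>i\<in>I. emb i (z i))"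
        by (rule D.M.finsum_cong') (use rmod_hom_closed[OF emb_hom] comp[OF z] in auto)
      finally show ?thesis using z by simp
    qed
    then show "z \<in> H" using D.M.finsum_mem[OF fin Hs(2,3,1), of "\<lambda>i. emb i (z i)"] c comp[OF z] by simp
  qed
qed

lemma fin_gen_D:
  assumes "\<And>i. i \<in> I \<Longrightarrow> fin_gen A (X i)"
  shows "fin_gen A D"
proof -
  interpret D: right_module A D by (rule right_module_D)
  have "\<forall>i\<in>I. \<exists>S. S \<subseteq> carrier (X i) \<and> finite S \<and>
     (\<forall>H. submodule H A (X i) \<and> S \<subseteq> H \<longrightarrow> H = carrier (X i))"
    using assms by (simp add: fin_gen_def)
  from bchoice[OF this]
  obtain S where "\<forall>i\<in>I. S i \<subseteq> carrier (X i) \<and> finite (S i) \<and>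
     (\<forall>H. submodule H A (X i) \<and> S i \<subseteq> H \<longrightarrow> H = carrier (X i))" by (elim exE)
  note S = this[THEN bspec]
  let ?S = "\<Union>i\<in>I. emb i ` S i"
  have "H = carrier D" if H: "submodule H A D \<and> ?S \<subseteq> H" for H
  proof (rule D_generated)
    fix i x assume i: "i \<in> I" and x: "x \<in> carrier (X i)"
    have "submodule {x \<in> carrier (X i). emb i x \<in> H} A (X i)"
      by (rule submodule_preimage[OF summand[OF i] right_module_D emb_hom[OF i]]) (use H in simp)
    moreover have "S i \<subseteq> {x \<in> carrier (X i). emb i x \<in> H}" using S[OF i] H i by auto
    ultimately have "{x \<in> carrier (X i). emb i x \<in> H} = carrier (X i)"
      by (intro S[OF i, THEN conjunct2, THEN conjunct2, THEN spec, THEN mp] conjI)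
    then show "emb i x \<in> H" using x by blast
  qed (use H in simp)
  moreover have "finite ?S" using fin S by auto
  moreover have "?S \<subseteq> carrier D"
  proof
    fix y assume "y \<in> ?S"
    then obtain i x where ix: "i \<in> I" "x \<in> S i" "y = emb i x" by blast
    have "x \<in> carrier (X i)" using S[OF ix(1)] ix(2) by blast
    then show "y \<in> carrier D" unfolding ix(3) by (rule rmod_hom_closed[OF emb_hom[OF ix(1)]])
  qed
  ultimately show ?thesis unfolding fin_gen_def by (intro exI[of _ ?S] conjI allI impI)
qed

lemma copair_hom:
  assumes J: "right_module A J" and f: "\<And>i. i \<in> I \<Longrightarrow> f i \<in> rmod_hom A (X i) J"
  shows "(\<lambda>z\<in>carrier D. \<Oplus>\<^bsub>J\<^esub>i\<in>I. f i (z i)) \<in> rmod_hom A D J"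
proof (rule rmod_hom_restrictI[OF _ _ _ right_module_D])
  interpret J: right_module A J by fact
  have c: "i \<in> I \<Longrightarrow> z \<in> carrier D \<Longrightarrow> f i (z i) \<in> carrier J" for i z
    using rmod_hom_closed[OF f comp] by blast
  show "(\<Oplus>\<^bsub>J\<^esub>i\<in>I. f i (z i)) \<in> carrier J" if "z \<in> carrier D" for z
    using c that by (intro J.M.finsum_closed) auto
  show "(\<Oplus>\<^bsub>J\<^esub>i\<in>I. f i ((x \<oplus>\<^bsub>D\<^esub> y) i)) = (\<Oplus>\<^bsub>J\<^esub>i\<in>I. f i (x i)) \<oplus>\<^bsub>J\<^esub> (\<Oplus>\<^bsub>J\<^esub>i\<in>I. f i (y i))"
    if xy: "x \<in> carrier D" "y \<in> carrier D" for x y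
  proof -
    have "(\<Oplus>\<^bsub>J\<^esub>i\<in>I. f i ((x \<oplus>\<^bsub>D\<^esub> y) i)) = (\<Oplus>\<^bsub>J\<^esub>i\<in>I. f i (x i) \<oplus>\<^bsub>J\<^esub> f i (y i))"
      by (rule J.M.finsum_cong') (use c xy comp rmod_hom_add[OF f] in \<open>auto simp: D_comp\<close>)
    also have "\<dots> = (\<Oplus>\<^bsub>J\<^esub>i\<in>I. f i (x i)) \<oplus>\<^bsub>J\<^esub> (\<Oplus>\<^bsub>J\<^esub>i\<in>I. f i (y i))"
      using c xy by (intro J.M.finsum_addf) auto
    finally show ?thesis .
  qed
  show "(\<Oplus>\<^bsub>J\<^esub>i\<in>I. f i ((a \<odot>\<^bsub>D\<^esub> x) i)) = a \<odot>\<^bsub>J\<^esub> (\<Oplus>\<^bsub>J\<^esub>i\<in>I. f i (x i))"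
    if xy: "a \<in> carrier A" "x \<in> carrier D" for a x
  proof -
    have "(\<Oplus>\<^bsub>J\<^esub>i\<in>I. f i ((a \<odot>\<^bsub>D\<^esub> x) i)) = (\<Oplus>\<^bsub>J\<^esub>i\<in>I. a \<odot>\<^bsub>J\<^esub> f i (x i))"
      by (rule J.M.finsum_cong') (use c xy comp rmod_hom_smult[OF f] in \<open>auto simp: D_comp\<close>)
    also have "\<dots> = a \<odot>\<^bsub>J\<^esub> (\<Oplus>\<^bsub>J\<^esub>i\<in>I. f i (x i))"
      using c xy fin by (intro J.finsum_smult[symmetric]) auto
    finally show ?thesis .
  qed
qed

end

section \<open>Projective modules\<close>

text \<open>The test modules keep the fixed carrier type of \<open>mod_cat\<close>, while
  \<open>P\<close> may live in any type; the pointwise equation avoids the bookkeeping of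
  \<open>compose\<close>.\<close>

lemma projectiveI:
  fixes P :: "('a, 'm) module"
  assumes "right_module A P"
    "\<And>(M :: 'a fg_module) (N :: 'a fg_module) g f.
      right_module A M \<Longrightarrow> right_module A N \<Longrightarrow> fin_gen A M \<Longrightarrow> g \<in> rmod_hom A M N \<Longrightarrow> f \<in> rmod_hom A P N \<Longrightarrow>
      g ` carrier M = carrier N \<Longrightarrow> \<exists>h\<in>rmod_hom A P M. \<forall>x\<in>carrier P. g (h x) = f x"
  shows "projective A P"
  unfolding projective_def
proof (intro conjI ballI impI assms(1))
  fix M N :: "'a fg_module" and g f
  assume a: "M \<in> mod_cat A" "N \<in> mod_cat A" "g \<in> rmod_hom A M N" "f \<in> rmod_hom A P N" "g ` carrier M = carrier N"
  then obtain h where h: "h \<in> rmod_hom A P M" "\<forall>x\<in>carrier P. g (h x) = f x"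
    using assms(2)[of M N g f] by (auto simp: mod_cat_def)
  have "compose (carrier P) g h = f"
    by (rule rmod_hom_ext[OF rmod_hom_compose[OF assms(1) h(1) a(3)] a(4)]) (simp add: compose_def h(2))
  then show "\<exists>h\<in>rmod_hom A P M. compose (carrier P) g h = f" using h by blast
qed

lemma projective_right_module: "projective A P \<Longrightarrow> right_module A P"
  by (simp add: projective_def)

text \<open>The definition tests lifting against \<open>mod_cat\<close> only. A lifting problem over
  other carrier types is moved to isomorphic copies in \<open>mod_cat\<close>, solved there and
  moved back.\<close>

lemma projective_lift:
  assumes P: "projective A P" and M: "right_module A M" "fin_gen A M" and N: "right_module A N"
    and g: "g \<in> rmod_hom A M N" "g ` carrier M = carrier N" and f: "f \<in> rmod_hom A P N"
  shows "\<exists>h\<in>rmod_hom A P M. \<forall>x\<in>carrier P. g (h x) = f x"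
proof -
  have Pm: "right_module A P" using P by (rule projective_right_module)
  obtain M' where M': "M' \<in> mod_cat A" "rmod_iso A M M'" using mod_cat_complete[OF M] by blast
  obtain N' where N': "N' \<in> mod_cat A" "rmod_iso A N N'"
    using mod_cat_complete[OF N fin_gen_hom_image[OF M(1) N g M(2)]] by blast
  have M'm: "right_module A M'" and N'm: "right_module A N'" using M' N' by (simp_all add: mod_cat_def)
  obtain a a' where a: "a \<in> rmod_hom A M M'" "a' \<in> rmod_hom A M' M"
    "\<And>x. x \<in> carrier M \<Longrightarrow> a' (a x) = x" "\<And>y. y \<in> carrier M' \<Longrightarrow> a (a' y) = y"
    using rmod_isoE[OF M'(2) M(1) M'm] by metis
  obtain b b' where b: "b \<in> rmod_hom A N N'" "b' \<in> rmod_hom A N' N"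
    "\<And>x. x \<in> carrier N \<Longrightarrow> b' (b x) = x" "\<And>y. y \<in> carrier N' \<Longrightarrow> b (b' y) = y"
    using rmod_isoE[OF N'(2) N N'm] by metis
  let ?g = "compose (carrier M') b (compose (carrier M') g a')" and ?f = "compose (carrier P) b f"
  have g': "?g \<in> rmod_hom A M' N'" by (rule rmod_hom_compose[OF M'm rmod_hom_compose[OF M'm a(2) g(1)] b(1)])
  have f': "?f \<in> rmod_hom A P N'" by (rule rmod_hom_compose[OF Pm f b(1)])
  have "?g ` carrier M' = carrier N'"
  proof
    show "?g ` carrier M' \<subseteq> carrier N'" using rmod_hom_closed[OF g'] by blast
    show "carrier N' \<subseteq> ?g ` carrier M'"
    proof
      fix y assume y: "y \<in> carrier N'"
      then have "b' y \<in> carrier N" by (rule rmod_hom_closed[OF b(2)])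
      then obtain x where x: "x \<in> carrier M" "b' y = g x" using g(2) by blast
      have ax: "a x \<in> carrier M'" using a(1) x(1) by (rule rmod_hom_closed)
      have "?g (a x) = y" using ax a(3)[OF x(1)] x(2) b(4)[OF y] by (simp add: compose_def)
      then show "y \<in> ?g ` carrier M'" using ax by blast
    qed
  qed
  then obtain h where h: "h \<in> rmod_hom A P M'" "compose (carrier P) ?g h = ?f"
    using P M'(1) N'(1) g' f' unfolding projective_def by blast
  have "g (compose (carrier P) a' h x) = f x" if x: "x \<in> carrier P" for x
  proof -
    have hx: "h x \<in> carrier M'" using h(1) x by (rule rmod_hom_closed)
    have "b (g (a' (h x))) = b (f x)"
      using fun_cong[OF h(2), of x] x hx by (simp add: compose_def)
    then have "b' (b (g (a' (h x)))) = b' (b (f x))" by simp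
    then show ?thesis
      using b(3) rmod_hom_closed[OF f x] rmod_hom_closed[OF g(1) rmod_hom_closed[OF a(2) hx]] x
      by (simp add: compose_def)
  qed
  moreover have "compose (carrier P) a' h \<in> rmod_hom A P M" by (rule rmod_hom_compose[OF Pm h(1) a(2)])
  ultimately show ?thesis by blast
qed

lemma projective_retract:
  assumes P: "projective A P" and Q: "right_module A Q"
    and i: "i \<in> rmod_hom A Q P" and p: "p \<in> rmod_hom A P Q" "\<And>x. x \<in> carrier Q \<Longrightarrow> p (i x) = x"
  shows "projective A Q"
proof (rule projectiveI[OF Q])
  fix M N :: "'a fg_module" and g f
  assume a: "right_module A M" "right_module A N" "fin_gen A M" "g \<in> rmod_hom A M N" "f \<in> rmod_hom A Q N"
      "g ` carrier M = carrier N"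
  have Pm: "right_module A P" using P by (rule projective_right_module)
  obtain h where h: "h \<in> rmod_hom A P M" "\<forall>x\<in>carrier P. g (h x) = compose (carrier P) f p x"
    using projective_lift[OF P a(1,3,2,4,6) rmod_hom_compose[OF Pm p(1) a(5)]] by blast
  show "\<exists>h\<in>rmod_hom A Q M. \<forall>x\<in>carrier Q. g (h x) = f x"
    by (rule bexI[OF _ rmod_hom_compose[OF Q i h(1)]])
       (use h(2) rmod_hom_closed[OF i] p(2) in \<open>simp add: compose_def\<close>)
qed

lemma projective_iso:
  assumes "projective A P" "rmod_iso A P Q" "right_module A Q"
  shows "projective A Q"
  by (rule rmod_isoE[OF assms(2) projective_right_module[OF assms(1)] assms(3)])
     (rule projective_retract[OF assms(1,3)])

text \<open>The components of a section of the map from the direct sum onto \<open>J\<close> are the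
  maps \<open>s i\<close>. This serves sums of two submodules here and dual bases over an
  endomorphism ring below.\<close>

lemma projective_family:
  assumes J: "projective A J" and fin: "finite I"
    and X: "\<And>i. i \<in> I \<Longrightarrow> right_module A (X i)" "\<And>i. i \<in> I \<Longrightarrow> fin_gen A (X i)"
    and f: "\<And>i. i \<in> I \<Longrightarrow> f i \<in> rmod_hom A (X i) J"
    and onto: "\<And>y. y \<in> carrier J \<Longrightarrow> \<exists>z\<in>(\<Pi>\<^sub>E i\<in>I. carrier (X i)). y = (\<Oplus>\<^bsub>J\<^esub>i\<in>I. f i (z i))"
  obtains s where "\<And>i. i \<in> I \<Longrightarrow> s i \<in> rmod_hom A J (X i)"
    "\<And>y. y \<in> carrier J \<Longrightarrow> y = (\<Oplus>\<^bsub>J\<^esub>i\<in>I. f i (s i y))"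
proof -
  have Jm: "right_module A J" using J by (rule projective_right_module)
  interpret J: right_module A J by fact
  interpret X: finite_direct_sum A I X by (intro finite_direct_sum.intro finite_direct_sum_axioms.intro J.A.ring_axioms fin X(1))
  let ?g = "\<lambda>z\<in>carrier X.D. \<Oplus>\<^bsub>J\<^esub>i\<in>I. f i (z i)"
  have g: "?g \<in> rmod_hom A X.D J" by (rule X.copair_hom[OF Jm f])
  have "carrier J \<subseteq> ?g ` carrier X.D"
  proof
    fix y assume "y \<in> carrier J"
    then obtain z where "z \<in> carrier X.D" "y = (\<Oplus>\<^bsub>J\<^esub>i\<in>I. f i (z i))" using onto X.ds(1) by metis
    then show "y \<in> ?g ` carrier X.D" by (intro image_eqI[of _ _ z]) simp_all
  qed
  then have "?g ` carrier X.D = carrier J" using rmod_hom_closed[OF g] by blast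
  then obtain h where h: "h \<in> rmod_hom A J X.D" "\<forall>y\<in>carrier J. ?g (h y) = (\<lambda>y\<in>carrier J. y) y"
    using projective_lift[OF J X.right_module_D X.fin_gen_D[OF X(2)] Jm g _ rmod_hom_id[OF Jm]] by blast
  show thesis
  proof (rule that)
    show "compose (carrier J) (\<lambda>z\<in>carrier X.D. z i) h \<in> rmod_hom A J (X i)" if "i \<in> I" for i
      by (rule rmod_hom_compose[OF Jm h(1) X.proj_hom[OF that]])
    show "y = (\<Oplus>\<^bsub>J\<^esub>i\<in>I. f i (compose (carrier J) (\<lambda>z\<in>carrier X.D. z i) h y))" if y: "y \<in> carrier J" for y
    proof -
      have "?g (h y) = y" using h(2) y by simp
      then have "(\<Oplus>\<^bsub>J\<^esub>i\<in>I. f i (h y i)) = y" using rmod_hom_closed[OF h(1) y] by simp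
      then show ?thesis using y rmod_hom_closed[OF h(1) y] by (simp add: compose_def)
    qed
  qed
qed

text \<open>Even if \<open>T\<close> and \<open>N\<close> overlap, projectivity splits the identity
  into a part with values in \<open>T\<close> and a part with values in \<open>N\<close>, by a
  section of the map from their direct sum.\<close>

lemma projective_two_submodules:
  assumes P: "projective A P" and T: "submodule T A P" "fin_gen A (P\<lparr>carrier := T\<rparr>)"
    and N: "submodule N A P" "fin_gen A (P\<lparr>carrier := N\<rparr>)" and TN: "T <+>\<^bsub>P\<^esub> N = carrier P"
  obtains t n where "t \<in> rmod_hom A P (P\<lparr>carrier := T\<rparr>)" "n \<in> rmod_hom A P (P\<lparr>carrier := N\<rparr>)"
    "\<And>x. x \<in> carrier P \<Longrightarrow> t x \<oplus>\<^bsub>P\<^esub> n x = x"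
proof -
  have Pm: "right_module A P" using P by (rule projective_right_module)
  interpret P: right_module A P by fact
  have c: "T \<subseteq> carrier P" "N \<subseteq> carrier P" using T N by (simp_all add: P.submodule_iff)
  let ?X = "\<lambda>i::bool. if i then P\<lparr>carrier := T\<rparr> else P\<lparr>carrier := N\<rparr>"
  let ?f = "\<lambda>i::bool. if i then (\<lambda>x\<in>T. x) else (\<lambda>x\<in>N. x)"
  have fs: "(\<Oplus>\<^bsub>P\<^esub>i\<in>{True, False}. g i) = g True \<oplus>\<^bsub>P\<^esub> g False"
    if "g True \<in> carrier P" "g False \<in> carrier P" for g
    using that by (subst P.M.finsum_insert) auto
  show thesis
  proof (rule projective_family[OF P, of "{True, False}" ?X ?f])
    show "\<exists>z\<in>(\<Pi>\<^sub>E i\<in>{True, False}. carrier (?X i)). y = (\<Oplus>\<^bsub>P\<^esub>i\<in>{True, False}. ?f i (z i))"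
      if "y \<in> carrier P" for y
    proof -
      have "y \<in> T <+>\<^bsub>P\<^esub> N" using TN that by simp
      then obtain t n where tn: "t \<in> T" "n \<in> N" "y = t \<oplus>\<^bsub>P\<^esub> n" by (auto simp: set_add_def')
      let ?z = "\<lambda>i\<in>{True, False}. if i then t else n"
      have "?z \<in> (\<Pi>\<^sub>E i\<in>{True, False}. carrier (?X i))" using tn by auto
      moreover have "y = (\<Oplus>\<^bsub>P\<^esub>i\<in>{True, False}. ?f i (?z i))"
        by (subst fs) (use tn c in auto)
      ultimately show ?thesis by blast
    qed
    fix s assume s: "\<And>i. i \<in> {True, False} \<Longrightarrow> s i \<in> rmod_hom A P (?X i)"
      and e: "\<And>y. y \<in> carrier P \<Longrightarrow> y = (\<Oplus>\<^bsub>P\<^esub>i\<in>{True, False}. ?f i (s i y))"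
    have s1: "s True \<in> rmod_hom A P (P\<lparr>carrier := T\<rparr>)" and s2: "s False \<in> rmod_hom A P (P\<lparr>carrier := N\<rparr>)"
      using s[of True] s[of False] by simp_all
    have "s True x \<oplus>\<^bsub>P\<^esub> s False x = x" if x: "x \<in> carrier P" for x
    proof -
      have m: "s True x \<in> T" "s False x \<in> N" using rmod_hom_closed[OF s1 x] rmod_hom_closed[OF s2 x] by simp_all
      have "(\<Oplus>\<^bsub>P\<^esub>i\<in>{True, False}. ?f i (s i x)) = s True x \<oplus>\<^bsub>P\<^esub> s False x"
        by (subst fs) (use m c in auto)
      then show ?thesis using e[OF x] by simp
    qed
    then show thesis by (rule that[OF s1 s2])
  next
    show "right_module A (?X i)" "fin_gen A (?X i)" "?f i \<in> rmod_hom A (?X i) P" for i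
      using T N P.right_module_submodule rmod_hom_inclusion[OF Pm] by auto
  qed simp
qed

text \<open>Lifts on the summands are glued by the universal property of the direct sum.\<close>

lemma (in finite_direct_sum) projective_D:
  assumes "\<And>i. i \<in> I \<Longrightarrow> projective A (X i)"
  shows "projective A D"
proof (rule projectiveI[OF right_module_D])
  fix M N :: "'a fg_module" and g f
  assume a: "right_module A M" "right_module A N" "fin_gen A M" "g \<in> rmod_hom A M N" "f \<in> rmod_hom A D N"
      "g ` carrier M = carrier N"
  interpret M: right_module A M by fact
  interpret N: right_module A N by fact
  have "\<forall>i\<in>I. \<exists>h. h \<in> rmod_hom A (X i) M \<and> (\<forall>x\<in>carrier (X i). g (h x) = compose (carrier (X i)) f (emb i) x)"
  proof
    fix i assume i: "i \<in> I"
    show "\<exists>h. h \<in> rmod_hom A (X i) M \<and> (\<forall>x\<in>carrier (X i). g (h x) = compose (carrier (X i)) f (emb i) x)"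
      using projective_lift[OF assms[OF i] a(1,3,2,4,6) rmod_hom_compose[OF summand[OF i] emb_hom[OF i] a(5)]] by blast
  qed
  from bchoice[OF this]
  obtain h where "\<forall>i\<in>I. h i \<in> rmod_hom A (X i) M \<and> (\<forall>x\<in>carrier (X i). g (h i x) = compose (carrier (X i)) f (emb i) x)"
    by (elim exE)
  then have h: "\<And>i. i \<in> I \<Longrightarrow> h i \<in> rmod_hom A (X i) M"
     "\<And>i x. i \<in> I \<Longrightarrow> x \<in> carrier (X i) \<Longrightarrow> g (h i x) = f (emb i x)" by (auto simp: compose_def)
  let ?h = "\<lambda>z\<in>carrier D. \<Oplus>\<^bsub>M\<^esub>i\<in>I. h i (z i)"
  have H: "?h \<in> rmod_hom A D M" by (rule copair_hom[OF a(1) h(1)])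
  have "g (?h z) = f z" if z: "z \<in> carrier D" for z
  proof -
    have c: "i \<in> I \<Longrightarrow> h i (z i) \<in> carrier M" for i using rmod_hom_closed[OF h(1) comp[OF z]] by blast
    have "g (\<Oplus>\<^bsub>M\<^esub>i\<in>I. h i (z i)) = (\<Oplus>\<^bsub>N\<^esub>i\<in>I. g (h i (z i)))"
      by (rule rmod_hom_finsum[OF a(1,2,4) fin c])
    also have "\<dots> = (\<Oplus>\<^bsub>N\<^esub>i\<in>I. f (emb i (z i)))"
      by (rule N.M.finsum_cong') (use h(2) comp[OF z] rmod_hom_closed[OF a(5) rmod_hom_closed[OF emb_hom]] in auto)
    finally show ?thesis using hom_eq_finsum[OF a(2,5) z] z by simp
  qed
  then show "\<exists>h\<in>rmod_hom A D M. \<forall>x\<in>carrier D. g (h x) = f x" using H by blast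
qed

text \<open>The section makes \<open>M\<close> the direct sum of the image of \<open>s\<close> and
  the kernel of \<open>f\<close>; the former is non-zero, so the latter vanishes and
  \<open>f\<close> is bijective.\<close>

lemma split_epi_indecomposable:
  assumes M: "right_module A M" "indecomposable A M" and P: "right_module A P" "carrier P \<noteq> {\<zero>\<^bsub>P\<^esub>}"
    and f: "f \<in> rmod_hom A M P" and s: "s \<in> rmod_hom A P M" "\<And>x. x \<in> carrier P \<Longrightarrow> f (s x) = x"
  shows "rmod_iso A M P"
proof -
  interpret P: right_module A P by fact
  let ?S = "s ` carrier P" and ?K = "{x \<in> carrier M. f x = \<zero>\<^bsub>P\<^esub>}"
  note sc = rmod_hom_closed[OF s(1)] and fc = rmod_hom_closed[OF f]
  have "internal_sum A M ?S ?K" by (rule retract_internal_sum[OF P(1) M(1) s(1) f s(2)])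
  then consider "?S = {\<zero>\<^bsub>M\<^esub>}" | "?K = {\<zero>\<^bsub>M\<^esub>}" using M(2) unfolding indecomposable_def by blast
  then show ?thesis
  proof cases
    case 1
    have "x = \<zero>\<^bsub>P\<^esub>" if x: "x \<in> carrier P" for x
    proof -
      have "s x = \<zero>\<^bsub>M\<^esub>" using 1 x by blast
      then show ?thesis using s(2)[OF x] rmod_hom_zero[OF M(1) P(1) f] by simp
    qed
    then show ?thesis using P(2) P.M.zero_closed by blast
  next
    case 2
    have "inj_on f (carrier M)" unfolding rmod_hom_inj_iff[OF M(1) P(1) f] using 2 by blast
    moreover have "f ` carrier M = carrier P"
    proof
      show "f ` carrier M \<subseteq> carrier P" using fc by blast
      show "carrier P \<subseteq> f ` carrier M"
      proof
        fix x assume x: "x \<in> carrier P"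
        have "x = f (s x)" using s(2)[OF x] by simp
        then show "x \<in> f ` carrier M" using sc[OF x] by (rule image_eqI)
      qed
    qed
    ultimately show ?thesis unfolding rmod_iso_def using f by (auto simp: bij_betw_def)
  qed
qed

section \<open>Projective modules over an Artin ring\<close>

abbreviation principal_module :: "('a, 'b) ring_scheme \<Rightarrow> 'a \<Rightarrow> ('a, 'a) module" where
  "principal_module A e \<equiv> (regular_module A)\<lparr>carrier := e <#\<^bsub>A\<^esub> carrier A\<rparr>"

text \<open>These two conditions are what the Artin algebra contributes; they pass to every finitely
  generated right module and from there to its submodules.\<close>

locale artin_ring = ring A for A :: "('a, 'b) ring_scheme" (structure) +
  assumes regular_artinian: "artinian_module A (regular_module A)"
    and regular_noetherian: "noetherian_module A (regular_module A)"

sublocale artin_ring \<subseteq> Reg: right_module A "regular_module A"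
  by (rule right_module_regular)

text \<open>The ring elements that carry \<open>m\<close> into \<open>H\<close> are closed under
  addition; as they include all members of \<open>E\<close>, they include their sum 1.\<close>

lemma (in right_module) mem_if_components:
  assumes E: "finite E" "E \<subseteq> carrier A" "(\<Oplus>\<^bsub>A\<^esub>e\<in>E. e) = \<one>\<^bsub>A\<^esub>"
    and H: "submodule H A M" and m: "m \<in> carrier M" and c: "\<And>e. e \<in> E \<Longrightarrow> e \<odot>\<^bsub>M\<^esub> m \<in> H"
  shows "m \<in> H"
proof -
  let ?R = "{a \<in> carrier A. a \<odot>\<^bsub>M\<^esub> m \<in> H}"
  have "(\<Oplus>\<^bsub>A\<^esub>e\<in>E. e) \<in> ?R"
    by (rule A.finsum_mem[OF E(1)])
       (use m H E(2) c in \<open>auto simp: submodule_iff smult_l_distr smult_zero_left\<close>)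
  then show ?thesis using E(3) m by simp
qed

context artin_ring
begin

lemma fin_gen_artinian: "right_module A M \<Longrightarrow> fin_gen A M \<Longrightarrow> artinian_module A M"
  by (rule fin_gen_chain(1)[OF _ _ regular_artinian regular_noetherian])

lemma fin_gen_noetherian: "right_module A M \<Longrightarrow> fin_gen A M \<Longrightarrow> noetherian_module A M"
  by (rule fin_gen_chain(2)[OF _ _ regular_artinian regular_noetherian])

lemma fin_gen_submodule:
  assumes "right_module A M" "fin_gen A M" "submodule U A M"
  shows "fin_gen A (M\<lparr>carrier := U\<rparr>)"
proof -
  interpret M: right_module A M by fact
  show ?thesis
    by (rule noetherian_fin_gen[OF M.right_module_submodule[OF assms(3)]
          M.noetherian_submodule[OF assms(3) fin_gen_noetherian[OF assms(1,2)]]])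
qed

section \<open>Principal right ideals as modules\<close>

lemma mem_principal: "x \<in> e <# carrier A \<longleftrightarrow> (\<exists>a\<in>carrier A. x = e \<otimes> a)"
  by (auto simp: l_coset_def)

lemma mem_principal_idempotent:
  assumes "e \<in> carrier A" "e \<otimes> e = e"
  shows "x \<in> e <# carrier A \<longleftrightarrow> x \<in> carrier A \<and> e \<otimes> x = x"
proof
  assume "x \<in> e <# carrier A"
  then obtain a where "a \<in> carrier A" "x = e \<otimes> a" by (auto simp: mem_principal)
  then show "x \<in> carrier A \<and> e \<otimes> x = x" using assms by (simp add: m_assoc[symmetric])
next
  assume x: "x \<in> carrier A \<and> e \<otimes> x = x"
  show "x \<in> e <# carrier A" unfolding mem_principal by (rule bexI[of _ x]) (use x in simp_all)
qed

lemma submodule_principal: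
  assumes e: "e \<in> carrier A"
  shows "submodule (e <# carrier A) A (regular_module A)"
  unfolding Reg.submodule_iff
proof (intro conjI ballI)
  show "e <# carrier A \<subseteq> carrier (regular_module A)" using e by (auto simp: mem_principal)
  show "\<zero>\<^bsub>regular_module A\<^esub> \<in> e <# carrier A"
    unfolding mem_principal by (rule bexI[of _ \<zero>]) (use e in simp_all)
  fix x assume "x \<in> e <# carrier A"
  then obtain a where a: "a \<in> carrier A" "x = e \<otimes> a" by (auto simp: mem_principal)
  show "b \<odot>\<^bsub>regular_module A\<^esub> x \<in> e <# carrier A" if "b \<in> carrier A" for b
    unfolding mem_principal by (rule bexI[of _ "a \<otimes> b"]) (use e a that in \<open>simp_all add: m_assoc\<close>)
  fix y assume "y \<in> e <# carrier A"
  then obtain b where b: "b \<in> carrier A" "y = e \<otimes> b" by (auto simp: mem_principal)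
  show "x \<oplus>\<^bsub>regular_module A\<^esub> y \<in> e <# carrier A"
    unfolding mem_principal by (rule bexI[of _ "a \<oplus> b"]) (use e a b in \<open>simp_all add: r_distr\<close>)
qed

lemma right_module_principal: "e \<in> carrier A \<Longrightarrow> right_module A (principal_module A e)"
  by (rule Reg.right_module_submodule[OF submodule_principal])

lemma principal_artinian: "e \<in> carrier A \<Longrightarrow> artinian_module A (principal_module A e)"
  by (rule Reg.artinian_submodule[OF submodule_principal regular_artinian])

lemma principal_noetherian: "e \<in> carrier A \<Longrightarrow> noetherian_module A (principal_module A e)"
  by (rule Reg.noetherian_submodule[OF submodule_principal regular_noetherian])

lemma fin_gen_principal: "e \<in> carrier A \<Longrightarrow> fin_gen A (principal_module A e)"
  by (rule noetherian_fin_gen[OF right_module_principal principal_noetherian])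

lemma principal_hom:
  assumes M: "right_module A M" and e: "e \<in> carrier A" and m: "m \<in> carrier M"
  shows "(\<lambda>x\<in>e <# carrier A. x \<odot>\<^bsub>M\<^esub> m) \<in> rmod_hom A (principal_module A e) M"
proof -
  interpret M: right_module A M by fact
  have c: "x \<in> e <# carrier A \<Longrightarrow> x \<in> carrier A" for x using e by (auto simp: mem_principal)
  show ?thesis
    using rmod_hom_restrictI[OF _ _ _ right_module_principal[OF e], of "\<lambda>x. x \<odot>\<^bsub>M\<^esub> m" M] m c
    by (simp add: M.smult_l_distr M.smult_assoc)
qed

text \<open>A map out of \<open>eA\<close> is determined by its value at \<open>e\<close>; any
  preimage of that value defines the lift, since \<open>x = ex\<close> for all \<open>x\<close> in
  \<open>eA\<close>.\<close>

lemma projective_principal: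
  assumes e: "e \<in> carrier A" "e \<otimes> e = e"
  shows "projective A (principal_module A e)"
proof (rule projectiveI[OF right_module_principal[OF e(1)]])
  fix M N :: "'a fg_module" and g f
  assume a: "right_module A M" "right_module A N" "fin_gen A M" "g \<in> rmod_hom A M N"
      "f \<in> rmod_hom A (principal_module A e) N" "g ` carrier M = carrier N"
  have ec: "e \<in> e <# carrier A" using e by (simp add: mem_principal_idempotent)
  then have "f e \<in> carrier N" using rmod_hom_closed[OF a(5), of e] by simp
  then obtain m where m: "m \<in> carrier M" "f e = g m" using a(6) by blast
  have "g (x \<odot>\<^bsub>M\<^esub> m) = f x" if x: "x \<in> e <# carrier A" for x
  proof -
    have xc: "x \<in> carrier A" "e \<otimes> x = x" using x e by (simp_all add: mem_principal_idempotent)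
    have "f (x \<odot>\<^bsub>principal_module A e\<^esub> e) = x \<odot>\<^bsub>N\<^esub> f e"
      by (rule rmod_hom_smult[OF a(5)]) (use xc ec in simp_all)
    then show ?thesis using rmod_hom_smult[OF a(4) xc(1) m(1)] xc m by simp
  qed
  then show "\<exists>h\<in>rmod_hom A (principal_module A e) M. \<forall>x\<in>carrier (principal_module A e). g (h x) = f x"
    by (intro bexI[OF _ principal_hom[OF a(1) e(1) m(1)]]) simp
qed

text \<open>A decomposition of \<open>eA\<close> into \<open>U\<close> and \<open>V\<close> gives
  \<open>e = u + v\<close> with orthogonal idempotents \<open>u\<close>, \<open>v\<close>.
  Primitivity makes one of them zero, and a summand containing \<open>e\<close> is all of
  \<open>eA\<close>.\<close>

lemma indecomposable_principal:
  assumes "primitive_idempotent A e"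
  shows "indecomposable A (principal_module A e)"
proof -
  have e: "e \<in> carrier A" "e \<otimes> e = e" "e \<noteq> \<zero>"
    and prim: "\<And>f g. f \<in> carrier A \<Longrightarrow> g \<in> carrier A \<Longrightarrow> f \<otimes> f = f \<Longrightarrow> g \<otimes> g = g \<Longrightarrow>
      f \<otimes> g = \<zero> \<Longrightarrow> g \<otimes> f = \<zero> \<Longrightarrow> e = f \<oplus> g \<Longrightarrow> f = \<zero> \<or> g = \<zero>"
    using assms by (auto simp: primitive_idempotent_def)
  have ec: "e \<in> e <# carrier A" using e by (simp add: mem_principal_idempotent)
  interpret P: right_module A "principal_module A e" by (rule right_module_principal) fact
  \<comment> \<open>Multiplying \<open>e = u + v\<close> by \<open>u\<close> from the right gives
    \<open>u = uu + vu\<close>. Hence \<open>vu = u - uu\<close> lies in both \<open>U\<close> and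
    \<open>V\<close> and vanishes.\<close>
  have half: "v \<otimes> u = \<zero> \<and> u \<otimes> u = u"
    if UV: "internal_sum A (principal_module A e) U V" "u \<in> U" "v \<in> V" "e = u \<oplus> v" for U V u v
  proof -
    note d = P.internal_sumD[OF UV(1)]
    have c: "u \<in> e <# carrier A" "v \<in> e <# carrier A" using d(5)[OF UV(2)] d(6)[OF UV(3)] by simp_all
    have uc: "u \<in> carrier A" "v \<in> carrier A" "e \<otimes> u = u" using c e by (simp_all add: mem_principal_idempotent)
    have eq: "u = u \<otimes> u \<oplus> v \<otimes> u" using UV(4) uc by (metis l_distr)
    have uu: "u \<otimes> u \<in> U" "v \<otimes> u \<in> V" using d(1,2) UV(2,3) uc by (auto simp: P.submodule_iff)
    have "v \<otimes> u = u \<ominus> u \<otimes> u"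
      using eq uc by (metis a_comm add_diff_cancel m_closed)
    moreover have "u \<ominus>\<^bsub>principal_module A e\<^esub> u \<otimes> u \<in> U" by (rule P.diff_mem_submodule[OF d(1) UV(2) uu(1)])
    \<comment> \<open>Negatives in the submodule record are formed relative to its smaller carrier,
      so its subtraction has to be identified with that of the ring.\<close>
    moreover have "u \<ominus>\<^bsub>principal_module A e\<^esub> u \<otimes> u = u \<ominus> u \<otimes> u"
    proof -
      have "u \<otimes> u \<in> e <# carrier A" using d(5)[OF uu(1)] by simp
      then have cc: "u \<ominus>\<^bsub>principal_module A e\<^esub> u \<otimes> u \<in> e <# carrier A" using P.M.minus_closed[of u "u \<otimes> u"] c by simp
      have "(u \<ominus>\<^bsub>principal_module A e\<^esub> u \<otimes> u) \<oplus> u \<otimes> u = u"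
        using P.M.diff_add_cancel[of u "u \<otimes> u"] c \<open>u \<otimes> u \<in> e <# carrier A\<close> by simp
      moreover have "u \<ominus>\<^bsub>principal_module A e\<^esub> u \<otimes> u \<in> carrier A" using cc e by (simp add: mem_principal_idempotent)
      ultimately show ?thesis using add_diff_cancel[of "u \<ominus>\<^bsub>principal_module A e\<^esub> u \<otimes> u" "u \<otimes> u"] uc by simp
    qed
    ultimately have "v \<otimes> u \<in> U" by simp
    then have "v \<otimes> u = \<zero>" using uu(2) d(3) by auto
    then show ?thesis using eq uc by simp
  qed
  have swap: "internal_sum A (principal_module A e) V U" if "internal_sum A (principal_module A e) U V" for U V
  proof (rule P.internal_sumI)
    note d = P.internal_sumD[OF that]
    show "submodule V A (principal_module A e)" "submodule U A (principal_module A e)" "V \<inter> U \<subseteq> {\<zero>\<^bsub>principal_module A e\<^esub>}"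
      using d(1-3) by auto
    fix x assume "x \<in> carrier (principal_module A e)"
    then obtain u v where uv: "u \<in> U" "v \<in> V" "x = u \<oplus>\<^bsub>principal_module A e\<^esub> v" using d(4) by blast
    then have "x = v \<oplus>\<^bsub>principal_module A e\<^esub> u" using P.M.a_comm[OF d(5)[OF uv(1)] d(6)[OF uv(2)]] by simp
    then show "\<exists>v\<in>V. \<exists>u\<in>U. x = v \<oplus>\<^bsub>principal_module A e\<^esub> u" using uv by blast
  qed
  have triv: "V = {\<zero>}" if UV: "internal_sum A (principal_module A e) U V" "e \<in> U" for U V
  proof -
    note d = P.internal_sumD[OF UV(1)]
    have "v \<in> U" if "v \<in> V" for v
    proof -
      have "v \<in> e <# carrier A" using d(6)[OF that] by simp
      then have v: "v \<in> carrier A" "e \<otimes> v = v" using e by (simp_all add: mem_principal_idempotent)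
      have "\<forall>a\<in>carrier A. \<forall>x\<in>U. a \<odot>\<^bsub>principal_module A e\<^esub> x \<in> U" using d(1) unfolding P.submodule_iff by (elim conjE)
      then have "v \<odot>\<^bsub>principal_module A e\<^esub> e \<in> U" using v(1) UV(2) by blast
      then show ?thesis using v by simp
    qed
    then show ?thesis using d(2,3) by (auto simp: P.submodule_iff)
  qed
  show ?thesis unfolding indecomposable_def
  proof (intro conjI allI impI)
    show "carrier (principal_module A e) \<noteq> {\<zero>\<^bsub>principal_module A e\<^esub>}" using ec e by auto
    fix U V assume UV: "internal_sum A (principal_module A e) U V"
    note d = P.internal_sumD[OF UV]
    obtain u v where uv: "u \<in> U" "v \<in> V" "e = u \<oplus> v" using d(4)[of e] ec by auto
    have c: "u \<in> e <# carrier A" "v \<in> e <# carrier A" using d(5)[OF uv(1)] d(6)[OF uv(2)] by simp_all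
    have uc: "u \<in> carrier A" "v \<in> carrier A" using c e by (simp_all add: mem_principal_idempotent)
    have "e = v \<oplus> u" using uv uc by (simp add: a_comm)
    then have "u = \<zero> \<or> v = \<zero>"
      using half[OF UV uv] half[OF swap[OF UV] uv(2,1)] prim uc uv by simp
    then consider "e = v" | "e = u" using uv uc by auto
    then show "U = {\<zero>\<^bsub>principal_module A e\<^esub>} \<or> V = {\<zero>\<^bsub>principal_module A e\<^esub>}"
      using triv[OF UV] triv[OF swap[OF UV]] uv by cases simp_all
  qed
qed

text \<open>Take \<open>N\<close> maximal and \<open>p\<close>, \<open>e\<close> with
  \<open>pe\<close> outside \<open>N\<close>. The image \<open>T\<close> of \<open>eA\<close> under
  the map \<open>x \<mapsto> px\<close> then satisfies \<open>T + N = P\<close>, and locality of the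
  endomorphisms of \<open>P\<close> forces \<open>T = P\<close>. The resulting epimorphism splits,
  and \<open>eA\<close> is indecomposable.\<close>

lemma indecomposable_projective_iso_principal:
  assumes E: "complete_primitive_idempotents A E"
    and P: "projective A P" "fin_gen A P" "indecomposable A P"
  shows "\<exists>e\<in>E. rmod_iso A P (principal_module A e)"
proof -
  have Ep: "finite E" "E \<subseteq> carrier A" "(\<Oplus>e\<in>E. e) = \<one>" "\<And>e. e \<in> E \<Longrightarrow> primitive_idempotent A e"
    using E by (auto simp: complete_primitive_idempotents_def orthogonal_idempotents_def)
  have Pm: "right_module A P" using P(1) by (rule projective_right_module)
  interpret P: right_module A P by fact
  have nz: "carrier P \<noteq> {\<zero>\<^bsub>P\<^esub>}" using P(3) by (simp add: indecomposable_def)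
  have art: "artinian_module A P" and noeth: "noetherian_module A P"
    using fin_gen_artinian fin_gen_noetherian Pm P(2) by blast+
  obtain N where N: "submodule N A P" "N \<noteq> carrier P"
      "\<forall>W. submodule W A P \<longrightarrow> N \<subset> W \<longrightarrow> \<not> W \<noteq> carrier P"
    using noetherian_maximal[where P = "\<lambda>U. U \<noteq> carrier P", OF noeth P.submodule_zero] nz by auto
  have Nc: "N \<subseteq> carrier P" using N(1) by (simp add: P.submodule_iff)
  then obtain p where p: "p \<in> carrier P" "p \<notin> N" using N(2) by blast
  obtain e where e: "e \<in> E" "e \<odot>\<^bsub>P\<^esub> p \<notin> N" using P.mem_if_components[OF Ep(1-3) N(1) p(1)] p(2) by blast
  have ec: "e \<in> carrier A" "e \<otimes> e = e" using Ep(4)[OF e(1)] by (auto simp: primitive_idempotent_def)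
  let ?f = "\<lambda>x\<in>e <# carrier A. x \<odot>\<^bsub>P\<^esub> p"
  have f: "?f \<in> rmod_hom A (principal_module A e) P" by (rule principal_hom[OF Pm ec(1) p(1)])
  define T where "T = ?f ` (e <# carrier A)"
  have T: "submodule T A P"
    using submodule_image[OF right_module_principal[OF ec(1)] Pm f
        right_module.submodule_carrier[OF right_module_principal[OF ec(1)]]] by (simp add: T_def)
  have eT: "e \<odot>\<^bsub>P\<^esub> p \<in> T"
  proof -
    have "e \<in> e <# carrier A" using ec by (simp add: mem_principal_idempotent)
    then show ?thesis unfolding T_def by (intro image_eqI[of _ _ e]) simp_all
  qed
  have TN: "T <+>\<^bsub>P\<^esub> N = carrier P"
  proof -
    have s: "submodule (T <+>\<^bsub>P\<^esub> N) A P" by (rule P.submodule_sum[OF T N(1)])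
    have T0: "\<zero>\<^bsub>P\<^esub> \<in> T" "\<zero>\<^bsub>P\<^esub> \<in> N" using T N(1) by (simp_all add: P.submodule_iff)
    have "N \<subseteq> T <+>\<^bsub>P\<^esub> N"
    proof
      fix n assume n: "n \<in> N"
      then have "n = \<zero>\<^bsub>P\<^esub> \<oplus>\<^bsub>P\<^esub> n" using Nc by auto
      then show "n \<in> T <+>\<^bsub>P\<^esub> N" using n T0 unfolding set_add_def' by blast
    qed
    moreover have "e \<odot>\<^bsub>P\<^esub> p \<in> T <+>\<^bsub>P\<^esub> N"
    proof -
      have "e \<odot>\<^bsub>P\<^esub> p = e \<odot>\<^bsub>P\<^esub> p \<oplus>\<^bsub>P\<^esub> \<zero>\<^bsub>P\<^esub>" using p ec by simp
      then show ?thesis using eT T0 unfolding set_add_def' by blast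
    qed
    ultimately have "N \<subset> T <+>\<^bsub>P\<^esub> N" using e(2) by blast
    then show ?thesis using N(3) s by blast
  qed
  have fgT: "fin_gen A (P\<lparr>carrier := T\<rparr>)" and fgN: "fin_gen A (P\<lparr>carrier := N\<rparr>)"
    by (rule fin_gen_submodule[OF Pm P(2)]; fact)+
  \<comment> \<open>The identity is \<open>t + n\<close> with \<open>n\<close> mapping into the
    proper submodule \<open>N\<close>. As \<open>n\<close> is not onto, \<open>t\<close> is, and the
    values of \<open>t\<close> lie in \<open>T\<close>.\<close>
  obtain t n where tn: "t \<in> rmod_hom A P (P\<lparr>carrier := T\<rparr>)" "n \<in> rmod_hom A P (P\<lparr>carrier := N\<rparr>)"
    "\<And>x. x \<in> carrier P \<Longrightarrow> t x \<oplus>\<^bsub>P\<^esub> n x = x"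
    by (rule projective_two_submodules[OF P(1) T fgT N(1) fgN TN]) (rule that)
  have Tc: "T \<subseteq> carrier P" using T by (simp add: P.submodule_iff)
  have t: "t \<in> rmod_hom A P P" and n: "n \<in> rmod_hom A P P"
    using rmod_hom_codom_extend[OF tn(1) Tc] rmod_hom_codom_extend[OF tn(2) Nc] by simp_all
  have nt: "n x \<oplus>\<^bsub>P\<^esub> t x = x" if "x \<in> carrier P" for x
    using tn(3)[OF that] rmod_hom_closed[OF t that] rmod_hom_closed[OF n that] by (simp add: P.M.a_comm)
  have "n ` carrier P \<subseteq> N" using rmod_hom_closed[OF tn(2)] by auto
  then have "n ` carrier P \<noteq> carrier P" using N(2) Nc by blast
  then have "t ` carrier P = carrier P" by (rule P.indecomposable_local[OF n t nt art noeth P(3), rotated])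
  moreover have "t ` carrier P \<subseteq> T" using rmod_hom_closed[OF tn(1)] by auto
  ultimately have "T = carrier P" using Tc by blast
  then have onto: "?f ` carrier (principal_module A e) = carrier P" by (simp add: T_def)
  obtain s where s: "s \<in> rmod_hom A P (principal_module A e)" "\<forall>x\<in>carrier P. ?f (s x) = (\<lambda>x\<in>carrier P. x) x"
    using projective_lift[OF P(1) right_module_principal[OF ec(1)] fin_gen_principal[OF ec(1)] Pm f onto rmod_hom_id[OF Pm]]
    by blast
  have "rmod_iso A (principal_module A e) P"
    by (rule split_epi_indecomposable[OF right_module_principal[OF ec(1)] indecomposable_principal[OF Ep(4)[OF e(1)]]
          Pm nz f s(1)]) (use s(2) in simp)
  then show ?thesis using e(1) rmod_iso_sym[OF _ right_module_principal[OF ec(1)] Pm] by blast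
qed

section \<open>The Jacobson radical\<close>

definition maximal_right_ideal :: "'a set \<Rightarrow> bool" where
  "maximal_right_ideal I \<longleftrightarrow> submodule I A (regular_module A) \<and> I \<noteq> carrier A \<and>
     (\<forall>H. submodule H A (regular_module A) \<and> I \<subseteq> H \<longrightarrow> H = I \<or> H = carrier A)"

abbreviation J where "J \<equiv> jacobson_radical A"

lemma J_iff: "x \<in> J \<longleftrightarrow> x \<in> carrier A \<and> (\<forall>I. maximal_right_ideal I \<longrightarrow> x \<in> I)"
  by (auto simp: jacobson_radical_def maximal_right_ideal_def)

lemma right_ideal_iff:
  "submodule I A (regular_module A) \<longleftrightarrow> I \<subseteq> carrier A \<and> \<zero> \<in> I \<and> (\<forall>x\<in>I. \<forall>y\<in>I. x \<oplus> y \<in> I) \<and>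
     (\<forall>a\<in>carrier A. \<forall>x\<in>I. x \<otimes> a \<in> I)"
  by (simp add: Reg.submodule_iff)

lemma right_ideal_J: "submodule J A (regular_module A)"
  unfolding right_ideal_iff by (auto simp: J_iff maximal_right_ideal_def right_ideal_iff)

lemmas J_right_ideal = right_ideal_J[unfolded right_ideal_iff]

lemma maximal_right_ideal_exists:
  assumes "submodule H A (regular_module A)" "H \<noteq> carrier A"
  shows "\<exists>I. maximal_right_ideal I \<and> H \<subseteq> I"
proof -
  obtain V where V: "submodule V A (regular_module A)" "H \<subseteq> V \<and> V \<noteq> carrier A"
    "\<forall>W. submodule W A (regular_module A) \<longrightarrow> V \<subset> W \<longrightarrow> \<not> (H \<subseteq> W \<and> W \<noteq> carrier A)"
    using noetherian_maximal[where P = "\<lambda>V. H \<subseteq> V \<and> V \<noteq> carrier A", OF regular_noetherian assms(1)] assms(2) by auto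
  have "maximal_right_ideal V" unfolding maximal_right_ideal_def
  proof (intro conjI allI impI)
    fix W assume W: "submodule W A (regular_module A) \<and> V \<subseteq> W"
    then show "W = V \<or> W = carrier A" using V by blast
  qed (use V in auto)
  then show ?thesis using V by blast
qed

lemma maximal_right_ideal_split:
  assumes I: "maximal_right_ideal I" and a: "a \<in> carrier A" "a \<notin> I"
  shows "\<exists>b\<in>carrier A. \<exists>i\<in>I. \<one> = i \<oplus> a \<otimes> b"
proof -
  have Is: "submodule I A (regular_module A)" using I by (simp add: maximal_right_ideal_def)
  have c: "a \<in> carrier (regular_module A)" using a by simp
  define W where "W = {w \<oplus>\<^bsub>regular_module A\<^esub> b \<odot>\<^bsub>regular_module A\<^esub> a |w b. w \<in> I \<and> b \<in> carrier A}"
  note W = Reg.adjoin_element(1-3)[OF Is c, folded W_def]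
  have "W = I \<or> W = carrier A"
    using I[unfolded maximal_right_ideal_def, THEN conjunct2, THEN conjunct2, THEN spec, THEN mp] W(1,2) by blast
  then have "\<one> \<in> W" using W(3) a(2) by (metis one_closed)
  then show ?thesis by (auto simp: W_def)
qed

text \<open>For \<open>a\<close> outside a maximal right ideal \<open>I\<close>, the right ideal of
  all \<open>x\<close> with \<open>ax \<in> I\<close> is maximal too, so it contains
  \<open>j\<close>.\<close>

lemma J_left_ideal:
  assumes a: "a \<in> carrier A" and j: "j \<in> J"
  shows "a \<otimes> j \<in> J"
  unfolding J_iff
proof (intro conjI allI impI)
  have jc: "j \<in> carrier A" using j by (simp add: J_iff)
  show "a \<otimes> j \<in> carrier A" using a jc by simp
  fix I assume I: "maximal_right_ideal I"
  have Is: "I \<subseteq> carrier A" "\<zero> \<in> I" "\<And>x y. x \<in> I \<Longrightarrow> y \<in> I \<Longrightarrow> x \<oplus> y \<in> I" "\<And>x b. b \<in> carrier A \<Longrightarrow> x \<in> I \<Longrightarrow> x \<otimes> b \<in> I"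
    using I by (auto simp: maximal_right_ideal_def right_ideal_iff)
  show "a \<otimes> j \<in> I"
  proof (cases "a \<in> I")
    case True then show ?thesis using Is jc by simp
  next
    case False
    let ?I = "{x \<in> carrier A. a \<otimes> x \<in> I}"
    have s: "submodule ?I A (regular_module A)"
      unfolding right_ideal_iff using Is a by (auto simp: r_distr m_assoc[symmetric])
    have "maximal_right_ideal ?I" unfolding maximal_right_ideal_def
    proof (intro conjI allI impI s)
      show "?I \<noteq> carrier A"
      proof
        assume "?I = carrier A"
        then have "\<one> \<in> ?I" by simp
        then show False using False a by simp
      qed
      fix H assume H: "submodule H A (regular_module A) \<and> ?I \<subseteq> H"
      then have Hs: "H \<subseteq> carrier A" "\<And>x y. x \<in> H \<Longrightarrow> y \<in> H \<Longrightarrow> x \<oplus> y \<in> H" "\<And>x b. b \<in> carrier A \<Longrightarrow> x \<in> H \<Longrightarrow> x \<otimes> b \<in> H"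
        by (auto simp: right_ideal_iff)
      show "H = ?I \<or> H = carrier A"
      proof (cases "H \<subseteq> ?I")
        case True then show ?thesis using H by blast
      next
        case False
        then obtain h where h: "h \<in> H" "a \<otimes> h \<notin> I" using Hs(1) by blast
        have hc: "h \<in> carrier A" using h Hs by auto
        obtain b i where bi: "b \<in> carrier A" "i \<in> I" "\<one> = i \<oplus> a \<otimes> h \<otimes> b"
          using maximal_right_ideal_split[OF I, of "a \<otimes> h"] a hc h by auto
        have ic: "i \<in> carrier A" using bi Is by auto
        \<comment> \<open>Multiplying \<open>1 = i + ahb\<close> by \<open>a\<close> from the right
          yields \<open>a(1 - hba) = ia \<in> I\<close>. So \<open>1 - hba\<close> lies in
          \<open>?I\<close> and thus in \<open>H\<close>, and \<open>H\<close> contains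
          \<open>hba\<close>, hence 1.\<close>
        have "a = i \<otimes> a \<oplus> a \<otimes> (h \<otimes> (b \<otimes> a))"
        proof -
          have "a = (i \<oplus> a \<otimes> h \<otimes> b) \<otimes> a" using bi(3)[symmetric] a by simp
          then show ?thesis using a bi(1) hc ic by (simp add: l_distr m_assoc)
        qed
        moreover have "a \<otimes> (\<one> \<ominus> h \<otimes> (b \<otimes> a)) = a \<ominus> a \<otimes> (h \<otimes> (b \<otimes> a))"
          using a hc bi(1) by (simp add: a_minus_def r_distr r_minus)
        ultimately have "a \<otimes> (\<one> \<ominus> h \<otimes> (b \<otimes> a)) = i \<otimes> a"
          using add_diff_cancel[of "i \<otimes> a" "a \<otimes> (h \<otimes> (b \<otimes> a))"] a hc bi(1) ic by simp
        then have "\<one> \<ominus> h \<otimes> (b \<otimes> a) \<in> ?I" using Is(4)[OF a bi(2)] a hc bi(1) by simp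
        then have "\<one> \<ominus> h \<otimes> (b \<otimes> a) \<in> H" using H by blast
        then have "(\<one> \<ominus> h \<otimes> (b \<otimes> a)) \<oplus> h \<otimes> (b \<otimes> a) \<in> H" using Hs(2,3) h(1) a bi(1) by simp
        then have "\<one> \<in> H" using diff_add_cancel[of \<one> "h \<otimes> (b \<otimes> a)"] hc bi(1) a by simp
        then have "x \<in> H" if "x \<in> carrier A" for x using Hs(3)[OF that, of \<one>] that by simp
        then show ?thesis using Hs(1) by blast
      qed
    qed
    then show ?thesis using j by (auto simp: J_iff)
  qed
qed

text \<open>Otherwise \<open>(1 - j)A\<close> lies in a maximal right ideal, which also contains
  \<open>j\<close> and therefore 1.\<close>

lemma one_minus_J:
  assumes "j \<in> J"
  shows "\<exists>b\<in>carrier A. (\<one> \<ominus> j) \<otimes> b = \<one>"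
proof (rule ccontr)
  assume n: "\<not> ?thesis"
  have jc: "j \<in> carrier A" using assms by (simp add: J_iff)
  have "\<one> \<notin> (\<one> \<ominus> j) <# carrier A"
  proof
    assume "\<one> \<in> (\<one> \<ominus> j) <# carrier A"
    then show False using n unfolding mem_principal by metis
  qed
  then have "(\<one> \<ominus> j) <# carrier A \<noteq> carrier A" using one_closed by metis
  then obtain I where I: "maximal_right_ideal I" "(\<one> \<ominus> j) <# carrier A \<subseteq> I"
    using maximal_right_ideal_exists submodule_principal jc minus_closed one_closed by meson
  have "\<one> \<ominus> j \<in> (\<one> \<ominus> j) <# carrier A" unfolding mem_principal by (rule bexI[of _ \<one>]) (use jc in simp_all)
  then have a: "\<one> \<ominus> j \<in> I" using I by blast
  have Is: "I \<subseteq> carrier A" "\<And>x y. x \<in> I \<Longrightarrow> y \<in> I \<Longrightarrow> x \<oplus> y \<in> I" "\<And>x b. b \<in> carrier A \<Longrightarrow> x \<in> I \<Longrightarrow> x \<otimes> b \<in> I" "I \<noteq> carrier A"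
    using I by (auto simp: maximal_right_ideal_def right_ideal_iff)
  have "j \<in> I" using assms I by (simp add: J_iff)
  then have "(\<one> \<ominus> j) \<oplus> j \<in> I" using a Is by blast
  then have "\<one> \<in> I" using diff_add_cancel[of \<one> j] jc by simp
  then have "x \<in> I" if "x \<in> carrier A" for x using Is(3)[OF that, of \<one>] that by simp
  then show False using Is by blast
qed

section \<open>Powers of the radical and nilpotency\<close>

primrec Jpow :: "nat \<Rightarrow> 'a set" where
  "Jpow 0 = carrier A"
| "Jpow (Suc n) = J \<cdot>\<^bsub>A\<^esub> Jpow n"

lemma right_ideal_prod:
  assumes U: "submodule U A (regular_module A)" and V: "submodule V A (regular_module A)"
  shows "submodule (U \<cdot>\<^bsub>A\<^esub> V) A (regular_module A)"
proof -
  have Us: "U \<subseteq> carrier A" "\<zero> \<in> U" and Vs: "V \<subseteq> carrier A" "\<zero> \<in> V" "\<And>x b. b \<in> carrier A \<Longrightarrow> x \<in> V \<Longrightarrow> x \<otimes> b \<in> V"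
    using U V by (auto simp: right_ideal_iff)
  have c: "x \<in> carrier A" if "x \<in> U \<cdot>\<^bsub>A\<^esub> V" for x
    using that by induction (use Us Vs in auto)
  have m: "x \<otimes> a \<in> U \<cdot>\<^bsub>A\<^esub> V" if "x \<in> U \<cdot>\<^bsub>A\<^esub> V" and a: "a \<in> carrier A" for x a
    using that(1)
  proof induction
    case (prod i j)
    have "i \<otimes> (j \<otimes> a) \<in> U \<cdot>\<^bsub>A\<^esub> V" using prod Vs(3)[OF a] by (intro ideal_prod.prod)
    then show ?case using prod Us Vs a by (simp add: m_assoc subset_iff)
  next
    case (sum s1 s2)
    then show ?case using c a by (simp add: l_distr ideal_prod.sum)
  qed
  have "\<zero> \<otimes> \<zero> \<in> U \<cdot>\<^bsub>A\<^esub> V" using Us Vs by (intro ideal_prod.prod)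
  then show ?thesis unfolding right_ideal_iff using c m ideal_prod.sum[of _ A U V] by auto
qed

lemma right_ideal_Jpow: "submodule (Jpow n) A (regular_module A)"
proof (induction n)
  case 0
  show ?case using Reg.submodule_carrier by simp
qed (simp add: right_ideal_prod right_ideal_J)

lemma Jpow_right_ideal:
  "x \<in> Jpow n \<Longrightarrow> x \<in> carrier A" "\<zero> \<in> Jpow n" "x \<in> Jpow n \<Longrightarrow> y \<in> Jpow n \<Longrightarrow> x \<oplus> y \<in> Jpow n"
  "a \<in> carrier A \<Longrightarrow> x \<in> Jpow n \<Longrightarrow> x \<otimes> a \<in> Jpow n"
  using right_ideal_Jpow[of n] by (auto simp: right_ideal_iff)

lemma J_carrier: "j \<in> J \<Longrightarrow> j \<in> carrier A"
  by (simp add: J_iff)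

text \<open>\<open>Jpow\<close> adds factors on the left, so a factor on the right takes an
  induction; its base case is where the left ideal property of \<open>J\<close> enters.\<close>

lemma Jpow_mult: "x \<in> Jpow n \<Longrightarrow> j \<in> J \<Longrightarrow> x \<otimes> j \<in> Jpow (Suc n)"
proof (induction n arbitrary: x)
  case 0
  have "x \<otimes> j \<in> J" using 0 J_left_ideal by simp
  then have "(x \<otimes> j) \<otimes> \<one> \<in> J \<cdot>\<^bsub>A\<^esub> carrier A" by (intro ideal_prod.prod) simp_all
  then show ?case using 0 J_carrier by simp
next
  case (Suc n)
  have jc: "j \<in> carrier A" using Suc.prems J_carrier by simp
  from Suc.prems(1) have "x \<in> J \<cdot>\<^bsub>A\<^esub> Jpow n" by simp
  then show ?case
  proof induction
    case (prod i s)
    have "i \<otimes> (s \<otimes> j) \<in> Jpow (Suc (Suc n))"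
      using ideal_prod.prod[OF prod(1) Suc.IH[OF prod(2) Suc.prems(2)]] by simp
    then show ?case using prod J_carrier Jpow_right_ideal(1) jc by (simp add: m_assoc)
  next
    case (sum s1 s2)
    have "s1 \<in> carrier A" "s2 \<in> carrier A" using sum(1,2) Jpow_right_ideal(1)[of _ "Suc n"] by simp_all
    then show ?case using sum jc Jpow_right_ideal(3)[of _ "Suc (Suc n)"] by (simp add: l_distr)
  qed
qed

lemma Jpow_add: "x \<in> Jpow (m + n) \<Longrightarrow> x \<in> Jpow m \<cdot>\<^bsub>A\<^esub> Jpow n"
proof (induction m arbitrary: x)
  case 0
  have "\<one> \<otimes> x \<in> carrier A \<cdot>\<^bsub>A\<^esub> Jpow n" using 0 by (intro ideal_prod.prod) simp_all
  then show ?case using 0 Jpow_right_ideal(1) by simp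
next
  case (Suc m)
  from Suc.prems have "x \<in> J \<cdot>\<^bsub>A\<^esub> Jpow (m + n)" by simp
  then show ?case
  proof induction
    case (prod j s)
    have jc: "j \<in> carrier A" using prod J_carrier by simp
    have "s \<in> Jpow m \<cdot>\<^bsub>A\<^esub> Jpow n" using prod Suc.IH by simp
    then have "s \<in> carrier A \<and> j \<otimes> s \<in> Jpow (Suc m) \<cdot>\<^bsub>A\<^esub> Jpow n"
    proof induction
      case (prod p q)
      have c: "p \<in> carrier A" "q \<in> carrier A" using prod Jpow_right_ideal(1) by simp_all
      have "j \<otimes> p \<in> Jpow (Suc m)" using ideal_prod.prod[OF \<open>j \<in> J\<close> prod(1)] by simp
      then have "(j \<otimes> p) \<otimes> q \<in> Jpow (Suc m) \<cdot>\<^bsub>A\<^esub> Jpow n" using prod(2) by (rule ideal_prod.prod)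
      then show ?case using c jc by (simp add: m_assoc)
    next
      case (sum s1 s2)
      then show ?case using jc by (simp add: r_distr ideal_prod.sum)
    qed
    then show ?case by simp
  next
    case (sum s1 s2)
    then show ?case by (intro ideal_prod.sum)
  qed
qed

lemma Jpow_antimono: "Jpow (Suc n) \<subseteq> Jpow n"
proof (induction n)
  case 0
  show ?case using Jpow_right_ideal(1)[of _ "Suc 0"] by auto
next
  case (Suc n)
  show ?case
  proof
    fix x assume "x \<in> Jpow (Suc (Suc n))"
    then have "x \<in> J \<cdot>\<^bsub>A\<^esub> Jpow (Suc n)" by simp
    then have "x \<in> J \<cdot>\<^bsub>A\<^esub> Jpow n"
    proof induction
      case (prod i s)
      then show ?case using Suc.IH by (intro ideal_prod.prod) auto
    qed (rule ideal_prod.sum)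
    then show "x \<in> Jpow (Suc n)" by simp
  qed
qed

text \<open>If the stable power \<open>I\<close> were non-zero, a minimal right ideal
  \<open>X\<close> with \<open>XI \<noteq> 0\<close> would equal \<open>xI\<close>, because
  \<open>xI\<close> is not killed by \<open>I\<close> either. Then \<open>x = xi\<close> with
  \<open>i \<in> J\<close>, and the right inverse of \<open>1 - i\<close> gives
  \<open>x = 0\<close>.\<close>

lemma J_nilpotent: "\<exists>n. Jpow n = {\<zero>}"
proof (rule ccontr)
  assume nn: "\<not> ?thesis"
  obtain m0 where "\<forall>n\<ge>m0. Jpow n = Jpow m0"
    using artinian_chain_stable[where U = Jpow, OF regular_artinian right_ideal_Jpow Jpow_antimono] by blast
  \<comment> \<open>The successor ensures \<open>I \<subseteq> J\<close>, on which the invertibility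
    of \<open>1 - i\<close> below relies.\<close>
  define m where "m = Suc m0"
  define I where "I = Jpow m"
  have stable: "Jpow (m + m) = I"
    using \<open>\<forall>n\<ge>m0. Jpow n = Jpow m0\<close>[THEN spec, of "m + m"] \<open>\<forall>n\<ge>m0. Jpow n = Jpow m0\<close>[THEN spec, of m]
    by (simp add: m_def I_def)
  have IJ: "I \<subseteq> J"
  proof
    fix x assume "x \<in> I"
    then have "x \<in> J \<cdot>\<^bsub>A\<^esub> Jpow m0" by (simp add: I_def m_def)
    then show "x \<in> J"
      by induction (use J_right_ideal Jpow_right_ideal(1) in auto)
  qed
  have Is: "x \<in> I \<Longrightarrow> x \<in> carrier A" "\<zero> \<in> I" "x \<in> I \<Longrightarrow> y \<in> I \<Longrightarrow> x \<oplus> y \<in> I" "a \<in> carrier A \<Longrightarrow> x \<in> I \<Longrightarrow> x \<otimes> a \<in> I" for x y a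
    by (simp_all add: I_def Jpow_right_ideal)
  have "I \<noteq> {\<zero>}" using nn by (auto simp: I_def)
  define P where "P X \<longleftrightarrow> (\<exists>x\<in>X. \<exists>i\<in>I. x \<otimes> i \<noteq> \<zero>)" for X
  have "P (carrier A)"
  proof -
    obtain i where "i \<in> I" "i \<noteq> \<zero>" using \<open>I \<noteq> {\<zero>}\<close> Is(2) by auto
    then show ?thesis unfolding P_def using Is(1) by (intro bexI[of _ \<one>] bexI[of _ i]) auto
  qed
  then obtain X where X: "submodule X A (regular_module A)" "P X"
    "\<forall>Y. submodule Y A (regular_module A) \<longrightarrow> Y \<subset> X \<longrightarrow> \<not> P Y"
    using artinian_minimal[where P = P, OF regular_artinian Reg.submodule_carrier] by auto
  obtain x i0 where x: "x \<in> X" "i0 \<in> I" "x \<otimes> i0 \<noteq> \<zero>" using X(2) by (auto simp: P_def)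
  have Xs: "X \<subseteq> carrier A" "\<And>x b. b \<in> carrier A \<Longrightarrow> x \<in> X \<Longrightarrow> x \<otimes> b \<in> X" using X(1) by (auto simp: right_ideal_iff)
  have xc: "x \<in> carrier A" using x Xs by auto
  define Y where "Y = {x \<otimes> i |i. i \<in> I}"
  have Y: "submodule Y A (regular_module A)" unfolding right_ideal_iff
  proof (intro conjI ballI)
    show "Y \<subseteq> carrier A" using xc Is(1) by (auto simp: Y_def)
    show "\<zero> \<in> Y" unfolding Y_def using xc Is(2) by (auto intro!: exI[of _ \<zero>])
    fix y assume "y \<in> Y"
    then obtain i where i: "i \<in> I" "y = x \<otimes> i" by (auto simp: Y_def)
    show "y \<otimes> a \<in> Y" if "a \<in> carrier A" for a
      unfolding Y_def using i that xc Is(1,4) by (auto simp: m_assoc intro!: exI[of _ "i \<otimes> a"])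
    fix z assume "z \<in> Y"
    then obtain k where k: "k \<in> I" "z = x \<otimes> k" by (auto simp: Y_def)
    show "y \<oplus> z \<in> Y"
      unfolding Y_def using i k xc Is(1,3) by (auto simp: r_distr intro!: exI[of _ "i \<oplus> k"])
  qed
  \<comment> \<open>Stability makes \<open>i0\<close> a sum of products of two elements of
    \<open>I\<close>, so \<open>x i0 \<noteq> 0\<close> rules out that \<open>xI\<close> is
    annihilated by \<open>I\<close>.\<close>
  have "P Y"
  proof (rule ccontr)
    assume "\<not> P Y"
    then have z: "x \<otimes> i \<otimes> k = \<zero>" if "i \<in> I" "k \<in> I" for i k using that by (auto simp: P_def Y_def)
    have "i0 \<in> I \<cdot>\<^bsub>A\<^esub> I" using Jpow_add[of i0 m m] x(2) stable by (simp add: I_def)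
    then have "i0 \<in> carrier A \<and> x \<otimes> i0 = \<zero>"
    proof induction
      case (prod i k)
      then show ?case using z Is(1) xc by (simp add: m_assoc)
    next
      case (sum s t)
      then show ?case using xc by (simp add: r_distr)
    qed
    then show False using x by simp
  qed
  moreover have "Y \<subseteq> X" using Xs(2) x(1) Is(1) by (auto simp: Y_def)
  ultimately have "Y = X" using X(3) Y by blast
  then obtain i where i: "i \<in> I" "x = x \<otimes> i" using x(1) by (auto simp: Y_def)
  obtain b where b: "b \<in> carrier A" "(\<one> \<ominus> i) \<otimes> b = \<one>" using one_minus_J i(1) IJ by blast
  have ic: "i \<in> carrier A" using i Is(1) by simp
  have "x \<otimes> (\<one> \<ominus> i) = x \<ominus> x \<otimes> i" using xc ic by (simp add: a_minus_def r_distr r_minus)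
  also have "\<dots> = \<zero>" using i(2)[symmetric] xc by (simp add: a_minus_def r_neg)
  finally have "x \<otimes> (\<one> \<ominus> i) \<otimes> b = \<zero>" using b(1) by simp
  then have "x \<otimes> ((\<one> \<ominus> i) \<otimes> b) = \<zero>" using xc ic b(1) by (simp add: m_assoc)
  then have "x = \<zero>" using b(2) xc by simp
  then show False using x Is(1) by simp
qed

text \<open>
  Inserting \<open>\<Sum>w = 1\<close> between the factors of an element of \<open>yJ\<^sup>2z\<close> splits it along the vertices \<open>w\<close>.
  If there is no path from \<open>y\<close> to \<open>z\<close>, then for each \<open>w\<close> one of the two halves is missing a path too.
\<close>

lemma no_path_radical:
  assumes E: "complete_primitive_idempotents A E" and yz: "y \<in> E" "z \<in> E"
    and no: "(y, z) \<notin> (valued_quiver A E)\<^sup>+" and j: "j \<in> J"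
  shows "y \<otimes> j \<otimes> z = \<zero>"
proof -
  have Ep: "finite E" "E \<subseteq> carrier A" "(\<Oplus>e\<in>E. e) = \<one>" "\<And>e. e \<in> E \<Longrightarrow> e \<otimes> e = e"
    using E by (auto simp: complete_primitive_idempotents_def orthogonal_idempotents_def)
  let ?Q = "valued_quiver A E"
  \<comment> \<open>The vanishing is proved as membership in every power of the radical, by
    induction on the exponent for all pairs without a path; nilpotency finishes the
    argument.\<close>
  have "y \<otimes> j \<otimes> z \<in> Jpow k" if "y \<in> E" "z \<in> E" "(y, z) \<notin> ?Q\<^sup>+" "j \<in> J" for y z j k
    using that
  proof (induction k arbitrary: y z j)
    case 0
    then show ?case using Ep(2) J_carrier by auto
  next
    case (Suc k)
    have yzc: "y \<in> carrier A" "z \<in> carrier A" using Suc.prems Ep(2) by auto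
    have "(y, z) \<notin> ?Q" using Suc.prems(3) by blast
    \<comment> \<open>Without an arrow the sets \<open>yJz\<close> and \<open>yJJz\<close> coincide,
      so \<open>j\<close> may be replaced by a sum of products of two radical elements.\<close>
    then have "(\<lambda>j. y \<otimes> j \<otimes> z) ` J = (\<lambda>j. y \<otimes> j \<otimes> z) ` (J \<cdot>\<^bsub>A\<^esub> J)"
      using Suc.prems(1,2) by (simp add: valued_quiver_def Let_def)
    then obtain s where s: "s \<in> J \<cdot>\<^bsub>A\<^esub> J" "y \<otimes> j \<otimes> z = y \<otimes> s \<otimes> z" using Suc.prems(4) by blast
    from s(1) have "s \<in> carrier A \<and> y \<otimes> s \<otimes> z \<in> Jpow (Suc k)"
    proof induction
      case (prod a b)
      have c: "a \<in> carrier A" "b \<in> carrier A" using prod J_carrier by simp_all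
      let ?R = "{w \<in> carrier A. y \<otimes> a \<otimes> w \<otimes> (b \<otimes> z) \<in> Jpow (Suc k)}"
      have "(\<Oplus>w\<in>E. w) \<in> ?R"
      proof (rule finsum_mem[OF Ep(1)])
        show "\<zero> \<in> ?R" using c yzc Jpow_right_ideal(2)[of "Suc k"] by simp
        show "?R \<subseteq> carrier A" by blast
        show "u \<oplus> v \<in> ?R" if "u \<in> ?R" "v \<in> ?R" for u v
          using that c yzc Jpow_right_ideal(3)[of _ "Suc k"] by (simp add: l_distr r_distr)
        fix w assume w: "w \<in> E"
        have wc: "w \<in> carrier A" using w Ep(2) by auto
        show "w \<in> ?R"
        proof (cases "(y, w) \<in> ?Q\<^sup>+")
          case False
          have "y \<otimes> a \<otimes> w \<in> Jpow k" using Suc.IH[OF Suc.prems(1) w False] prod by simp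
          moreover have "b \<otimes> z \<in> J" using prod J_right_ideal yzc by simp
          ultimately have "y \<otimes> a \<otimes> w \<otimes> (b \<otimes> z) \<in> Jpow (Suc k)" by (rule Jpow_mult)
          then show ?thesis using wc by simp
        next
          case True
          then have "(w, z) \<notin> ?Q\<^sup>+" using Suc.prems(3) by (meson trancl_trans)
          then have "w \<otimes> b \<otimes> z \<in> Jpow k" using Suc.IH[OF w Suc.prems(2)] prod by simp
          moreover have "y \<otimes> a \<in> J" using prod J_left_ideal yzc by simp
          ultimately have "(y \<otimes> a) \<otimes> (w \<otimes> b \<otimes> z) \<in> Jpow (Suc k)" by (simp add: ideal_prod.prod)
          moreover have "(y \<otimes> a) \<otimes> (w \<otimes> b \<otimes> z) = y \<otimes> a \<otimes> w \<otimes> (b \<otimes> z)" using wc c yzc by (simp add: m_assoc)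
          ultimately show ?thesis using wc by simp
        qed
      qed
      then have "y \<otimes> a \<otimes> (b \<otimes> z) \<in> Jpow (Suc k)" using Ep(3) c yzc by simp
      moreover have "y \<otimes> (a \<otimes> b) \<otimes> z = y \<otimes> a \<otimes> (b \<otimes> z)" using c yzc by (simp add: m_assoc)
      ultimately show ?case using c by simp
    next
      case (sum s t)
      then show ?case using yzc Jpow_right_ideal(3)[of _ "Suc k"] by (simp add: r_distr l_distr)
    qed
    then show ?case using s(2) by simp
  qed
  then show ?thesis using J_nilpotent yz no j by (metis singletonD)
qed

text \<open>If \<open>a\<close> avoided a maximal right ideal \<open>I\<close>, then
  \<open>1 = i + ab\<close> and \<open>e = abe + ie\<close> with \<open>i \<in> I\<close>. Left
  multiplication by \<open>abe\<close> is not onto \<open>eA\<close>, so by locality left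
  multiplication by \<open>ie\<close> is, which puts \<open>e\<close> and then \<open>a = ea\<close>
  into \<open>I\<close>.\<close>

lemma nongenerator_in_J:
  assumes e: "primitive_idempotent A e" and a: "a \<in> e <# carrier A" and p: "e \<notin> a <# carrier A"
  shows "a \<in> J"
  unfolding J_iff
proof (intro conjI allI impI)
  have ep: "e \<in> carrier A" "e \<otimes> e = e" using e by (auto simp: primitive_idempotent_def)
  show ac: "a \<in> carrier A" using a ep by (simp add: mem_principal_idempotent)
  have ea: "e \<otimes> a = a" using a ep by (simp add: mem_principal_idempotent)
  fix I assume I: "maximal_right_ideal I"
  have Is: "I \<subseteq> carrier A" "\<And>x b. b \<in> carrier A \<Longrightarrow> x \<in> I \<Longrightarrow> x \<otimes> b \<in> I"
    using I by (auto simp: maximal_right_ideal_def right_ideal_iff)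
  show "a \<in> I"
  proof (rule ccontr)
    assume "a \<notin> I"
    then obtain b i where bi: "b \<in> carrier A" "i \<in> I" "\<one> = i \<oplus> a \<otimes> b"
      using maximal_right_ideal_split[OF I ac] by blast
    have ic: "i \<in> carrier A" using bi Is by auto
    interpret P: right_module A "principal_module A e" by (rule right_module_principal) fact
    define c where "c = a \<otimes> b \<otimes> e"
    define d where "d = i \<otimes> e"
    have cd: "e = d \<oplus> c"
    proof -
      have "e = (i \<oplus> a \<otimes> b) \<otimes> e" using bi(3)[symmetric] ep by simp
      then show ?thesis using ic ac bi(1) ep by (simp add: l_distr c_def d_def)
    qed
    have cc: "c \<in> carrier A" "d \<in> carrier A" using ac ic bi ep by (simp_all add: c_def d_def)
    have ec: "e \<otimes> c = c" using ea ac bi(1) ep by (simp add: c_def m_assoc[symmetric])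
    have ed: "e \<otimes> d = d"
    proof -
      have "d = e \<ominus> c" using cd cc add_diff_cancel by metis
      then show ?thesis using ec ep cc by (simp add: a_minus_def r_distr r_minus)
    qed
    have hom: "(\<lambda>x\<in>e <# carrier A. r \<otimes> x) \<in> rmod_hom A (principal_module A e) (principal_module A e)"
      if r: "r \<in> carrier A" "e \<otimes> r = r" for r
      using rmod_hom_restrictI[OF _ _ _ P.right_module_axioms, of "\<lambda>x. r \<otimes> x" "principal_module A e"] r ep
      by (simp add: mem_principal_idempotent r_distr m_assoc[symmetric])
    let ?t = "\<lambda>x\<in>e <# carrier A. c \<otimes> x" and ?u = "\<lambda>x\<in>e <# carrier A. d \<otimes> x"
    have t: "?t \<in> rmod_hom A (principal_module A e) (principal_module A e)" by (rule hom[OF cc(1) ec])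
    have u: "?u \<in> rmod_hom A (principal_module A e) (principal_module A e)" by (rule hom[OF cc(2) ed])
    have eP: "e \<in> e <# carrier A" using ep by (simp add: mem_principal_idempotent)
    have "?u ` carrier (principal_module A e) = carrier (principal_module A e)"
    proof (rule P.indecomposable_local[OF t u _ principal_artinian[OF ep(1)] principal_noetherian[OF ep(1)]
          indecomposable_principal[OF e]])
      fix x assume "x \<in> carrier (principal_module A e)"
      then have x: "x \<in> e <# carrier A" "x \<in> carrier A" "e \<otimes> x = x" using ep by (simp_all add: mem_principal_idempotent)
      have "c \<otimes> x \<oplus> d \<otimes> x = (d \<oplus> c) \<otimes> x" using x cc by (simp add: l_distr a_comm)
      then show "?t x \<oplus>\<^bsub>principal_module A e\<^esub> ?u x = x" using x cd by simp
    next
      show "?t ` carrier (principal_module A e) \<noteq> carrier (principal_module A e)"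
      proof
        assume "?t ` carrier (principal_module A e) = carrier (principal_module A e)"
        then have "e \<in> ?t ` (e <# carrier A)" using eP by simp
        then obtain x where x: "x \<in> e <# carrier A" "e = c \<otimes> x" by auto
        have "x \<in> carrier A" using x ep by (simp add: mem_principal_idempotent)
        then have "e = a \<otimes> (b \<otimes> e \<otimes> x)" using x(2) ac bi(1) ep by (simp add: c_def m_assoc)
        then show False using p \<open>x \<in> carrier A\<close> bi(1) ep unfolding mem_principal by blast
      qed
    qed
    then have "e \<in> ?u ` (e <# carrier A)" using eP by simp
    then obtain x where x: "x \<in> e <# carrier A" "e = d \<otimes> x" by auto
    have xc: "x \<in> carrier A" using x ep by (simp add: mem_principal_idempotent)
    have "d \<in> I" unfolding d_def by (rule Is(2)[OF ep(1) bi(2)])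
    then have "e \<in> I" using Is(2)[OF xc] x(2) by metis
    then have "a \<in> I" using Is(2)[OF ac] ea by metis
    then show False using \<open>a \<notin> I\<close> by simp
  qed
qed

end

section \<open>The additive closure of the left part\<close>

lemma mod_catD: "M \<in> mod_cat A \<Longrightarrow> right_module A M" "M \<in> mod_cat A \<Longrightarrow> fin_gen A M"
  by (simp_all add: mod_cat_def)

text \<open>Factoring through a surjection plays the part of the universal property of a quotient
  module. The map is defined by choosing preimages, and the kernel condition makes its values
  independent of the choice.\<close>

lemma hom_factor:
  assumes D: "right_module A D" and X: "right_module A X" and N: "right_module A N"
    and c: "c \<in> rmod_hom A D N" "c ` carrier D = carrier N" and f: "f \<in> rmod_hom A D X"
    and ker: "\<And>x. x \<in> carrier D \<Longrightarrow> c x = \<zero>\<^bsub>N\<^esub> \<Longrightarrow> f x = \<zero>\<^bsub>X\<^esub>"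
  obtains g where "g \<in> rmod_hom A N X" "\<And>x. x \<in> carrier D \<Longrightarrow> g (c x) = f x"
proof -
  interpret D: right_module A D by fact
  interpret X: right_module A X by fact
  interpret N: right_module A N by fact
  define s where "s = inv_into (carrier D) c"
  have s: "s y \<in> carrier D" "c (s y) = y" if "y \<in> carrier N" for y
    using that c(2) by (auto simp: s_def inv_into_into f_inv_into_f)
  have w: "f x = f x'" if x: "x \<in> carrier D" "x' \<in> carrier D" "c x = c x'" for x x'
  proof -
    have "c (x \<ominus>\<^bsub>D\<^esub> x') = \<zero>\<^bsub>N\<^esub>"
      using rmod_hom_diff[OF D N c(1) x(1,2)] x(3) rmod_hom_closed[OF c(1) x(2)] by (simp add: a_minus_def N.M.r_neg)
    then have "f (x \<ominus>\<^bsub>D\<^esub> x') = \<zero>\<^bsub>X\<^esub>" using ker x D.M.minus_closed by blast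
    then have "f x \<ominus>\<^bsub>X\<^esub> f x' = \<zero>\<^bsub>X\<^esub>" using rmod_hom_diff[OF D X f x(1,2)] by simp
    then show ?thesis using X.M.diff_eq_zero rmod_hom_closed[OF f] x(1,2) by blast
  qed
  have "restrict (\<lambda>y. f (s y)) (carrier N) \<in> rmod_hom A N X"
  proof (rule rmod_hom_restrictI[OF _ _ _ N])
    show "f (s y) \<in> carrier X" if "y \<in> carrier N" for y using s(1)[OF that] by (rule rmod_hom_closed[OF f])
    show "f (s (y \<oplus>\<^bsub>N\<^esub> z)) = f (s y) \<oplus>\<^bsub>X\<^esub> f (s z)" if "y \<in> carrier N" "z \<in> carrier N" for y z
    proof -
      have "f (s (y \<oplus>\<^bsub>N\<^esub> z)) = f (s y \<oplus>\<^bsub>D\<^esub> s z)"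
        by (rule w) (use that s rmod_hom_add[OF c(1)] in simp_all)
      then show ?thesis using that s by (simp add: rmod_hom_add[OF f])
    qed
    show "f (s (a \<odot>\<^bsub>N\<^esub> y)) = a \<odot>\<^bsub>X\<^esub> f (s y)" if "a \<in> carrier A" "y \<in> carrier N" for a y
    proof -
      have "f (s (a \<odot>\<^bsub>N\<^esub> y)) = f (a \<odot>\<^bsub>D\<^esub> s y)"
        by (rule w) (use that s rmod_hom_smult[OF c(1)] in simp_all)
      then show ?thesis using that s by (simp add: rmod_hom_smult[OF f])
    qed
  qed
  then show thesis
  proof (rule that)
    fix x assume x: "x \<in> carrier D"
    have cx: "c x \<in> carrier N" using rmod_hom_closed[OF c(1) x] .
    show "restrict (\<lambda>y. f (s y)) (carrier N) (c x) = f x" using w[OF s(1)[OF cx] x] s(2)[OF cx] cx by simp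
  qed
qed

section \<open>Membership in the additive closure\<close>

lemma direct_summandI:
  assumes M: "right_module A M" and S: "right_module A S"
    and i: "i \<in> rmod_hom A M S" and p: "p \<in> rmod_hom A S M" "\<And>x. x \<in> carrier M \<Longrightarrow> p (i x) = x"
  shows "direct_summand A M S"
proof -
  let ?U = "i ` carrier M"
  have "internal_sum A S ?U {x \<in> carrier S. p x = \<zero>\<^bsub>M\<^esub>}" by (rule retract_internal_sum[OF M S i p])
  moreover have "rmod_iso A M (S\<lparr>carrier := ?U\<rparr>)"
  proof (unfold rmod_iso_def, rule bexI)
    show "i \<in> rmod_hom A M (S\<lparr>carrier := ?U\<rparr>)" by (rule rmod_hom_codom_restrict[OF i]) simp
    show "bij_betw i (carrier M) (carrier (S\<lparr>carrier := ?U\<rparr>))"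
      unfolding bij_betw_def using p(2) by (auto intro: inj_on_inverseI)
  qed
  ultimately show ?thesis unfolding direct_summand_def by blast
qed

text \<open>The identity of \<open>M\<close> is such a sum exactly when \<open>M\<close> lies in the additive closure of \<open>\<L>\<close>.\<close>

inductive_set factor_sums ::
    "('a, 'b) ring_scheme \<Rightarrow> 'a fg_module set \<Rightarrow> 'a fg_module \<Rightarrow> 'a fg_map set"
  for A \<L> M where
  zero: "zero_hom M M \<in> factor_sums A \<L> M"
| step: "\<phi> \<in> factor_sums A \<L> M \<Longrightarrow> F \<in> \<L> \<Longrightarrow> i \<in> rmod_hom A M F \<Longrightarrow> p \<in> rmod_hom A F M \<Longrightarrow>
    (\<lambda>x\<in>carrier M. \<phi> x \<oplus>\<^bsub>M\<^esub> p (i x)) \<in> factor_sums A \<L> M"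

lemma factor_sums_closed:
  assumes M: "right_module A M" and "\<phi> \<in> factor_sums A \<L> M"
  shows "\<phi> \<in> extensional (carrier M)" "x \<in> carrier M \<Longrightarrow> \<phi> x \<in> carrier M"
proof -
  interpret right_module A M by fact
  have "\<phi> \<in> extensional (carrier M) \<and> (\<forall>x\<in>carrier M. \<phi> x \<in> carrier M)"
    using assms(2)
  proof induction
    case zero
    show ?case by (auto simp: zero_hom_def extensional_def)
  next
    case (step \<phi> F i p)
    have "p (i x) \<in> carrier M" if "x \<in> carrier M" for x
      by (rule rmod_hom_closed[OF step(4) rmod_hom_closed[OF step(3) that]])
    then show ?case using step.IH by (auto simp: extensional_def)
  qed
  then show "\<phi> \<in> extensional (carrier M)" "x \<in> carrier M \<Longrightarrow> \<phi> x \<in> carrier M" by auto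
qed

lemma factor_sums_add:
  assumes M: "right_module A M" and \<phi>: "\<phi> \<in> factor_sums A \<L> M" and "\<psi> \<in> factor_sums A \<L> M"
  shows "(\<lambda>x\<in>carrier M. \<phi> x \<oplus>\<^bsub>M\<^esub> \<psi> x) \<in> factor_sums A \<L> M"
  using assms(3)
proof induction
  interpret right_module A M by fact
  note c = factor_sums_closed[OF M \<phi>]
  case zero
  have "(\<lambda>x\<in>carrier M. \<phi> x \<oplus>\<^bsub>M\<^esub> zero_hom M M x) = \<phi>"
    by (rule extensionalityI[OF _ c(1)]) (use c(2) in \<open>auto simp: zero_hom_def\<close>)
  then show ?case using \<phi> by simp
next
  interpret right_module A M by fact
  note c = factor_sums_closed[OF M \<phi>]
  case (step \<psi> F i p)
  have pi: "p (i x) \<in> carrier M" if "x \<in> carrier M" for x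
    by (rule rmod_hom_closed[OF step(4) rmod_hom_closed[OF step(3) that]])
  have "(\<lambda>x\<in>carrier M. \<phi> x \<oplus>\<^bsub>M\<^esub> (\<lambda>x\<in>carrier M. \<psi> x \<oplus>\<^bsub>M\<^esub> p (i x)) x) =
    (\<lambda>x\<in>carrier M. (\<lambda>x\<in>carrier M. \<phi> x \<oplus>\<^bsub>M\<^esub> \<psi> x) x \<oplus>\<^bsub>M\<^esub> p (i x))"
    by (rule restrict_ext) (use c(2) pi factor_sums_closed(2)[OF M step(1)] in \<open>simp add: M.a_assoc\<close>)
  then show ?case using factor_sums.step[OF step.IH step(2-4)] by (simp only:)
qed

text \<open>With the projection onto a direct summand and its inclusion, an expression for the
  identity of the summand turns into one for the corresponding projection of the whole
  module.\<close>

lemma factor_sums_conj: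
  assumes \<L>: "\<L> \<subseteq> mod_cat A" and M: "right_module A M" and N: "right_module A N"
    and \<pi>: "\<pi> \<in> rmod_hom A N M" and \<iota>: "\<iota> \<in> rmod_hom A M N" and "\<phi> \<in> factor_sums A \<L> M"
  shows "(\<lambda>x\<in>carrier N. \<iota> (\<phi> (\<pi> x))) \<in> factor_sums A \<L> N"
  using assms(6)
proof induction
  case zero
  have "(\<lambda>x\<in>carrier N. \<iota> (zero_hom M M (\<pi> x))) = zero_hom N N"
    unfolding zero_hom_def
    by (rule restrict_ext) (use rmod_hom_closed[OF \<pi>] rmod_hom_zero[OF M N \<iota>] in simp)
  then show ?case using factor_sums.zero[of N] by simp
next
  case (step \<phi> F i p)
  have pi: "p (i x) \<in> carrier M" if "x \<in> carrier M" for x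
    by (rule rmod_hom_closed[OF step(4) rmod_hom_closed[OF step(3) that]])
  have "(\<lambda>x\<in>carrier N. \<iota> ((\<lambda>x\<in>carrier M. \<phi> x \<oplus>\<^bsub>M\<^esub> p (i x)) (\<pi> x))) =
     (\<lambda>x\<in>carrier N. (\<lambda>x\<in>carrier N. \<iota> (\<phi> (\<pi> x))) x \<oplus>\<^bsub>N\<^esub> (compose (carrier F) \<iota> p) (compose (carrier N) i \<pi> x))"
    by (rule restrict_ext)
       (use rmod_hom_closed[OF \<pi>] pi factor_sums_closed(2)[OF M step(1)] rmod_hom_closed[OF step(3)]
        in \<open>simp add: compose_def rmod_hom_add[OF \<iota>]\<close>)
  moreover have "\<dots> \<in> factor_sums A \<L> N"
  proof (rule factor_sums.step[where i = "compose (carrier N) i \<pi>" and p = "compose (carrier F) \<iota> p", OF step.IH step(2)])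
    show "compose (carrier N) i \<pi> \<in> rmod_hom A N F" by (rule rmod_hom_compose[OF N \<pi> step(3)])
    have "right_module A F" using step(2) \<L> mod_catD(1) by blast
    then show "compose (carrier F) \<iota> p \<in> rmod_hom A F N" by (rule rmod_hom_compose[OF _ step(4) \<iota>])
  qed
  ultimately show ?case by (simp only:)
qed

lemma factor_sums_id:
  assumes M: "right_module A M" "M \<in> \<L>"
  shows "(\<lambda>x\<in>carrier M. x) \<in> factor_sums A \<L> M"
proof -
  interpret right_module A M by fact
  let ?id = "\<lambda>x\<in>carrier M. x"
  have "(\<lambda>x\<in>carrier M. zero_hom M M x \<oplus>\<^bsub>M\<^esub> ?id (?id x)) = ?id"
    by (auto simp: fun_eq_iff zero_hom_def restrict_def)
  then show ?thesis using factor_sums.step[OF factor_sums.zero M(2) rmod_hom_id[OF M(1)] rmod_hom_id[OF M(1)]] by metis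
qed

text \<open>\<open>add_closure\<close> asks for a direct sum over an initial segment of the
  naturals, so the inductively built sum is unrolled into a family of that shape.\<close>

lemma factor_sums_family:
  assumes M: "right_module A M" and "\<phi> \<in> factor_sums A \<L> M"
  shows "\<exists>(n::nat) F i p. (\<forall>k<n. F k \<in> \<L> \<and> i k \<in> rmod_hom A M (F k) \<and> p k \<in> rmod_hom A (F k) M) \<and>
    (\<forall>x\<in>carrier M. \<phi> x = (\<Oplus>\<^bsub>M\<^esub>k\<in>{..<n}. p k (i k x)))"
  using assms(2)
proof induction
  interpret right_module A M by fact
  case zero
  show ?case by (rule exI[of _ 0]) (simp add: zero_hom_def)
next
  interpret right_module A M by fact
  case (step \<phi> G j q)
  then obtain n :: nat and F i p where
    h: "\<forall>k<n. F k \<in> \<L> \<and> i k \<in> rmod_hom A M (F k) \<and> p k \<in> rmod_hom A (F k) M"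
      "\<forall>x\<in>carrier M. \<phi> x = (\<Oplus>\<^bsub>M\<^esub>k\<in>{..<n}. p k (i k x))" by (elim exE conjE)
  have pi: "p k (i k x) \<in> carrier M" if "x \<in> carrier M" "k < n" for x k
  proof -
    have "i k \<in> rmod_hom A M (F k)" "p k \<in> rmod_hom A (F k) M" using h(1) that(2) by simp_all
    then show ?thesis using that(1) by (auto intro: rmod_hom_closed)
  qed
  have qj: "q (j x) \<in> carrier M" if "x \<in> carrier M" for x
    by (rule rmod_hom_closed[OF step(4) rmod_hom_closed[OF step(3) that]])
  let ?F = "F(n := G)" and ?i = "i(n := j)" and ?p = "p(n := q)"
  have "(\<Oplus>\<^bsub>M\<^esub>k\<in>{..<Suc n}. ?p k (?i k x)) = \<phi> x \<oplus>\<^bsub>M\<^esub> q (j x)" if x: "x \<in> carrier M" for x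
  proof -
    have "(\<Oplus>\<^bsub>M\<^esub>k\<in>{..<n}. ?p k (?i k x)) = (\<Oplus>\<^bsub>M\<^esub>k\<in>{..<n}. p k (i k x))"
      by (rule M.finsum_cong') (use pi x in auto)
    then have e: "(\<Oplus>\<^bsub>M\<^esub>k\<in>{..<n}. ?p k (?i k x)) = \<phi> x" using h(2) x by simp
    have "(\<Oplus>\<^bsub>M\<^esub>k\<in>insert n {..<n}. ?p k (?i k x)) = ?p n (?i n x) \<oplus>\<^bsub>M\<^esub> (\<Oplus>\<^bsub>M\<^esub>k\<in>{..<n}. ?p k (?i k x))"
      by (rule M.finsum_insert) (use pi qj x in auto)
    then show ?thesis
      using e qj x factor_sums_closed(2)[OF M step(1) x] by (simp add: lessThan_Suc M.a_comm)
  qed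
  moreover have "\<forall>k<Suc n. ?F k \<in> \<L> \<and> ?i k \<in> rmod_hom A M (?F k) \<and> ?p k \<in> rmod_hom A (?F k) M"
    using h(1) step by (auto simp: less_Suc_eq)
  ultimately show ?case
    by (intro exI[of _ "Suc n"] exI[of _ ?F] exI[of _ ?i] exI[of _ ?p]) simp
qed

text \<open>The maps \<open>i k\<close> together form a map into the direct sum of the
  \<open>F k\<close>, the maps \<open>p k\<close> a map back, and the sum formula says that the
  composite is the identity of \<open>M\<close>.\<close>

lemma add_closureI:
  assumes M: "M \<in> mod_cat A" and \<L>: "\<L> \<subseteq> mod_cat A"
    and id: "(\<lambda>x\<in>carrier M. x) \<in> factor_sums A \<L> M"
  shows "M \<in> add_closure A \<L>"
proof -
  have Mm: "right_module A M" using M by (rule mod_catD)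
  interpret right_module A M by fact
  obtain n :: nat and F i p where
    "\<forall>k<n. F k \<in> \<L> \<and> i k \<in> rmod_hom A M (F k) \<and> p k \<in> rmod_hom A (F k) M"
      and e: "\<forall>x\<in>carrier M. (\<lambda>x\<in>carrier M. x) x = (\<Oplus>\<^bsub>M\<^esub>k\<in>{..<n}. p k (i k x))"
    using factor_sums_family[OF Mm id] by (elim exE conjE)
  then have h: "\<And>k. k < n \<Longrightarrow> F k \<in> \<L>" "\<And>k. k < n \<Longrightarrow> i k \<in> rmod_hom A M (F k)" "\<And>k. k < n \<Longrightarrow> p k \<in> rmod_hom A (F k) M"
    by simp_all
  interpret S: finite_direct_sum A "{..<n}" F
  proof (intro finite_direct_sum.intro finite_direct_sum_axioms.intro A.ring_axioms)
    fix k assume "k \<in> {..<n}"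
    then have "F k \<in> mod_cat A" using h(1) \<L> by auto
    then show "right_module A (F k)" by (rule mod_catD)
  qed simp
  let ?i = "\<lambda>x\<in>carrier M. \<lambda>k\<in>{..<n}. i k x"
  have ic: "(\<lambda>k\<in>{..<n}. i k x) \<in> carrier S.D" if "x \<in> carrier M" for x
    using rmod_hom_closed[OF h(2) that] by (auto simp: S.ds)
  have i: "?i \<in> rmod_hom A M S.D"
  proof (rule rmod_hom_restrictI[OF ic _ _ Mm])
    show "(\<lambda>k\<in>{..<n}. i k (x \<oplus>\<^bsub>M\<^esub> y)) = (\<lambda>k\<in>{..<n}. i k x) \<oplus>\<^bsub>S.D\<^esub> (\<lambda>k\<in>{..<n}. i k y)"
      if "x \<in> carrier M" "y \<in> carrier M" for x y
      unfolding S.ds by (rule restrict_ext) (use that h(2) rmod_hom_add in fastforce)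
    show "(\<lambda>k\<in>{..<n}. i k (a \<odot>\<^bsub>M\<^esub> x)) = a \<odot>\<^bsub>S.D\<^esub> (\<lambda>k\<in>{..<n}. i k x)"
      if "a \<in> carrier A" "x \<in> carrier M" for a x
      unfolding S.ds by (rule restrict_ext) (use that h(2) rmod_hom_smult in fastforce)
  qed
  have p: "(\<lambda>z\<in>carrier S.D. \<Oplus>\<^bsub>M\<^esub>k\<in>{..<n}. p k (z k)) \<in> rmod_hom A S.D M"
    by (rule S.copair_hom[OF Mm]) (use h(3) in simp)
  have "direct_summand A M S.D"
  proof (rule direct_summandI[OF Mm S.right_module_D i p])
    fix x assume x: "x \<in> carrier M"
    have "(\<Oplus>\<^bsub>M\<^esub>k\<in>{..<n}. p k ((\<lambda>k\<in>{..<n}. i k x) k)) = (\<Oplus>\<^bsub>M\<^esub>k\<in>{..<n}. p k (i k x))"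
      by (rule M.finsum_cong') (use rmod_hom_closed[OF h(3) rmod_hom_closed[OF h(2) x]] in auto)
    then show "(\<lambda>z\<in>carrier S.D. \<Oplus>\<^bsub>M\<^esub>k\<in>{..<n}. p k (z k)) (?i x) = x"
      using e x ic[OF x] by simp
  qed
  then show ?thesis using M h(1) unfolding add_closure_def by blast
qed

section \<open>Closure of the left part under predecessors and of its additive closure under
  submodules\<close>

lemma left_part_mod_cat: "left_part A \<subseteq> mod_cat A"
  by (auto simp: left_part_def ind_cat_def)

lemma left_part_subset_add_closure: "left_part A \<subseteq> add_closure A (left_part A)"
proof
  fix M assume M: "M \<in> left_part A"
  then have Mc: "M \<in> mod_cat A" using left_part_mod_cat by blast
  show "M \<in> add_closure A (left_part A)"
    by (rule add_closureI[OF Mc left_part_mod_cat factor_sums_id[OF mod_catD(1)[OF Mc] M]])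
qed

text \<open>Appending \<open>f\<close> to a path ending in \<open>M\<close> gives a path to
  \<open>N\<close>, so every predecessor of \<open>M\<close> is one of \<open>N\<close>.\<close>

lemma left_part_predecessor:
  assumes M: "M \<in> ind_cat A" and N: "N \<in> left_part A" and f: "f \<in> rmod_hom A M N" "f \<noteq> zero_hom M N"
  shows "M \<in> left_part A"
proof -
  have Ni: "N \<in> ind_cat A" and pd: "\<And>L. predecessor A L N \<Longrightarrow> proj_dim A L \<le> 1"
    using N by (auto simp: left_part_def)
  have "predecessor A L N" if "predecessor A L M" for L
    using that M Ni f unfolding predecessor_def by (auto intro!: rtrancl_into_rtrancl[of L M])
  then show ?thesis using M pd by (simp add: left_part_def)
qed

text \<open>After the embedding of \<open>M\<close> into a direct sum of members of the left part,
  the non-zero value \<open>f x\<close> has a non-zero coordinate, and the corresponding component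
  is a non-zero map from \<open>X\<close> into the left part.\<close>

lemma hom_add_closure_left_part:
  assumes A: "ring A" and X: "X \<in> ind_cat A" and M: "M \<in> add_closure A (left_part A)"
    and f: "f \<in> rmod_hom A X M" and x: "x \<in> carrier X" "f x \<noteq> \<zero>\<^bsub>M\<^esub>"
  shows "X \<in> left_part A"
proof -
  have Xm: "right_module A X" using X by (simp add: ind_cat_def mod_cat_def)
  have Mm: "right_module A M" using M by (simp add: add_closure_def mod_cat_def)
  obtain n :: nat and F where F: "\<And>i. i < n \<Longrightarrow> F i \<in> left_part A" "direct_summand A M (direct_sum {..<n} F)"
    using M unfolding add_closure_def by blast
  interpret S: finite_direct_sum A "{..<n}" F
  proof (intro finite_direct_sum.intro finite_direct_sum_axioms.intro A)
    fix k assume "k \<in> {..<n}"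
    then have "F k \<in> mod_cat A" using F(1) left_part_mod_cat by auto
    then show "right_module A (F k)" by (rule mod_catD)
  qed simp
  interpret D: right_module A S.D by (rule S.right_module_D)
  obtain U V where U: "internal_sum A S.D U V" "rmod_iso A M (S.D\<lparr>carrier := U\<rparr>)"
    using F(2) unfolding direct_summand_def by blast
  have Us: "submodule U A S.D" using U(1) by (simp add: internal_sum_def)
  then have Uc: "U \<subseteq> carrier S.D" by (simp add: D.submodule_iff)
  obtain g where g: "g \<in> rmod_hom A M (S.D\<lparr>carrier := U\<rparr>)" "inj_on g (carrier M)"
    using U(2) unfolding rmod_iso_def bij_betw_def by blast
  have g': "g \<in> rmod_hom A M S.D" by (rule rmod_hom_codom_extend[OF g(1) Uc])
  have fx: "f x \<in> carrier M" using f x(1) by (rule rmod_hom_closed)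
  have "g (f x) \<noteq> \<zero>\<^bsub>S.D\<^esub>"
    using rmod_hom_inj_iff[OF Mm S.right_module_D g'] g(2) fx x(2) by blast
  moreover have gfx: "g (f x) \<in> carrier S.D" using g' fx by (rule rmod_hom_closed)
  ultimately obtain k where k: "k < n" "g (f x) k \<noteq> \<zero>\<^bsub>F k\<^esub>"
    using S.ext[OF gfx S.D_closed(1)] S.D_comp(1) by force
  let ?h = "compose (carrier X) (compose (carrier M) (\<lambda>z\<in>carrier S.D. z k) g) f"
  have h: "?h \<in> rmod_hom A X (F k)"
    by (rule rmod_hom_compose[OF Xm f rmod_hom_compose[OF Mm g' S.proj_hom]]) (use k in simp)
  have "?h x \<noteq> zero_hom X (F k) x" using x fx gfx k(2) by (simp add: compose_def zero_hom_def)
  then have "?h \<noteq> zero_hom X (F k)" by metis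
  then show ?thesis by (rule left_part_predecessor[OF X F(1)[OF k(1)] h])
qed

context artin_ring
begin

lemma mod_cat_submodule:
  assumes "M \<in> mod_cat A" "submodule U A M"
  shows "M\<lparr>carrier := U\<rparr> \<in> mod_cat A"
proof -
  have M: "right_module A M" "fin_gen A M" using assms(1) by (rule mod_catD)+
  interpret M: right_module A M by (rule M)
  show ?thesis using M.right_module_submodule[OF assms(2)] fin_gen_submodule[OF M assms(2)]
    by (simp add: mod_cat_def)
qed

text \<open>\<open>X\<close> is cut into indecomposable pieces; each embeds into \<open>M\<close>,
  hence maps non-trivially to a member of the left part and belongs to it. The pieces are
  reassembled by writing the identity of \<open>X\<close> as a sum of maps through them.\<close>

lemma add_closure_left_part_subobject:
  assumes X: "X \<in> mod_cat A" and M: "M \<in> add_closure A (left_part A)"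
    and j: "j \<in> rmod_hom A X M" "inj_on j (carrier X)"
  shows "X \<in> add_closure A (left_part A)"
proof -
  have Xm: "right_module A X" "fin_gen A X" using X by (rule mod_catD)+
  have Mm: "right_module A M" using M by (simp add: add_closure_def mod_cat_def)
  interpret X: right_module A X by (rule Xm)
  \<comment> \<open>The property is phrased by factor sums because these can be conjugated and added
    along an internal sum.\<close>
  let ?P = "\<lambda>U. (\<lambda>x\<in>U. x) \<in> factor_sums A (left_part A) (X\<lparr>carrier := U\<rparr>)"
  have "?P (carrier X)"
  proof (rule X.decomposition_induct[where P = ?P, OF fin_gen_artinian[OF Xm] X.submodule_carrier])
    have "zero_hom (X\<lparr>carrier := {\<zero>\<^bsub>X\<^esub>}\<rparr>) (X\<lparr>carrier := {\<zero>\<^bsub>X\<^esub>}\<rparr>) = (\<lambda>x\<in>{\<zero>\<^bsub>X\<^esub>}. x)"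
      unfolding zero_hom_def by (simp add: restrict_def fun_eq_iff)
    then show "?P {\<zero>\<^bsub>X\<^esub>}" using factor_sums.zero[of "X\<lparr>carrier := {\<zero>\<^bsub>X\<^esub>}\<rparr>"] by metis
  next
    fix U assume U: "submodule U A X" "indecomposable A (X\<lparr>carrier := U\<rparr>)"
    let ?U = "X\<lparr>carrier := U\<rparr>"
    have Uc: "U \<subseteq> carrier X" "\<zero>\<^bsub>X\<^esub> \<in> U" using U(1) by (simp_all add: X.submodule_iff)
    have Ui: "?U \<in> ind_cat A" using mod_cat_submodule[OF X U(1)] U(2) by (simp add: ind_cat_def)
    obtain x where x: "x \<in> U" "x \<noteq> \<zero>\<^bsub>X\<^esub>" using U(2) Uc(2) unfolding indecomposable_def by auto
    have "j x \<noteq> \<zero>\<^bsub>M\<^esub>" using rmod_hom_inj_iff[OF Xm(1) Mm j(1)] j(2) x Uc by blast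
    then have L: "?U \<in> left_part A"
      using hom_add_closure_left_part[OF ring_axioms Ui M rmod_hom_restrict_dom[OF Xm(1) j(1) U(1)], of x] x by simp
    have Um: "right_module A ?U" by (rule X.right_module_submodule[OF U(1)])
    show "?P U" using factor_sums_id[OF Um L] by simp
  next
    fix U V W
    assume U: "submodule U A X" and VW: "internal_sum A (X\<lparr>carrier := U\<rparr>) V W" and P: "?P V" "?P W"
    let ?U = "X\<lparr>carrier := U\<rparr>" and ?V = "X\<lparr>carrier := V\<rparr>" and ?W = "X\<lparr>carrier := W\<rparr>"
    have Um: "right_module A ?U" by (rule X.right_module_submodule[OF U])
    interpret U: right_module A ?U by fact
    note d = U.internal_sumD[OF VW]
    have Vm: "right_module A ?V" and Wm: "right_module A ?W"
      using U.right_module_submodule[OF d(1)] U.right_module_submodule[OF d(2)] by simp_all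
    obtain p q where pq: "p \<in> rmod_hom A ?U (?U\<lparr>carrier := V\<rparr>)" "q \<in> rmod_hom A ?U (?U\<lparr>carrier := W\<rparr>)"
      "\<And>x. x \<in> carrier ?U \<Longrightarrow> p x \<oplus>\<^bsub>?U\<^esub> q x = x"
      by (rule U.internal_sum_projections[OF VW]) (rule that)
    have pq': "p \<in> rmod_hom A ?U ?V" "q \<in> rmod_hom A ?U ?W" using pq(1,2) by simp_all
    have iV: "(\<lambda>x\<in>V. x) \<in> rmod_hom A ?V ?U" and iW: "(\<lambda>x\<in>W. x) \<in> rmod_hom A ?W ?U"
      using rmod_hom_inclusion[OF Um d(1)] rmod_hom_inclusion[OF Um d(2)] by simp_all
    note 1 = factor_sums_conj[OF left_part_mod_cat Vm Um pq'(1) iV P(1)] and 2 = factor_sums_conj[OF left_part_mod_cat Wm Um pq'(2) iW P(2)]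
    have pqc: "p x \<in> V" "q x \<in> W" if "x \<in> U" for x
      using rmod_hom_closed[OF pq'(1), of x] rmod_hom_closed[OF pq'(2), of x] that by simp_all
    have "(\<lambda>x\<in>carrier ?U. (\<lambda>x\<in>carrier ?U. (\<lambda>x\<in>V. x) ((\<lambda>x\<in>V. x) (p x))) x \<oplus>\<^bsub>?U\<^esub>
        (\<lambda>x\<in>carrier ?U. (\<lambda>x\<in>W. x) ((\<lambda>x\<in>W. x) (q x))) x) = (\<lambda>x\<in>U. x)"
      by (simp, rule restrict_ext) (use pqc pq(3) in simp)
    then show "?P U" using factor_sums_add[OF Um 1 2] by metis
  qed
  then show ?thesis using add_closureI[OF X left_part_mod_cat] by simp
qed

end

section \<open>Abelian exactness of the left part\<close>

locale left_abelian = artin_ring A for A :: "('a, 'b) ring_scheme" (structure) +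
  assumes abelian_exact: "abelian_exact_subcategory A (add_closure A (left_part A))"
begin

abbreviation \<C> where "\<C> \<equiv> add_closure A (left_part A)"

lemma \<C>D: "M \<in> \<C> \<Longrightarrow> M \<in> mod_cat A" "M \<in> \<C> \<Longrightarrow> right_module A M" "M \<in> \<C> \<Longrightarrow> fin_gen A M"
  by (simp_all add: add_closure_def mod_cat_def)

lemma \<C>_submodule:
  assumes "M \<in> \<C>" "submodule U A M"
  shows "M\<lparr>carrier := U\<rparr> \<in> \<C>"
proof (rule add_closure_left_part_subobject[OF _ assms(1)])
  show "M\<lparr>carrier := U\<rparr> \<in> mod_cat A" by (rule mod_cat_submodule[OF \<C>D(1)[OF assms(1)] assms(2)])
  show "(\<lambda>x\<in>U. x) \<in> rmod_hom A (M\<lparr>carrier := U\<rparr>) M" by (rule rmod_hom_inclusion[OF \<C>D(2)[OF assms(1)] assms(2)])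
  show "inj_on (\<lambda>x\<in>U. x) (carrier (M\<lparr>carrier := U\<rparr>))" by (simp add: inj_on_def)
qed

text \<open>
  A monomorphism of an abelian category is the kernel of its cokernel, so exactness of the inclusion
  identifies the cokernel in \<open>\<C>\<close> of \<open>U \<subseteq> M\<close> with \<open>M/U\<close>.
\<close>

lemma \<C>_quotient:
  assumes M: "M \<in> \<C>" and U: "submodule U A M"
  obtains N c where "N \<in> \<C>" "c \<in> rmod_hom A M N" "c ` carrier M = carrier N"
    "{x \<in> carrier M. c x = \<zero>\<^bsub>N\<^esub>} = U"
proof -
  let ?U = "M\<lparr>carrier := U\<rparr>" and ?f = "\<lambda>x\<in>U. x"
  have Mm: "right_module A M" using M by (rule \<C>D)
  interpret M: right_module A M by fact
  have Uc: "U \<subseteq> carrier M" using U by (simp add: M.submodule_iff)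
  have UC: "?U \<in> \<C>" by (rule \<C>_submodule[OF M U])
  have f: "?f \<in> rmod_hom A ?U M" by (rule rmod_hom_inclusion[OF Mm U])
  have ab: "abelian_category A \<C>" and ex: "exact_inclusion A \<C>"
    using abelian_exact by (simp_all add: abelian_exact_subcategory_def)
  have "is_mono A \<C> ?U M ?f"
    unfolding is_mono_def
  proof (intro ballI impI)
    fix T s t assume T: "T \<in> \<C>" and s: "s \<in> rmod_hom A T ?U" and t: "t \<in> rmod_hom A T ?U"
      and e: "compose (carrier T) ?f s = compose (carrier T) ?f t"
    show "s = t"
    proof (rule rmod_hom_ext[OF s t])
      fix x assume x: "x \<in> carrier T"
      have "s x \<in> U" "t x \<in> U" using rmod_hom_closed[OF s x] rmod_hom_closed[OF t x] by simp_all
      then show "s x = t x" using fun_cong[OF e, of x] x by (simp add: compose_def)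
    qed
  qed
  moreover have "(\<exists>C c. is_cokernel A \<C> ?U M ?f C c) \<and>
      (is_mono A \<C> ?U M ?f \<longrightarrow> (\<exists>L\<in>\<C>. \<exists>g\<in>rmod_hom A M L. is_kernel A \<C> M L g ?U ?f))"
    using ab UC M f unfolding abelian_category_def by blast
  ultimately obtain N c L g where cok: "is_cokernel A \<C> ?U M ?f N c" and L: "L \<in> \<C>" "g \<in> rmod_hom A M L"
    and ker: "is_kernel A \<C> M L g ?U ?f" by blast
  have N: "N \<in> \<C>" and c: "c \<in> rmod_hom A M N" and c0: "compose (carrier ?U) c ?f = zero_hom ?U N"
    and cu: "\<And>T t. T \<in> \<C> \<Longrightarrow> t \<in> rmod_hom A M T \<Longrightarrow> compose (carrier ?U) t ?f = zero_hom ?U T \<Longrightarrow>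
        (\<exists>!u. u \<in> rmod_hom A N T \<and> compose (carrier M) u c = t)"
    using cok unfolding is_cokernel_def by simp_all
  have g0: "compose (carrier ?U) g ?f = zero_hom ?U L"
    and ku: "\<And>T t. T \<in> \<C> \<Longrightarrow> t \<in> rmod_hom A T M \<Longrightarrow> compose (carrier T) g t = zero_hom T L \<Longrightarrow>
        (\<exists>!u. u \<in> rmod_hom A T ?U \<and> compose (carrier T) ?f u = t)"
    using ker unfolding is_kernel_def by simp_all
  obtain u where u: "u \<in> rmod_hom A N L" "compose (carrier M) u c = g"
    using cu[OF L g0] by blast
  \<comment> \<open>\<open>g\<close> factors as \<open>u\<close> after \<open>c\<close>, so a map
    killed by \<open>c\<close> is killed by \<open>g\<close> and factors through \<open>U\<close>.
    Thus the inclusion is a kernel of its own cokernel, which is the situation that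
    \<open>exact_inclusion\<close> speaks about.\<close>
  have "is_kernel A \<C> M N c ?U ?f"
    unfolding is_kernel_def
  proof (intro conjI ballI impI UC f c0)
    fix T t assume T: "T \<in> \<C>" and t: "t \<in> rmod_hom A T M" and ct: "compose (carrier T) c t = zero_hom T N"
    have "compose (carrier T) g t = zero_hom T L"
    proof
      fix x
      show "compose (carrier T) g t x = zero_hom T L x"
      proof (cases "x \<in> carrier T")
        case True
        have "c (t x) = \<zero>\<^bsub>N\<^esub>" using fun_cong[OF ct, of x] True by (simp add: compose_def zero_hom_def)
        moreover have "g (t x) = u (c (t x))"
          using fun_cong[OF u(2), of "t x"] rmod_hom_closed[OF t True] by (simp add: compose_def)
        ultimately show ?thesis
          using True rmod_hom_zero[OF \<C>D(2)[OF N] \<C>D(2)[OF L(1)] u(1)] by (simp add: compose_def zero_hom_def)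
      qed (simp add: compose_def zero_hom_def)
    qed
    then show "\<exists>!u. u \<in> rmod_hom A T ?U \<and> compose (carrier T) ?f u = t" by (rule ku[OF T t])
  qed
  then have "inj_on ?f (carrier ?U) \<and> ?f ` carrier ?U = {x \<in> carrier M. c x = \<zero>\<^bsub>N\<^esub>} \<and> c ` carrier M = carrier N"
    using ex UC M N f c cok unfolding exact_inclusion_def by blast
  then show thesis using that[OF N c] by simp
qed

text \<open>The image embeds into the quotient of \<open>D\<close> by the kernel of
  \<open>f\<close>, which lies in \<open>\<C>\<close>, and \<open>\<C>\<close> is closed under
  subobjects.\<close>

lemma \<C>_image:
  assumes D: "D \<in> \<C>" and X: "X \<in> mod_cat A" and f: "f \<in> rmod_hom A D X"
  shows "X\<lparr>carrier := f ` carrier D\<rparr> \<in> \<C>"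
proof -
  have Dm: "right_module A D" and Xm: "right_module A X" using D X by (simp_all add: \<C>D mod_catD)
  let ?I = "X\<lparr>carrier := f ` carrier D\<rparr>"
  have I: "submodule (f ` carrier D) A X"
    by (rule submodule_image[OF Dm Xm f right_module.submodule_carrier[OF Dm]])
  have Im: "right_module A ?I" by (rule right_module.right_module_submodule[OF Xm I])
  have f': "f \<in> rmod_hom A D ?I" by (rule rmod_hom_codom_restrict[OF f]) simp
  obtain N c where N: "N \<in> \<C>" "c \<in> rmod_hom A D N" "c ` carrier D = carrier N"
    "{x \<in> carrier D. c x = \<zero>\<^bsub>N\<^esub>} = {x \<in> carrier D. f x = \<zero>\<^bsub>X\<^esub>}"
    by (rule \<C>_quotient[OF D submodule_kernel[OF Dm Xm f]])
  have Nm: "right_module A N" using N(1) by (rule \<C>D)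
  obtain g where g: "g \<in> rmod_hom A ?I N" "\<And>x. x \<in> carrier D \<Longrightarrow> g (f x) = c x"
    by (rule hom_factor[OF Dm Nm Im f' _ N(2)]) (use N(4) in auto)
  have "inj_on g (carrier ?I)" unfolding rmod_hom_inj_iff[OF Im Nm g(1)]
  proof (intro ballI impI)
    fix y assume y: "y \<in> carrier ?I" "g y = \<zero>\<^bsub>N\<^esub>"
    then obtain x where x: "x \<in> carrier D" "y = f x" by auto
    then have "c x = \<zero>\<^bsub>N\<^esub>" using y(2) g(2) by simp
    then show "y = \<zero>\<^bsub>?I\<^esub>" using x N(4) by auto
  qed
  then show ?thesis by (rule add_closure_left_part_subobject[OF mod_cat_submodule[OF X I] N(1) g(1)])
qed

text \<open>An abelian category has products; addition maps the product of \<open>U\<close> and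
  \<open>V\<close> in \<open>\<C>\<close> onto \<open>U + V\<close>, and images stay in
  \<open>\<C>\<close>.\<close>

lemma \<C>_sum:
  assumes X: "X \<in> mod_cat A" and U: "submodule U A X" "X\<lparr>carrier := U\<rparr> \<in> \<C>"
    and V: "submodule V A X" "X\<lparr>carrier := V\<rparr> \<in> \<C>"
  shows "X\<lparr>carrier := U <+>\<^bsub>X\<^esub> V\<rparr> \<in> \<C>"
proof -
  let ?U = "X\<lparr>carrier := U\<rparr>" and ?V = "X\<lparr>carrier := V\<rparr>"
  have Xm: "right_module A X" using X by (rule mod_catD)
  interpret X: right_module A X by fact
  have Uc: "U \<subseteq> carrier X" "\<zero>\<^bsub>X\<^esub> \<in> U" and Vc: "V \<subseteq> carrier X" "\<zero>\<^bsub>X\<^esub> \<in> V" using U V by (simp_all add: X.submodule_iff)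
  have ab: "abelian_category A \<C>" using abelian_exact by (simp add: abelian_exact_subcategory_def)
  obtain P p q where "is_product A \<C> ?U ?V P p q"
    using ab U V unfolding abelian_category_def by blast
  then have P: "P \<in> \<C>" "p \<in> rmod_hom A P ?U" "q \<in> rmod_hom A P ?V"
    and up: "\<And>T f g. T \<in> \<C> \<Longrightarrow> f \<in> rmod_hom A T ?U \<Longrightarrow> g \<in> rmod_hom A T ?V \<Longrightarrow>
      (\<exists>!h. h \<in> rmod_hom A T P \<and> compose (carrier T) p h = f \<and> compose (carrier T) q h = g)"
    unfolding is_product_def by simp_all
  have Pm: "right_module A P" using P(1) by (rule \<C>D)
  have Um: "right_module A ?U" and Vm: "right_module A ?V" using U V by (simp_all add: \<C>D)
  have pc: "p x \<in> U" "p x \<in> carrier X" "q x \<in> V" "q x \<in> carrier X" if "x \<in> carrier P" for x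
    using rmod_hom_closed[OF P(2) that] rmod_hom_closed[OF P(3) that] Uc Vc by auto
  let ?f = "\<lambda>x\<in>carrier P. p x \<oplus>\<^bsub>X\<^esub> q x"
  have f: "?f \<in> rmod_hom A P X"
    by (rule rmod_hom_restrictI[OF _ _ _ Pm])
       (use pc in \<open>simp_all add: rmod_hom_add[OF P(2)] rmod_hom_add[OF P(3)] rmod_hom_smult[OF P(2)]
          rmod_hom_smult[OF P(3)] X.M.a_ac X.smult_r_distr\<close>)
  \<comment> \<open>The product in \<open>\<C>\<close> is known only through its universal property.
    Testing it on \<open>U\<close> and \<open>V\<close> themselves, with an identity and a zero map,
    supplies the coordinate embeddings that make the sum map onto.\<close>
  obtain h where h: "h \<in> rmod_hom A ?U P" "compose (carrier ?U) p h = (\<lambda>x\<in>carrier ?U. x)"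
      "compose (carrier ?U) q h = zero_hom ?U ?V"
    using up[OF U(2) rmod_hom_id[OF Um] zero_hom_mem[OF Um Vm]] by blast
  obtain k where k: "k \<in> rmod_hom A ?V P" "compose (carrier ?V) p k = zero_hom ?V ?U"
      "compose (carrier ?V) q k = (\<lambda>x\<in>carrier ?V. x)"
    using up[OF V(2) zero_hom_mem[OF Vm Um] rmod_hom_id[OF Vm]] by blast
  have "?f ` carrier P = U <+>\<^bsub>X\<^esub> V"
  proof
    show "?f ` carrier P \<subseteq> U <+>\<^bsub>X\<^esub> V"
    proof
      fix y assume "y \<in> ?f ` carrier P"
      then obtain x where x: "x \<in> carrier P" "y = p x \<oplus>\<^bsub>X\<^esub> q x" by auto
      show "y \<in> U <+>\<^bsub>X\<^esub> V" unfolding set_add_def' x(2) using pc(1,3)[OF x(1)] by blast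
    qed
    have fi: "submodule (?f ` carrier P) A X"
      by (rule submodule_image[OF Pm Xm f right_module.submodule_carrier[OF Pm]])
    have "u \<in> ?f ` carrier P" if u: "u \<in> U" for u
    proof -
      have hu: "h u \<in> carrier P" using rmod_hom_closed[OF h(1), of u] u by simp
      have "p (h u) = u" "q (h u) = \<zero>\<^bsub>X\<^esub>"
        using fun_cong[OF h(2), of u] fun_cong[OF h(3), of u] u by (simp_all add: compose_def zero_hom_def)
      then have "u = ?f (h u)" using hu u Uc by auto
      then show ?thesis using hu by (rule image_eqI)
    qed
    moreover have "v \<in> ?f ` carrier P" if v: "v \<in> V" for v
    proof -
      have hu: "k v \<in> carrier P" using rmod_hom_closed[OF k(1), of v] v by simp
      have "p (k v) = \<zero>\<^bsub>X\<^esub>" "q (k v) = v"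
        using fun_cong[OF k(2), of v] fun_cong[OF k(3), of v] v by (simp_all add: compose_def zero_hom_def)
      then have "v = ?f (k v)" using hu v Vc by auto
      then show ?thesis using hu by (rule image_eqI)
    qed
    moreover have "\<And>x y. x \<in> ?f ` carrier P \<Longrightarrow> y \<in> ?f ` carrier P \<Longrightarrow> x \<oplus>\<^bsub>X\<^esub> y \<in> ?f ` carrier P"
      using fi unfolding X.submodule_iff by blast
    ultimately show "U <+>\<^bsub>X\<^esub> V \<subseteq> ?f ` carrier P"
      by (auto simp only: set_add_def' intro!: UN_least)
  qed
  then show ?thesis using \<C>_image[OF P(1) X f] by simp
qed

text \<open>The identity of the zero module is the empty factor sum.\<close>

lemma \<C>_zero:
  assumes X: "X \<in> mod_cat A"
  shows "X\<lparr>carrier := {\<zero>\<^bsub>X\<^esub>}\<rparr> \<in> \<C>"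
proof -
  have Xm: "right_module A X" using X by (rule mod_catD)
  interpret X: right_module A X by fact
  have "zero_hom (X\<lparr>carrier := {\<zero>\<^bsub>X\<^esub>}\<rparr>) (X\<lparr>carrier := {\<zero>\<^bsub>X\<^esub>}\<rparr>) = (\<lambda>x\<in>{\<zero>\<^bsub>X\<^esub>}. x)"
    unfolding zero_hom_def by (simp add: restrict_def fun_eq_iff)
  then have "(\<lambda>x\<in>carrier (X\<lparr>carrier := {\<zero>\<^bsub>X\<^esub>}\<rparr>). x) \<in> factor_sums A (left_part A) (X\<lparr>carrier := {\<zero>\<^bsub>X\<^esub>}\<rparr>)"
    using factor_sums.zero[of "X\<lparr>carrier := {\<zero>\<^bsub>X\<^esub>}\<rparr>" A "left_part A"] by simp
  then show ?thesis by (rule add_closureI[OF mod_cat_submodule[OF X X.submodule_zero] left_part_mod_cat])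
qed

text \<open>A maximal submodule \<open>T\<close> in \<open>\<C>\<close> contains the image of every
  map from \<open>\<C>\<close>, because the sum of \<open>T\<close> with that image is in
  \<open>\<C>\<close> again. Besides giving the approximation, this is the test for membership in
  \<open>\<C>\<close>: \<open>X\<close> itself is in \<open>\<C>\<close> once such images generate
  it.\<close>

lemma largest_\<C>_submodule:
  assumes X: "X \<in> mod_cat A"
  obtains T where "submodule T A X" "X\<lparr>carrier := T\<rparr> \<in> \<C>"
    "\<And>D f x. D \<in> \<C> \<Longrightarrow> f \<in> rmod_hom A D X \<Longrightarrow> x \<in> carrier D \<Longrightarrow> f x \<in> T"
proof -
  have Xm: "right_module A X" "fin_gen A X" using X by (rule mod_catD)+
  interpret X: right_module A X by (rule Xm)
  define P where "P U \<longleftrightarrow> X\<lparr>carrier := U\<rparr> \<in> \<C>" for U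
  have P0: "P {\<zero>\<^bsub>X\<^esub>}" using \<C>_zero[OF X] by (simp add: P_def)
  obtain T where T: "submodule T A X" "P T" "\<forall>W. submodule W A X \<longrightarrow> T \<subset> W \<longrightarrow> \<not> P W"
    using noetherian_maximal[where P = P, OF fin_gen_noetherian[OF Xm] X.submodule_zero P0] by auto
  have TC: "X\<lparr>carrier := T\<rparr> \<in> \<C>" using T(2) by (simp add: P_def)
  have Ts: "T \<subseteq> carrier X" "\<zero>\<^bsub>X\<^esub> \<in> T" using T(1) by (simp_all add: X.submodule_iff)
  have "f x \<in> T" if D: "D \<in> \<C>" "f \<in> rmod_hom A D X" "x \<in> carrier D" for D f x
  proof -
    let ?I = "f ` carrier D"
    have Dm: "right_module A D" using D(1) by (rule \<C>D)
    have I: "submodule ?I A X" by (rule submodule_image[OF Dm Xm(1) D(2) right_module.submodule_carrier[OF Dm]])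
    have Is: "?I \<subseteq> carrier X" "\<zero>\<^bsub>X\<^esub> \<in> ?I" using I by (simp_all add: X.submodule_iff)
    have "P (T <+>\<^bsub>X\<^esub> ?I)" unfolding P_def by (rule \<C>_sum[OF X T(1) TC I \<C>_image[OF D(1) X D(2)]])
    moreover have s: "submodule (T <+>\<^bsub>X\<^esub> ?I) A X" by (rule X.submodule_sum[OF T(1) I])
    moreover have "T \<subseteq> T <+>\<^bsub>X\<^esub> ?I"
    proof
      fix t assume t: "t \<in> T"
      then have "t = t \<oplus>\<^bsub>X\<^esub> \<zero>\<^bsub>X\<^esub>" using Ts by auto
      then show "t \<in> T <+>\<^bsub>X\<^esub> ?I" using t Is(2) unfolding set_add_def' by blast
    qed
    ultimately have e: "T <+>\<^bsub>X\<^esub> ?I = T" using T(3) by blast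
    have fx: "f x \<in> ?I" using D(3) by blast
    then have "f x = \<zero>\<^bsub>X\<^esub> \<oplus>\<^bsub>X\<^esub> f x" using Is(1) by auto
    then have "f x \<in> T <+>\<^bsub>X\<^esub> ?I" using fx Ts(2) unfolding set_add_def' by blast
    then show ?thesis using e by blast
  qed
  then show thesis by (rule that[OF T(1) TC])
qed

lemma left_supported: "left_supported A"
  unfolding left_supported_def contravariantly_finite_def
proof
  fix X assume X: "X \<in> mod_cat A"
  have Xm: "right_module A X" using X by (rule mod_catD)
  obtain T where T: "submodule T A X" "X\<lparr>carrier := T\<rparr> \<in> \<C>"
    "\<And>D f x. D \<in> \<C> \<Longrightarrow> f \<in> rmod_hom A D X \<Longrightarrow> x \<in> carrier D \<Longrightarrow> f x \<in> T"
    by (rule largest_\<C>_submodule[OF X]) (rule that)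
  let ?D = "X\<lparr>carrier := T\<rparr>"
  have "\<exists>h\<in>rmod_hom A D' ?D. g = compose (carrier D') (\<lambda>x\<in>T. x) h"
    if D': "D' \<in> \<C>" "g \<in> rmod_hom A D' X" for D' g
  proof
    show g: "g \<in> rmod_hom A D' ?D" by (rule rmod_hom_codom_restrict[OF D'(2)]) (rule T(3)[OF D'])
    have "compose (carrier D') (\<lambda>x\<in>T. x) g \<in> rmod_hom A D' X"
      by (rule rmod_hom_compose[OF \<C>D(2)[OF D'(1)] g rmod_hom_inclusion[OF Xm T(1)]])
    then show "g = compose (carrier D') (\<lambda>x\<in>T. x) g"
      by (rule rmod_hom_ext[OF D'(2)]) (use T(3)[OF D'] in \<open>simp add: compose_def\<close>)
  qed
  then show "\<exists>D\<in>\<C>. \<exists>f\<in>rmod_hom A D X. \<forall>D'\<in>\<C>. \<forall>g\<in>rmod_hom A D' X. \<exists>h\<in>rmod_hom A D' D. g = compose (carrier D') f h"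
    using T(2) rmod_hom_inclusion[OF Xm T(1)] by blast
qed

end

section \<open>Submodules of projective modules\<close>

text \<open>The infimum is attained, since \<open>enat\<close> is well-ordered; without any
  resolution it would be infinite.\<close>

lemma proj_dim_le_one_resolution:
  assumes "proj_dim A M \<le> 1"
  obtains n C d where "n \<le> 1" "projective_resolution A M n C d"
proof -
  let ?S = "{enat n | n. \<exists>C d. projective_resolution A M n C d}"
  have "?S \<noteq> {}"
  proof
    assume "?S = {}"
    then have "proj_dim A M = \<infinity>" by (simp add: proj_dim_def Inf_enat_def)
    then show False using assms by simp
  qed
  then obtain s where "s \<in> ?S" by blast
  then have "Inf ?S \<in> ?S" by (rule wellorder_InfI)
  then obtain n C d where "Inf ?S = enat n" "projective_resolution A M n C d" by auto
  then show thesis using assms that by (simp add: proj_dim_def one_enat_def)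
qed

text \<open>The identity map is a resolution of length 0.\<close>

lemma proj_dim_projective:
  assumes "M \<in> mod_cat A" "projective A M"
  shows "proj_dim A M \<le> 1"
proof -
  have Mm: "right_module A M" using assms by (simp add: mod_catD)
  have "projective_resolution A M 0 (\<lambda>_. M) (\<lambda>_. \<lambda>x\<in>carrier M. x)"
    unfolding projective_resolution_def using assms rmod_hom_id[OF Mm] by (auto simp: inj_on_def)
  then have "proj_dim A M \<le> enat 0" unfolding proj_dim_def by (intro Inf_lower) blast
  then show ?thesis using order_trans[of _ "enat 0" 1] by (simp add: zero_enat_def[symmetric])
qed

lemma projective_zero:
  assumes "right_module A M" "carrier M = {\<zero>\<^bsub>M\<^esub>}"
  shows "projective A M"
proof (rule projectiveI[OF assms(1)])
  fix X N :: "'a fg_module" and g f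
  assume a: "right_module A X" "right_module A N" "g \<in> rmod_hom A X N" "f \<in> rmod_hom A M N"
  have "zero_hom M X \<in> rmod_hom A M X" by (rule zero_hom_mem[OF assms(1) a(1)])
  moreover have "\<forall>x\<in>carrier M. g (zero_hom M X x) = f x"
    using assms(2) rmod_hom_zero[OF a(1-3)] rmod_hom_zero[OF assms(1) a(2,4)] by (simp add: zero_hom_def)
  ultimately show "\<exists>h\<in>rmod_hom A M X. \<forall>x\<in>carrier M. g (h x) = f x" by blast
qed

text \<open>Schanuel's argument: the kernel of \<open>g\<close> is a retract of \<open>K \<oplus> Q\<close>, where \<open>K\<close> is the kernel of \<open>d\<close>.\<close>

lemma schanuel:
  fixes P Q M :: "'a fg_module"
  assumes P: "P \<in> mod_cat A" "projective A P" and Q: "Q \<in> mod_cat A" "projective A Q" and M: "right_module A M"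
    and d: "d \<in> rmod_hom A P M" "d ` carrier P = carrier M"
    and K: "projective A (P\<lparr>carrier := {x \<in> carrier P. d x = \<zero>\<^bsub>M\<^esub>}\<rparr>)"
    and g: "g \<in> rmod_hom A Q M" "g ` carrier Q = carrier M"
  shows "projective A (Q\<lparr>carrier := {x \<in> carrier Q. g x = \<zero>\<^bsub>M\<^esub>}\<rparr>)"
proof -
  have Pm: "right_module A P" "fin_gen A P" and Qm: "right_module A Q" "fin_gen A Q"
    using P(1) Q(1) by (simp_all add: mod_catD)
  interpret P: right_module A P by (rule Pm)
  interpret Q: right_module A Q by (rule Qm)
  interpret M: right_module A M by (rule M)
  let ?K = "{x \<in> carrier P. d x = \<zero>\<^bsub>M\<^esub>}" and ?U = "{x \<in> carrier Q. g x = \<zero>\<^bsub>M\<^esub>}"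
  have Ks: "submodule ?K A P" by (rule submodule_kernel[OF Pm(1) M d(1)])
  have Us: "submodule ?U A Q" by (rule submodule_kernel[OF Qm(1) M g(1)])
  have Um: "right_module A (Q\<lparr>carrier := ?U\<rparr>)" by (rule Q.right_module_submodule[OF Us])
  obtain a where a: "a \<in> rmod_hom A Q P" "\<forall>x\<in>carrier Q. d (a x) = g x"
    using projective_lift[OF Q(2) Pm M d g(1)] by blast
  obtain b where b: "b \<in> rmod_hom A P Q" "\<forall>x\<in>carrier P. g (b x) = d x"
    using projective_lift[OF P(2) Qm M g d(1)] by blast
  note ac = rmod_hom_closed[OF a(1)] and bc = rmod_hom_closed[OF b(1)]
  have bK: "restrict b ?K \<in> rmod_hom A (P\<lparr>carrier := ?K\<rparr>) (Q\<lparr>carrier := ?U\<rparr>)"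
    by (rule rmod_hom_codom_restrict[OF rmod_hom_restrict_dom[OF Pm(1) b(1) Ks]]) (use b(2) bc in simp)
  \<comment> \<open>Since \<open>g b a = d a = g\<close>, this map lands in the kernel of
    \<open>g\<close>. On that kernel the identity is the sum of \<open>b a\<close>, which passes
    through \<open>K\<close>, and of \<open>?r\<close>, which is defined on all of
    \<open>Q\<close>.\<close>
  let ?r = "\<lambda>x\<in>carrier Q. x \<ominus>\<^bsub>Q\<^esub> b (a x)"
  have r0: "?r \<in> rmod_hom A Q Q"
  proof (rule rmod_hom_restrictI[OF _ _ _ Qm(1)])
    show "x \<ominus>\<^bsub>Q\<^esub> b (a x) \<in> carrier Q" if "x \<in> carrier Q" for x using that ac bc by simp
    show "(x \<oplus>\<^bsub>Q\<^esub> y) \<ominus>\<^bsub>Q\<^esub> b (a (x \<oplus>\<^bsub>Q\<^esub> y)) = (x \<ominus>\<^bsub>Q\<^esub> b (a x)) \<oplus>\<^bsub>Q\<^esub> (y \<ominus>\<^bsub>Q\<^esub> b (a y))"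
      if "x \<in> carrier Q" "y \<in> carrier Q" for x y
      using that ac bc by (simp add: rmod_hom_add[OF a(1)] rmod_hom_add[OF b(1)] a_minus_def Q.M.minus_add Q.M.a_ac)
    show "c \<odot>\<^bsub>Q\<^esub> x \<ominus>\<^bsub>Q\<^esub> b (a (c \<odot>\<^bsub>Q\<^esub> x)) = c \<odot>\<^bsub>Q\<^esub> (x \<ominus>\<^bsub>Q\<^esub> b (a x))"
      if cx: "c \<in> carrier A" "x \<in> carrier Q" for c x
    proof -
      have "c \<odot>\<^bsub>Q\<^esub> (x \<ominus>\<^bsub>Q\<^esub> b (a x)) \<oplus>\<^bsub>Q\<^esub> c \<odot>\<^bsub>Q\<^esub> b (a x) = c \<odot>\<^bsub>Q\<^esub> x"
        using cx ac bc by (simp add: Q.smult_r_distr[symmetric] Q.M.diff_add_cancel)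
      then have "c \<odot>\<^bsub>Q\<^esub> x \<ominus>\<^bsub>Q\<^esub> c \<odot>\<^bsub>Q\<^esub> b (a x) = c \<odot>\<^bsub>Q\<^esub> (x \<ominus>\<^bsub>Q\<^esub> b (a x))"
        using Q.M.add_diff_cancel[of "c \<odot>\<^bsub>Q\<^esub> (x \<ominus>\<^bsub>Q\<^esub> b (a x))" "c \<odot>\<^bsub>Q\<^esub> b (a x)"] cx ac bc by simp
      then show ?thesis using cx ac by (simp add: rmod_hom_smult[OF a(1)] rmod_hom_smult[OF b(1)])
    qed
  qed
  have r: "?r \<in> rmod_hom A Q (Q\<lparr>carrier := ?U\<rparr>)"
  proof (rule rmod_hom_codom_restrict[OF r0])
    fix x assume x: "x \<in> carrier Q"
    have "g (x \<ominus>\<^bsub>Q\<^esub> b (a x)) = g x \<ominus>\<^bsub>M\<^esub> g (b (a x))" by (rule rmod_hom_diff[OF Qm(1) M g(1) x bc[OF ac[OF x]]])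
    also have "\<dots> = \<zero>\<^bsub>M\<^esub>" using a(2) b(2) ac[OF x] x rmod_hom_closed[OF g(1) x] by (simp add: a_minus_def M.M.r_neg)
    finally show "?r x \<in> ?U" using x ac bc by simp
  qed
  show ?thesis
  proof (rule projectiveI[OF Um])
    fix X N :: "'a fg_module" and s f
    assume X: "right_module A X" "right_module A N" "fin_gen A X" "s \<in> rmod_hom A X N"
      and f: "f \<in> rmod_hom A (Q\<lparr>carrier := ?U\<rparr>) N" and on: "s ` carrier X = carrier N"
    interpret X: right_module A X by (rule X(1))
    have Km: "right_module A (P\<lparr>carrier := ?K\<rparr>)" by (rule P.right_module_submodule[OF Ks])
    obtain h1 where h1: "h1 \<in> rmod_hom A (P\<lparr>carrier := ?K\<rparr>) X"
      "\<forall>x\<in>carrier (P\<lparr>carrier := ?K\<rparr>). s (h1 x) = compose (carrier (P\<lparr>carrier := ?K\<rparr>)) f (restrict b ?K) x"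
      using projective_lift[OF K X(1,3,2,4) on rmod_hom_compose[OF Km bK f]] by blast
    obtain h2 where h2: "h2 \<in> rmod_hom A Q X" "\<forall>x\<in>carrier Q. s (h2 x) = compose (carrier Q) f ?r x"
      using projective_lift[OF Q(2) X(1,3,2,4) on rmod_hom_compose[OF Qm(1) r f]] by blast
    have aU: "restrict a ?U \<in> rmod_hom A (Q\<lparr>carrier := ?U\<rparr>) (P\<lparr>carrier := ?K\<rparr>)"
      by (rule rmod_hom_codom_restrict[OF rmod_hom_restrict_dom[OF Qm(1) a(1) Us]]) (use a(2) ac in simp)
    let ?k = "compose ?U h1 (restrict a ?U)"
    have k: "?k \<in> rmod_hom A (Q\<lparr>carrier := ?U\<rparr>) X" using rmod_hom_compose[OF Um aU h1(1)] by simp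
    have h2U: "restrict h2 ?U \<in> rmod_hom A (Q\<lparr>carrier := ?U\<rparr>) X" by (rule rmod_hom_restrict_dom[OF Qm(1) h2(1) Us])
    note kc = rmod_hom_closed[OF k] and hc = rmod_hom_closed[OF h2U]
    \<comment> \<open>The lift \<open>h1\<close> handles the summand \<open>b (a x)\<close> and
      \<open>h2\<close> the summand \<open>?r x\<close>, so their sum lifts
      \<open>f x\<close>.\<close>
    let ?h = "\<lambda>x\<in>carrier (Q\<lparr>carrier := ?U\<rparr>). ?k x \<oplus>\<^bsub>X\<^esub> restrict h2 ?U x"
    have h: "?h \<in> rmod_hom A (Q\<lparr>carrier := ?U\<rparr>) X"
    proof (rule rmod_hom_restrictI[OF _ _ _ Um])
      fix x assume x: "x \<in> carrier (Q\<lparr>carrier := ?U\<rparr>)"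
      show "?k x \<oplus>\<^bsub>X\<^esub> restrict h2 ?U x \<in> carrier X" using kc[OF x] hc[OF x] by (rule X.M.a_closed)
      show "?k (c \<odot>\<^bsub>Q\<lparr>carrier := ?U\<rparr>\<^esub> x) \<oplus>\<^bsub>X\<^esub> restrict h2 ?U (c \<odot>\<^bsub>Q\<lparr>carrier := ?U\<rparr>\<^esub> x) = c \<odot>\<^bsub>X\<^esub> (?k x \<oplus>\<^bsub>X\<^esub> restrict h2 ?U x)"
        if c: "c \<in> carrier A" for c
        unfolding rmod_hom_smult[OF k c x] rmod_hom_smult[OF h2U c x] using kc[OF x] hc[OF x] c
        by (simp only: X.smult_r_distr)
      fix y assume y: "y \<in> carrier (Q\<lparr>carrier := ?U\<rparr>)"
      show "?k (x \<oplus>\<^bsub>Q\<lparr>carrier := ?U\<rparr>\<^esub> y) \<oplus>\<^bsub>X\<^esub> restrict h2 ?U (x \<oplus>\<^bsub>Q\<lparr>carrier := ?U\<rparr>\<^esub> y) =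
        (?k x \<oplus>\<^bsub>X\<^esub> restrict h2 ?U x) \<oplus>\<^bsub>X\<^esub> (?k y \<oplus>\<^bsub>X\<^esub> restrict h2 ?U y)"
        unfolding rmod_hom_add[OF k x y] rmod_hom_add[OF h2U x y] using kc[OF x] hc[OF x] kc[OF y] hc[OF y]
        by (simp only: X.M.a_ac X.M.a_closed)
    qed
    have "s (?h x) = f x" if "x \<in> carrier (Q\<lparr>carrier := ?U\<rparr>)" for x
    proof -
      have x: "x \<in> carrier Q" "g x = \<zero>\<^bsub>M\<^esub>" using that by simp_all
      have axK: "a x \<in> ?K" using a(2) ac x by simp
      have bU: "b (a x) \<in> ?U" using b(2) axK bc by simp
      have rU: "?r x \<in> ?U" using rmod_hom_closed[OF r x(1)] by simp
      have e1: "s (h1 (a x)) = f (b (a x))" using h1(2) axK by (simp add: compose_def)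
      have e2: "s (h2 x) = f (?r x)" using h2(2) x by (simp add: compose_def)
      have h1c: "h1 (a x) \<in> carrier X" using rmod_hom_closed[OF h1(1), of "a x"] axK by simp
      have "s (?h x) = s (h1 (a x) \<oplus>\<^bsub>X\<^esub> h2 x)" using x by (simp add: compose_def)
      also have "\<dots> = s (h1 (a x)) \<oplus>\<^bsub>N\<^esub> s (h2 x)"
        by (rule rmod_hom_add[OF X(4) h1c rmod_hom_closed[OF h2(1) x(1)]])
      also have "\<dots> = f (b (a x)) \<oplus>\<^bsub>N\<^esub> f (?r x)" by (simp only: e1 e2)
      also have "\<dots> = f (b (a x) \<oplus>\<^bsub>Q\<^esub> ?r x)" using rmod_hom_add[OF f, of "b (a x)" "?r x"] bU rU by simp
      also have "b (a x) \<oplus>\<^bsub>Q\<^esub> ?r x = x" using Q.M.diff_add_cancel[of x "b (a x)"] x bU by (simp add: Q.M.a_comm)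
      finally show ?thesis .
    qed
    then show "\<exists>h\<in>rmod_hom A (Q\<lparr>carrier := ?U\<rparr>) X. \<forall>x\<in>carrier (Q\<lparr>carrier := ?U\<rparr>). s (h x) = f x"
      using h by blast
  qed
qed

text \<open>A form of projective dimension at most one that mentions no chosen resolution: it
  applies to whichever projective module happens to map onto \<open>M\<close>, and it can be checked
  along direct decompositions.\<close>

definition projective_kernels :: "('a, 'b) ring_scheme \<Rightarrow> 'a fg_module \<Rightarrow> bool" where
  "projective_kernels A M \<longleftrightarrow> (\<forall>Q\<in>mod_cat A. \<forall>g\<in>rmod_hom A Q M. projective A Q \<and> g ` carrier Q = carrier M \<longrightarrow>
     projective A (Q\<lparr>carrier := {x \<in> carrier Q. g x = \<zero>\<^bsub>M\<^esub>}\<rparr>))"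

text \<open>The kernel of the first map of a short resolution is projective, and Schanuel's argument
  carries this over to every other epimorphism from a projective module.\<close>

lemma (in artin_ring) projective_kernels_proj_dim:
  assumes M: "M \<in> mod_cat A" and pd: "proj_dim A M \<le> 1"
  shows "projective_kernels A M"
proof -
  have Mm: "right_module A M" using M by (rule mod_catD)
  obtain n C d where n: "n \<le> 1" "projective_resolution A M n C d" by (rule proj_dim_le_one_resolution[OF pd])
  note r = n(2)[unfolded projective_resolution_def]
  note C = r[THEN conjunct1] r[THEN conjunct2, THEN conjunct1, rule_format]
    r[THEN conjunct2, THEN conjunct2, THEN conjunct1, rule_format]
    r[THEN conjunct2, THEN conjunct2, THEN conjunct2, THEN conjunct1]
    r[THEN conjunct2, THEN conjunct2, THEN conjunct2, THEN conjunct2, THEN conjunct1, rule_format]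
    r[THEN conjunct2, THEN conjunct2, THEN conjunct2, THEN conjunct2, THEN conjunct2]
  have C1: "C 1 \<in> mod_cat A" "projective A (C 1)" using C(2)[of 1] n by auto
  have C1m: "right_module A (C 1)" using C1(1) by (rule mod_catD)
  have d0: "d 0 \<in> rmod_hom A (C 1) M" using C(3)[of 0] C(1) by simp
  let ?K = "{x \<in> carrier (C 1). d 0 x = \<zero>\<^bsub>M\<^esub>}"
  have Ks: "submodule ?K A (C 1)" by (rule submodule_kernel[OF C1m Mm d0])
  have Km: "right_module A ((C 1)\<lparr>carrier := ?K\<rparr>)" by (rule right_module.right_module_submodule[OF C1m Ks])
  \<comment> \<open>In length 0 this kernel vanishes; in length 1 it is isomorphic to
    \<open>C 2\<close>.\<close>
  have K: "projective A ((C 1)\<lparr>carrier := ?K\<rparr>)"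
  proof (cases "n = 0")
    case True
    have "?K \<subseteq> {\<zero>\<^bsub>C 1\<^esub>}" using C(6) True rmod_hom_inj_iff[OF C1m Mm d0] by auto
    moreover have "\<zero>\<^bsub>C 1\<^esub> \<in> ?K" using Ks right_module.submodule_iff[OF C1m] by blast
    ultimately have "?K = {\<zero>\<^bsub>C 1\<^esub>}" by blast
    then show ?thesis by (intro projective_zero[OF Km]) simp
  next
    case False
    then have n1: "n = 1" using n by simp
    have C2: "C 2 \<in> mod_cat A" "projective A (C 2)" using C(2)[of 2] n1 by auto
    have d1: "d 1 \<in> rmod_hom A (C 2) (C 1)" using C(3)[of 1] n1 by (simp add: numeral_2_eq_2)
    have im: "d 1 ` carrier (C 2) = ?K" using C(5)[of 0] n1 C(1) by (simp add: numeral_2_eq_2)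
    have "d 1 \<in> rmod_hom A (C 2) ((C 1)\<lparr>carrier := ?K\<rparr>)" by (rule rmod_hom_codom_restrict[OF d1]) (use im in blast)
    moreover have "bij_betw (d 1) (carrier (C 2)) (carrier ((C 1)\<lparr>carrier := ?K\<rparr>))"
      using im C(6) n1 by (simp add: bij_betw_def numeral_2_eq_2)
    ultimately have "rmod_iso A (C 2) ((C 1)\<lparr>carrier := ?K\<rparr>)" unfolding rmod_iso_def by blast
    then show ?thesis by (rule projective_iso[OF C2(2) _ Km])
  qed
  show ?thesis unfolding projective_kernels_def
  proof (intro ballI impI)
    fix Q g assume "Q \<in> mod_cat A" "g \<in> rmod_hom A Q M" "projective A Q \<and> g ` carrier Q = carrier M"
    then show "projective A (Q\<lparr>carrier := {x \<in> carrier Q. g x = \<zero>\<^bsub>M\<^esub>}\<rparr>)"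
      by (intro schanuel[OF C1 _ _ Mm d0 C(4) K]) simp_all
  qed
qed

context left_abelian
begin

text \<open>Indecomposable submodules of \<open>M\<close> lie in the left part and have the bound by
  definition. Along a decomposition of \<open>U\<close> into \<open>V\<close> and \<open>W\<close>,
  the kernel of a map onto \<open>U\<close> is reached in two stages: the kernel of its
  \<open>V\<close>-component, and inside it the kernel of the \<open>W\<close>-component.\<close>

lemma projective_kernels_\<C>:
  assumes M: "M \<in> \<C>"
  shows "projective_kernels A M"
proof -
  have Mc: "M \<in> mod_cat A" and Mm: "right_module A M" "fin_gen A M" using M by (simp_all add: \<C>D)
  interpret M: right_module A M by (rule Mm)
  let ?P = "\<lambda>U. projective_kernels A (M\<lparr>carrier := U\<rparr>)"
  have "?P (carrier M)"
  proof (rule M.decomposition_induct[where P = ?P, OF fin_gen_artinian[OF Mm] M.submodule_carrier])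
    show "?P {\<zero>\<^bsub>M\<^esub>}"
      unfolding projective_kernels_def
    proof (intro ballI impI)
      fix Q g assume Q: "g \<in> rmod_hom A Q (M\<lparr>carrier := {\<zero>\<^bsub>M\<^esub>}\<rparr>)"
        "projective A Q \<and> g ` carrier Q = carrier (M\<lparr>carrier := {\<zero>\<^bsub>M\<^esub>}\<rparr>)"
      have "{x \<in> carrier Q. g x = \<zero>\<^bsub>M\<lparr>carrier := {\<zero>\<^bsub>M\<^esub>}\<rparr>\<^esub>} = carrier Q"
        using rmod_hom_closed[OF Q(1)] by auto
      then show "projective A (Q\<lparr>carrier := {x \<in> carrier Q. g x = \<zero>\<^bsub>M\<lparr>carrier := {\<zero>\<^bsub>M\<^esub>}\<rparr>\<^esub>}\<rparr>)"
        using Q(2) by simp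
    qed
  next
    fix U assume U: "submodule U A M" "indecomposable A (M\<lparr>carrier := U\<rparr>)"
    have Uc: "U \<subseteq> carrier M" "\<zero>\<^bsub>M\<^esub> \<in> U" using U(1) by (simp_all add: M.submodule_iff)
    have Um: "M\<lparr>carrier := U\<rparr> \<in> mod_cat A" by (rule mod_cat_submodule[OF Mc U(1)])
    have Ui: "M\<lparr>carrier := U\<rparr> \<in> ind_cat A" using Um U(2) by (simp add: ind_cat_def)
    obtain x where x: "x \<in> U" "x \<noteq> \<zero>\<^bsub>M\<^esub>" using U(2) Uc(2) unfolding indecomposable_def by auto
    have "M\<lparr>carrier := U\<rparr> \<in> left_part A"
      by (rule hom_add_closure_left_part[OF ring_axioms Ui M rmod_hom_inclusion[OF Mm(1) U(1)], of x]) (use x in simp_all)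
    then have "proj_dim A (M\<lparr>carrier := U\<rparr>) \<le> 1"
      using Ui unfolding left_part_def predecessor_def by blast
    then show "?P U" by (rule projective_kernels_proj_dim[OF Um])
  next
    fix U V W
    assume U: "submodule U A M" and VW: "internal_sum A (M\<lparr>carrier := U\<rparr>) V W" and P: "?P V" "?P W"
    let ?U = "M\<lparr>carrier := U\<rparr>" and ?V = "M\<lparr>carrier := V\<rparr>" and ?W = "M\<lparr>carrier := W\<rparr>"
    have Um: "right_module A ?U" by (rule M.right_module_submodule[OF U])
    interpret U: right_module A ?U by fact
    note d = U.internal_sumD[OF VW]
    obtain p q where pq0: "p \<in> rmod_hom A ?U (?U\<lparr>carrier := V\<rparr>)" "q \<in> rmod_hom A ?U (?U\<lparr>carrier := W\<rparr>)"
      and pq1: "\<And>x. x \<in> carrier ?U \<Longrightarrow> p x \<oplus>\<^bsub>?U\<^esub> q x = x"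
      by (rule U.internal_sum_projections[OF VW]) (rule that)
    have p: "p \<in> rmod_hom A ?U ?V" and q: "q \<in> rmod_hom A ?U ?W" using pq0 by simp_all
    have pq: "p x \<in> V" "q x \<in> W" "p x \<in> U" "q x \<in> U" "p x \<oplus>\<^bsub>M\<^esub> q x = x" if "x \<in> U" for x
      using rmod_hom_closed[OF p, of x] rmod_hom_closed[OF q, of x] pq1[of x] that d(5)[of "p x"] d(6)[of "q x"] by simp_all
    have Uc: "U \<subseteq> carrier M" using U by (simp add: M.submodule_iff)
    \<comment> \<open>The projections were obtained only with \<open>p x + q x = x\<close>;
      directness of the sum is used to compute them on elements of \<open>V\<close> and
      \<open>W\<close>.\<close>
    have uniq: "p x = v \<and> q x = w" if v: "v \<in> V" "w \<in> W" "x = v \<oplus>\<^bsub>M\<^esub> w" for v w x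
    proof -
      have vw: "v \<in> U" "w \<in> U" using d(5)[OF v(1)] d(6)[OF v(2)] by simp_all
      then have xU: "x \<in> U" using v(3) U by (simp add: M.submodule_iff)
      have c: "p x \<in> carrier M" "q x \<in> carrier M" "v \<in> carrier M" "w \<in> carrier M" using pq[OF xU] vw Uc by auto
      have e: "p x \<ominus>\<^bsub>M\<^esub> v = w \<ominus>\<^bsub>M\<^esub> q x" using M.M.add_diff_swap[OF c(1,2,3,4)] pq(5)[OF xU] v(3) by simp
      have Vs: "submodule V A M" "submodule W A M" using d(1,2) by (simp_all add: M.submodule_submodule_iff[OF U])
      have "p x \<ominus>\<^bsub>M\<^esub> v \<in> V" "w \<ominus>\<^bsub>M\<^esub> q x \<in> W"
        using M.diff_mem_submodule[OF Vs(1) pq(1)[OF xU] v(1)] M.diff_mem_submodule[OF Vs(2) v(2) pq(2)[OF xU]] by simp_all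
      then have "p x \<ominus>\<^bsub>M\<^esub> v = \<zero>\<^bsub>M\<^esub>" "w \<ominus>\<^bsub>M\<^esub> q x = \<zero>\<^bsub>M\<^esub>" using e d(3) by auto
      then have "p x = v" "w = q x" using M.M.diff_eq_zero c by blast+
      then show ?thesis by simp
    qed
    have z: "\<zero>\<^bsub>M\<^esub> \<in> V" "\<zero>\<^bsub>M\<^esub> \<in> W" using d(3) by auto
    show "?P U"
      unfolding projective_kernels_def
    proof (intro ballI impI)
      fix Q g assume Q: "Q \<in> mod_cat A" and g: "g \<in> rmod_hom A Q ?U" and Qp: "projective A Q \<and> g ` carrier Q = carrier ?U"
      have Qm: "right_module A Q" using Q by (rule mod_catD)
      interpret Q: right_module A Q by fact
      have gU: "g x \<in> U" if "x \<in> carrier Q" for x using rmod_hom_closed[OF g that] by simp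
      let ?pg = "compose (carrier Q) p g" and ?qg = "compose (carrier Q) q g"
      have pg: "?pg \<in> rmod_hom A Q ?V" by (rule rmod_hom_compose[OF Qm g p])
      have qg: "?qg \<in> rmod_hom A Q ?W" by (rule rmod_hom_compose[OF Qm g q])
      have Vm: "right_module A ?V" and Wm: "right_module A ?W"
        using U.right_module_submodule[OF d(1)] U.right_module_submodule[OF d(2)] by simp_all
      let ?K = "{x \<in> carrier Q. ?pg x = \<zero>\<^bsub>?V\<^esub>}"
      have onV: "?pg ` carrier Q = carrier ?V"
      proof
        show "?pg ` carrier Q \<subseteq> carrier ?V" using rmod_hom_closed[OF pg] by blast
        show "carrier ?V \<subseteq> ?pg ` carrier Q"
        proof
          fix v assume "v \<in> carrier ?V"
          then have v: "v \<in> V" by simp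
          have vU: "v \<in> U" using d(5)[OF v] by simp
          then obtain x where x: "x \<in> carrier Q" "v = g x" using Qp by auto
          have "p v = v" using uniq[OF v z(2), of v] vU Uc by auto
          then have "?pg x = v" using x by (simp add: compose_def)
          then show "v \<in> ?pg ` carrier Q" using x(1) by blast
        qed
      qed
      have Kp: "projective A (Q\<lparr>carrier := ?K\<rparr>)" using P(1) Q pg Qp onV unfolding projective_kernels_def by blast
      have Ks: "submodule ?K A Q" by (rule submodule_kernel[OF Qm Vm pg])
      have Kc: "Q\<lparr>carrier := ?K\<rparr> \<in> mod_cat A" by (rule mod_cat_submodule[OF Q Ks])
      have qK: "restrict ?qg ?K \<in> rmod_hom A (Q\<lparr>carrier := ?K\<rparr>) ?W" by (rule rmod_hom_restrict_dom[OF Qm qg Ks])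
      \<comment> \<open>A preimage \<open>x\<close> of an element of \<open>W\<close> has
        \<open>V\<close>-component zero, so it already lies in \<open>?K\<close>.\<close>
      have onW: "restrict ?qg ?K ` carrier (Q\<lparr>carrier := ?K\<rparr>) = carrier ?W"
      proof
        show "restrict ?qg ?K ` carrier (Q\<lparr>carrier := ?K\<rparr>) \<subseteq> carrier ?W" using rmod_hom_closed[OF qK] by blast
        show "carrier ?W \<subseteq> restrict ?qg ?K ` carrier (Q\<lparr>carrier := ?K\<rparr>)"
        proof
          fix w assume "w \<in> carrier ?W"
          then have w: "w \<in> W" by simp
          have wU: "w \<in> U" using d(6)[OF w] by simp
          then obtain x where x: "x \<in> carrier Q" "w = g x" using Qp by auto
          have pw: "p w = \<zero>\<^bsub>M\<^esub>" "q w = w" using uniq[OF z(1) w, of w] wU Uc by auto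
          have "x \<in> ?K" using x pw by (simp add: compose_def)
          moreover have "restrict ?qg ?K x = w" using calculation x pw by (simp add: compose_def)
          ultimately show "w \<in> restrict ?qg ?K ` carrier (Q\<lparr>carrier := ?K\<rparr>)" by force
        qed
      qed
      have "projective A ((Q\<lparr>carrier := ?K\<rparr>)\<lparr>carrier := {x \<in> carrier (Q\<lparr>carrier := ?K\<rparr>). restrict ?qg ?K x = \<zero>\<^bsub>?W\<^esub>}\<rparr>)"
        using P(2) Kc qK Kp onW unfolding projective_kernels_def by blast
      moreover have "{x \<in> carrier (Q\<lparr>carrier := ?K\<rparr>). restrict ?qg ?K x = \<zero>\<^bsub>?W\<^esub>} = {x \<in> carrier Q. g x = \<zero>\<^bsub>?U\<^esub>}"
      proof -
        have zz: "p \<zero>\<^bsub>M\<^esub> = \<zero>\<^bsub>M\<^esub>" "q \<zero>\<^bsub>M\<^esub> = \<zero>\<^bsub>M\<^esub>" using uniq[OF z, of "\<zero>\<^bsub>M\<^esub>"] by simp_all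
        have "(p (g x) = \<zero>\<^bsub>M\<^esub> \<and> q (g x) = \<zero>\<^bsub>M\<^esub>) \<longleftrightarrow> g x = \<zero>\<^bsub>M\<^esub>" if "x \<in> carrier Q" for x
          using pq(5)[OF gU[OF that]] zz by auto
        then show ?thesis by (auto simp: compose_def)
      qed
      ultimately show "projective A (Q\<lparr>carrier := {x \<in> carrier Q. g x = \<zero>\<^bsub>?U\<^esub>}\<rparr>)" by simp
    qed
  qed
  then show ?thesis by simp
qed

lemma projective_submodule:
  assumes P: "P \<in> \<C>" "projective A P" and U: "submodule U A P"
  shows "projective A (P\<lparr>carrier := U\<rparr>)"
proof -
  obtain N c where N: "N \<in> \<C>" "c \<in> rmod_hom A P N" "c ` carrier P = carrier N" "{x \<in> carrier P. c x = \<zero>\<^bsub>N\<^esub>} = U"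
    by (rule \<C>_quotient[OF P(1) U])
  have "projective A (P\<lparr>carrier := {x \<in> carrier P. c x = \<zero>\<^bsub>N\<^esub>}\<rparr>)"
    using projective_kernels_\<C>[OF N(1)] \<C>D(1)[OF P(1)] N(2,3) P(2) unfolding projective_kernels_def by blast
  then show ?thesis using N(4) by simp
qed

end

section \<open>Hereditary endomorphism rings\<close>

lemma rmod_End_simps [simp]:
  "carrier (rmod_End A M) = rmod_hom A M M"
  "\<zero>\<^bsub>rmod_End A M\<^esub> = zero_hom M M"
  "\<one>\<^bsub>rmod_End A M\<^esub> = (\<lambda>x\<in>carrier M. x)"
  "f \<oplus>\<^bsub>rmod_End A M\<^esub> g = (\<lambda>x\<in>carrier M. f x \<oplus>\<^bsub>M\<^esub> g x)"
  "f \<otimes>\<^bsub>rmod_End A M\<^esub> g = compose (carrier M) f g"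
  by (simp_all add: rmod_End_def)

text \<open>\<open>finsum\<close> is evaluated in a record, so sums taken in a submodule and in the
  whole module must be identified; the inclusion homomorphism does it.\<close>

lemma (in right_module) finsum_submodule:
  assumes U: "submodule U A M" and S: "finite S" "\<And>i. i \<in> S \<Longrightarrow> \<phi> i \<in> U"
  shows "(\<Oplus>\<^bsub>M\<lparr>carrier := U\<rparr>\<^esub>i\<in>S. \<phi> i) = (\<Oplus>\<^bsub>M\<^esub>i\<in>S. \<phi> i)"
proof -
  have m: "right_module A (M\<lparr>carrier := U\<rparr>)" by (rule right_module_submodule) fact
  interpret U: right_module A "M\<lparr>carrier := U\<rparr>" by fact
  have Uc: "U \<subseteq> carrier M" using U by (simp add: submodule_iff)
  have i: "(\<lambda>x\<in>U. x) \<in> rmod_hom A (M\<lparr>carrier := U\<rparr>) M" by (rule rmod_hom_inclusion[OF right_module_axioms U])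
  have c: "(\<Oplus>\<^bsub>M\<lparr>carrier := U\<rparr>\<^esub>i\<in>S. \<phi> i) \<in> U" using U.M.finsum_closed[of \<phi> S] S by auto
  have "(\<lambda>x\<in>U. x) (\<Oplus>\<^bsub>M\<lparr>carrier := U\<rparr>\<^esub>i\<in>S. \<phi> i) = (\<Oplus>\<^bsub>M\<^esub>i\<in>S. (\<lambda>x\<in>U. x) (\<phi> i))"
    by (rule rmod_hom_finsum[OF m right_module_axioms i S(1)]) (use S in simp)
  also have "\<dots> = (\<Oplus>\<^bsub>M\<^esub>i\<in>S. \<phi> i)" by (rule M.finsum_cong') (use S Uc in auto)
  finally show ?thesis using c by simp
qed

context right_module
begin

lemma End_add: "f \<in> rmod_hom A M M \<Longrightarrow> g \<in> rmod_hom A M M \<Longrightarrow> (\<lambda>x\<in>carrier M. f x \<oplus>\<^bsub>M\<^esub> g x) \<in> rmod_hom A M M"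
  by (rule rmod_hom_restrictI[OF _ _ _ right_module_axioms])
     (simp_all add: rmod_hom_closed rmod_hom_add rmod_hom_smult M.a_ac smult_r_distr)

lemma ring_End: "ring (rmod_End A M)"
proof (rule ringI)
  let ?E = "rmod_End A M"
  note cl = rmod_hom_closed[of _ A M M]
  note eq = rmod_hom_ext[of _ A M M _ M]
  note comp = rmod_hom_compose[OF right_module_axioms]
  show "abelian_group ?E"
  proof (rule abelian_groupI)
    fix f g assume f: "f \<in> carrier ?E" and g: "g \<in> carrier ?E"
    show "f \<oplus>\<^bsub>?E\<^esub> g \<in> carrier ?E" using End_add f g by simp
    show "f \<oplus>\<^bsub>?E\<^esub> g = g \<oplus>\<^bsub>?E\<^esub> f" using f g by (auto intro!: restrict_ext simp: cl M.a_comm)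
    fix h assume h: "h \<in> carrier ?E"
    show "f \<oplus>\<^bsub>?E\<^esub> g \<oplus>\<^bsub>?E\<^esub> h = f \<oplus>\<^bsub>?E\<^esub> (g \<oplus>\<^bsub>?E\<^esub> h)"
      using f g h by (auto intro!: restrict_ext simp: cl M.a_assoc)
  next
    show "\<zero>\<^bsub>?E\<^esub> \<in> carrier ?E" using zero_hom_mem[OF right_module_axioms right_module_axioms] by simp
    fix f assume f: "f \<in> carrier ?E"
    then have f': "f \<in> rmod_hom A M M" by simp
    have z: "zero_hom M M \<in> rmod_hom A M M" by (rule zero_hom_mem[OF right_module_axioms right_module_axioms])
    show "\<zero>\<^bsub>?E\<^esub> \<oplus>\<^bsub>?E\<^esub> f = f"
      unfolding rmod_End_simps by (rule eq[OF End_add[OF z f'] f']) (simp add: zero_hom_def cl[OF f'])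
    let ?g = "\<lambda>x\<in>carrier M. \<ominus>\<^bsub>M\<^esub> f x"
    have g: "?g \<in> rmod_hom A M M"
    proof (rule rmod_hom_restrictI[OF _ _ _ right_module_axioms])
      show "\<ominus>\<^bsub>M\<^esub> f x \<in> carrier M" if "x \<in> carrier M" for x using cl[OF f' that] by simp
      show "\<ominus>\<^bsub>M\<^esub> f (x \<oplus>\<^bsub>M\<^esub> y) = \<ominus>\<^bsub>M\<^esub> f x \<oplus>\<^bsub>M\<^esub> \<ominus>\<^bsub>M\<^esub> f y" if "x \<in> carrier M" "y \<in> carrier M" for x y
        using that cl[OF f'] by (simp add: rmod_hom_add[OF f'] M.minus_add)
      show "\<ominus>\<^bsub>M\<^esub> f (a \<odot>\<^bsub>M\<^esub> x) = a \<odot>\<^bsub>M\<^esub> \<ominus>\<^bsub>M\<^esub> f x" if ax: "a \<in> carrier A" "x \<in> carrier M" for a x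
      proof -
        have "\<ominus>\<^bsub>M\<^esub> f (a \<odot>\<^bsub>M\<^esub> x) = f (\<ominus>\<^bsub>M\<^esub> (a \<odot>\<^bsub>M\<^esub> x))"
          using rmod_hom_minus[OF right_module_axioms right_module_axioms f'] ax by simp
        also have "\<ominus>\<^bsub>M\<^esub> (a \<odot>\<^bsub>M\<^esub> x) = a \<odot>\<^bsub>M\<^esub> \<ominus>\<^bsub>M\<^esub> x"
          using ax by (intro M.minus_equality) (simp_all add: smult_r_distr[symmetric] M.l_neg smult_zero_right)
        finally show ?thesis
          using ax rmod_hom_minus[OF right_module_axioms right_module_axioms f'] by (simp add: rmod_hom_smult[OF f'])
      qed
    qed
    have "?g \<oplus>\<^bsub>?E\<^esub> f = \<zero>\<^bsub>?E\<^esub>"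
      unfolding rmod_End_simps by (rule eq[OF End_add[OF g f'] z]) (simp add: zero_hom_def cl[OF f'] M.l_neg)
    then show "\<exists>g\<in>carrier ?E. g \<oplus>\<^bsub>?E\<^esub> f = \<zero>\<^bsub>?E\<^esub>" by (rule bexI[of _ ?g]) (use g in simp)
  qed
  have id: "(\<lambda>x\<in>carrier M. x) \<in> rmod_hom A M M" by (rule rmod_hom_id[OF right_module_axioms])
  show "monoid ?E"
  proof (rule monoidI)
    fix f g h assume f: "f \<in> carrier ?E" and g: "g \<in> carrier ?E" and h: "h \<in> carrier ?E"
    show "f \<otimes>\<^bsub>?E\<^esub> g \<in> carrier ?E" using comp f g by simp
    show "f \<otimes>\<^bsub>?E\<^esub> g \<otimes>\<^bsub>?E\<^esub> h = f \<otimes>\<^bsub>?E\<^esub> (g \<otimes>\<^bsub>?E\<^esub> h)"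
      using f g h by (auto intro!: restrict_ext simp: compose_def cl)
  next
    show "\<one>\<^bsub>?E\<^esub> \<in> carrier ?E" using id by simp
    fix f assume f: "f \<in> carrier ?E"
    then have f': "f \<in> rmod_hom A M M" by simp
    show "\<one>\<^bsub>?E\<^esub> \<otimes>\<^bsub>?E\<^esub> f = f"
      unfolding rmod_End_simps by (rule eq[OF comp[OF f' id] f']) (simp add: compose_def cl[OF f'])
    show "f \<otimes>\<^bsub>?E\<^esub> \<one>\<^bsub>?E\<^esub> = f"
      unfolding rmod_End_simps by (rule eq[OF comp[OF id f'] f']) (simp add: compose_def)
  qed
  fix f g h assume f: "f \<in> carrier ?E" and g: "g \<in> carrier ?E" and h: "h \<in> carrier ?E"
  show "(f \<oplus>\<^bsub>?E\<^esub> g) \<otimes>\<^bsub>?E\<^esub> h = f \<otimes>\<^bsub>?E\<^esub> h \<oplus>\<^bsub>?E\<^esub> g \<otimes>\<^bsub>?E\<^esub> h"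
    using f g h by (auto intro!: restrict_ext simp: compose_def cl)
  show "h \<otimes>\<^bsub>?E\<^esub> (f \<oplus>\<^bsub>?E\<^esub> g) = h \<otimes>\<^bsub>?E\<^esub> f \<oplus>\<^bsub>?E\<^esub> h \<otimes>\<^bsub>?E\<^esub> g"
    using f g h by (auto intro!: restrict_ext simp: compose_def cl rmod_hom_add[of h])
qed

text \<open>
  A right ideal \<open>I\<close> of \<open>End(M)\<close> is \<open>Hom(M, U)\<close> for the submodule \<open>U = IM = \<Sum>f\<^sub>i(M)\<close>. A splitting
  \<open>(s\<^sub>i)\<close> of \<open>M\<^sup>n \<rightarrow> U\<close> yields a dual basis of \<open>I\<close>, because \<open>x = \<Sum>f\<^sub>i(s\<^sub>ix)\<close> for all \<open>x \<in> I\<close>.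
\<close>

lemma hereditary_End:
  assumes fg: "fin_gen A M" and noeth: "noetherian_module A M"
    and proj: "\<And>U. submodule U A M \<Longrightarrow> projective A (M\<lparr>carrier := U\<rparr>)"
  shows "hereditary (rmod_End A M)"
  unfolding hereditary_def
proof (intro allI impI)
  let ?E = "rmod_End A M"
  let ?R = "regular_module ?E"
  interpret E: ring ?E by (rule ring_End)
  interpret R: right_module ?E ?R by (rule E.right_module_regular)
  fix I assume I: "submodule I ?E ?R"
  let ?I = "?R\<lparr>carrier := I\<rparr>"
  have Im: "right_module ?E ?I" by (rule R.right_module_submodule[OF I])
  interpret I: right_module ?E ?I by (rule Im)
  have Is: "I \<subseteq> rmod_hom A M M" "\<And>f a. a \<in> rmod_hom A M M \<Longrightarrow> f \<in> I \<Longrightarrow> compose (carrier M) f a \<in> I"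
    using I by (auto simp: R.submodule_iff)
  \<comment> \<open>For a submodule \<open>U\<close>, \<open>P U\<close> says that \<open>U\<close>
    is the sum of the images of finitely many members of \<open>I\<close>. Maximality among such
    \<open>U\<close> forces \<open>g(M) \<subseteq> U\<close> for every \<open>g\<close> in
    \<open>I\<close>, so \<open>U\<close> is the submodule \<open>IM\<close>.\<close>
  define P where "P U \<longleftrightarrow> (\<exists>(n::nat) f. (\<forall>i<n. f i \<in> I) \<and> (\<forall>i<n. \<forall>x\<in>carrier M. f i x \<in> U) \<and>
     (\<forall>y\<in>U. \<exists>z\<in>(\<Pi>\<^sub>E i\<in>{..<n}. carrier M). y = (\<Oplus>\<^bsub>M\<^esub>i\<in>{..<n}. f i (z i))))" for U
  have P0: "P {\<zero>\<^bsub>M\<^esub>}" unfolding P_def by (rule exI[of _ 0]) auto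
  obtain U where U: "submodule U A M" "P U" "\<forall>W. submodule W A M \<longrightarrow> U \<subset> W \<longrightarrow> \<not> P W"
    using noetherian_maximal[where P = P, OF noeth submodule_zero P0] by auto
  have Uc: "U \<subseteq> carrier M" "\<zero>\<^bsub>M\<^esub> \<in> U" using U(1) by (simp_all add: submodule_iff)
  obtain n :: nat and f where f: "\<forall>i<n. f i \<in> I" "\<forall>i<n. \<forall>x\<in>carrier M. f i x \<in> U"
     "\<forall>y\<in>U. \<exists>z\<in>(\<Pi>\<^sub>E i\<in>{..<n}. carrier M). y = (\<Oplus>\<^bsub>M\<^esub>i\<in>{..<n}. f i (z i))"
    using U(2) unfolding P_def by (elim exE conjE)
  have fh: "f i \<in> rmod_hom A M M" if "i < n" for i using f(1) Is(1) that by blast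
  have gU: "g x \<in> U" if g: "g \<in> I" and x: "x \<in> carrier M" for g x
  proof -
    have gh: "g \<in> rmod_hom A M M" using g Is(1) by blast
    let ?G = "g ` carrier M"
    have G: "submodule ?G A M" by (rule submodule_image[OF right_module_axioms right_module_axioms gh submodule_carrier])
    have Gs: "?G \<subseteq> carrier M" "\<zero>\<^bsub>M\<^esub> \<in> ?G" using G by (simp_all add: submodule_iff)
    have UG: "u \<in> U <+>\<^bsub>M\<^esub> ?G" if "u \<in> U" for u
    proof -
      have "u = u \<oplus>\<^bsub>M\<^esub> \<zero>\<^bsub>M\<^esub>" using that Uc by auto
      then show ?thesis using that Gs(2) unfolding set_add_def' by blast
    qed
    have GG: "y \<in> U <+>\<^bsub>M\<^esub> ?G" if "y \<in> ?G" for y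
    proof -
      have "y \<in> carrier M" using that Gs(1) by blast
      then have "y = \<zero>\<^bsub>M\<^esub> \<oplus>\<^bsub>M\<^esub> y" by simp
      then show ?thesis using that Uc(2) unfolding set_add_def' by blast
    qed
    let ?f = "f(n := g)"
    have "P (U <+>\<^bsub>M\<^esub> ?G)" unfolding P_def
    proof (intro exI[of _ "Suc n"] exI[of _ ?f] conjI allI impI ballI)
      fix i assume i: "i < Suc n"
      show "?f i \<in> I" using i f(1) g by (auto simp: less_Suc_eq)
      fix x assume "x \<in> carrier M"
      then show "?f i x \<in> U <+>\<^bsub>M\<^esub> ?G" using i f(2) UG GG by (auto simp: less_Suc_eq)
    next
      fix y assume "y \<in> U <+>\<^bsub>M\<^esub> ?G"
      then obtain u x where ux: "u \<in> U" "x \<in> carrier M" "y = u \<oplus>\<^bsub>M\<^esub> g x" by (auto simp: set_add_def')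
      obtain z where z: "z \<in> (\<Pi>\<^sub>E i\<in>{..<n}. carrier M)" "u = (\<Oplus>\<^bsub>M\<^esub>i\<in>{..<n}. f i (z i))" using f(3) ux(1) by blast
      let ?z = "z(n := x)"
      have zc: "z i \<in> carrier M" if "i < n" for i using z(1) that by auto
      have gx: "g x \<in> carrier M" using rmod_hom_closed[OF gh ux(2)] .
      have fz: "f i (z i) \<in> carrier M" if "i < n" for i using rmod_hom_closed[OF fh zc] that by blast
      have "?z \<in> (\<Pi>\<^sub>E i\<in>{..<Suc n}. carrier M)" using z(1) ux(2) by (auto simp: PiE_iff extensional_def)
      moreover have "y = (\<Oplus>\<^bsub>M\<^esub>i\<in>{..<Suc n}. ?f i (?z i))"
      proof -
        have e: "(\<Oplus>\<^bsub>M\<^esub>i\<in>{..<n}. ?f i (?z i)) = u"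
          unfolding z(2) by (rule M.finsum_cong') (use fz in auto)
        have "(\<Oplus>\<^bsub>M\<^esub>i\<in>insert n {..<n}. ?f i (?z i)) = ?f n (?z n) \<oplus>\<^bsub>M\<^esub> (\<Oplus>\<^bsub>M\<^esub>i\<in>{..<n}. ?f i (?z i))"
          by (rule M.finsum_insert) (use fz gx in auto)
        then show ?thesis unfolding e ux(3) using ux(1) Uc gx by (simp add: lessThan_Suc M.a_comm subset_iff)
      qed
      ultimately show "\<exists>z\<in>(\<Pi>\<^sub>E i\<in>{..<Suc n}. carrier M). y = (\<Oplus>\<^bsub>M\<^esub>i\<in>{..<Suc n}. ?f i (z i))" by blast
    qed
    then have "\<not> U \<subset> U <+>\<^bsub>M\<^esub> ?G" using U(3) submodule_sum[OF U(1) G] by blast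
    then have "U <+>\<^bsub>M\<^esub> ?G \<subseteq> U" using UG by blast
    then show ?thesis using GG x by blast
  qed
  let ?U = "M\<lparr>carrier := U\<rparr>"
  \<comment> \<open>\<open>projective_family\<close> is applied to the maps \<open>f i\<close> from
    copies of \<open>M\<close> onto the projective module \<open>U\<close>; the \<open>s i\<close>
    are the components of the splitting.\<close>
  obtain s where s: "\<And>i. i \<in> {..<n} \<Longrightarrow> s i \<in> rmod_hom A ?U M"
    "\<And>y. y \<in> carrier ?U \<Longrightarrow> y = (\<Oplus>\<^bsub>?U\<^esub>i\<in>{..<n}. f i (s i y))"
  proof (rule projective_family[OF proj[OF U(1)], of "{..<n}" "\<lambda>_. M" f])
    show "f i \<in> rmod_hom A M ?U" if "i \<in> {..<n}" for i
      by (rule rmod_hom_codom_restrict[OF fh]) (use f(2) that in auto)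
    show "\<exists>z\<in>(\<Pi>\<^sub>E i\<in>{..<n}. carrier M). y = (\<Oplus>\<^bsub>?U\<^esub>i\<in>{..<n}. f i (z i))" if y: "y \<in> carrier ?U" for y
    proof -
      obtain z where z: "z \<in> (\<Pi>\<^sub>E i\<in>{..<n}. carrier M)" "y = (\<Oplus>\<^bsub>M\<^esub>i\<in>{..<n}. f i (z i))" using f(3) y by auto
      have "(\<Oplus>\<^bsub>?U\<^esub>i\<in>{..<n}. f i (z i)) = (\<Oplus>\<^bsub>M\<^esub>i\<in>{..<n}. f i (z i))"
        by (rule finsum_submodule[OF U(1)]) (use f(2) z(1) in auto)
      then show ?thesis using z by metis
    qed
    fix s assume "\<And>i. i \<in> {..<n} \<Longrightarrow> s i \<in> rmod_hom A ?U M"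
      "\<And>y. y \<in> carrier ?U \<Longrightarrow> y = (\<Oplus>\<^bsub>?U\<^esub>i\<in>{..<n}. f i (s i y))"
    then show thesis by (rule that)
  qed (simp_all add: fg right_module_axioms)
  have sU: "s i y \<in> carrier M" if "i < n" "y \<in> U" for i y using rmod_hom_closed[OF s(1), of i y] that by simp
  have s2: "y = (\<Oplus>\<^bsub>M\<^esub>i\<in>{..<n}. f i (s i y))" if y: "y \<in> U" for y
  proof -
    have "(\<Oplus>\<^bsub>?U\<^esub>i\<in>{..<n}. f i (s i y)) = (\<Oplus>\<^bsub>M\<^esub>i\<in>{..<n}. f i (s i y))"
      by (rule finsum_submodule[OF U(1)]) (use f(2) sU y in auto)
    then show ?thesis using s(2)[of y] y by simp
  qed
  \<comment> \<open>These are the coordinate functionals of the dual basis: \<open>t i\<close> sends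
    \<open>x\<close> in \<open>I\<close> to the endomorphism obtained by following \<open>x\<close>
    with \<open>s i\<close>, and it is linear over the endomorphism ring.\<close>
  define t where "t i x = compose (carrier M) (s i) x" for i x
  have t: "t i x \<in> rmod_hom A M M" if "i < n" "x \<in> I" for i x
    unfolding t_def
  proof (rule rmod_hom_compose[OF right_module_axioms _ s(1)])
    show "x \<in> rmod_hom A M ?U" by (rule rmod_hom_codom_restrict) (use gU that Is(1) in auto)
  qed (use that in simp)
  have t_add: "t i (x \<oplus>\<^bsub>?I\<^esub> y) = t i x \<oplus>\<^bsub>?E\<^esub> t i y" if "i < n" "x \<in> I" "y \<in> I" for i x y
  proof -
    have "s i (x m \<oplus>\<^bsub>M\<^esub> y m) = s i (x m) \<oplus>\<^bsub>M\<^esub> s i (y m)" if "m \<in> carrier M" for m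
      using rmod_hom_add[OF s(1), of i "x m" "y m"] gU[OF \<open>x \<in> I\<close> that] gU[OF \<open>y \<in> I\<close> that] \<open>i < n\<close> by simp
    then show ?thesis by (simp add: t_def compose_def cong: restrict_cong)
  qed
  have t_smult: "t i (a \<odot>\<^bsub>?I\<^esub> x) = t i x \<otimes>\<^bsub>?E\<^esub> a" if "i < n" "x \<in> I" "a \<in> rmod_hom A M M" for i x a
    using rmod_hom_closed[OF that(3)] by (simp add: t_def compose_def cong: restrict_cong)
  have fI: "compose (carrier M) (f i) (t i x) \<in> I" if "i < n" "x \<in> I" for i x
    by (rule Is(2)[OF t[OF that]]) (use f(1) that in blast)
  have eval: "(\<Oplus>\<^bsub>?I\<^esub>i\<in>T. \<phi> i) \<in> I \<and> (\<Oplus>\<^bsub>?I\<^esub>i\<in>T. \<phi> i) m = (\<Oplus>\<^bsub>M\<^esub>i\<in>T. \<phi> i m)"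
    if "finite T" "\<And>i. i \<in> T \<Longrightarrow> \<phi> i \<in> I" and m: "m \<in> carrier M" for T m and \<phi> :: "nat \<Rightarrow> _"
    using that(1,2)
  proof induction
    case empty
    have "zero_hom M M \<in> I" using I by (simp add: R.submodule_iff)
    moreover have "zero_hom M M m = \<zero>\<^bsub>M\<^esub>" using m by (simp add: zero_hom_def)
    ultimately show ?case by simp
  next
    case (insert i T)
    have 1: "(\<Oplus>\<^bsub>?I\<^esub>i\<in>insert i T. \<phi> i) = \<phi> i \<oplus>\<^bsub>?I\<^esub> (\<Oplus>\<^bsub>?I\<^esub>i\<in>T. \<phi> i)"
      using insert by (intro I.M.finsum_insert) auto
    have \<phi>m: "\<phi> j m \<in> carrier M" if "j \<in> insert i T" for j
      using rmod_hom_closed[OF _ m] insert.prems[OF that] Is(1) by blast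
    have 2: "(\<Oplus>\<^bsub>M\<^esub>i\<in>insert i T. \<phi> i m) = \<phi> i m \<oplus>\<^bsub>M\<^esub> (\<Oplus>\<^bsub>M\<^esub>i\<in>T. \<phi> i m)"
      using insert \<phi>m by (intro M.finsum_insert) auto
    moreover have "\<phi> i \<oplus>\<^bsub>?I\<^esub> (\<Oplus>\<^bsub>?I\<^esub>i\<in>T. \<phi> i) \<in> I"
      using I.M.a_closed[of "\<phi> i" "\<Oplus>\<^bsub>?I\<^esub>i\<in>T. \<phi> i"] insert by simp
    moreover have "(\<phi> i \<oplus>\<^bsub>?I\<^esub> (\<Oplus>\<^bsub>?I\<^esub>i\<in>T. \<phi> i)) m = \<phi> i m \<oplus>\<^bsub>M\<^esub> (\<Oplus>\<^bsub>M\<^esub>i\<in>T. \<phi> i m)"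
      using insert m by simp
    ultimately show ?case unfolding 1 2 by blast
  qed
  have expand: "x = (\<Oplus>\<^bsub>?I\<^esub>i\<in>{..<n}. compose (carrier M) (f i) (t i x))" (is "x = ?y") if x: "x \<in> I" for x
  proof -
    have \<phi>: "\<And>i. i \<in> {..<n} \<Longrightarrow> compose (carrier M) (f i) (t i x) \<in> I" using fI x by simp
    have yI: "?y \<in> I" using I.M.finsum_closed[of "\<lambda>i. compose (carrier M) (f i) (t i x)" "{..<n}"] \<phi> by auto
    show ?thesis
    proof (rule rmod_hom_ext[of _ A M M _ M])
      show "x \<in> rmod_hom A M M" "?y \<in> rmod_hom A M M" using x yI Is(1) by blast+
      fix m assume m: "m \<in> carrier M"
      have xm: "x m \<in> U" by (rule gU[OF x m])
      have "?y m = (\<Oplus>\<^bsub>M\<^esub>i\<in>{..<n}. compose (carrier M) (f i) (t i x) m)"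
        by (rule eval[where T = "{..<n}" and \<phi> = "\<lambda>i. compose (carrier M) (f i) (t i x)",
              OF finite_lessThan \<phi> m, THEN conjunct2])
      also have "\<dots> = (\<Oplus>\<^bsub>M\<^esub>i\<in>{..<n}. f i (s i (x m)))"
        by (rule M.finsum_cong') (use m sU xm rmod_hom_closed[OF fh] in \<open>auto simp: compose_def t_def\<close>)
      finally show "x m = ?y m" using s2[OF xm] by simp
    qed
  qed
  show "projective ?E ?I"
  proof (rule projectiveI[OF Im])
    fix X N :: "('m \<Rightarrow> 'm) fg_module" and g h
    assume a: "right_module ?E X" "right_module ?E N" "g \<in> rmod_hom ?E X N" "h \<in> rmod_hom ?E ?I N"
      "g ` carrier X = carrier N"
    interpret X: right_module ?E X by (rule a)
    interpret N: right_module ?E N by (rule a)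
    have "\<forall>i\<in>{..<n}. \<exists>m. m \<in> carrier X \<and> g m = h (f i)"
    proof
      fix i assume "i \<in> {..<n}"
      then have "h (f i) \<in> carrier N" using rmod_hom_closed[OF a(4), of "f i"] f(1) by simp
      then have "h (f i) \<in> g ` carrier X" by (simp only: a(5))
      then obtain m where "h (f i) = g m" "m \<in> carrier X" by (rule imageE)
      then show "\<exists>m. m \<in> carrier X \<and> g m = h (f i)" by (intro exI[of _ m]) simp
    qed
    from bchoice[OF this] obtain m where m: "\<forall>i\<in>{..<n}. m i \<in> carrier X \<and> g (m i) = h (f i)" by (elim exE)
    \<comment> \<open>Preimages \<open>m i\<close> of the \<open>h (f i)\<close>, combined with the
      coordinates \<open>t i x\<close>, define the lift. The dual basis expansion of
      \<open>x\<close> then gives \<open>g (?k x) = h x\<close>.\<close>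
    let ?k = "\<lambda>x\<in>carrier ?I. \<Oplus>\<^bsub>X\<^esub>i\<in>{..<n}. t i x \<odot>\<^bsub>X\<^esub> m i"
    have c: "t i x \<odot>\<^bsub>X\<^esub> m i \<in> carrier X" if "i < n" "x \<in> I" for i x
      using t[OF that] m that by simp
    have k: "?k \<in> rmod_hom ?E ?I X"
    proof (rule rmod_hom_restrictI[OF _ _ _ Im])
      show "(\<Oplus>\<^bsub>X\<^esub>i\<in>{..<n}. t i x \<odot>\<^bsub>X\<^esub> m i) \<in> carrier X" if "x \<in> carrier ?I" for x
        by (rule X.M.finsum_closed) (use c that in auto)
      show "(\<Oplus>\<^bsub>X\<^esub>i\<in>{..<n}. t i (x \<oplus>\<^bsub>?I\<^esub> y) \<odot>\<^bsub>X\<^esub> m i) =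
         (\<Oplus>\<^bsub>X\<^esub>i\<in>{..<n}. t i x \<odot>\<^bsub>X\<^esub> m i) \<oplus>\<^bsub>X\<^esub> (\<Oplus>\<^bsub>X\<^esub>i\<in>{..<n}. t i y \<odot>\<^bsub>X\<^esub> m i)"
        if "x \<in> carrier ?I" "y \<in> carrier ?I" for x y
      proof -
        have xy: "x \<in> I" "y \<in> I" using that by simp_all
        have "(\<Oplus>\<^bsub>X\<^esub>i\<in>{..<n}. t i (x \<oplus>\<^bsub>?I\<^esub> y) \<odot>\<^bsub>X\<^esub> m i) = (\<Oplus>\<^bsub>X\<^esub>i\<in>{..<n}. t i x \<odot>\<^bsub>X\<^esub> m i \<oplus>\<^bsub>X\<^esub> t i y \<odot>\<^bsub>X\<^esub> m i)"
        proof (rule X.M.finsum_cong')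
          fix i assume "i \<in> {..<n}"
          then have i: "i < n" "m i \<in> carrier X" using m by simp_all
          show "t i (x \<oplus>\<^bsub>?I\<^esub> y) \<odot>\<^bsub>X\<^esub> m i = t i x \<odot>\<^bsub>X\<^esub> m i \<oplus>\<^bsub>X\<^esub> t i y \<odot>\<^bsub>X\<^esub> m i"
            unfolding t_add[OF i(1) xy]
            by (rule X.smult_l_distr) (use t[OF i(1)] xy i(2) in simp_all)
        qed (use c xy in auto)
        also have "\<dots> = (\<Oplus>\<^bsub>X\<^esub>i\<in>{..<n}. t i x \<odot>\<^bsub>X\<^esub> m i) \<oplus>\<^bsub>X\<^esub> (\<Oplus>\<^bsub>X\<^esub>i\<in>{..<n}. t i y \<odot>\<^bsub>X\<^esub> m i)"
          by (rule X.M.finsum_addf) (use c xy in auto)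
        finally show ?thesis .
      qed
      show "(\<Oplus>\<^bsub>X\<^esub>i\<in>{..<n}. t i (b \<odot>\<^bsub>?I\<^esub> x) \<odot>\<^bsub>X\<^esub> m i) = b \<odot>\<^bsub>X\<^esub> (\<Oplus>\<^bsub>X\<^esub>i\<in>{..<n}. t i x \<odot>\<^bsub>X\<^esub> m i)"
        if "b \<in> carrier ?E" "x \<in> carrier ?I" for b x
      proof -
        have bx: "b \<in> rmod_hom A M M" "x \<in> I" using that by simp_all
        have "(\<Oplus>\<^bsub>X\<^esub>i\<in>{..<n}. t i (b \<odot>\<^bsub>?I\<^esub> x) \<odot>\<^bsub>X\<^esub> m i) = (\<Oplus>\<^bsub>X\<^esub>i\<in>{..<n}. b \<odot>\<^bsub>X\<^esub> (t i x \<odot>\<^bsub>X\<^esub> m i))"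
        proof (rule X.M.finsum_cong')
          fix i assume "i \<in> {..<n}"
          then have i: "i < n" "m i \<in> carrier X" using m by simp_all
          show "t i (b \<odot>\<^bsub>?I\<^esub> x) \<odot>\<^bsub>X\<^esub> m i = b \<odot>\<^bsub>X\<^esub> (t i x \<odot>\<^bsub>X\<^esub> m i)"
            unfolding t_smult[OF i(1) bx(2,1)]
            by (rule X.smult_assoc) (use t[OF i(1)] bx i(2) in simp_all)
        qed (use c bx that in auto)
        also have "\<dots> = b \<odot>\<^bsub>X\<^esub> (\<Oplus>\<^bsub>X\<^esub>i\<in>{..<n}. t i x \<odot>\<^bsub>X\<^esub> m i)"
          by (rule X.finsum_smult[symmetric]) (use c bx that in auto)
        finally show ?thesis .
      qed
    qed
    have "g (?k x) = h x" if "x \<in> carrier ?I" for x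
    proof -
      have x: "x \<in> I" using that by simp
      have "g (?k x) = g (\<Oplus>\<^bsub>X\<^esub>i\<in>{..<n}. t i x \<odot>\<^bsub>X\<^esub> m i)" using x by simp
      also have "\<dots> = (\<Oplus>\<^bsub>N\<^esub>i\<in>{..<n}. g (t i x \<odot>\<^bsub>X\<^esub> m i))"
        by (rule rmod_hom_finsum[OF a(1-3)]) (use c x in auto)
      also have "\<dots> = (\<Oplus>\<^bsub>N\<^esub>i\<in>{..<n}. h (compose (carrier M) (f i) (t i x)))"
      proof (rule N.M.finsum_cong')
        fix i assume "i \<in> {..<n}"
        then have i: "i < n" "m i \<in> carrier X" "g (m i) = h (f i)" "f i \<in> I" using m f(1) by simp_all
        have tc: "t i x \<in> carrier ?E" using t[OF i(1) x] by simp
        have "g (t i x \<odot>\<^bsub>X\<^esub> m i) = t i x \<odot>\<^bsub>N\<^esub> h (f i)" using rmod_hom_smult[OF a(3) tc i(2)] i(3) by simp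
        also have "\<dots> = h (t i x \<odot>\<^bsub>?I\<^esub> f i)" using rmod_hom_smult[OF a(4) tc, of "f i"] i(4) by simp
        finally show "g (t i x \<odot>\<^bsub>X\<^esub> m i) = h (compose (carrier M) (f i) (t i x))" by simp
      next
        show "(\<lambda>i. h (compose (carrier M) (f i) (t i x))) \<in> {..<n} \<rightarrow> carrier N"
          using rmod_hom_closed[OF a(4)] fI x by auto
      qed simp
      also have "\<dots> = h (\<Oplus>\<^bsub>?I\<^esub>i\<in>{..<n}. compose (carrier M) (f i) (t i x))"
        by (rule rmod_hom_finsum[OF Im a(2,4), symmetric]) (use fI x in auto)
      also have "\<dots> = h x" using expand[OF x] by metis
      finally show ?thesis .
    qed
    then show "\<exists>k\<in>rmod_hom ?E ?I X. \<forall>x\<in>carrier ?I. g (k x) = h x" using k by blast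
  qed
qed

end

section \<open>The left support\<close>

lemma indecomposable_iso:
  assumes M: "right_module A M" "indecomposable A M" and N: "right_module A N" and iso: "rmod_iso A M N"
  shows "indecomposable A N"
  unfolding indecomposable_def
proof (intro conjI allI impI)
  interpret M: right_module A M by (rule M)
  interpret N: right_module A N by (rule N)
  obtain f g where f: "f \<in> rmod_hom A M N" and g: "g \<in> rmod_hom A N M"
    and gf: "\<And>x. x \<in> carrier M \<Longrightarrow> g (f x) = x" and fg: "\<And>y. y \<in> carrier N \<Longrightarrow> f (g y) = y"
    by (rule rmod_isoE[OF iso M(1) N]) (rule that)
  note f0 = rmod_hom_zero[OF M(1) N f] and g0 = rmod_hom_zero[OF N M(1) g]
  obtain x where x: "x \<in> carrier M" "x \<noteq> \<zero>\<^bsub>M\<^esub>" using M(2) M.M.zero_closed unfolding indecomposable_def by blast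
  show "carrier N \<noteq> {\<zero>\<^bsub>N\<^esub>}"
  proof
    assume "carrier N = {\<zero>\<^bsub>N\<^esub>}"
    then have "f x = \<zero>\<^bsub>N\<^esub>" using rmod_hom_closed[OF f x(1)] by simp
    then show False using gf[OF x(1)] g0 x(2) by simp
  qed
  fix U V assume UV: "internal_sum A N U V"
  note d = N.internal_sumD[OF UV]
  have "internal_sum A M (g ` U) (g ` V)"
  proof (rule M.internal_sumI)
    show "submodule (g ` U) A M" "submodule (g ` V) A M"
      by (rule submodule_image[OF N M(1) g]; fact d)+
    show "g ` U \<inter> g ` V \<subseteq> {\<zero>\<^bsub>M\<^esub>}"
    proof
      fix x assume "x \<in> g ` U \<inter> g ` V"
      then obtain u v where uv: "u \<in> U" "v \<in> V" "x = g u" "x = g v" by blast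
      have "u = v" using fg[OF d(5)[OF uv(1)]] fg[OF d(6)[OF uv(2)]] uv(3,4) by metis
      then have "u = \<zero>\<^bsub>N\<^esub>" using uv(1,2) d(3) by blast
      then show "x \<in> {\<zero>\<^bsub>M\<^esub>}" using uv(3) g0 by simp
    qed
    fix x assume x: "x \<in> carrier M"
    obtain u v where uv: "u \<in> U" "v \<in> V" "f x = u \<oplus>\<^bsub>N\<^esub> v" using d(4)[OF rmod_hom_closed[OF f x]] by blast
    have "x = g u \<oplus>\<^bsub>M\<^esub> g v"
      using gf[OF x] uv(3) rmod_hom_add[OF g d(5)[OF uv(1)] d(6)[OF uv(2)]] by simp
    then show "\<exists>u\<in>g ` U. \<exists>v\<in>g ` V. x = u \<oplus>\<^bsub>M\<^esub> v" using uv by blast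
  qed
  then have e: "g ` U = {\<zero>\<^bsub>M\<^esub>} \<or> g ` V = {\<zero>\<^bsub>M\<^esub>}" using M(2) unfolding indecomposable_def by blast
  have z: "W = {\<zero>\<^bsub>N\<^esub>}" if "g ` W = {\<zero>\<^bsub>M\<^esub>}" "submodule W A N" for W
  proof -
    have Ws: "W \<subseteq> carrier N" "\<zero>\<^bsub>N\<^esub> \<in> W" using that(2) by (simp_all add: N.submodule_iff)
    have "w = \<zero>\<^bsub>N\<^esub>" if w: "w \<in> W" for w
    proof -
      have "g w = \<zero>\<^bsub>M\<^esub>" using w \<open>g ` W = {\<zero>\<^bsub>M\<^esub>}\<close> by blast
      then show ?thesis using fg[of w] Ws(1) w f0 by auto
    qed
    then show ?thesis using Ws(2) by blast
  qed
  show "U = {\<zero>\<^bsub>N\<^esub>} \<or> V = {\<zero>\<^bsub>N\<^esub>}" using e z[OF _ d(1)] z[OF _ d(2)] by blast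
qed

context left_abelian
begin

text \<open>The regular module and the supporting projective module have carriers outside the type
  of \<open>mod_cat\<close>, so they cannot be members of \<open>\<C>\<close>. A submodule is
  carried to a copy in \<open>\<C>\<close>, is projective there, and is carried back.\<close>

lemma projective_submodule_iso:
  assumes X: "right_module A X" "projective A X" and X': "X' \<in> \<C>" "rmod_iso A X X'" and U: "submodule U A X"
  shows "projective A (X\<lparr>carrier := U\<rparr>)"
proof -
  have X'm: "right_module A X'" using X'(1) by (rule \<C>D)
  interpret X: right_module A X by (rule X)
  interpret X': right_module A X' by (rule X'm)
  obtain a a' where a: "a \<in> rmod_hom A X X'" and a': "a' \<in> rmod_hom A X' X"
    and aa: "\<And>x. x \<in> carrier X \<Longrightarrow> a' (a x) = x" "\<And>y. y \<in> carrier X' \<Longrightarrow> a (a' y) = y"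
    by (rule rmod_isoE[OF X'(2) X(1) X'm]) (rule that)
  let ?V = "a ` U"
  have Uc: "U \<subseteq> carrier X" using U by (simp add: X.submodule_iff)
  have V: "submodule ?V A X'" by (rule submodule_image[OF X(1) X'm a U])
  have pV: "projective A (X'\<lparr>carrier := ?V\<rparr>)"
    by (rule projective_submodule[OF X'(1) projective_iso[OF X(2) X'(2) X'm] V])
  show ?thesis
  proof (rule projective_retract[OF pV X.right_module_submodule[OF U]])
    show "restrict a U \<in> rmod_hom A (X\<lparr>carrier := U\<rparr>) (X'\<lparr>carrier := ?V\<rparr>)"
      by (rule rmod_hom_codom_restrict[OF rmod_hom_restrict_dom[OF X(1) a U]]) simp
    show "restrict a' ?V \<in> rmod_hom A (X'\<lparr>carrier := ?V\<rparr>) (X\<lparr>carrier := U\<rparr>)"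
      by (rule rmod_hom_codom_restrict[OF rmod_hom_restrict_dom[OF X'm a' V]]) (use aa Uc in auto)
    show "restrict a' ?V (restrict a U x) = x" if "x \<in> carrier (X\<lparr>carrier := U\<rparr>)" for x
      using that aa(1) Uc by auto
  qed
qed

lemma mod_cat_copy_principal:
  assumes e: "primitive_idempotent A e"
  obtains P where "P \<in> ind_cat A" "projective A P" "rmod_iso A (principal_module A e) P"
proof -
  have ec: "e \<in> carrier A" "e \<otimes> e = e" using e by (auto simp: primitive_idempotent_def)
  obtain P where P: "P \<in> mod_cat A" "rmod_iso A (principal_module A e) P"
    using mod_cat_complete[OF right_module_principal[OF ec(1)] fin_gen_principal[OF ec(1)]] by blast
  have "indecomposable A P"
    by (rule indecomposable_iso[OF right_module_principal[OF ec(1)] indecomposable_principal[OF e] mod_catD(1)[OF P(1)] P(2)])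
  moreover have "projective A P" by (rule projective_iso[OF projective_principal[OF ec] P(2) mod_catD(1)[OF P(1)]])
  ultimately show thesis using that P by (simp add: ind_cat_def)
qed

text \<open>An isomorphism from a non-zero module is a non-zero map, so \<open>P\<close> is a
  predecessor of \<open>Q\<close>.\<close>

lemma ind_cat_iso_left_part:
  assumes P: "P \<in> ind_cat A" and Q: "Q \<in> left_part A" and iso: "rmod_iso A P Q"
  shows "P \<in> left_part A"
proof -
  have Pm: "right_module A P" using P by (simp add: ind_cat_def mod_cat_def)
  have Qm: "right_module A Q" using Q left_part_mod_cat mod_catD(1) by blast
  interpret P: right_module A P by fact
  obtain f g where f: "f \<in> rmod_hom A P Q" and g: "g \<in> rmod_hom A Q P"
    and gf: "\<And>x. x \<in> carrier P \<Longrightarrow> g (f x) = x" and fg: "\<And>y. y \<in> carrier Q \<Longrightarrow> f (g y) = y"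
    by (rule rmod_isoE[OF iso Pm Qm]) (rule that)
  obtain x where x: "x \<in> carrier P" "x \<noteq> \<zero>\<^bsub>P\<^esub>"
    using P P.M.zero_closed unfolding ind_cat_def indecomposable_def by blast
  have "f \<noteq> zero_hom P Q"
  proof
    assume "f = zero_hom P Q"
    then have "f x = \<zero>\<^bsub>Q\<^esub>" using x by (simp add: zero_hom_def)
    then show False using gf[OF x(1)] rmod_hom_zero[OF Qm Pm g] x(2) by simp
  qed
  then show ?thesis by (rule left_part_predecessor[OF P Q f])
qed

text \<open>The map from \<open>eA\<close> to \<open>X\<close> given by \<open>u\<close> takes
  \<open>e\<close> to \<open>ue\<close>. Read on the copy \<open>P\<close> of \<open>eA\<close>,
  which lies in \<open>\<C>\<close>, it has its image in \<open>T\<close>.\<close>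

lemma principal_image:
  assumes e: "e \<in> carrier A" "e \<otimes> e = e" and P: "P \<in> \<C>" "rmod_iso A (principal_module A e) P" and X: "X \<in> mod_cat A"
    and T: "\<And>D f x. D \<in> \<C> \<Longrightarrow> f \<in> rmod_hom A D X \<Longrightarrow> x \<in> carrier D \<Longrightarrow> f x \<in> T" and u: "u \<in> carrier X"
  shows "e \<odot>\<^bsub>X\<^esub> u \<in> T"
proof -
  have Pm: "right_module A P" and Xm: "right_module A X" using P(1) X by (simp_all add: \<C>D mod_catD)
  obtain f g where f: "f \<in> rmod_hom A (principal_module A e) P" and g: "g \<in> rmod_hom A P (principal_module A e)"
    and gf: "\<And>x. x \<in> carrier (principal_module A e) \<Longrightarrow> g (f x) = x" and fg: "\<And>y. y \<in> carrier P \<Longrightarrow> f (g y) = y"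
    by (rule rmod_isoE[OF P(2) right_module_principal[OF e(1)] Pm]) (rule that)
  have ec: "e \<in> e <# carrier A" using e by (simp add: mem_principal_idempotent)
  let ?h = "compose (carrier P) (\<lambda>x\<in>e <# carrier A. x \<odot>\<^bsub>X\<^esub> u) g"
  have h: "?h \<in> rmod_hom A P X" by (rule rmod_hom_compose[OF Pm g principal_hom[OF Xm e(1) u]])
  have fe: "f e \<in> carrier P" using rmod_hom_closed[OF f, of e] ec by simp
  have "?h (f e) = e \<odot>\<^bsub>X\<^esub> u" using fe gf[of e] ec by (simp add: compose_def)
  then show ?thesis using T[OF P(1) h fe] by simp
qed

text \<open>Each class is assigned an idempotent \<open>e\<close> of \<open>E\<close> such that its
  representative is isomorphic to \<open>eA\<close>. Equal idempotents make representatives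
  isomorphic, so the assignment is injective. This makes the sum defining the supporting projective
  module finite.\<close>

lemma left_part_projectives_finite:
  assumes E: "complete_primitive_idempotents A E"
  defines "R \<equiv> {(P, Q). P \<in> left_part_projectives A \<and> Q \<in> left_part_projectives A \<and> rmod_iso A P Q}"
  shows "finite (left_part_projectives A // R)"
    "c \<in> left_part_projectives A // R \<Longrightarrow> (SOME P. P \<in> c) \<in> left_part_projectives A"
proof -
  let ?L = "left_part_projectives A"
  have Lm: "right_module A P" "fin_gen A P" "indecomposable A P" "projective A P" if "P \<in> ?L" for P
    using that left_part_mod_cat by (auto simp: left_part_projectives_def left_part_def ind_cat_def mod_cat_def)
  have refl: "(P, P) \<in> R" if "P \<in> ?L" for P
  proof -
    have "rmod_iso A P P" by (rule rmod_isoI[OF rmod_hom_id rmod_hom_id]) (use Lm(1)[OF that] in simp_all)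
    then show ?thesis using that by (simp add: R_def)
  qed
  have some: "(SOME P. P \<in> c) \<in> c" if c: "c \<in> ?L // R" for c
  proof -
    obtain P where "P \<in> ?L" "c = R `` {P}" using c by (rule quotientE)
    then have "P \<in> c" using refl by blast
    then show ?thesis by (rule someI)
  qed
  have cL: "c \<subseteq> ?L" if "c \<in> ?L // R" for c
    using that by (auto elim!: quotientE simp: R_def)
  show sL: "(SOME P. P \<in> c) \<in> ?L" if "c \<in> ?L // R" for c using some[OF that] cL[OF that] by blast
  have "\<forall>c\<in>?L // R. \<exists>e. e \<in> E \<and> rmod_iso A (SOME P. P \<in> c) (principal_module A e)"
  proof
    fix c assume "c \<in> ?L // R"
    then have "(SOME P. P \<in> c) \<in> ?L" by (rule sL)
    then show "\<exists>e. e \<in> E \<and> rmod_iso A (SOME P. P \<in> c) (principal_module A e)"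
      using indecomposable_projective_iso_principal[OF E Lm(4,2,3)] by blast
  qed
  from bchoice[OF this] obtain \<epsilon>
    where \<epsilon>: "\<forall>c\<in>?L // R. \<epsilon> c \<in> E \<and> rmod_iso A (SOME P. P \<in> c) (principal_module A (\<epsilon> c))" by (elim exE)
  have Ec: "finite E" "E \<subseteq> carrier A"
    using E by (auto simp: complete_primitive_idempotents_def orthogonal_idempotents_def)
  have "inj_on \<epsilon> (?L // R)"
  proof (rule inj_onI)
    fix c d assume c: "c \<in> ?L // R" and d: "d \<in> ?L // R" and eq: "\<epsilon> c = \<epsilon> d"
    let ?P = "SOME P. P \<in> c" and ?Q = "SOME P. P \<in> d"
    have PL: "?P \<in> ?L" "?Q \<in> ?L" using sL c d by blast+
    have m: "right_module A (principal_module A (\<epsilon> d))" using \<epsilon> d Ec(2) by (intro right_module_principal) blast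
    have Pd: "rmod_iso A ?P (principal_module A (\<epsilon> d))"
      using \<epsilon>[THEN bspec, OF c] unfolding eq by (rule conjunct2)
    have Qd: "rmod_iso A ?Q (principal_module A (\<epsilon> d))"
      using \<epsilon>[THEN bspec, OF d] by (rule conjunct2)
    have PQ: "rmod_iso A ?P ?Q"
      by (rule rmod_iso_trans[OF Pd rmod_iso_sym[OF Qd Lm(1)[OF PL(2)] m] Lm(1)[OF PL(1)]])
    have iff: "(P, Z) \<in> R \<longleftrightarrow> (P', Z) \<in> R" if "(P, P') \<in> R" for P P' Z
    proof -
      have a: "P \<in> ?L" "P' \<in> ?L" "rmod_iso A P P'" using that by (simp_all add: R_def)
      have b: "rmod_iso A P' P" by (rule rmod_iso_sym[OF a(3) Lm(1)[OF a(1)] Lm(1)[OF a(2)]])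
      have "rmod_iso A P Z \<longleftrightarrow> rmod_iso A P' Z"
        using rmod_iso_trans[OF a(3) _ Lm(1)[OF a(1)]] rmod_iso_trans[OF b _ Lm(1)[OF a(2)]] by blast
      then show ?thesis using a by (simp add: R_def)
    qed
    obtain P0 where P0: "P0 \<in> ?L" "c = R `` {P0}" using c by (rule quotientE)
    obtain Q0 where Q0: "Q0 \<in> ?L" "d = R `` {Q0}" using d by (rule quotientE)
    have 1: "(P0, ?P) \<in> R" using some[OF c] P0(2) by auto
    have 2: "(Q0, ?Q) \<in> R" using some[OF d] Q0(2) by auto
    have 3: "(?P, ?Q) \<in> R" using PQ PL by (simp add: R_def)
    have "(P0, Z) \<in> R \<longleftrightarrow> (Q0, Z) \<in> R" for Z using iff[OF 1, of Z] iff[OF 2, of Z] iff[OF 3, of Z] by simp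
    then show "c = d" using P0(2) Q0(2) by blast
  qed
  moreover have "\<epsilon> ` (?L // R) \<subseteq> E" using \<epsilon> by blast
  ultimately show "finite (?L // R)" using Ec(1) by (rule inj_on_finite)
qed

text \<open>It suffices to place a copy \<open>S'\<close> of the supporting projective module in
  \<open>\<C>\<close>. Its summands lie in the left part, so their images in \<open>S'\<close> lie
  in the largest submodule from \<open>\<C>\<close>, and these images generate
  \<open>S'\<close>.\<close>

lemma hereditary_left_support:
  assumes E: "complete_primitive_idempotents A E"
  shows "hereditary (left_support A)"
proof -
  let ?R = "{(P, Q). P \<in> left_part_projectives A \<and> Q \<in> left_part_projectives A \<and> rmod_iso A P Q}"
  let ?I = "left_part_projectives A // ?R" and ?X = "\<lambda>c. SOME P. P \<in> c"
  have XL: "?X c \<in> left_part_projectives A" if "c \<in> ?I" for c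
    by (rule left_part_projectives_finite(2)[OF E that])
  have X: "?X c \<in> left_part A" "projective A (?X c)" "right_module A (?X c)" "fin_gen A (?X c)" if "c \<in> ?I" for c
    using XL[OF that] left_part_mod_cat by (auto simp: left_part_projectives_def left_part_def ind_cat_def mod_cat_def)
  interpret S: finite_direct_sum A ?I ?X
    by (intro finite_direct_sum.intro finite_direct_sum_axioms.intro ring_axioms
        left_part_projectives_finite(1)[OF E] X(3))
  let ?S = "supporting_projective A"
  have SD: "?S = S.D" by (simp add: supporting_projective_def)
  have Sm: "right_module A ?S" unfolding SD by (rule S.right_module_D)
  have Sf: "fin_gen A ?S" unfolding SD by (rule S.fin_gen_D[OF X(4)])
  have Sp: "projective A ?S" unfolding SD by (rule S.projective_D[OF X(2)])
  obtain S' where S': "S' \<in> mod_cat A" "rmod_iso A ?S S'" using mod_cat_complete[OF Sm Sf] by blast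
  have S'm: "right_module A S'" using S'(1) by (rule mod_catD)
  obtain a a' where a: "a \<in> rmod_hom A ?S S'" and a': "a' \<in> rmod_hom A S' ?S"
    and aa: "\<And>x. x \<in> carrier ?S \<Longrightarrow> a' (a x) = x" "\<And>y. y \<in> carrier S' \<Longrightarrow> a (a' y) = y"
    by (rule rmod_isoE[OF S'(2) Sm S'm]) (rule that)
  obtain T where T: "submodule T A S'" "S'\<lparr>carrier := T\<rparr> \<in> \<C>"
    "\<And>D f x. D \<in> \<C> \<Longrightarrow> f \<in> rmod_hom A D S' \<Longrightarrow> x \<in> carrier D \<Longrightarrow> f x \<in> T"
    by (rule largest_\<C>_submodule[OF S'(1)]) (rule that)
  have "{z \<in> carrier S.D. a z \<in> T} = carrier S.D"
  proof (rule S.D_generated)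
    show "submodule {z \<in> carrier S.D. a z \<in> T} A S.D"
      using submodule_preimage[OF Sm S'm a T(1)] by (simp add: SD)
    fix c x assume c: "c \<in> ?I" and x: "x \<in> carrier (?X c)"
    have ix: "S.emb c x \<in> carrier S.D" by (rule rmod_hom_closed[OF S.emb_hom[OF c] x])
    have "compose (carrier (?X c)) a (S.emb c) \<in> rmod_hom A (?X c) S'"
      by (rule rmod_hom_compose[OF X(3)[OF c] S.emb_hom[OF c] a[unfolded SD]])
    then have "compose (carrier (?X c)) a (S.emb c) x \<in> T"
      using T(3)[OF _ _ x] X(1)[OF c] left_part_subset_add_closure by blast
    then show "S.emb c x \<in> {z \<in> carrier S.D. a z \<in> T}" using x ix by (simp add: compose_def)
  qed
  then have aT: "a z \<in> T" if "z \<in> carrier ?S" for z using that by (auto simp: SD)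
  have "y \<in> T" if y: "y \<in> carrier S'" for y
    using aT[OF rmod_hom_closed[OF a' y]] aa(2)[OF y] by simp
  moreover have "T \<subseteq> carrier S'" using T(1) by (simp add: right_module.submodule_iff[OF S'm])
  ultimately have "T = carrier S'" by blast
  then have S'C: "S' \<in> \<C>" using T(2) by simp
  show ?thesis unfolding left_support_def
    by (rule right_module.hereditary_End[OF Sm Sf fin_gen_noetherian[OF Sm Sf] projective_submodule_iso[OF Sm Sp S'C S'(2)]])
qed

text \<open>
  Choose \<open>y\<close> with \<open>yA\<close> outside the left part such that no path of the quiver leads from \<open>y\<close> to a
  vertex \<open>z\<close> with \<open>zA\<close> outside the left part. Then \<open>(yJ)z = 0\<close> for all such \<open>z\<close>, so \<open>yJ\<close> is
  generated by images of modules in \<open>\<L>\<close> and lies in \<open>add \<L>\<close>. Hence every proper predecessor of \<open>yA\<close> lies in \<open>\<L>\<close>.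
\<close>

lemma principal_in_left_part:
  assumes E: "complete_primitive_idempotents A E" and acyclic: "acyclic (valued_quiver A E)"
    and P: "\<And>e. e \<in> E \<Longrightarrow> P e \<in> ind_cat A" "\<And>e. e \<in> E \<Longrightarrow> projective A (P e)"
      "\<And>e. e \<in> E \<Longrightarrow> rmod_iso A (principal_module A e) (P e)"
    and e: "e \<in> E"
  shows "P e \<in> left_part A"
proof (rule ccontr)
  assume "P e \<notin> left_part A"
  let ?Q = "valued_quiver A E"
  have Ep: "finite E" "E \<subseteq> carrier A" "(\<Oplus>e\<in>E. e) = \<one>" "\<And>e. e \<in> E \<Longrightarrow> primitive_idempotent A e"
    "\<And>e. e \<in> E \<Longrightarrow> e \<otimes> e = e"
    using E by (auto simp: complete_primitive_idempotents_def orthogonal_idempotents_def)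
  have Q: "?Q \<subseteq> E \<times> E" by (auto simp: valued_quiver_def Let_def)
  then have "finite ?Q" using Ep(1) by (meson finite_SigmaI finite_subset)
  then have "wf (?Q\<inverse>)" using acyclic by (rule finite_acyclic_wf_converse)
  then have wf: "wf ((?Q\<inverse>)\<^sup>+)" by (rule wf_trancl)
  have "e \<in> {z \<in> E. P z \<notin> left_part A}" using e \<open>P e \<notin> left_part A\<close> by simp
  then obtain y where y0: "y \<in> {z \<in> E. P z \<notin> left_part A}"
    and ymin: "\<And>z. (z, y) \<in> (?Q\<inverse>)\<^sup>+ \<Longrightarrow> z \<notin> {z \<in> E. P z \<notin> left_part A}"
    by (rule wfE_min[OF wf]) (rule that)
  have y: "y \<in> E" "P y \<notin> left_part A" and ymin': "\<And>z. z \<in> E \<Longrightarrow> P z \<notin> left_part A \<Longrightarrow> (y, z) \<notin> ?Q\<^sup>+"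
    using y0 ymin by (auto simp: trancl_converse)
  have yc: "y \<in> carrier A" "y \<otimes> y = y" using y(1) Ep by auto
  let ?P = "P y"
  have Pi: "?P \<in> ind_cat A" and Pp: "projective A ?P" using P y(1) by blast+
  then have Pc: "?P \<in> mod_cat A" and Pind: "indecomposable A ?P" by (simp_all add: ind_cat_def)
  have Pm: "right_module A ?P" using Pc by (rule mod_catD)
  interpret P: right_module A ?P by (rule Pm)
  have Pnz: "carrier ?P \<noteq> {\<zero>\<^bsub>?P\<^esub>}" using Pind by (simp add: indecomposable_def)
  have ym: "right_module A (principal_module A y)" by (rule right_module_principal[OF yc(1)])
  obtain b' b where b': "b' \<in> rmod_hom A (principal_module A y) ?P" and b: "b \<in> rmod_hom A ?P (principal_module A y)"
    and b'b: "\<And>x. x \<in> carrier (principal_module A y) \<Longrightarrow> b (b' x) = x" "\<And>u. u \<in> carrier ?P \<Longrightarrow> b' (b u) = u"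
    by (rule rmod_isoE[OF P(3)[OF y(1)] ym Pm]) (rule that)
  have yP: "y \<in> y <# carrier A" using yc by (simp add: mem_principal_idempotent)
  obtain T where T: "submodule T A ?P" "?P\<lparr>carrier := T\<rparr> \<in> \<C>"
    "\<And>D f x. D \<in> \<C> \<Longrightarrow> f \<in> rmod_hom A D ?P \<Longrightarrow> x \<in> carrier D \<Longrightarrow> f x \<in> T"
    by (rule largest_\<C>_submodule[OF Pc]) (rule that)
  \<comment> \<open>In place of \<open>yJ\<close>, all proper submodules of the copy of
    \<open>yA\<close> are bounded by the largest submodule from \<open>\<C>\<close>. The components
    \<open>uz\<close> of an element \<open>u\<close> are treated separately: either
    \<open>zA\<close> is in the left part and maps into \<open>T\<close>, or
    \<open>uz = 0\<close>.\<close>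
  have proper: "U \<subseteq> T" if U: "submodule U A ?P" "U \<noteq> carrier ?P" for U
  proof
    have Us: "U \<subseteq> carrier ?P" "\<And>c x. c \<in> carrier A \<Longrightarrow> x \<in> U \<Longrightarrow> c \<odot>\<^bsub>?P\<^esub> x \<in> U"
      using U(1) by (auto simp: P.submodule_iff)
    fix u assume u: "u \<in> U"
    then have uc: "u \<in> carrier ?P" using Us by blast
    show "u \<in> T"
    proof (rule P.mem_if_components[OF Ep(1-3) T(1) uc])
      fix z assume z: "z \<in> E"
      have zc: "z \<in> carrier A" "z \<otimes> z = z" using z Ep by auto
      show "z \<odot>\<^bsub>?P\<^esub> u \<in> T"
      proof (cases "P z \<in> left_part A")
        case True
        then have PC: "P z \<in> \<C>" using left_part_subset_add_closure by blast
        show ?thesis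
          by (rule principal_image[where T = T, OF zc PC P(3)[OF z] Pc _ uc]) (rule T(3))
      next
        case False
        have bu: "b u \<in> y <# carrier A" using rmod_hom_closed[OF b uc] by simp
        then have buc: "b u \<in> carrier A" "y \<otimes> b u = b u" using yc by (simp_all add: mem_principal_idempotent)
        \<comment> \<open>If \<open>b u\<close> generated \<open>yA\<close>, then \<open>u\<close>
          would generate the whole module and \<open>U\<close> would not be proper.\<close>
        have "y \<notin> b u <# carrier A"
        proof
          assume "y \<in> b u <# carrier A"
          then obtain c where c: "c \<in> carrier A" "y = b u \<otimes> c" by (auto simp: mem_principal)
          have "b (c \<odot>\<^bsub>?P\<^esub> u) = y" using rmod_hom_smult[OF b c(1) uc] c(2) by simp
          then have by': "b' y = c \<odot>\<^bsub>?P\<^esub> u" using b'b(2)[of "c \<odot>\<^bsub>?P\<^esub> u"] c(1) uc by simp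
          have "carrier ?P \<subseteq> U"
          proof
            fix v assume v: "v \<in> carrier ?P"
            have "b v \<in> y <# carrier A" using rmod_hom_closed[OF b v] by simp
            then have bv: "b v \<in> carrier A" "y \<otimes> b v = b v" using yc by (simp_all add: mem_principal_idempotent)
            have "v = b' (b v \<odot>\<^bsub>principal_module A y\<^esub> y)" using b'b(2)[OF v] bv by simp
            also have "\<dots> = b v \<odot>\<^bsub>?P\<^esub> b' y" by (rule rmod_hom_smult[OF b' bv(1)]) (use yP in simp)
            finally have v': "v = b v \<odot>\<^bsub>?P\<^esub> (c \<odot>\<^bsub>?P\<^esub> u)" unfolding by' .
            show "v \<in> U" by (subst v') (intro Us(2) bv(1) c(1) u)
          qed
          then show False using U(2) Us(1) by blast
        qed
        then have J: "b u \<in> J" by (rule nongenerator_in_J[OF Ep(4)[OF y(1)] bu])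
        have "b u \<otimes> z = \<zero>"
          using no_path_radical[OF E y(1) z ymin'[OF z False] J] buc by simp
        then have "b (z \<odot>\<^bsub>?P\<^esub> u) = \<zero>" using rmod_hom_smult[OF b zc(1) uc] by simp
        then have "z \<odot>\<^bsub>?P\<^esub> u = \<zero>\<^bsub>?P\<^esub>"
          using b'b(2)[of "z \<odot>\<^bsub>?P\<^esub> u"] rmod_hom_zero[OF ym Pm b'] zc(1) uc by simp
        then show ?thesis using T(1) by (simp add: P.submodule_iff)
      qed
    qed
  qed
  have Tc: "T \<subseteq> carrier ?P" using T(1) by (simp add: P.submodule_iff)
  \<comment> \<open>A map onto the projective module splits and so is an isomorphism on the
    indecomposable \<open>X\<close>; any other map has its image in \<open>T\<close>, which carries
    a module of \<open>\<C>\<close>.\<close>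
  have hom_to_P: "X \<in> left_part A \<or> rmod_iso A X ?P"
    if X: "X \<in> ind_cat A" and g: "g \<in> rmod_hom A X ?P" and x: "x \<in> carrier X" "g x \<noteq> \<zero>\<^bsub>?P\<^esub>" for X g x
  proof (cases "g ` carrier X = carrier ?P")
    case True
    have Xm: "right_module A X" "fin_gen A X" and Xi: "indecomposable A X" using X by (simp_all add: ind_cat_def mod_cat_def)
    obtain s where s: "s \<in> rmod_hom A ?P X" "\<forall>x\<in>carrier ?P. g (s x) = (\<lambda>x\<in>carrier ?P. x) x"
      using projective_lift[OF Pp Xm Pm g True rmod_hom_id[OF Pm]] by blast
    have "rmod_iso A X ?P" by (rule split_epi_indecomposable[OF Xm(1) Xi Pm Pnz g s(1)]) (use s(2) in simp)
    then show ?thesis ..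
  next
    case False
    have Xm: "right_module A X" using X by (simp add: ind_cat_def mod_cat_def)
    have "g ` carrier X \<subseteq> T"
      by (rule proper[OF submodule_image[OF Xm Pm g right_module.submodule_carrier[OF Xm]] False])
    then have "g \<in> rmod_hom A X (?P\<lparr>carrier := T\<rparr>)" by (intro rmod_hom_codom_restrict[OF g]) blast
    then have "X \<in> left_part A" by (rule hom_add_closure_left_part[OF ring_axioms X T(2) _ x(1)]) (use x(2) in simp)
    then show ?thesis ..
  qed
  \<comment> \<open>Going backwards along a path, each module is either in the left part, which is
    closed under predecessors, or isomorphic to \<open>?P\<close>, and then the preceding map may be
    read as a map into \<open>?P\<close>.\<close>
  have pred: "W \<in> left_part A \<or> rmod_iso A W ?P" if W: "predecessor A W ?P" for W
  proof -
    have "(W, ?P) \<in> {(U, V). U \<in> ind_cat A \<and> V \<in> ind_cat A \<and> (\<exists>f \<in> rmod_hom A U V. f \<noteq> zero_hom U V)}\<^sup>*"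
      using W by (simp add: predecessor_def)
    then show ?thesis
    proof (induction rule: converse_rtrancl_induct)
      case base
      have "rmod_iso A ?P ?P" by (rule rmod_isoI[OF rmod_hom_id rmod_hom_id]) (use Pm in simp_all)
      then show ?case ..
    next
      case (step U V)
      then obtain f where UV: "U \<in> ind_cat A" "V \<in> ind_cat A" "f \<in> rmod_hom A U V" "f \<noteq> zero_hom U V" by blast
      have Um: "right_module A U" and Vm: "right_module A V" using UV(1,2) by (simp_all add: ind_cat_def mod_cat_def)
      show ?case
      proof (cases "V \<in> left_part A")
        case True
        then show ?thesis using left_part_predecessor[OF UV(1) True UV(3,4)] by blast
      next
        case False
        then have "rmod_iso A V ?P" using step.IH by blast
        then obtain k k' where k: "k \<in> rmod_hom A V ?P" and k': "k' \<in> rmod_hom A ?P V"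
          and kk: "\<And>x. x \<in> carrier V \<Longrightarrow> k' (k x) = x"
          using rmod_isoE[OF _ Vm Pm] by metis
        have "\<exists>x\<in>carrier U. f x \<noteq> \<zero>\<^bsub>V\<^esub>"
        proof (rule ccontr)
          assume "\<not> ?thesis"
          then have "f = zero_hom U V"
            using rmod_hom_ext[OF UV(3) zero_hom_mem[OF Um Vm]] by (simp add: zero_hom_def)
          then show False using UV(4) by simp
        qed
        then obtain x where x: "x \<in> carrier U" "f x \<noteq> \<zero>\<^bsub>V\<^esub>" by blast
        have "k (f x) \<noteq> \<zero>\<^bsub>?P\<^esub>"
          using kk[OF rmod_hom_closed[OF UV(3) x(1)]] rmod_hom_zero[OF Pm Vm k'] x(2) by auto
        then show ?thesis
          using hom_to_P[OF UV(1) rmod_hom_compose[OF Um UV(3) k] x(1)] x(1)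
          by (simp add: compose_def)
      qed
    qed
  qed
  \<comment> \<open>Members of the left part have this bound, and modules isomorphic to
    \<open>?P\<close> are projective. So \<open>?P\<close> satisfies the defining condition of the
    left part.\<close>
  have "proj_dim A W \<le> 1" if W: "predecessor A W ?P" for W
  proof -
    have Wi: "W \<in> ind_cat A" using W by (simp add: predecessor_def)
    then have Wc: "W \<in> mod_cat A" by (simp add: ind_cat_def)
    from pred[OF W] show ?thesis
    proof
      assume "W \<in> left_part A"
      then show ?thesis using Wi by (auto simp: left_part_def predecessor_def)
    next
      assume "rmod_iso A W ?P"
      then have "projective A W"
        using projective_iso[OF Pp rmod_iso_sym[OF _ mod_catD(1)[OF Wc] Pm] mod_catD(1)[OF Wc]] by blast
      then show ?thesis by (rule proj_dim_projective[OF Wc])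
    qed
  qed
  then have "?P \<in> left_part A" using Pi by (simp add: left_part_def)
  then show False using y(2) by simp
qed

text \<open>Each indecomposable projective module is isomorphic to some \<open>eA\<close>. The
  components \<open>xe\<close> of the elements of a copy of the regular module are images from
  these, so that copy lies in \<open>\<C>\<close>, and right ideals are projective like all
  submodules of projective members of \<open>\<C>\<close>.\<close>

lemma acyclic_hereditary:
  assumes E: "complete_primitive_idempotents A E" and acyclic: "acyclic (valued_quiver A E)"
  shows "equals_left_support A" "hereditary A"
proof -
  have Ep: "finite E" "E \<subseteq> carrier A" "(\<Oplus>e\<in>E. e) = \<one>" "\<And>e. e \<in> E \<Longrightarrow> primitive_idempotent A e"
    "\<And>e. e \<in> E \<Longrightarrow> e \<otimes> e = e"
    using E by (auto simp: complete_primitive_idempotents_def orthogonal_idempotents_def)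
  have "\<forall>e\<in>E. \<exists>P. P \<in> ind_cat A \<and> projective A P \<and> rmod_iso A (principal_module A e) P"
    using mod_cat_copy_principal[OF Ep(4)] by metis
  from bchoice[OF this] obtain P
    where "\<forall>e\<in>E. P e \<in> ind_cat A \<and> projective A (P e) \<and> rmod_iso A (principal_module A e) (P e)" by (elim exE)
  then have P: "P e \<in> ind_cat A" "projective A (P e)" "rmod_iso A (principal_module A e) (P e)" if "e \<in> E" for e
    using that by simp_all
  have L: "P e \<in> left_part A" if "e \<in> E" for e
    by (rule principal_in_left_part[where P = P, OF E acyclic P that])
  show "equals_left_support A" unfolding equals_left_support_def
  proof (intro ballI impI)
    fix X assume X: "X \<in> ind_cat A" "projective A X"
    have Xm: "right_module A X" "fin_gen A X" "indecomposable A X" using X(1) by (simp_all add: ind_cat_def mod_cat_def)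
    obtain e where e: "e \<in> E" "rmod_iso A X (principal_module A e)"
      using indecomposable_projective_iso_principal[OF E X(2) Xm(2,3)] by blast
    have "rmod_iso A X (P e)" by (rule rmod_iso_trans[OF e(2) P(3)[OF e(1)] Xm(1)])
    then show "X \<in> left_part A" by (rule ind_cat_iso_left_part[OF X(1) L[OF e(1)]])
  qed
  let ?R = "regular_module A"
  have Rm: "right_module A ?R" by (rule right_module_regular)
  have Rf: "fin_gen A ?R" by (rule noetherian_fin_gen[OF Rm regular_noetherian])
  have Rp: "projective A ?R"
  proof -
    have "x \<in> \<one> <# carrier A \<longleftrightarrow> x \<in> carrier A" for x by (auto simp: mem_principal_idempotent)
    then have "\<one> <# carrier A = carrier ?R" by auto
    then have "principal_module A \<one> = ?R" by simp
    then show ?thesis using projective_principal[of \<one>] by simp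
  qed
  obtain R' where R': "R' \<in> mod_cat A" "rmod_iso A ?R R'" using mod_cat_complete[OF Rm Rf] by blast
  have R'm: "right_module A R'" using R'(1) by (rule mod_catD)
  interpret R': right_module A R' by (rule R'm)
  obtain T where T: "submodule T A R'" "R'\<lparr>carrier := T\<rparr> \<in> \<C>"
    "\<And>D f x. D \<in> \<C> \<Longrightarrow> f \<in> rmod_hom A D R' \<Longrightarrow> x \<in> carrier D \<Longrightarrow> f x \<in> T"
    by (rule largest_\<C>_submodule[OF R'(1)]) (rule that)
  have "x \<in> T" if x: "x \<in> carrier R'" for x
  proof (rule R'.mem_if_components[OF Ep(1-3) T(1) x])
    fix e assume e: "e \<in> E"
    have ec: "e \<in> carrier A" "e \<otimes> e = e" using e Ep by auto
    have PC: "P e \<in> \<C>" using L[OF e] left_part_subset_add_closure by blast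
    show "e \<odot>\<^bsub>R'\<^esub> x \<in> T"
      by (rule principal_image[where T = T, OF ec PC P(3)[OF e] R'(1) _ x]) (rule T(3))
  qed
  moreover have "T \<subseteq> carrier R'" using T(1) by (simp add: R'.submodule_iff)
  ultimately have "T = carrier R'" by blast
  then have R'C: "R' \<in> \<C>" using T(2) by simp
  show "hereditary A" unfolding hereditary_def
    using projective_submodule_iso[OF Rm Rp R'C R'(2)] by blast
qed

end

theorem corollary3p2:
  fixes K :: "('k, 'c) ring_scheme" and \<phi> :: "'k \<Rightarrow> 'a" and A :: "('a, 'b) ring_scheme"
  assumes "artin_algebra K \<phi> A" and "basic A" and "connected_ring A"
    and "abelian_exact_subcategory A (add_closure A (left_part A))"
  shows "hereditary (left_support A) \<and>
    left_supported A \<and>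
    (\<forall>E. complete_primitive_idempotents A E \<and> acyclic (valued_quiver A E) \<longrightarrow>
      equals_left_support A \<and> hereditary A)"
proof -
  have "ring A" using assms(1) by (simp add: artin_algebra_def)
  then interpret left_abelian A
    using artin_algebra_chain[OF assms(1)] assms(4)
    by (intro left_abelian.intro artin_ring.intro artin_ring_axioms.intro left_abelian_axioms.intro)
  \<comment> \<open>Basicness supplies one complete set, which serves the finiteness argument for
    the left support; the third claim brings its own set.\<close>
  obtain E where "complete_primitive_idempotents A E" using assms(2) by (auto simp: basic_def)
  then show ?thesis using hereditary_left_support left_supported acyclic_hereditary by blast
qed

end
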